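(* Assume that $u\in H^3(\Omega)$ is the exact solution of $-\nabla\cdot(a\nabla u)=f$ in $\Omega=(0,1)^2$, $u=g$ on $\partial\Omega$. Let $\mathbf q=(q_1,q_2)'=a\nabla u$, $q_{1x}=\partial_x q_1$, $q_{2y}=\partial_y q_2$, and let $w_b\in V_b$ be given on each element $T\in\mathcal T_h$ (with left, right, bottom, top edges $e_1,e_2,e_3,e_4$) by $$w_b=\begin{cases}\frac{1}{12}|e_s|\rho^{-1}h^{-1}\big(\rho h^{-1}|e_s|\,Q_b(u_{yy})|_{e_s}-6\,Q_b(q_{2y})|_{e_s}\big) & \text{on } e_s,\ s=1,2,\\[2pt] \frac{1}{12}|e_s|\rho^{-1}h^{-1}\big(\rho h^{-1}|e_s|\,Q_b(u_{xx})|_{e_s}-6\,Q_b(q_{1x})|_{e_s}\big) & \text{on } e_s,\ s=3,4.\end{cases}$$ Let $u_h=\{u_0,u_b\}\in V_h$ be the lowest order weak Galerkin approximation, i.e. the solution of $$\sum_{T\in\mathcal T_h}(a\nabla_d u_h,\nabla_d v)_T+s(u_h,v)=(f,v_0)\qquad\forall v=\{v_0,v_b\}\in V_h^0,$$ with the boundary value $u_b|_{\partial\Omega}=Q_b g+h^2 w_b|_{\partial\Omega}$. Denote by $\widetilde e_b=(Q_bu+h^2w_b)-u_b$ the modified error function. Then $$\Big(\sum_{T\in\mathcal T_h}\|\nabla_d\widetilde e_b\|_T^2\Big)^{1/2}+|||\mathcal S(\widetilde e_b)-\widetilde e_b|||\le C h^2\|u\|_3 .$$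
   Context: Problem: $\Omega=(0,1)^2$; $f$, $g$ are given; $a=\{a_{ij}\}_{2\times2}$ is symmetric, uniformly bounded and positive definite in $\Omega$, and is a piecewise constant matrix with respect to the partition $\mathcal T_h$. Partition: $\mathcal T_h=\Delta_x\times\Delta_y$ is the (possibly nonuniform) rectangular partition of $\Omega$ with elements $[x_{i-1},x_i]\times[y_{j-1},y_j]$, where $0=x_0<\dots<x_n=1$, $0=y_0<\dots<y_m=1$. It is shape regular (aspect ratios of elements bounded independently of $h$). $h=\max_T h_T$ with $h_T$ the diameter of $T$. For $T=[x_{i-1},x_i]\times[y_{j-1},y_j]$, the edges are $e_1$ (left), $e_2$ (right), $e_3$ (bottom), $e_4$ (top), with lengths $|e_1|=|e_2|$, $|e_3|=|e_4|$. Spaces (lowest order): $V_h$ is the space of $v=\{v_0,v_b\}$ with $v_0|_T\in P_1(T)$ for each $T$ (no continuity imposed) and $v_b$ constant on each edge, single-valued on each edge of $\mathcal T_h$. $V_h^0=\{v\in V_h: v_b|_{\partial\Omega}=0\}$. $V_b=\{\{0,v_b\}\in V_h\}$, identified with the edgewise constant functions $v_b$. Operators: $Q_b$ is the $L^2$ projection onto constants on each edge (the edge average). The discrete weak gradient $\nabla_d v\in[P_0(T)]^2$ on each $T$ is defined by $(\nabla_d v,\boldsymbol\psi)_T=-(v_0,\nabla\cdot\boldsymbol\psi)_T+\langle v_b,\boldsymbol\psi\cdot\mathbf n\rangle_{\partial T}$ for all $\boldsymbol\psi\in[P_0(T)]^2$, with $\mathbf n$ the unit outward normal (so it depends only on $v_b$,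 and $\nabla_d v_b$ is written accordingly). For $\rho>0$ a fixed parameter, $s(w,v)=\rho h^{-1}\sum_{T\in\mathcal T_h}\langle w_b-Q_bw_0,v_b-Q_bv_0\rangle_{\partial T}$. The extension $\mathcal S(v_b)$ is, on each $T$, the linear function $\mathcal S(v_b)\in P_1(T)$ with $\langle\mathcal S(v_b),Q_b\phi\rangle_{\partial T}=\langle v_b,\phi\rangle_{\partial T}$ for all $\phi\in P_1(T)$. Norms: $|||\mathcal S(v_b)-v_b|||^2:=\rho h^{-1}\sum_{T\in\mathcal T_h}\langle Q_b\mathcal S(v_b)-v_b,Q_b\mathcal S(v_b)-v_b\rangle_{\partial T}$; $\|\cdot\|_T$ is the $L^2(T)$ norm and $\|\cdot\|_3$ the $H^3(\Omega)$ norm. $C$ denotes a generic positive constant independent of $h$ and $u$. *)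

theory Defs
  imports "HOL-Analysis.Analysis"
begin

type_synonym point = "real \<times> real"

definition unit_square :: "point set" where
  "unit_square = {0<..<1} \<times> {0<..<1}"

definition dx :: "(point \<Rightarrow> real) \<Rightarrow> point \<Rightarrow> real" where
  "dx \<phi> = (\<lambda>(x, y). deriv (\<lambda>s. \<phi> (s, y)) x)"

definition dy :: "(point \<Rightarrow> real) \<Rightarrow> point \<Rightarrow> real" where
  "dy \<phi> = (\<lambda>(x, y). deriv (\<lambda>t. \<phi> (x, t)) y)"

text \<open>Frechet differentiability of all the iterated derivatives makes the mixed partial
  derivatives independent of the order and continuous, so this is \<open>C\<^sup>\<infinity>\<close> on the plane.\<close>

definition smooth :: "(point \<Rightarrow> real) \<Rightarrow> bool" where
  "smooth \<phi> \<longleftrightarrow> (\<forall>i j p. (dx ^^ i) ((dy ^^ j) \<phi>) differentiable (at p))"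

definition test_functions :: "point set \<Rightarrow> (point \<Rightarrow> real) set" where
  "test_functions R =
     {\<phi>. smooth \<phi> \<and> compact (closure {p. \<phi> p \<noteq> 0}) \<and> closure {p. \<phi> p \<noteq> 0} \<subseteq> R}"

definition L2 :: "'a::euclidean_space set \<Rightarrow> ('a \<Rightarrow> real) \<Rightarrow> bool" where
  "L2 R f \<longleftrightarrow> set_borel_measurable lebesgue R f \<and> set_integrable lebesgue R (\<lambda>p. (f p)\<^sup>2)"

definition has_weak_deriv ::
  "point set \<Rightarrow> nat \<Rightarrow> nat \<Rightarrow> (point \<Rightarrow> real) \<Rightarrow> (point \<Rightarrow> real) \<Rightarrow> bool" where
  "has_weak_deriv R i j v w \<longleftrightarrow> L2 R v \<and> L2 R w \<and>
     (\<forall>\<phi> \<in> test_functions R.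
        (LINT p:R|lebesgue. v p * (dx ^^ i) ((dy ^^ j) \<phi>) p)
          = (- 1) ^ (i + j) * (LINT p:R|lebesgue. w p * \<phi> p))"

text \<open>A representative, determined only up to a null set.\<close>

definition weak_deriv :: "point set \<Rightarrow> nat \<Rightarrow> nat \<Rightarrow> (point \<Rightarrow> real) \<Rightarrow> point \<Rightarrow> real" where
  "weak_deriv R i j v = (SOME w. has_weak_deriv R i j v w)"

definition Hspace :: "nat \<Rightarrow> point set \<Rightarrow> (point \<Rightarrow> real) set" where
  "Hspace k R = {v. \<forall>i j. i + j \<le> k \<longrightarrow> (\<exists>w. has_weak_deriv R i j v w)}"

definition Hnorm :: "nat \<Rightarrow> point set \<Rightarrow> (point \<Rightarrow> real) \<Rightarrow> real" where
  "Hnorm k R v =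
     sqrt (\<Sum>(i, j) \<in> {(i, j). i + j \<le> k}. LINT p:R|lebesgue. (weak_deriv R i j v p)\<^sup>2)"

definition weak_grad :: "point set \<Rightarrow> (point \<Rightarrow> real) \<Rightarrow> point \<Rightarrow> real ^ 2" where
  "weak_grad R v p = vector [weak_deriv R 1 0 v p, weak_deriv R 0 1 v p]"

text \<open>\<open>Vert c a b\<close> is the segment \<open>{c} \<times> [a, b]\<close> and \<open>Horz c a b\<close> is \<open>[a, b] \<times> {c}\<close>. An edge
  shared by two elements is thus one and the same object for both.\<close>

datatype edge = Vert real real real | Horz real real real

fun edge_interval :: "edge \<Rightarrow> real set" where
  "edge_interval (Vert c a b) = {a..b}"
| "edge_interval (Horz c a b) = {a..b}"

fun edge_point :: "edge \<Rightarrow> real \<Rightarrow> point" where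
  "edge_point (Vert c a b) t = (c, t)"
| "edge_point (Horz c a b) t = (t, c)"

fun edge_length :: "edge \<Rightarrow> real" where
  "edge_length (Vert c a b) = b - a"
| "edge_length (Horz c a b) = b - a"

definition edge_set :: "edge \<Rightarrow> point set" where
  "edge_set e = edge_point e ` edge_interval e"

definition edge_integral :: "edge \<Rightarrow> (point \<Rightarrow> real) \<Rightarrow> real" where
  "edge_integral e \<phi> = (LINT t:edge_interval e|lebesgue. \<phi> (edge_point e t))"

definition Qb :: "(point \<Rightarrow> real) \<Rightarrow> edge \<Rightarrow> real" where
  "Qb \<phi> e = edge_integral e \<phi> / edge_length e"

text \<open>\<open>g\<close> is the trace on the edge \<open>e\<close>, contained in the closure of the rectangle \<open>R\<close>, of
  \<open>v \<in> H\<^sup>1(R)\<close>: the continuous extension to \<open>H\<^sup>1(R)\<close> of the restriction of smooth functions.\<close>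

definition has_trace :: "point set \<Rightarrow> (point \<Rightarrow> real) \<Rightarrow> edge \<Rightarrow> (point \<Rightarrow> real) \<Rightarrow> bool" where
  "has_trace R v e g \<longleftrightarrow>
     v \<in> Hspace 1 R \<and> L2 (edge_interval e) (\<lambda>t. g (edge_point e t)) \<and>
     (\<exists>\<phi>. (\<forall>k. smooth (\<phi> k)) \<and>
          (\<lambda>k. Hnorm 1 R (\<lambda>p. \<phi> k p - v p)) \<longlonglongrightarrow> 0 \<and>
          (\<lambda>k. edge_integral e (\<lambda>p. (\<phi> k p - g p)\<^sup>2)) \<longlonglongrightarrow> 0)"

definition trace_on :: "point set \<Rightarrow> (point \<Rightarrow> real) \<Rightarrow> edge \<Rightarrow> point \<Rightarrow> real" where
  "trace_on R v e = (SOME g. has_trace R v e g)"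

definition Qb_trace :: "point set \<Rightarrow> (point \<Rightarrow> real) \<Rightarrow> edge \<Rightarrow> real" where
  "Qb_trace R v e = Qb (trace_on R v e) e"

datatype rect = Rect real real real real

fun cell :: "rect \<Rightarrow> point set" where
  "cell (Rect a b c d) = {a..b} \<times> {c..d}"

fun left_edge :: "rect \<Rightarrow> edge" where "left_edge (Rect a b c d) = Vert a c d"
fun right_edge :: "rect \<Rightarrow> edge" where "right_edge (Rect a b c d) = Vert b c d"
fun bottom_edge :: "rect \<Rightarrow> edge" where "bottom_edge (Rect a b c d) = Horz c a b"
fun top_edge :: "rect \<Rightarrow> edge" where "top_edge (Rect a b c d) = Horz d a b"

definition edges :: "rect \<Rightarrow> edge set" where
  "edges T = {left_edge T, right_edge T, bottom_edge T, top_edge T}"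

definition normal :: "rect \<Rightarrow> edge \<Rightarrow> real ^ 2" where
  "normal T e =
     (if e = left_edge T then vector [- 1, 0]
      else if e = right_edge T then vector [1, 0]
      else if e = bottom_edge T then vector [0, - 1]
      else vector [0, 1])"

definition grid :: "nat \<Rightarrow> (nat \<Rightarrow> real) \<Rightarrow> bool" where
  "grid n x \<longleftrightarrow> x 0 = 0 \<and> x n = 1 \<and> (\<forall>i < n. x i < x (Suc i))"

definition rect_partition :: "nat \<Rightarrow> (nat \<Rightarrow> real) \<Rightarrow> nat \<Rightarrow> (nat \<Rightarrow> real) \<Rightarrow> rect set" where
  "rect_partition n x m y = {Rect (x i) (x (Suc i)) (y j) (y (Suc j)) | i j. i < n \<and> j < m}"

definition mesh_size :: "rect set \<Rightarrow> real" where
  "mesh_size M = Max ((\<lambda>T. diameter (cell T)) ` M)"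

definition shape_regular :: "real \<Rightarrow> rect set \<Rightarrow> bool" where
  "shape_regular \<kappa> M \<longleftrightarrow>
     (\<forall>T \<in> M. edge_length (left_edge T) \<le> \<kappa> * edge_length (bottom_edge T) \<and>
             edge_length (bottom_edge T) \<le> \<kappa> * edge_length (left_edge T))"

definition boundary_edges :: "rect set \<Rightarrow> edge set" where
  "boundary_edges M = {e \<in> (\<Union>T \<in> M. edges T). edge_set e \<subseteq> frontier unit_square}"

text \<open>A function on the boundary of an element may take different values on different edges, so
  it is a function of the edge and of the point.\<close>

definition bd_inner ::
  "rect \<Rightarrow> (edge \<Rightarrow> point \<Rightarrow> real) \<Rightarrow> (edge \<Rightarrow> point \<Rightarrow> real) \<Rightarrow> real" where
  "bd_inner T F G = (\<Sum>e \<in> edges T. edge_integral e (\<lambda>p. F e p * G e p))"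

definition P1 :: "(point \<Rightarrow> real) set" where
  "P1 = {\<phi>. \<exists>c0 c1 c2. \<forall>x y. \<phi> (x, y) = c0 + c1 * x + c2 * y}"

text \<open>In \<open>v = (v\<^sub>0, v\<^sub>b)\<close> the function \<open>v\<^sub>0 T\<close> is the interior part on the element \<open>T\<close>, extended
  to the plane as a polynomial; values of \<open>v\<^sub>0\<close> and \<open>v\<^sub>b\<close> off the mesh play no role.\<close>

type_synonym weak_fun = "(rect \<Rightarrow> point \<Rightarrow> real) \<times> (edge \<Rightarrow> real)"

definition Vh :: "rect set \<Rightarrow> weak_fun set" where
  "Vh M = {(v0, vb). \<forall>T \<in> M. v0 T \<in> P1}"

definition Vh0 :: "rect set \<Rightarrow> weak_fun set" where
  "Vh0 M = {(v0, vb) \<in> Vh M. \<forall>e \<in> boundary_edges M. vb e = 0}"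

definition divergence :: "(point \<Rightarrow> real ^ 2) \<Rightarrow> point \<Rightarrow> real" where
  "divergence \<psi> p = dx (\<lambda>q. \<psi> q $ 1) p + dy (\<lambda>q. \<psi> q $ 2) p"

definition discrete_grad :: "weak_fun \<Rightarrow> rect \<Rightarrow> real ^ 2" where
  "discrete_grad v T =
     (THE c. \<forall>\<psi> :: real ^ 2.
        (LINT p:cell T|lebesgue. c \<bullet> \<psi>) =
          - (LINT p:cell T|lebesgue. fst v T p * divergence (\<lambda>_. \<psi>) p)
          + bd_inner T (\<lambda>e _. snd v e) (\<lambda>e _. \<psi> \<bullet> normal T e))"

abbreviation discrete_grad_b :: "(edge \<Rightarrow> real) \<Rightarrow> rect \<Rightarrow> real ^ 2" where
  "discrete_grad_b vb \<equiv> discrete_grad (\<lambda>_ _. 0, vb)"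

definition stabilizer :: "real \<Rightarrow> rect set \<Rightarrow> weak_fun \<Rightarrow> weak_fun \<Rightarrow> real" where
  "stabilizer \<rho> M w v =
     \<rho> * inverse (mesh_size M) *
     (\<Sum>T \<in> M. bd_inner T (\<lambda>e _. snd w e - Qb (fst w T) e) (\<lambda>e _. snd v e - Qb (fst v T) e))"

definition extension :: "(edge \<Rightarrow> real) \<Rightarrow> rect \<Rightarrow> point \<Rightarrow> real" where
  "extension vb T =
     (THE s. s \<in> P1 \<and>
        (\<forall>\<phi> \<in> P1. bd_inner T (\<lambda>_. s) (\<lambda>e _. Qb \<phi> e) = bd_inner T (\<lambda>e _. vb e) (\<lambda>_. \<phi>)))"

definition extension_seminorm :: "real \<Rightarrow> rect set \<Rightarrow> (edge \<Rightarrow> real) \<Rightarrow> real" where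
  "extension_seminorm \<rho> M vb =
     sqrt (\<rho> * inverse (mesh_size M) *
       (\<Sum>T \<in> M. bd_inner T (\<lambda>e _. Qb (extension vb T) e - vb e)
                           (\<lambda>e _. Qb (extension vb T) e - vb e)))"

definition admissible_coefficient ::
  "real \<Rightarrow> real \<Rightarrow> rect set \<Rightarrow> (point \<Rightarrow> real ^ 2 ^ 2) \<Rightarrow> bool" where
  "admissible_coefficient \<alpha> \<beta> M a \<longleftrightarrow>
     (\<forall>p \<in> unit_square. transpose (a p) = a p \<and>
        (\<forall>i j. \<bar>a p $ i $ j\<bar> \<le> \<beta>) \<and>
        (\<forall>\<xi>. \<alpha> * (\<xi> \<bullet> \<xi>) \<le> \<xi> \<bullet> (a p *v \<xi>))) \<and>
     (\<forall>T \<in> M. a constant_on interior (cell T))"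

definition flux :: "(point \<Rightarrow> real ^ 2 ^ 2) \<Rightarrow> (point \<Rightarrow> real) \<Rightarrow> point \<Rightarrow> real ^ 2" where
  "flux a u p = a p *v weak_grad unit_square u p"

text \<open>The equation is understood in the sense of distributions, which includes the continuity of
  the normal flux across the interfaces of \<open>a\<close>; the boundary condition in the sense of traces.\<close>

definition exact_solution ::
  "(point \<Rightarrow> real ^ 2 ^ 2) \<Rightarrow> (point \<Rightarrow> real) \<Rightarrow> (point \<Rightarrow> real) \<Rightarrow> (point \<Rightarrow> real) \<Rightarrow> bool" where
  "exact_solution a f g u \<longleftrightarrow>
     L2 unit_square f \<and>
     (\<forall>\<phi> \<in> test_functions unit_square.
        (LINT p:unit_square|lebesgue. flux a u p \<bullet> vector [dx \<phi> p, dy \<phi> p])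
          = (LINT p:unit_square|lebesgue. f p * \<phi> p)) \<and>
     (\<forall>e \<in> edges (Rect 0 1 0 1). has_trace unit_square u e g)"

text \<open>The formula has to hold on every element with the trace of the derivatives of the flux taken
  from that element. For the single value \<open>w\<^sub>b e\<close> on an interior edge this includes the requirement
  that both adjacent elements prescribe the same number.\<close>

definition is_correction ::
  "real \<Rightarrow> rect set \<Rightarrow> (point \<Rightarrow> real ^ 2 ^ 2) \<Rightarrow> (point \<Rightarrow> real) \<Rightarrow> (edge \<Rightarrow> real) \<Rightarrow> bool" where
  "is_correction \<rho> M a u wb \<longleftrightarrow>
     (\<forall>T \<in> M.
        (let h = mesh_size M;
             u_xx = weak_deriv unit_square 2 0 u;
             u_yy = weak_deriv unit_square 0 2 u;
             T' = interior (cell T);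
             q1x = weak_deriv T' 1 0 (\<lambda>p. flux a u p $ 1);
             q2y = weak_deriv T' 0 1 (\<lambda>p. flux a u p $ 2)
         in (\<forall>e \<in> {left_edge T, right_edge T}.
               wb e = 1 / 12 * edge_length e * inverse \<rho> * inverse h *
                 (\<rho> * inverse h * edge_length e * Qb_trace unit_square u_yy e
                   - 6 * Qb_trace T' q2y e)) \<and>
            (\<forall>e \<in> {bottom_edge T, top_edge T}.
               wb e = 1 / 12 * edge_length e * inverse \<rho> * inverse h *
                 (\<rho> * inverse h * edge_length e * Qb_trace unit_square u_xx e
                   - 6 * Qb_trace T' q1x e))))"

definition wg_solution ::
  "real \<Rightarrow> rect set \<Rightarrow> (point \<Rightarrow> real ^ 2 ^ 2) \<Rightarrow> (point \<Rightarrow> real) \<Rightarrow> (edge \<Rightarrow> real)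
     \<Rightarrow> weak_fun \<Rightarrow> bool" where
  "wg_solution \<rho> M a f bv uh \<longleftrightarrow>
     uh \<in> Vh M \<and> (\<forall>e \<in> boundary_edges M. snd uh e = bv e) \<and>
     (\<forall>v \<in> Vh0 M.
        (\<Sum>T \<in> M. LINT p:cell T|lebesgue. (a p *v discrete_grad uh T) \<bullet> discrete_grad v T)
          + stabilizer \<rho> M uh v
        = (\<Sum>T \<in> M. LINT p:cell T|lebesgue. f p * fst v T p))"

end

theory Submission
  imports Defs
begin

text \<open>The error equation is tested with \<open>(\<S>(e), e)\<close>, where \<open>e\<close> is the modified error. For this choice
  the stabilizer does not see the interior part of the discrete solution, and on each element it
  reduces to the product of the alternating sums \<open>v\<^sub>1 + v\<^sub>2 - v\<^sub>3 - v\<^sub>4\<close> of the four edge values. The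
  alternating sum of the edge averages of \<open>u\<close> is a difference of two trapezoidal errors, hence has a
  main part with second derivatives of \<open>u\<close>; the load \<open>(f, \<S>(e))\<close> contributes, after integration by
  parts, the normal fluxes on the edges and the integrals of the derivatives of the flux. The
  correction \<open>w\<^sub>b\<close> removes precisely these terms, and the remainder contains third derivatives only.
  The normal fluxes cancel between neighbours: the distributional form of the equation forces equal
  normal fluxes on both sides, and \<open>e\<close> vanishes on the boundary.

  The average over an edge of the trace of \<open>v\<close> equals the average over an adjacent rectangle of
  \<open>v + (x - x\<^sub>0) \<partial>\<^sub>x v\<close>, where \<open>x = x\<^sub>0\<close> is the opposite edge. All edge quantities thus become
  integrals over elements, and no trace inequality is needed. Traces exist since smooth functions
  are dense in \<open>H\<^sup>1\<close> of the unit square, which follows from the cosine expansion.\<close>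

section \<open>Square integrable functions and smooth functions of one variable\<close>

text \<open>An affine function has the same mean value, its value at the centre, over either pair of
  opposite edges. So the averages of affine functions form a hyperplane in the four-dimensional
  space of edge values, and the alternating sum is the functional that defines it. This is why the
  interior part of the discrete solution drops out and one scalar per element describes the
  stabilizer. The difficulty lies in what the traces are taken of. Weak derivatives and traces are
  chosen representatives, the coefficient jumps, and the flux is in H^1 only element by element. On
  one element, however, the derivatives of the flux agree almost everywhere with constant
  combinations of second derivatives of u, and these lie in H^1 of the whole square. All
  approximation is therefore done on the square and restricted afterwards. Two orders of accuracy
  come from symmetry: centred weights have mean zero, which allows one more integration by parts,
  and differences of opposite edge averages are integrals of a derivative. For the latter reason the
  correction, already of second order, perturbs the discrete gradient by third derivatives
  only.\<close>

definition sq_int :: "'a measure \<Rightarrow> ('a \<Rightarrow> real) \<Rightarrow> bool" where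
  "sq_int M f \<longleftrightarrow> f \<in> borel_measurable M \<and> integrable M (\<lambda>x. (f x)\<^sup>2)"

lemma sq_int_measurable: "sq_int M f \<Longrightarrow> f \<in> borel_measurable M"
  by (simp add: sq_int_def)

lemma sq_int_square: "sq_int M f \<Longrightarrow> integrable M (\<lambda>x. (f x)\<^sup>2)"
  by (simp add: sq_int_def)

lemma sq_int_mult:
  assumes "sq_int M f" "sq_int M g"
  shows "integrable M (\<lambda>x. f x * g x)"
proof (rule Bochner_Integration.integrable_bound)
  show "integrable M (\<lambda>x. (f x)\<^sup>2 + (g x)\<^sup>2)" "(\<lambda>x. f x * g x) \<in> borel_measurable M"
    using assms by (auto simp: sq_int_def)
  have "\<bar>u * v\<bar> \<le> u\<^sup>2 + v\<^sup>2" for u v :: real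
    using sum_squares_bound[of "\<bar>u\<bar>" "\<bar>v\<bar>"] abs_ge_zero[of "u * v"]
    unfolding abs_mult power2_abs mult.assoc[of 2] by linarith
  then show "AE x in M. norm (f x * g x) \<le> norm ((f x)\<^sup>2 + (g x)\<^sup>2)"
    by (intro AE_I2) (metis abs_ge_self order_trans real_norm_def)
qed

lemma sq_int_cmult: "sq_int M f \<Longrightarrow> sq_int M (\<lambda>x. c * f x)"
  by (auto simp: sq_int_def power_mult_distrib)

lemma sq_int_add:
  assumes "sq_int M f" "sq_int M g"
  shows "sq_int M (\<lambda>x. f x + g x)"
  unfolding sq_int_def
proof
  show "(\<lambda>x. f x + g x) \<in> borel_measurable M" using assms by (auto simp: sq_int_def)
  have "integrable M (\<lambda>x. (f x)\<^sup>2 + (g x)\<^sup>2 + 2 * (f x * g x))"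
    using assms sq_int_mult[OF assms] by (auto simp: sq_int_def)
  then show "integrable M (\<lambda>x. (f x + g x)\<^sup>2)"
    by (simp add: power2_sum mult.assoc)
qed

lemma sq_int_diff: "sq_int M f \<Longrightarrow> sq_int M g \<Longrightarrow> sq_int M (\<lambda>x. f x - g x)"
  using sq_int_add[of M f "\<lambda>x. -1 * g x"] sq_int_cmult[of M g "-1"] by simp

lemma sq_int_zero: "sq_int M (\<lambda>x. 0)"
  by (simp add: sq_int_def)

lemma sq_int_sum: "(\<And>i. i \<in> A \<Longrightarrow> sq_int M (f i)) \<Longrightarrow> sq_int M (\<lambda>x. \<Sum>i\<in>A. f i x)"
  by (induction A rule: infinite_finite_induct) (auto intro: sq_int_add sq_int_zero)

lemma sq_int_mult_bounded:
  assumes f: "sq_int M f" and g: "g \<in> borel_measurable M" and B: "\<And>x. x \<in> space M \<Longrightarrow> \<bar>g x\<bar> \<le> B"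
  shows "sq_int M (\<lambda>x. f x * g x)"
  unfolding sq_int_def
proof
  show "(\<lambda>x. f x * g x) \<in> borel_measurable M" using f g by (auto simp: sq_int_def)
  show "integrable M (\<lambda>x. (f x * g x)\<^sup>2)"
  proof (rule Bochner_Integration.integrable_bound)
    show "integrable M (\<lambda>x. B\<^sup>2 * (f x)\<^sup>2)" "(\<lambda>x. (f x * g x)\<^sup>2) \<in> borel_measurable M"
      using f g by (auto simp: sq_int_def)
    have "(f x * g x)\<^sup>2 \<le> B\<^sup>2 * (f x)\<^sup>2" if "x \<in> space M" for x
    proof -
      have "(g x)\<^sup>2 \<le> B\<^sup>2" using power_mono[OF B[OF that] abs_ge_zero, of 2] by simp
      then have "(f x)\<^sup>2 * (g x)\<^sup>2 \<le> (f x)\<^sup>2 * B\<^sup>2" by (intro mult_left_mono) auto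
      then show ?thesis by (simp add: power_mult_distrib mult.commute)
    qed
    then show "AE x in M. norm ((f x * g x)\<^sup>2) \<le> norm (B\<^sup>2 * (f x)\<^sup>2)"
      by (intro AE_I2) simp
  qed
qed

lemma sq_int_const:
  assumes "finite_measure M" shows "sq_int M (\<lambda>x. c)"
  using assms by (simp add: sq_int_def finite_measure.integrable_const)

lemma sq_int_bounded:
  assumes "finite_measure M" "g \<in> borel_measurable M" "\<And>x. x \<in> space M \<Longrightarrow> \<bar>g x\<bar> \<le> B"
  shows "sq_int M g"
  using sq_int_mult_bounded[OF sq_int_const[OF assms(1), of 1] assms(2,3)] by simp

lemma sq_int_integrable:
  assumes "finite_measure M" "sq_int M f" shows "integrable M f"
  using sq_int_mult[OF assms(2) sq_int_const[OF assms(1), of 1]] by simp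

lemma sq_int_cong_AE:
  assumes "sq_int M f" "g \<in> borel_measurable M" "AE x in M. f x = g x"
  shows "sq_int M g"
proof -
  have "integrable M (\<lambda>x. (f x)\<^sup>2) = integrable M (\<lambda>x. (g x)\<^sup>2)"
    using assms by (intro integrable_cong_AE) (auto simp: sq_int_def)
  with assms show ?thesis by (simp add: sq_int_def)
qed

lemma integral_square_add:
  assumes "sq_int M f" "sq_int M g"
  shows "(\<integral>x. (f x + c * g x)\<^sup>2 \<partial>M)
    = (\<integral>x. (f x)\<^sup>2 \<partial>M) + 2 * c * (\<integral>x. f x * g x \<partial>M) + c\<^sup>2 * (\<integral>x. (g x)\<^sup>2 \<partial>M)"
proof -
  have "(\<integral>x. (f x + c * g x)\<^sup>2 \<partial>M)
      = (\<integral>x. ((f x)\<^sup>2 + (2 * c) * (f x * g x)) + c\<^sup>2 * (g x)\<^sup>2 \<partial>M)"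
    by (intro Bochner_Integration.integral_cong) (auto simp: power2_eq_square algebra_simps)
  also have "\<dots> = (\<integral>x. (f x)\<^sup>2 \<partial>M) + 2 * c * (\<integral>x. f x * g x \<partial>M) + c\<^sup>2 * (\<integral>x. (g x)\<^sup>2 \<partial>M)"
    using sq_int_square[OF assms(1)] sq_int_square[OF assms(2)] sq_int_mult[OF assms] by simp
  finally show ?thesis .
qed

text \<open>The integral of \<open>(f + t g)\<^sup>2\<close> is a polynomial in t that is never
  negative, so its discriminant cannot be positive.\<close>

lemma sq_int_Cauchy_Schwarz:
  assumes f: "sq_int M f" and g: "sq_int M g"
  shows "(\<integral>x. f x * g x \<partial>M)\<^sup>2 \<le> (\<integral>x. (f x)\<^sup>2 \<partial>M) * (\<integral>x. (g x)\<^sup>2 \<partial>M)"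
proof -
  define a b c where "a = (\<integral>x. (f x)\<^sup>2 \<partial>M)" and "b = (\<integral>x. f x * g x \<partial>M)" and "c = (\<integral>x. (g x)\<^sup>2 \<partial>M)"
  have q: "0 \<le> a + 2 * t * b + t\<^sup>2 * c" for t
  proof -
    have "0 \<le> (\<integral>x. (f x + t * g x)\<^sup>2 \<partial>M)" by (rule Bochner_Integration.integral_nonneg) simp
    then show ?thesis
      unfolding integral_square_add[OF f g] a_def b_def c_def .
  qed
  have c: "0 \<le> c" by (simp add: c_def)
  show "b\<^sup>2 \<le> a * c"
  proof (cases "c = 0")
    case True
    have "b = 0"
    proof (rule ccontr)
      assume "b \<noteq> 0"
      then show False
        \<comment> \<open>With \<open>c = 0\<close> the polynomial is affine in t and takes the
          value -1 at this point.\<close>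
        using q[of "- (a + 1) / (2 * b)"] True by (simp add: field_simps)
    qed
    with True show ?thesis by simp
  next
    case False
    then show ?thesis
      using q[of "- b / c"] c by (simp add: field_simps power2_eq_square)
  qed
qed

lemma sq_int_Cauchy_Schwarz_sqrt:
  assumes f: "sq_int M f" and g: "sq_int M g"
  shows "\<bar>\<integral>x. f x * g x \<partial>M\<bar> \<le> sqrt (\<integral>x. (f x)\<^sup>2 \<partial>M) * sqrt (\<integral>x. (g x)\<^sup>2 \<partial>M)"
  using real_sqrt_le_mono[OF sq_int_Cauchy_Schwarz[OF assms]] by (simp add: real_sqrt_mult)

lemma integral_square_sum_le:
  assumes "sq_int M f" "sq_int M g"
  shows "(\<integral>x. (f x + g x)\<^sup>2 \<partial>M) \<le> 2 * (\<integral>x. (f x)\<^sup>2 \<partial>M) + 2 * (\<integral>x. (g x)\<^sup>2 \<partial>M)"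
proof -
  have "(\<integral>x. (f x + g x)\<^sup>2 \<partial>M) \<le> (\<integral>x. 2 * (f x)\<^sup>2 + 2 * (g x)\<^sup>2 \<partial>M)"
  proof (rule integral_mono)
    show "integrable M (\<lambda>x. (f x + g x)\<^sup>2)" using sq_int_add[OF assms] by (simp add: sq_int_def)
    show "integrable M (\<lambda>x. 2 * (f x)\<^sup>2 + 2 * (g x)\<^sup>2)" using assms by (simp add: sq_int_def)
    show "(f x + g x)\<^sup>2 \<le> 2 * (f x)\<^sup>2 + 2 * (g x)\<^sup>2" for x
      using sum_squares_bound[of "f x" "g x"] by (simp add: power2_sum)
  qed
  then show ?thesis using assms by (simp add: sq_int_def)
qed

text \<open>Square integrability of all members and of the limit is part of the notion: the integral
  of a function that is not integrable is 0 by default, so the limit of the integrals alone would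
  say nothing.\<close>

definition L2_lim :: "'a measure \<Rightarrow> (nat \<Rightarrow> 'a \<Rightarrow> real) \<Rightarrow> ('a \<Rightarrow> real) \<Rightarrow> bool" where
  "L2_lim M \<phi> v \<longleftrightarrow> sq_int M v \<and> (\<forall>k. sq_int M (\<phi> k)) \<and>
     (\<lambda>k. \<integral>x. (\<phi> k x - v x)\<^sup>2 \<partial>M) \<longlonglongrightarrow> 0"

text \<open>Strong convergence implies weak convergence, by the Cauchy-Schwarz inequality.\<close>

lemma L2_lim_inner:
  assumes "L2_lim M \<phi> v" "sq_int M g"
  shows "(\<lambda>k. \<integral>x. \<phi> k x * g x \<partial>M) \<longlonglongrightarrow> (\<integral>x. v x * g x \<partial>M)"
proof -
  have v: "sq_int M v" and p: "\<And>k. sq_int M (\<phi> k)"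
    and l: "(\<lambda>k. \<integral>x. (\<phi> k x - v x)\<^sup>2 \<partial>M) \<longlonglongrightarrow> 0"
    using assms(1) by (auto simp: L2_lim_def)
  have eq: "(\<integral>x. \<phi> k x * g x \<partial>M) - (\<integral>x. v x * g x \<partial>M) = (\<integral>x. (\<phi> k x - v x) * g x \<partial>M)" for k
    using sq_int_mult[OF p assms(2), of k] sq_int_mult[OF v assms(2)]
    by (simp add: left_diff_distrib)
  have "(\<lambda>k. (\<integral>x. \<phi> k x * g x \<partial>M) - (\<integral>x. v x * g x \<partial>M)) \<longlonglongrightarrow> 0"
  proof (rule Lim_null_comparison)
    show "\<forall>\<^sub>F k in sequentially. norm ((\<integral>x. \<phi> k x * g x \<partial>M) - (\<integral>x. v x * g x \<partial>M))
        \<le> sqrt (\<integral>x. (\<phi> k x - v x)\<^sup>2 \<partial>M) * sqrt (\<integral>x. (g x)\<^sup>2 \<partial>M)"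
      unfolding eq using sq_int_Cauchy_Schwarz_sqrt[OF sq_int_diff[OF p v] assms(2)] by simp
    show "(\<lambda>k. sqrt (\<integral>x. (\<phi> k x - v x)\<^sup>2 \<partial>M) * sqrt (\<integral>x. (g x)\<^sup>2 \<partial>M)) \<longlonglongrightarrow> 0"
      using tendsto_mult[OF tendsto_real_sqrt[OF l] tendsto_const] by simp
  qed
  then show ?thesis by (simp add: LIM_zero_iff)
qed

lemma L2_lim_add:
  assumes "L2_lim M \<phi> v" "L2_lim M \<psi> w"
  shows "L2_lim M (\<lambda>k x. \<phi> k x + \<psi> k x) (\<lambda>x. v x + w x)"
  unfolding L2_lim_def
proof (intro conjI allI)
  have v: "sq_int M v" "sq_int M w" and p: "\<And>k. sq_int M (\<phi> k)" "\<And>k. sq_int M (\<psi> k)"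
    and l: "(\<lambda>k. \<integral>x. (\<phi> k x - v x)\<^sup>2 \<partial>M) \<longlonglongrightarrow> 0" "(\<lambda>k. \<integral>x. (\<psi> k x - w x)\<^sup>2 \<partial>M) \<longlonglongrightarrow> 0"
    using assms by (auto simp: L2_lim_def)
  show "sq_int M (\<lambda>x. v x + w x)" "\<And>k. sq_int M (\<lambda>x. \<phi> k x + \<psi> k x)"
    using v p by (auto intro: sq_int_add)
  show "(\<lambda>k. \<integral>x. (\<phi> k x + \<psi> k x - (v x + w x))\<^sup>2 \<partial>M) \<longlonglongrightarrow> 0"
  proof (rule Lim_null_comparison)
    have "(\<integral>x. (\<phi> k x + \<psi> k x - (v x + w x))\<^sup>2 \<partial>M)
        \<le> 2 * (\<integral>x. (\<phi> k x - v x)\<^sup>2 \<partial>M) + 2 * (\<integral>x. (\<psi> k x - w x)\<^sup>2 \<partial>M)" for k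
      using integral_square_sum_le[OF sq_int_diff[OF p(1) v(1)] sq_int_diff[OF p(2) v(2)], of k k]
      by (simp add: algebra_simps)
    then show "\<forall>\<^sub>F k in sequentially. norm (\<integral>x. (\<phi> k x + \<psi> k x - (v x + w x))\<^sup>2 \<partial>M)
        \<le> 2 * (\<integral>x. (\<phi> k x - v x)\<^sup>2 \<partial>M) + 2 * (\<integral>x. (\<psi> k x - w x)\<^sup>2 \<partial>M)"
      by (intro always_eventually) simp
    show "(\<lambda>k. 2 * (\<integral>x. (\<phi> k x - v x)\<^sup>2 \<partial>M) + 2 * (\<integral>x. (\<psi> k x - w x)\<^sup>2 \<partial>M)) \<longlonglongrightarrow> 0"
      using tendsto_add[OF tendsto_mult[OF tendsto_const l(1)] tendsto_mult[OF tendsto_const l(2)], of 2 2]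
      by simp
  qed
qed

lemma L2_lim_cmult:
  assumes "L2_lim M \<phi> v"
  shows "L2_lim M (\<lambda>k x. c * \<phi> k x) (\<lambda>x. c * v x)"
proof -
  have "(\<lambda>k. c\<^sup>2 * (\<integral>x. (\<phi> k x - v x)\<^sup>2 \<partial>M)) \<longlonglongrightarrow> c\<^sup>2 * 0"
    using assms by (intro tendsto_intros) (simp add: L2_lim_def)
  moreover have "(\<integral>x. (c * \<phi> k x - c * v x)\<^sup>2 \<partial>M) = c\<^sup>2 * (\<integral>x. (\<phi> k x - v x)\<^sup>2 \<partial>M)" for k
    by (simp flip: right_diff_distrib add: power_mult_distrib)
  ultimately show ?thesis
    using assms by (auto simp: L2_lim_def intro: sq_int_cmult)
qed

section \<open>Lebesgue measure on subsets\<close>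

lemma set_integral_eq_lebesgue_on:
  fixes f :: "'a::euclidean_space \<Rightarrow> real"
  assumes "R \<in> sets lebesgue"
  shows "(LINT p:R|lebesgue. f p) = integral\<^sup>L (lebesgue_on R) f"
  using assms by (simp add: set_lebesgue_integral_def integral_restrict_space)

lemma L2_eq_sq_int:
  assumes "R \<in> sets lebesgue"
  shows "L2 R f \<longleftrightarrow> sq_int (lebesgue_on R) f"
  using assms
  by (simp add: L2_def sq_int_def set_borel_measurable_def set_integrable_def
      borel_measurable_restrict_space_iff integrable_restrict_space)

lemma integrable_lebesgue_on_subset:
  fixes f :: "'a::euclidean_space \<Rightarrow> real"
  assumes "integrable (lebesgue_on R) f" "S \<subseteq> R" "S \<in> sets lebesgue" "R \<in> sets lebesgue"
  shows "integrable (lebesgue_on S) f"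
  using set_integrable_subset[of lebesgue R f S] assms
  by (simp add: set_integrable_def integrable_restrict_space)

lemma sq_int_subset:
  assumes "sq_int (lebesgue_on R) f" "S \<subseteq> R" "S \<in> sets lebesgue" "R \<in> sets lebesgue"
  shows "sq_int (lebesgue_on S) f"
  unfolding sq_int_def
  using assms integrable_lebesgue_on_subset[of R "\<lambda>x. (f x)\<^sup>2" S]
  by (auto simp: sq_int_def intro: measurable_restrict_mono)

lemma integral_lebesgue_on_subset_mono:
  fixes f :: "'a::euclidean_space \<Rightarrow> real"
  assumes f: "integrable (lebesgue_on R) f" and S: "S \<subseteq> R" "S \<in> sets lebesgue" "R \<in> sets lebesgue"
    and nn: "\<And>x. 0 \<le> f x"
  shows "integral\<^sup>L (lebesgue_on S) f \<le> integral\<^sup>L (lebesgue_on R) f"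
proof -
  have "integral\<^sup>L lebesgue (\<lambda>x. indicator S x *\<^sub>R f x) \<le> integral\<^sup>L lebesgue (\<lambda>x. indicator R x *\<^sub>R f x)"
    using f integrable_lebesgue_on_subset[OF f S] S nn
    by (intro integral_mono) (auto simp: integrable_restrict_space indicator_def)
  then show ?thesis using S by (simp add: integral_restrict_space)
qed

lemma L2_lim_subset:
  assumes "L2_lim (lebesgue_on R) \<phi> v" "S \<subseteq> R" "S \<in> sets lebesgue" "R \<in> sets lebesgue"
  shows "L2_lim (lebesgue_on S) \<phi> v"
  unfolding L2_lim_def
proof (intro conjI allI)
  have *: "sq_int (lebesgue_on R) v" "\<And>k. sq_int (lebesgue_on R) (\<phi> k)"
    "(\<lambda>k. \<integral>x. (\<phi> k x - v x)\<^sup>2 \<partial>lebesgue_on R) \<longlonglongrightarrow> 0" using assms(1) by (auto simp: L2_lim_def)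
  show "sq_int (lebesgue_on S) v" "\<And>k. sq_int (lebesgue_on S) (\<phi> k)"
    using * assms sq_int_subset by blast+
  show "(\<lambda>k. \<integral>x. (\<phi> k x - v x)\<^sup>2 \<partial>lebesgue_on S) \<longlonglongrightarrow> 0"
  proof (rule Lim_null_comparison[OF _ *(3)], rule always_eventually, rule allI)
    fix k
    show "norm (\<integral>x. (\<phi> k x - v x)\<^sup>2 \<partial>lebesgue_on S) \<le> (\<integral>x. (\<phi> k x - v x)\<^sup>2 \<partial>lebesgue_on R)"
      using integral_lebesgue_on_subset_mono[OF sq_int_square[OF sq_int_diff[OF *(2) *(1)]], of S k] assms(2-)
      by simp
  qed
qed

lemma L2_lim_cong_AE:
  assumes "L2_lim M \<phi> v" "w \<in> borel_measurable M" "AE x in M. v x = w x"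
  shows "L2_lim M \<phi> w"
proof -
  have v: "sq_int M v" "\<And>k. sq_int M (\<phi> k)" using assms by (auto simp: L2_lim_def)
  have w: "sq_int M w" using sq_int_cong_AE[OF v(1) assms(2,3)] .
  have "(\<integral>x. (\<phi> k x - v x)\<^sup>2 \<partial>M) = (\<integral>x. (\<phi> k x - w x)\<^sup>2 \<partial>M)" for k
    using sq_int_measurable[OF sq_int_diff[OF v(2) v(1)]] sq_int_measurable[OF sq_int_diff[OF v(2) w]] assms(3)
    by (intro integral_cong_AE borel_measurable_power) auto
  with assms(1) w show ?thesis by (simp add: L2_lim_def)
qed

section \<open>Smooth functions of one variable\<close>

definition smooth1 :: "(real \<Rightarrow> real) \<Rightarrow> bool" where
  "smooth1 f \<longleftrightarrow> (\<forall>n x. (deriv ^^ n) f differentiable at x)"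

text \<open>A class of differentiable functions that is closed under \<open>deriv\<close> contains
  only smooth functions. The proofs below only have to guess such a class, which avoids formulas for
  n-th derivatives.\<close>

lemma smooth1_coinduct:
  assumes "P f" and "\<And>g x. P g \<Longrightarrow> g differentiable at x" and "\<And>g. P g \<Longrightarrow> P (deriv g)"
  shows "smooth1 f"
proof -
  have "P ((deriv ^^ n) f)" for n
    by (induction n) (auto simp: assms)
  then show ?thesis by (simp add: smooth1_def assms(2))
qed

lemma smooth1_differentiable: "smooth1 f \<Longrightarrow> f differentiable at x"
  unfolding smooth1_def by (metis funpow_0)

lemma smooth1_DERIV: "smooth1 f \<Longrightarrow> (f has_real_derivative deriv f x) (at x)"
  by (simp add: DERIV_deriv_iff_real_differentiable smooth1_differentiable)

lemma smooth1_deriv: "smooth1 f \<Longrightarrow> smooth1 (deriv f)"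
  unfolding smooth1_def by (metis funpow_simps_right(2) comp_apply)

lemma smooth1_continuous: "smooth1 f \<Longrightarrow> continuous_on S f"
  by (meson DERIV_continuous_on has_field_derivative_at_within smooth1_DERIV)

text \<open>The derivative of a product is not a product, but it stays in the algebra generated by
  the smooth functions; this algebra is the class for the coinduction.\<close>

inductive smooth1_alg :: "(real \<Rightarrow> real) \<Rightarrow> bool" where
  base: "smooth1 f \<Longrightarrow> smooth1_alg f"
| add: "smooth1_alg f \<Longrightarrow> smooth1_alg g \<Longrightarrow> smooth1_alg (\<lambda>x. f x + g x)"
| mult: "smooth1_alg f \<Longrightarrow> smooth1_alg g \<Longrightarrow> smooth1_alg (\<lambda>x. f x * g x)"

lemma smooth1_alg_deriv:
  assumes "smooth1_alg f"
  shows "(\<forall>x. (f has_real_derivative deriv f x) (at x)) \<and> smooth1_alg (deriv f)"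
  using assms
proof induction
  case (base f)
  then show ?case by (auto intro: smooth1_alg.base smooth1_deriv smooth1_DERIV)
next
  case (add f g)
  have d: "((\<lambda>x. f x + g x) has_real_derivative deriv f x + deriv g x) (at x)" for x
    using add by (auto intro: derivative_intros)
  then have "deriv (\<lambda>x. f x + g x) = (\<lambda>x. deriv f x + deriv g x)"
    by (intro ext DERIV_imp_deriv)
  with d add show ?case by (auto intro: smooth1_alg.add)
next
  case (mult f g)
  have d: "((\<lambda>x. f x * g x) has_real_derivative deriv f x * g x + f x * deriv g x) (at x)" for x
    using mult by (auto intro!: derivative_eq_intros)
  then have "deriv (\<lambda>x. f x * g x) = (\<lambda>x. deriv f x * g x + f x * deriv g x)"
    by (intro ext DERIV_imp_deriv)
  with d mult show ?case by (auto intro: smooth1_alg.add smooth1_alg.mult)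
qed

lemma smooth1_coinduct_DERIV:
  assumes "P f" and *: "\<And>g. P g \<Longrightarrow> (\<forall>x. (g has_real_derivative deriv g x) (at x)) \<and> P (deriv g)"
  shows "smooth1 f"
proof (rule smooth1_coinduct[of P])
  show "g differentiable at x" if "P g" for g x
    using *[OF that] by (metis real_differentiable_def)
qed (use assms in simp_all)

lemma smooth1_alg_smooth1: "smooth1_alg f \<Longrightarrow> smooth1 f"
  by (erule smooth1_coinduct_DERIV) (rule smooth1_alg_deriv)

lemma smooth1_mult: "smooth1 f \<Longrightarrow> smooth1 g \<Longrightarrow> smooth1 (\<lambda>x. f x * g x)"
  by (rule smooth1_alg_smooth1, rule smooth1_alg.mult; rule smooth1_alg.base)

lemma smooth1_const: "smooth1 (\<lambda>x. c)"
  by (rule smooth1_coinduct[of "\<lambda>f. \<exists>c. f = (\<lambda>x. c)"]) auto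

lemma smooth1_ident: "smooth1 (\<lambda>x. x)"
  by (rule smooth1_coinduct[of "\<lambda>f. f = (\<lambda>x. x) \<or> smooth1 f"])
    (auto intro: smooth1_const smooth1_deriv smooth1_differentiable)

lemma smooth1_affine_compose:
  assumes "smooth1 f" shows "smooth1 (\<lambda>x. f (a * x + b))"
proof (rule smooth1_coinduct[of "\<lambda>g. \<exists>c h. smooth1 h \<and> g = (\<lambda>x. c * h (a * x + b))"])
  show "\<exists>c h. smooth1 h \<and> (\<lambda>x. f (a * x + b)) = (\<lambda>x. c * h (a * x + b))"
    using assms by (intro exI[of _ 1] exI[of _ f]) simp
  have D: "((\<lambda>x. c * h (a * x + b)) has_real_derivative (c * a) * deriv h (a * x + b)) (at x)"
    if "smooth1 h" for c h x
    by (rule DERIV_cong)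
       (rule DERIV_cmult, rule DERIV_chain2[OF smooth1_DERIV[OF that]], auto intro!: derivative_eq_intros)
  fix g assume "\<exists>c h. smooth1 h \<and> g = (\<lambda>x. c * h (a * x + b))"
  then obtain c h where h: "smooth1 h" "g = (\<lambda>x. c * h (a * x + b))" by auto
  then show "g differentiable at x" for x
    using D by (metis real_differentiable_def)
  have "deriv g = (\<lambda>x. (c * a) * deriv h (a * x + b))"
    unfolding h(2) by (intro ext DERIV_imp_deriv D h)
  then show "\<exists>c h. smooth1 h \<and> deriv g = (\<lambda>x. c * h (a * x + b))"
    using smooth1_deriv[OF h(1)] by (intro exI[of _ "c * a"] exI[of _ "deriv h"]) simp
qed

text \<open>Sine and cosine of one frequency are treated together because their span is closed under
  differentiation.\<close>

lemma smooth1_trig: "smooth1 (\<lambda>x. A * sin (w * x) + B * cos (w * x))"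
proof (rule smooth1_coinduct[of "\<lambda>g. \<exists>A B. g = (\<lambda>x. A * sin (w * x) + B * cos (w * x))"])
  have D: "((\<lambda>x. A * sin (w * x) + B * cos (w * x)) has_real_derivative
      (- (B * w)) * sin (w * x) + (A * w) * cos (w * x)) (at x)" for A B x
    by (auto intro!: derivative_eq_intros)
  fix g assume "\<exists>A B. g = (\<lambda>x. A * sin (w * x) + B * cos (w * x))"
  then obtain A B where g: "g = (\<lambda>x. A * sin (w * x) + B * cos (w * x))" by auto
  then show "g differentiable at x" for x using D by (metis real_differentiable_def)
  have "deriv g = (\<lambda>x. (- (B * w)) * sin (w * x) + (A * w) * cos (w * x))"
    unfolding g by (intro ext DERIV_imp_deriv D)
  then show "\<exists>A B. deriv g = (\<lambda>x. A * sin (w * x) + B * cos (w * x))"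
    by (intro exI[of _ "- (B * w)"] exI[of _ "A * w"])
qed (intro exI, rule refl)

lemma smooth1_sin: "smooth1 (\<lambda>x. sin (w * x))" and smooth1_cos: "smooth1 (\<lambda>x. cos (w * x))"
  using smooth1_trig[of 1 w 0] smooth1_trig[of 0 w 1] by simp_all

section \<open>Flat functions, from which the cut-offs are made\<close>

text \<open>All derivatives of \<open>exp (- 1 / x)\<close> lie in the span of these functions.\<close>

definition flat :: "nat \<Rightarrow> real \<Rightarrow> real" where
  "flat m x = (if x > 0 then (1 / x) ^ m * exp (- (1 / x)) else 0)"

text \<open>The substitution of \<open>inverse x\<close> for x turns the claim at 0 from the right
  into the decay of a power divided by the exponential at infinity.\<close>

lemma flat_tendsto_0: "(flat m \<longlongrightarrow> 0) (at 0)"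
proof -
  have "((\<lambda>x::real. x ^ m / exp x) \<longlongrightarrow> 0) at_top" by (rule tendsto_power_div_exp_0)
  then have *: "((\<lambda>x::real. inverse x ^ m / exp (inverse x)) \<longlongrightarrow> 0) (at_right 0)"
    by (rule filterlim_compose[OF _ filterlim_inverse_at_top_right])
  have "inverse x ^ m / exp (inverse x) = flat m x" if "x > 0" for x :: real
    using that by (simp only: flat_def if_True exp_minus inverse_eq_divide[of x, symmetric] divide_inverse[of _ "exp _"])
  then have "\<forall>\<^sub>F x in at_right 0. inverse x ^ m / exp (inverse x) = flat m x"
    by (rule eventually_at_rightI[of 0 1]) auto
  with * have 1: "(flat m \<longlongrightarrow> 0) (at_right 0)"
    by (rule Lim_transform_eventually)
  have "\<forall>\<^sub>F x in at_left 0. flat m x = 0"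
    by (rule eventually_at_leftI[of "-1"]) (auto simp: flat_def)
  then have "(flat m \<longlongrightarrow> 0) (at_left 0)" by (rule tendsto_eventually)
  with 1 show ?thesis by (simp add: filterlim_split_at)
qed

lemma flat_DERIV: "(flat m has_real_derivative flat (m + 2) x - m * flat (m + 1) x) (at x)"
proof (cases x "0::real" rule: linorder_cases)
  case less
  have "(flat m has_real_derivative 0) (at x)"
    by (rule has_field_derivative_transform_within_open[of "\<lambda>_. 0" _ _ "{..<0}"])
       (use less in \<open>auto simp: flat_def\<close>)
  then show ?thesis using less by (simp add: flat_def)
next
  case equal
  \<comment> \<open>At 0 the difference quotient is itself a flat function, so its limit is already
    known.\<close>
  have "flat (m + 1) h = (flat m (0 + h) - flat m 0) / h" for h
    by (cases "h > 0") (simp_all add: flat_def)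
  then have "\<forall>\<^sub>F h in at 0. flat (m + 1) h = (flat m (0 + h) - flat m 0) / h"
    by simp
  then have "((\<lambda>h. (flat m (0 + h) - flat m 0) / h) \<longlongrightarrow> 0) (at 0)"
    by (rule Lim_transform_eventually[OF flat_tendsto_0])
  then show ?thesis using equal by (simp add: DERIV_def flat_def)
next
  case greater
  define y where "y = 1 / x"
  have y: "((\<lambda>x. 1 / x) has_real_derivative - (y\<^sup>2)) (at x)"
    using greater by (auto intro!: derivative_eq_intros simp: y_def power2_eq_square)
  have 1: "((\<lambda>x. (1 / x) ^ m) has_real_derivative (- (y\<^sup>2)) * (m * y ^ (m - 1))) (at x)"
    by (rule DERIV_cong[OF DERIV_power[OF y]]) (simp add: y_def)
  have 2: "((\<lambda>x. exp (- (1 / x))) has_real_derivative exp (- y) * y\<^sup>2) (at x)"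
    by (rule DERIV_cong[OF DERIV_fun_exp[OF DERIV_minus[OF y]]]) (simp add: y_def)
  have "((\<lambda>x. (1 / x) ^ m * exp (- (1 / x))) has_real_derivative flat (m + 2) x - m * flat (m + 1) x) (at x)"
    by (rule DERIV_cong[OF DERIV_mult[OF 1 2]])
       (use greater in \<open>cases m; simp add: flat_def flip: y_def; simp add: algebra_simps power2_eq_square\<close>)
  then show ?thesis
    by (rule has_field_derivative_transform_within_open[of _ _ _ "{0<..}"])
       (use greater in \<open>auto simp: flat_def\<close>)
qed

inductive flat_span :: "(real \<Rightarrow> real) \<Rightarrow> bool" where
  base: "flat_span (\<lambda>x. c * flat m x)"
| add: "flat_span f \<Longrightarrow> flat_span g \<Longrightarrow> flat_span (\<lambda>x. f x + g x)"

lemma smooth1_flat: "smooth1 (flat m)"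
proof -
  have *: "(\<forall>x. (f has_real_derivative deriv f x) (at x)) \<and> flat_span (deriv f)" if "flat_span f" for f
    using that
  proof induction
    case (base c m)
    have d: "((\<lambda>x. c * flat m x) has_real_derivative c * flat (m+2) x + (- c * m) * flat (m+1) x) (at x)" for x
      by (rule DERIV_cong, rule DERIV_cmult[OF flat_DERIV]) (simp add: algebra_simps)
    then have "deriv (\<lambda>x. c * flat m x) = (\<lambda>x. c * flat (m+2) x + (- c * m) * flat (m+1) x)"
      by (intro ext DERIV_imp_deriv)
    with d show ?case by (metis flat_span.intros)
  next
    case (add f g)
    have d: "((\<lambda>x. f x + g x) has_real_derivative deriv f x + deriv g x) (at x)" for x
      using add by (auto intro: derivative_intros)
    then have "deriv (\<lambda>x. f x + g x) = (\<lambda>x. deriv f x + deriv g x)"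
      by (intro ext DERIV_imp_deriv)
    with d add show ?case by (auto intro: flat_span.add)
  qed
  have "flat_span (flat m)" using flat_span.base[of 1 m] by simp
  then show ?thesis
    by (rule smooth1_coinduct_DERIV) (rule *)
qed

section \<open>Smooth functions on the plane\<close>

text \<open>Keeps quantified points in one piece; splitting them into pairs would destroy the
  formulation by coordinates \<open>co\<close> and \<open>pt\<close>.\<close>

declare split_paired_All [simp del]

text \<open>Coordinate directions are indexed by truth values, \<open>True\<close> being the first one; \<open>pt z s t\<close> has
  coordinate \<open>s\<close> in direction \<open>z\<close>. This way every statement covers both directions.\<close>

definition co :: "bool \<Rightarrow> point \<Rightarrow> real" where "co z p = (if z then fst p else snd p)"

definition pt :: "bool \<Rightarrow> real \<Rightarrow> real \<Rightarrow> point" where "pt z s t = (if z then (s, t) else (t, s))"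

definition pd :: "bool \<Rightarrow> (point \<Rightarrow> real) \<Rightarrow> point \<Rightarrow> real" where "pd z = (if z then dx else dy)"

lemma co_pt [simp]: "co z (pt z s t) = s" "co (\<not> z) (pt z s t) = t"
  by (auto simp: co_def pt_def)

lemma pt_co [simp]: "pt z (co z p) (co (\<not> z) p) = p"
  by (cases p) (auto simp: co_def pt_def)

lemma ex_pt: obtains s t where "p = pt z s t"
  using pt_co[of z p] by metis

lemma pt_differentiable: "(\<lambda>s. pt z s t) differentiable (at s)"
proof -
  have "((\<lambda>s. (s, t)) has_derivative (\<lambda>h. (h, 0))) (at s)" "((\<lambda>s. (t, s)) has_derivative (\<lambda>h. (0, h))) (at s)"
    by (auto intro!: derivative_eq_intros)
  then show ?thesis by (cases z) (auto simp: pt_def differentiable_def)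
qed

lemma differentiable_DERIV_pd:
  assumes "\<phi> differentiable (at (pt z s t))"
  shows "((\<lambda>s. \<phi> (pt z s t)) has_real_derivative pd z \<phi> (pt z s t)) (at s)"
proof -
  have "(\<lambda>s. \<phi> (pt z s t)) differentiable (at s)"
    using differentiable_chain_at[OF pt_differentiable assms] by (simp add: o_def)
  then have "((\<lambda>s. \<phi> (pt z s t)) has_real_derivative deriv (\<lambda>s. \<phi> (pt z s t)) s) (at s)"
    by (simp add: DERIV_deriv_iff_real_differentiable)
  moreover have "deriv (\<lambda>s. \<phi> (pt z s t)) s = pd z \<phi> (pt z s t)"
    by (cases z) (simp_all add: pd_def pt_def dx_def dy_def)
  ultimately show ?thesis by simp
qed

lemma pd_eqI:
  assumes "\<And>s t. ((\<lambda>s. \<phi> (pt z s t)) has_real_derivative \<psi> (pt z s t)) (at s)"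
  shows "pd z \<phi> = \<psi>"
proof
  fix p
  obtain s t where p: "p = pt z s t" by (rule ex_pt)
  have "pd z \<phi> (pt z s t) = deriv (\<lambda>s. \<phi> (pt z s t)) s"
    by (cases z) (simp_all add: pd_def pt_def dx_def dy_def)
  then show "pd z \<phi> p = \<psi> p" using DERIV_imp_deriv[OF assms] p by simp
qed

lemma smooth_iterated: "smooth \<phi> \<Longrightarrow> (dx ^^ i) ((dy ^^ j) \<phi>) differentiable (at p)"
  by (simp add: smooth_def)

lemma smooth_differentiable: "smooth \<phi> \<Longrightarrow> \<phi> differentiable (at p)"
  using smooth_iterated[of \<phi> 0 0] by simp

lemma smooth_continuous: "smooth \<phi> \<Longrightarrow> continuous_on S \<phi>"
  by (meson smooth_differentiable continuous_at_imp_continuous_on differentiable_imp_continuous_within)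

lemma smooth_DERIV:
  "smooth \<phi> \<Longrightarrow> ((\<lambda>s. \<phi> (pt z s t)) has_real_derivative pd z \<phi> (pt z s t)) (at s)"
  by (rule differentiable_DERIV_pd[OF smooth_differentiable])

lemma smooth_dy: "smooth \<phi> \<Longrightarrow> smooth (dy \<phi>)"
  unfolding smooth_def by (metis funpow_simps_right(2) comp_apply)

lemma pd_continuous: "smooth \<phi> \<Longrightarrow> continuous_on S (pd z \<phi>)"
  using smooth_iterated[of \<phi> 1 0] smooth_iterated[of \<phi> 0 1]
  by (auto simp: pd_def intro!: continuous_at_imp_continuous_on differentiable_imp_continuous_within)

text \<open>Write \<phi> as the integral of \<open>dy \<phi>\<close> along a vertical segment.
  Differentiating in the first variable under the integral expresses \<open>dx \<phi>\<close> as an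
  integral of \<open>dx (dy \<phi>)\<close>, and the fundamental theorem differentiates that in the
  second variable.\<close>

lemma dy_dx_eq:
  assumes "smooth \<phi>"
  shows "dy (dx \<phi>) = dx (dy \<phi>)"
proof
  fix p :: point
  obtain x y where p: "p = (x, y)" by (cases p)
  \<comment> \<open>The base point of the vertical segments; any point below y would do, so that y
    is interior to \<open>{c..y+1}\<close>.\<close>
  define c where "c = y - 1"
  let ?H = "dx (dy \<phi>)"
  have dH: "?H differentiable (at q)" for q using smooth_iterated[OF assms, of 1 1] by simp
  have cH': "continuous_on S ?H" for S
    by (simp add: continuous_at_imp_continuous_on differentiable_imp_continuous_within dH)
  then have cH: "continuous_on S (\<lambda>(x, t). ?H (x, t))" for S
    by simp
  have cF: "continuous_on S (\<lambda>t. dy \<phi> (x, t))" for S x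
    by (rule continuous_on_compose2[OF smooth_continuous[OF smooth_dy[OF assms], of UNIV]])
       (auto intro!: continuous_intros)
  have cHt: "continuous_on S (\<lambda>t. ?H (x, t))" for S x
    by (rule continuous_on_compose2[OF cH'[of UNIV]])
       (auto intro!: continuous_intros)
  have Dy: "((\<lambda>t. \<psi> (x, t)) has_real_derivative dy \<psi> (x, t)) (at t)" if "\<psi> differentiable (at (x, t))" for \<psi> x t
    using differentiable_DERIV_pd[of \<psi> False t x] that by (simp add: pt_def pd_def)
  have Dx: "((\<lambda>s. \<psi> (s, t)) has_real_derivative dx \<psi> (s, t)) (at s)" if "\<psi> differentiable (at (s, t))" for \<psi> s t
    using differentiable_DERIV_pd[of \<psi> True s t] that by (simp add: pt_def pd_def)
  have phi: "\<phi> (s, t) = \<phi> (s, c) + integral {c..t} (\<lambda>u. dy \<phi> (s, u))" if "c \<le> t" for s t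
  proof -
    have "((\<lambda>u. dy \<phi> (s, u)) has_integral (\<phi> (s, t) - \<phi> (s, c))) {c..t}"
      using that Dy[OF smooth_differentiable[OF assms]]
      by (intro fundamental_theorem_of_calculus)
         (auto simp flip: has_real_derivative_iff_has_vector_derivative intro: has_field_derivative_at_within)
    then show ?thesis by (simp add: integral_unique)
  qed
  have dxphi: "dx \<phi> (x, t) = dx \<phi> (x, c) + integral {c..t} (\<lambda>u. ?H (x, u))" if "c \<le> t" for t
  proof -
    have "((\<lambda>s. integral (cbox c t) (\<lambda>u. dy \<phi> (s, u))) has_field_derivative
        integral (cbox c t) (\<lambda>u. ?H (x, u))) (at x within UNIV)"
    proof (rule leibniz_rule_field_derivative)
      show "((\<lambda>s. dy \<phi> (s, u)) has_real_derivative ?H (s, u)) (at s within UNIV)" for s u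
        using Dx[OF smooth_differentiable[OF smooth_dy[OF assms]]] by simp
      show "(\<lambda>u. dy \<phi> (s, u)) integrable_on cbox c t" for s
        by (intro integrable_continuous cF)
      show "continuous_on (UNIV \<times> cbox c t) (\<lambda>(s, u). ?H (s, u))" by (rule cH)
    qed auto
    then have "((\<lambda>s. \<phi> (s, c) + integral (cbox c t) (\<lambda>u. dy \<phi> (s, u))) has_field_derivative
        dx \<phi> (x, c) + integral (cbox c t) (\<lambda>u. ?H (x, u))) (at x)"
      by (intro DERIV_add Dx[OF smooth_differentiable[OF assms]]) simp
    moreover have "(\<lambda>s. \<phi> (s, c) + integral (cbox c t) (\<lambda>u. dy \<phi> (s, u))) = (\<lambda>s. \<phi> (s, t))"
      using phi[OF that] by (intro ext) simp
    ultimately show ?thesis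
      using DERIV_unique[OF Dx[OF smooth_differentiable[OF assms], of t x]] by simp
  qed
  have "((\<lambda>t. integral {c..t} (\<lambda>u. ?H (x, u))) has_real_derivative ?H (x, y)) (at y within {c..y+1})"
    by (rule integral_has_real_derivative[OF cHt]) (auto simp: c_def)
  then have "((\<lambda>t. dx \<phi> (x, c) + integral {c..t} (\<lambda>u. ?H (x, u))) has_real_derivative 0 + ?H (x, y)) (at y)"
    by (intro DERIV_add) (auto simp: c_def at_within_Icc_at)
  then have 0: "((\<lambda>t. dx \<phi> (x, c) + integral {c..t} (\<lambda>u. ?H (x, u))) has_real_derivative ?H (x, y)) (at y)"
    by simp
  have 1: "((\<lambda>t. dx \<phi> (x, t)) has_real_derivative ?H (x, y)) (at y)"
  proof (rule has_field_derivative_transform_within_open[OF 0, of "{c<..}"])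
    show "dx \<phi> (x, c) + integral {c..t} (\<lambda>u. ?H (x, u)) = dx \<phi> (x, t)"
      if "t \<in> {c<..}" for t
      using dxphi[of t] that by simp
  qed (auto simp: c_def)
  moreover have "((\<lambda>t. dx \<phi> (x, t)) has_real_derivative dy (dx \<phi>) (x, y)) (at y)"
    using Dy smooth_iterated[OF assms, of 1 0] by simp
  ultimately show "dy (dx \<phi>) p = dx (dy \<phi>) p"
    using DERIV_unique p by blast
qed

lemma dy_funpow_smooth: "smooth \<phi> \<Longrightarrow> smooth ((dy ^^ j) \<phi>)"
  by (induction j) (auto intro: smooth_dy)

lemma dy_funpow_dx: "smooth \<phi> \<Longrightarrow> (dy ^^ j) (dx \<phi>) = dx ((dy ^^ j) \<phi>)"
  by (induction j) (auto simp: dy_dx_eq dy_funpow_smooth)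

text \<open>In the definition of \<open>smooth\<close> the derivatives \<open>dx\<close> are always
  the outer ones. An inner \<open>dx\<close> has to be moved outwards past every \<open>dy\<close>
  before that definition applies.\<close>

lemma smooth_dx: "smooth \<phi> \<Longrightarrow> smooth (dx \<phi>)"
proof -
  assume s: "smooth \<phi>"
  have "(dx ^^ i) ((dy ^^ j) (dx \<phi>)) = (dx ^^ Suc i) ((dy ^^ j) \<phi>)" for i j
    by (simp add: dy_funpow_dx[OF s] funpow_swap1)
  with s show ?thesis unfolding smooth_def by metis
qed

lemma smooth_pd: "smooth \<phi> \<Longrightarrow> smooth (pd z \<phi>)"
  by (simp add: pd_def smooth_dx smooth_dy)

section \<open>Closure properties of smooth functions\<close>

lemma smooth_coinduct:
  assumes "P \<phi>" and 1: "\<And>g p. P g \<Longrightarrow> g differentiable (at p)" and 2: "\<And>g z. P g \<Longrightarrow> P (pd z g)"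
  shows "smooth \<phi>"
proof -
  have P: "P (dx g)" "P (dy g)" if "P g" for g
    using 2[OF that, of True] 2[OF that, of False] by (simp_all add: pd_def)
  have "P ((dy ^^ j) \<phi>)" for j by (induction j) (auto intro: P assms)
  then have "P ((dx ^^ i) ((dy ^^ j) \<phi>))" for i j by (induction i) (auto intro: P)
  then show ?thesis by (simp add: smooth_def 1)
qed

lemma pd_lincomb:
  assumes "smooth \<phi>" "smooth \<psi>"
  shows "pd z (\<lambda>p. a * \<phi> p + b * \<psi> p) = (\<lambda>p. a * pd z \<phi> p + b * pd z \<psi> p)"
  by (rule pd_eqI) (intro DERIV_add DERIV_cmult smooth_DERIV assms)

lemma smooth_lincomb:
  assumes "smooth \<phi>" "smooth \<psi>"
  shows "smooth (\<lambda>p. a * \<phi> p + b * \<psi> p)"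
proof (rule smooth_coinduct[of "\<lambda>g. \<exists>\<phi> \<psi>. smooth \<phi> \<and> smooth \<psi> \<and> g = (\<lambda>p. a * \<phi> p + b * \<psi> p)"])
  fix g assume "\<exists>\<phi> \<psi>. smooth \<phi> \<and> smooth \<psi> \<and> g = (\<lambda>p. a * \<phi> p + b * \<psi> p)"
  then obtain \<phi> \<psi> where g: "smooth \<phi>" "smooth \<psi>" "g = (\<lambda>p. a * \<phi> p + b * \<psi> p)" by auto
  then show "g differentiable at p" for p
    using smooth_differentiable[of \<phi> p] smooth_differentiable[of \<psi> p]
    by (simp add: differentiable_add differentiable_mult)
  show "\<exists>\<phi> \<psi>. smooth \<phi> \<and> smooth \<psi> \<and> pd z g = (\<lambda>p. a * \<phi> p + b * \<psi> p)" for z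
    unfolding g(3) pd_lincomb[OF g(1,2)] using g(1,2)[THEN smooth_pd] by metis
qed (use assms in metis)

lemma smooth_zero: "smooth (\<lambda>p. 0)"
proof (rule smooth_coinduct[of "\<lambda>g. g = (\<lambda>p. 0)"])
  show "g = (\<lambda>p. 0) \<Longrightarrow> pd z g = (\<lambda>p. 0)" for g z
    by (rule pd_eqI) auto
qed auto

text \<open>The algebra generated by the smooth functions of a single coordinate. It contains the
  polynomials, the products of cut-offs and the trigonometric products used below, and unlike the
  class of products it is closed under \<open>pd\<close>.\<close>

inductive smooth_alg :: "(point \<Rightarrow> real) \<Rightarrow> bool" where
  coord: "smooth1 f \<Longrightarrow> smooth_alg (\<lambda>p. f (co z p))"
| add: "smooth_alg f \<Longrightarrow> smooth_alg g \<Longrightarrow> smooth_alg (\<lambda>p. f p + g p)"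
| mult: "smooth_alg f \<Longrightarrow> smooth_alg g \<Longrightarrow> smooth_alg (\<lambda>p. f p * g p)"

lemma pd_coord_same: "smooth1 f \<Longrightarrow> pd z (\<lambda>p. f (co z p)) = (\<lambda>p. deriv f (co z p))"
  by (rule pd_eqI) (simp add: smooth1_DERIV)

lemma pd_coord_other: "pd z (\<lambda>p. f (co (\<not> z) p)) = (\<lambda>p. 0)"
  by (rule pd_eqI) simp

lemma co_differentiable: "co z differentiable (at p)"
proof -
  have "(fst has_derivative fst) (at p)" "(snd has_derivative snd) (at p)"
    by (auto intro!: derivative_eq_intros)
  then have "co z differentiable (at p)" for p
    unfolding co_def[abs_def] differentiable_def by (cases z) (auto intro!: derivative_eq_intros)
  then show ?thesis .
qed

lemma co_continuous [continuous_intros]: "continuous_on S (co z)"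
  unfolding co_def[abs_def] by (cases z) (auto intro!: continuous_intros)

lemma pt_continuous [continuous_intros]:
  "continuous_on S f \<Longrightarrow> continuous_on S g \<Longrightarrow> continuous_on S (\<lambda>x. pt z (f x) (g x))"
  unfolding pt_def[abs_def] by (cases z) (auto intro!: continuous_intros)

lemma smooth_alg_const: "smooth_alg (\<lambda>p. c)"
  using smooth_alg.coord[OF smooth1_const[of c]] by simp

lemma smooth_alg_pd:
  "smooth_alg \<phi> \<Longrightarrow> (\<forall>p. \<phi> differentiable (at p)) \<and> (\<forall>z. smooth_alg (pd z \<phi>))"
proof (induction rule: smooth_alg.induct)
  case (coord f z)
  have "f \<circ> co z differentiable (at p)" for p
    by (rule differentiable_chain_at[OF co_differentiable smooth1_differentiable[OF coord]])
  moreover have "smooth_alg (pd z' (\<lambda>p. f (co z p)))" for z'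
  proof (cases "z' = z")
    case True
    then show ?thesis
      using smooth_alg.coord[OF smooth1_deriv[OF coord], of z] pd_coord_same[OF coord, of z] by simp
  next
    case False
    then have "z = (\<not> z')" by simp
    then show ?thesis using pd_coord_other[of z' f] smooth_alg_const[of 0] by simp
  qed
  ultimately show ?case by (simp add: o_def)
next
  case (add f g)
  have "pd z (\<lambda>p. f p + g p) = (\<lambda>p. pd z f p + pd z g p)" for z
    using add by (intro pd_eqI DERIV_add differentiable_DERIV_pd) auto
  then show ?case using add by (simp add: smooth_alg.add differentiable_add)
next
  case (mult f g)
  have "pd z (\<lambda>p. f p * g p) = (\<lambda>p. pd z f p * g p + pd z g p * f p)" for z
    using mult by (intro pd_eqI DERIV_mult differentiable_DERIV_pd) auto
  then show ?case
    using mult by (simp add: differentiable_mult smooth_alg.add smooth_alg.mult)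
qed

lemma smooth_alg_smooth: "smooth_alg \<phi> \<Longrightarrow> smooth \<phi>"
  by (erule smooth_coinduct) (simp_all add: smooth_alg_pd)

lemma smooth_alg_tensor:
  "smooth1 f \<Longrightarrow> smooth1 g \<Longrightarrow> smooth_alg (\<lambda>p. f (co z p) * g (co (\<not> z) p))"
  by (rule smooth_alg.mult; rule smooth_alg.coord)

lemma pd_tensor:
  assumes "smooth1 f"
  shows "pd z (\<lambda>p. f (co z p) * g (co (\<not> z) p)) = (\<lambda>p. deriv f (co z p) * g (co (\<not> z) p))"
  by (rule pd_eqI) (simp add: DERIV_cmult_right smooth1_DERIV[OF assms])

lemma pd_tensor_other:
  assumes "smooth1 g"
  shows "pd (\<not> z) (\<lambda>p. f (co z p) * g (co (\<not> z) p)) = (\<lambda>p. f (co z p) * deriv g (co (\<not> z) p))"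
  using pd_tensor[OF assms, of "\<not> z" f] by (simp add: mult.commute)

text \<open>Makes the polynomials provided by the Stone-Weierstrass theorem available as smooth
  functions.\<close>

lemma real_polynomial_function_smooth_alg:
  "real_polynomial_function (f :: point \<Rightarrow> real) \<Longrightarrow> smooth_alg f"
proof (induction rule: real_polynomial_function.induct)
  case (linear f)
  have "f p = f (1, 0) * co True p + f (0, 1) * co False p" for p
  proof -
    have "p = fst p *\<^sub>R (1, 0) + snd p *\<^sub>R (0, 1)" by (simp add: prod_eq_iff)
    then have "f p = f (fst p *\<^sub>R (1, 0) + snd p *\<^sub>R (0, 1))" by simp
    also have "\<dots> = fst p * f (1, 0) + snd p * f (0, 1)"
      using bounded_linear.linear[OF linear]
      by (simp only: linear_add linear_scale real_scaleR_def)
    finally show ?thesis by (simp add: co_def mult.commute)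
  qed
  then have "f = (\<lambda>p. f (1, 0) * co True p + f (0, 1) * co False p)" by blast
  moreover have "smooth_alg (\<lambda>p. f (1, 0) * co True p + f (0, 1) * co False p)"
    by (intro smooth_alg.add smooth_alg.mult smooth_alg_const smooth_alg.coord[OF smooth1_ident])
  ultimately show ?case by simp
qed (erule (1) smooth_alg.add smooth_alg.mult | rule smooth_alg_const)+

section \<open>Test functions\<close>

lemma test_functionI:
  assumes "smooth \<phi>" "compact K" "K \<subseteq> R" "\<And>p. \<phi> p \<noteq> 0 \<Longrightarrow> p \<in> K"
  shows "\<phi> \<in> test_functions R"
proof -
  have "closure {p. \<phi> p \<noteq> 0} \<subseteq> K"
    using assms by (intro closure_minimal) (auto simp: compact_imp_closed)
  moreover from this have "compact (closure {p. \<phi> p \<noteq> 0})"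
    using compact_Int_closed[OF assms(2) closed_closure, of "{p. \<phi> p \<noteq> 0}"] by (simp add: Int_absorb1)
  ultimately show ?thesis using assms by (auto simp: test_functions_def)
qed

lemma test_function_smooth: "\<phi> \<in> test_functions R \<Longrightarrow> smooth \<phi>"
  by (simp add: test_functions_def)

lemma test_function_outside: "\<phi> \<in> test_functions R \<Longrightarrow> p \<notin> R \<Longrightarrow> \<phi> p = 0"
  using closure_subset[of "{p. \<phi> p \<noteq> 0}"] by (auto simp: test_functions_def)

text \<open>The complement of the support is open, so off the support the function vanishes on a
  whole neighbourhood within the coordinate line, and its derivative vanishes with it.\<close>

lemma pd_zero_outside:
  assumes "\<phi> \<in> test_functions R"
  shows "pd z \<phi> p \<noteq> 0 \<Longrightarrow> p \<in> closure {p. \<phi> p \<noteq> 0}"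
proof (rule ccontr)
  assume nz: "pd z \<phi> p \<noteq> 0" and p: "p \<notin> closure {p. \<phi> p \<noteq> 0}"
  obtain s t where pst: "p = pt z s t" by (rule ex_pt)
  let ?U = "- closure {p. \<phi> p \<noteq> 0}"
  have o: "open ((\<lambda>s. pt z s t) -` ?U)"
    by (intro open_vimage continuous_intros) auto
  have "((\<lambda>s. \<phi> (pt z s t)) has_real_derivative 0) (at s)"
  proof (rule has_field_derivative_transform_within_open[OF DERIV_const o])
    show "s \<in> (\<lambda>s. pt z s t) -` ?U" using p pst by simp
    show "0 = \<phi> (pt z s t)" if "s \<in> (\<lambda>s. pt z s t) -` ?U" for s
      using that closure_subset[of "{p. \<phi> p \<noteq> 0}"] by auto
  qed
  with smooth_DERIV[OF test_function_smooth[OF assms]] have "pd z \<phi> p = 0"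
    using DERIV_unique pst by blast
  with nz show False by simp
qed

lemma test_function_pd:
  assumes "\<phi> \<in> test_functions R"
  shows "pd z \<phi> \<in> test_functions R"
  using assms pd_zero_outside[OF assms, of z]
  by (intro test_functionI[of _ "closure {p. \<phi> p \<noteq> 0}"])
     (auto simp: test_functions_def intro: smooth_pd)

lemma test_functions_mono: "R \<subseteq> S \<Longrightarrow> test_functions R \<subseteq> test_functions S"
  by (auto simp: test_functions_def)

section \<open>Rectangles and test functions\<close>

text \<open>The first interval belongs to direction z and the second to the other direction. Every
  rectangle has thus two descriptions, exchanged by \<open>orect_not\<close>, and a statement about
  direction z also covers the other one.\<close>

definition orect :: "bool \<Rightarrow> real \<Rightarrow> real \<Rightarrow> real \<Rightarrow> real \<Rightarrow> point set" where
  "orect z a b c d = {p. co z p \<in> {a<..<b} \<and> co (\<not> z) p \<in> {c<..<d}}"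

definition crect :: "bool \<Rightarrow> real \<Rightarrow> real \<Rightarrow> real \<Rightarrow> real \<Rightarrow> point set" where
  "crect z a b c d = {p. co z p \<in> {a..b} \<and> co (\<not> z) p \<in> {c..d}}"

lemma orect_not: "orect (\<not> z) a b c d = orect z c d a b"
  and crect_not: "crect (\<not> z) a b c d = crect z c d a b"
  by (auto simp: orect_def crect_def)

lemma orect_True: "orect True a b c d = {a<..<b} \<times> {c<..<d}"
  and crect_True: "crect True a b c d = {a..b} \<times> {c..d}"
  by (auto simp: orect_def crect_def co_def)

lemma orect_box: "orect True a b c d = box (a, c) (b, d)"
  and crect_cbox: "crect True a b c d = cbox (a, c) (b, d)"
  by (auto simp: orect_True crect_True box_def cbox_def Basis_prod_def)

text \<open>Reduces facts about the shape of rectangles to the standard orientation, in which they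
  are boxes of the product space.\<close>

lemma rect_cases:
  assumes "\<And>a b c d. P (orect True a b c d) (crect True a b c d)"
  shows "P (orect z a b c d) (crect z a b c d)"
  using assms orect_not[of True] crect_not[of True] by (cases z) auto

lemma open_orect: "open (orect z a b c d)"
  by (rule rect_cases[of "\<lambda>U C. open U"]) (simp add: orect_box open_box)

lemma compact_crect: "compact (crect z a b c d)"
  by (rule rect_cases[of "\<lambda>U C. compact C"]) (simp add: crect_cbox compact_cbox)

lemma orect_sets [simp]: "orect z a b c d \<in> sets lebesgue"
  and crect_sets [simp]: "crect z a b c d \<in> sets lebesgue"
  using open_orect[of z a b c d] compact_crect[of z a b c d] by (auto simp: borel_compact)

lemma orect_subset_crect: "orect z a b c d \<subseteq> crect z a b c d"
  by (auto simp: orect_def crect_def)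

lemma negligible_crect_diff: "negligible (crect z a b c d - orect z a b c d)"
  by (rule rect_cases[of "\<lambda>U C. negligible (C - U)"])
     (simp add: crect_cbox orect_box negligible_frontier_interval)

lemma finite_measure_crect: "finite_measure (lebesgue_on (crect z a b c d))"
  by (intro finite_measure_lebesgue_on lmeasurable_compact compact_crect)

lemma finite_measure_orect: "finite_measure (lebesgue_on (orect z a b c d))"
  by (rule rect_cases[of "\<lambda>U C. finite_measure (lebesgue_on U)"])
     (simp add: orect_box finite_measure_lebesgue_on)

lemma integral_lebesgue_on_negligible_diff:
  fixes f :: "'a::euclidean_space \<Rightarrow> real"
  assumes S: "S \<subseteq> T" "negligible (T - S)" "S \<in> sets lebesgue" "T \<in> sets lebesgue"
    and f: "f \<in> borel_measurable (lebesgue_on T)"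
  shows "integral\<^sup>L (lebesgue_on S) f = integral\<^sup>L (lebesgue_on T) f"
proof -
  have fS: "f \<in> borel_measurable (lebesgue_on S)" using f S(1) by (rule measurable_restrict_mono)
  have "integral\<^sup>L lebesgue (\<lambda>x. indicator S x *\<^sub>R f x) = integral\<^sup>L lebesgue (\<lambda>x. indicator T x *\<^sub>R f x)"
  proof (rule integral_cong_AE)
    show "(\<lambda>x. indicator S x *\<^sub>R f x) \<in> borel_measurable lebesgue"
      "(\<lambda>x. indicator T x *\<^sub>R f x) \<in> borel_measurable lebesgue"
      using f fS S(3,4) by (simp_all add: borel_measurable_restrict_space_iff)
    have "AE x in lebesgue. x \<notin> T - S"
      using S(2) by (intro AE_not_in) (simp add: negligible_iff_null_sets)
    then show "AE x in lebesgue. indicator S x *\<^sub>R f x = indicator T x *\<^sub>R f x"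
      by eventually_elim (use S(1) in \<open>auto simp: indicator_def\<close>)
  qed
  then show ?thesis using S by (simp add: integral_restrict_space)
qed

lemma continuous_sq_int_crect:
  assumes "continuous_on UNIV f"
  shows "sq_int (lebesgue_on (crect z a b c d)) f"
proof -
  have "compact (f ` crect z a b c d)"
    using assms compact_crect by (intro compact_continuous_image) (auto intro: continuous_on_subset)
  then have "bounded (f ` crect z a b c d)" by (rule compact_imp_bounded)
  then obtain B where "\<forall>x\<in>crect z a b c d. \<bar>f x\<bar> \<le> B"
    by (auto simp: bounded_iff)
  moreover have "f \<in> borel_measurable (lebesgue_on (crect z a b c d))"
    using assms by (intro continuous_imp_measurable_on_sets_lebesgue) (auto intro: continuous_on_subset)
  ultimately show ?thesis
    by (intro sq_int_bounded[OF finite_measure_crect]) auto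
qed

lemma continuous_sq_int_orect:
  fixes f :: "point \<Rightarrow> real"
  shows "continuous_on UNIV f \<Longrightarrow> sq_int (lebesgue_on (orect z a b c d)) f"
  using continuous_sq_int_crect[of f z a b c d] sq_int_subset[OF _ orect_subset_crect] by simp

lemma continuous_sq_int_line:
  fixes f :: "real \<Rightarrow> real"
  assumes "continuous_on UNIV f"
  shows "sq_int (lebesgue_on {a..b}) f"
proof -
  have "compact (f ` {a..b})"
    using assms by (intro compact_continuous_image) (auto intro: continuous_on_subset)
  then have "bounded (f ` {a..b})" by (rule compact_imp_bounded)
  then obtain B where "\<forall>x\<in>{a..b}. \<bar>f x\<bar> \<le> B"
    by (auto simp: bounded_iff)
  moreover have "f \<in> borel_measurable (lebesgue_on {a..b})"
    using assms by (intro continuous_imp_measurable_on_sets_lebesgue) (auto intro: continuous_on_subset)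
  ultimately show ?thesis
    by (intro sq_int_bounded finite_measure_lebesgue_on) auto
qed

lemma continuous_orect_eq_crect:
  fixes f :: "point \<Rightarrow> real"
  shows "continuous_on UNIV f \<Longrightarrow>
    integral\<^sup>L (lebesgue_on (orect z a b c d)) f = integral\<^sup>L (lebesgue_on (crect z a b c d)) f"
  by (intro integral_lebesgue_on_negligible_diff orect_subset_crect negligible_crect_diff
      sq_int_measurable continuous_sq_int_crect) auto

lemma continuous_integrable_line:
  fixes f :: "real \<Rightarrow> real"
  assumes "continuous_on UNIV f" shows "integrable (lebesgue_on {a..b}) f"
  using assms by (intro continuous_imp_integrable_real) (auto intro: continuous_on_subset)

lemma continuous_integrable_orect:
  fixes f :: "point \<Rightarrow> real"
  assumes "continuous_on UNIV f" shows "integrable (lebesgue_on (orect z a b c d)) f"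
  by (rule sq_int_integrable[OF finite_measure_orect continuous_sq_int_orect[OF assms]])

text \<open>For continuous integrands the Fubini theorem of the gauge integral is enough. Its order
  of integration is the one needed for z = False; the other direction costs an exchange of the two
  integrals.\<close>

lemma integral_crect_iterated:
  fixes F :: "point \<Rightarrow> real"
  assumes F: "continuous_on UNIV F"
  shows "integral\<^sup>L (lebesgue_on (crect z a b c d)) F
    = integral\<^sup>L (lebesgue_on {c..d}) (\<lambda>t. integral\<^sup>L (lebesgue_on {a..b}) (\<lambda>s. F (pt z s t)))"
proof -
  have cF: "continuous_on S (\<lambda>(s, t). F (pt z s t))" for S z
    by (simp add: split_beta) (intro continuous_on_compose2[OF F] continuous_intros, auto)
  have cF1: "continuous_on S (\<lambda>s. F (pt z s t))" for S z t
    by (intro continuous_on_compose2[OF F] continuous_intros) auto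
  have cF2: "continuous_on S (\<lambda>t. integral (cbox a b) (\<lambda>s. F (pt z s t)))" for S z a b
    by (rule integral_continuous_on_param[where f = "\<lambda>t s. F (pt z s t)"])
       (simp add: split_beta, intro continuous_on_compose2[OF F] continuous_intros, auto)
  have inner: "integral\<^sup>L (lebesgue_on {a..b}) (\<lambda>s. F (pt z s t)) = integral (cbox a b) (\<lambda>s. F (pt z s t))" for z t a b
    using lebesgue_integral_eq_integral[OF continuous_integrable_line[OF cF1, of a b z t]] by simp
  have outer: "integral\<^sup>L (lebesgue_on {c..d}) (\<lambda>t. integral\<^sup>L (lebesgue_on {a..b}) (\<lambda>s. F (pt z s t)))
      = integral (cbox c d) (\<lambda>t. integral (cbox a b) (\<lambda>s. F (pt z s t)))" for z a b c d
    unfolding inner using lebesgue_integral_eq_integral[OF continuous_integrable_line[OF cF2, of c d]] by simp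
  have ip: "continuous_on (cbox a b) F" for a b using F by (rule continuous_on_subset) simp
  have rect: "integral\<^sup>L (lebesgue_on (crect True a b c d)) F
      = integral (cbox a b) (\<lambda>s. integral (cbox c d) (\<lambda>t. F (s, t)))" for a b c d
    using lebesgue_integral_eq_integral[OF continuous_imp_integrable[OF ip, of "(a,c)" "(b,d)"]]
      integral_prod_continuous[OF ip, of a c b d] by (simp add: crect_cbox)
  show ?thesis
  proof (cases z)
    case True
    have "integral (cbox a b) (\<lambda>s. integral (cbox c d) (\<lambda>t. F (s, t)))
        = integral (cbox c d) (\<lambda>t. integral (cbox a b) (\<lambda>s. F (s, t)))"
      by (rule integral_swap_continuous) (use cF[of _ True] in \<open>simp add: pt_def\<close>)
    then show ?thesis using True unfolding outer by (simp add: rect) (simp add: pt_def)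
  next
    case False
    then show ?thesis unfolding outer using crect_not[of True a b c d] by (simp add: rect) (simp add: pt_def)
  qed
qed

lemma integral_orect_iterated:
  fixes F :: "point \<Rightarrow> real"
  assumes "continuous_on UNIV F"
  shows "integral\<^sup>L (lebesgue_on (orect z a b c d)) F
    = integral\<^sup>L (lebesgue_on {c..d}) (\<lambda>t. integral\<^sup>L (lebesgue_on {a..b}) (\<lambda>s. F (pt z s t)))"
  using integral_crect_iterated[OF assms] continuous_orect_eq_crect[OF assms] by simp

lemma integral_line_FTC:
  fixes f :: "real \<Rightarrow> real"
  assumes "a \<le> b" "\<And>x. (F has_real_derivative f x) (at x)" "continuous_on UNIV f"
  shows "integral\<^sup>L (lebesgue_on {a..b}) f = F b - F a"
proof -
  have "(f has_integral (F b - F a)) {a..b}"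
    using assms(1,2) by (intro fundamental_theorem_of_calculus)
      (auto simp flip: has_real_derivative_iff_has_vector_derivative intro: has_field_derivative_at_within)
  then show ?thesis
    using lebesgue_integral_eq_integral[OF continuous_integrable_line[OF assms(3)], of a b]
    by (simp add: integral_unique)
qed

text \<open>Integration by parts on each line in direction z, against a weight \<open>P\<close>
  along the line and a factor \<beta> across it. The form is chosen for the zeros of
  \<open>P\<close>: an end at which \<open>P\<close> vanishes contributes no edge term, so the
  choice of \<open>P\<close> selects the edges that are seen.\<close>

lemma Green_smooth:
  assumes sm: "smooth \<phi>" and ab: "a \<le> b" and P: "\<And>s. (P has_real_derivative P' s) (at s)"
    and P': "continuous_on UNIV P'" and \<beta>: "continuous_on UNIV \<beta>"
  shows "(\<integral>p. \<phi> p * (P' (co z p) * \<beta> (co (\<not> z) p)) + pd z \<phi> p * (P (co z p) * \<beta> (co (\<not> z) p)) \<partial>lebesgue_on (orect z a b c d))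
    = (\<integral>t. (\<phi> (pt z b t) * P b - \<phi> (pt z a t) * P a) * \<beta> t \<partial>lebesgue_on {c..d})"
proof -
  have cP: "continuous_on UNIV P" using P by (meson DERIV_isCont continuous_at_imp_continuous_on)
  note cont = smooth_continuous[OF sm, of UNIV] pd_continuous[OF sm, of UNIV z] cP P' \<beta>
  have c2: "continuous_on UNIV (\<lambda>s. f (pt z s t))" if "continuous_on UNIV f" for f :: "point \<Rightarrow> real" and t
    by (intro continuous_on_compose2[OF that] continuous_intros) auto
  have c1: "continuous_on UNIV (\<lambda>p. f (co z p))" if "continuous_on UNIV f" for f :: "real \<Rightarrow> real" and z
    by (intro continuous_on_compose2[OF that] continuous_intros) auto
  have inner: "(\<integral>s. \<phi> (pt z s t) * (P' s * \<beta> t) + pd z \<phi> (pt z s t) * (P s * \<beta> t) \<partial>lebesgue_on {a..b})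
     = \<phi> (pt z b t) * (P b * \<beta> t) - \<phi> (pt z a t) * (P a * \<beta> t)" for t
  proof (rule integral_line_FTC[OF ab])
    show "((\<lambda>s. \<phi> (pt z s t) * (P s * \<beta> t)) has_real_derivative
        \<phi> (pt z s t) * (P' s * \<beta> t) + pd z \<phi> (pt z s t) * (P s * \<beta> t)) (at s)" for s
      by (rule DERIV_cong[OF DERIV_mult[OF smooth_DERIV[OF sm] DERIV_cmult_right[OF P]]]) (simp add: algebra_simps)
    show "continuous_on UNIV (\<lambda>s. \<phi> (pt z s t) * (P' s * \<beta> t) + pd z \<phi> (pt z s t) * (P s * \<beta> t))"
      by (intro continuous_intros c2 cont)
  qed
  have "(\<integral>p. \<phi> p * (P' (co z p) * \<beta> (co (\<not> z) p)) + pd z \<phi> p * (P (co z p) * \<beta> (co (\<not> z) p)) \<partial>lebesgue_on (orect z a b c d))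
    = (\<integral>t. \<phi> (pt z b t) * (P b * \<beta> t) - \<phi> (pt z a t) * (P a * \<beta> t) \<partial>lebesgue_on {c..d})"
    by (subst integral_orect_iterated) (auto simp: inner intro!: continuous_intros c1 cont)
  then show ?thesis by (simp add: left_diff_distrib mult.assoc)
qed

lemma pt_in_orect: "pt z s t \<in> orect z a b c d \<longleftrightarrow> s \<in> {a<..<b} \<and> t \<in> {c<..<d}"
  by (simp add: orect_def)

lemma smooth_test_by_parts:
  assumes sm: "smooth \<phi>" and \<psi>: "\<psi> \<in> test_functions (orect z a b c d)" and ab: "a \<le> b"
  shows "(\<integral>p. \<phi> p * pd z \<psi> p \<partial>lebesgue_on (orect z a b c d))
    = - (\<integral>p. pd z \<phi> p * \<psi> p \<partial>lebesgue_on (orect z a b c d))"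
proof -
  note sp = test_function_smooth[OF \<psi>]
  note cont = smooth_continuous[OF sm, of UNIV] pd_continuous[OF sm, of UNIV z]
    smooth_continuous[OF sp, of UNIV] pd_continuous[OF sp, of UNIV z]
  have c2: "continuous_on UNIV (\<lambda>s. f (pt z s t))" if "continuous_on UNIV f" for f :: "point \<Rightarrow> real" and t
    by (intro continuous_on_compose2[OF that] continuous_intros) auto
  have inner: "(\<integral>s. \<phi> (pt z s t) * pd z \<psi> (pt z s t) + pd z \<phi> (pt z s t) * \<psi> (pt z s t) \<partial>lebesgue_on {a..b}) = 0" for t
  proof -
    have "(\<integral>s. \<phi> (pt z s t) * pd z \<psi> (pt z s t) + pd z \<phi> (pt z s t) * \<psi> (pt z s t) \<partial>lebesgue_on {a..b})
        = \<phi> (pt z b t) * \<psi> (pt z b t) - \<phi> (pt z a t) * \<psi> (pt z a t)"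
    proof (rule integral_line_FTC[OF ab])
      show "((\<lambda>s. \<phi> (pt z s t) * \<psi> (pt z s t)) has_real_derivative
          \<phi> (pt z s t) * pd z \<psi> (pt z s t) + pd z \<phi> (pt z s t) * \<psi> (pt z s t)) (at s)" for s
        by (rule DERIV_cong[OF DERIV_mult[OF smooth_DERIV[OF sm] smooth_DERIV[OF sp]]]) simp
    qed (intro continuous_intros c2 cont)
    moreover have "\<psi> (pt z b t) = 0" "\<psi> (pt z a t) = 0"
      using test_function_outside[OF \<psi>] by (simp_all add: pt_in_orect)
    ultimately show ?thesis by simp
  qed
  have "(\<integral>p. \<phi> p * pd z \<psi> p + pd z \<phi> p * \<psi> p \<partial>lebesgue_on (orect z a b c d)) = 0"
    by (subst integral_orect_iterated) (auto simp: inner intro!: continuous_intros cont)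
  moreover have "integrable (lebesgue_on (orect z a b c d)) (\<lambda>p. \<phi> p * pd z \<psi> p)"
    "integrable (lebesgue_on (orect z a b c d)) (\<lambda>p. pd z \<phi> p * \<psi> p)"
    by (intro continuous_integrable_orect continuous_intros cont)+
  ultimately show ?thesis by simp
qed

text \<open>Two dominated convergences: w is truncated to \<open>[-n, n]\<close>, and the
  truncation, being measurable, is an almost everywhere limit of continuous functions. The quarters
  of e compensate the factor 2 in \<open>integral_square_sum_le\<close>.\<close>

lemma L2_continuous_dense:
  fixes w :: "'a::euclidean_space \<Rightarrow> real"
  assumes w: "sq_int (lebesgue_on S) w" and fin: "finite_measure (lebesgue_on S)"
    and S: "S \<in> sets lebesgue" and e: "e > 0"
  obtains g where "continuous_on UNIV g" "(\<integral>x. (w x - g x)\<^sup>2 \<partial>lebesgue_on S) < e"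
proof -
  let ?M = "lebesgue_on S"
  define cl where "cl n r = max (- real n) (min (real n) r)" for n r
  have cl_le: "\<bar>cl n r\<bar> \<le> real n" for n r by (auto simp: cl_def)
  have cl_err: "\<bar>r - cl n r\<bar> \<le> \<bar>r\<bar>" for n r by (auto simp: cl_def)
  have meas: "w \<in> borel_measurable ?M" using w by (rule sq_int_measurable)
  have mcl: "(\<lambda>x. cl n (w x)) \<in> borel_measurable ?M" for n using meas by (auto simp: cl_def)
  have "(\<lambda>n. \<integral>x. (w x - cl n (w x))\<^sup>2 \<partial>?M) \<longlonglongrightarrow> (\<integral>x. 0 \<partial>?M)"
  proof (rule integral_dominated_convergence)
    show "integrable ?M (\<lambda>x. (w x)\<^sup>2)" using w by (rule sq_int_square)
    show "AE x in ?M. (\<lambda>n. (w x - cl n (w x))\<^sup>2) \<longlonglongrightarrow> 0"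
    proof (rule AE_I2)
      fix x
      obtain N :: nat where "\<bar>w x\<bar> \<le> real N" using real_arch_simple by blast
      then have "\<forall>\<^sub>F n in sequentially. (w x - cl n (w x))\<^sup>2 = 0"
        unfolding eventually_sequentially by (intro exI[of _ N]) (auto simp: cl_def)
      then show "(\<lambda>n. (w x - cl n (w x))\<^sup>2) \<longlonglongrightarrow> 0" by (rule tendsto_eventually)
    qed
    show "AE x in ?M. norm ((w x - cl n (w x))\<^sup>2) \<le> (w x)\<^sup>2" for n
      using cl_err by (auto intro!: AE_I2 simp: abs_le_square_iff)
  qed (use meas mcl in auto)
  then have "\<forall>\<^sub>F n in sequentially. (\<integral>x. (w x - cl n (w x))\<^sup>2 \<partial>?M) < e / 4"
    using order_tendstoD(2)[of _ 0 sequentially "e/4"] e by simp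
  then obtain n where n: "(\<integral>x. (w x - cl n (w x))\<^sup>2 \<partial>?M) < e / 4"
    unfolding eventually_sequentially by blast
  have "(\<lambda>x. cl n (w x)) measurable_on S"
    using measurable_on_iff_borel_measurable[OF S] mcl by blast
  \<comment> \<open>The definition of \<open>measurable_on\<close> gives pointwise convergence off a
    null set but no bound. Clipping the functions \<open>h k\<close> at the level n supplies the
    majorant.\<close>
  then obtain N h where N: "negligible N" and h: "\<And>k. continuous_on UNIV (h k)"
    and lim: "\<And>x. x \<notin> N \<Longrightarrow> (\<lambda>k. h k x) \<longlonglongrightarrow> (if x \<in> S then cl n (w x) else 0)"
    unfolding measurable_on_def by blast
  define g where "g k x = cl n (h k x)" for k x
  have cg: "continuous_on UNIV (g k)" for k
    unfolding g_def[abs_def] cl_def by (intro continuous_intros h)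
  have mg: "g k \<in> borel_measurable ?M" for k
    using cg S by (intro continuous_imp_measurable_on_sets_lebesgue) (auto intro: continuous_on_subset)
  have "(\<lambda>k. \<integral>x. (cl n (w x) - g k x)\<^sup>2 \<partial>?M) \<longlonglongrightarrow> (\<integral>x. 0 \<partial>?M)"
  proof (rule integral_dominated_convergence)
    show "integrable ?M (\<lambda>x. (2 * real n)\<^sup>2)" using fin by (simp add: finite_measure.integrable_const)
    have "AE x in lebesgue. x \<notin> N" using N by (intro AE_not_in) (simp add: negligible_iff_null_sets)
    then have "AE x in lebesgue. x \<in> S \<longrightarrow> x \<notin> N" by eventually_elim simp
    then have "AE x in ?M. x \<notin> N" using S by (simp add: AE_restrict_space_iff)
    then show "AE x in ?M. (\<lambda>k. (cl n (w x) - g k x)\<^sup>2) \<longlonglongrightarrow> 0"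
    proof (rule AE_mp, intro AE_I2 impI)
      fix x assume x: "x \<in> space ?M" "x \<notin> N"
      then have "(\<lambda>k. h k x) \<longlonglongrightarrow> cl n (w x)" using lim[OF x(2)] by simp
      then have "(\<lambda>k. max (- real n) (min (real n) (h k x))) \<longlonglongrightarrow> max (- real n) (min (real n) (cl n (w x)))"
        by (intro tendsto_max tendsto_min tendsto_const)
      then have "(\<lambda>k. g k x) \<longlonglongrightarrow> cl n (cl n (w x))"
        unfolding g_def cl_def[of n "h _ x"] cl_def[of n "cl n (w x)"] .
      moreover have "cl n (cl n (w x)) = cl n (w x)" by (auto simp: cl_def)
      ultimately have "(\<lambda>k. (cl n (w x) - g k x)\<^sup>2) \<longlonglongrightarrow> (cl n (w x) - cl n (w x))\<^sup>2"
        by (intro tendsto_intros) simp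
      then show "(\<lambda>k. (cl n (w x) - g k x)\<^sup>2) \<longlonglongrightarrow> 0" by simp
    qed
    show "AE x in ?M. norm ((cl n (w x) - g k x)\<^sup>2) \<le> (2 * real n)\<^sup>2" for k
    proof (intro AE_I2)
      fix x
      have "\<bar>cl n (w x) - g k x\<bar> \<le> 2 * real n"
        using cl_le[of n "w x"] cl_le[of n "h k x"] unfolding g_def by linarith
      then show "norm ((cl n (w x) - g k x)\<^sup>2) \<le> (2 * real n)\<^sup>2"
        using abs_le_square_iff[of "cl n (w x) - g k x" "2 * real n"] by simp
    qed
  qed (use mcl mg in auto)
  then have "\<forall>\<^sub>F k in sequentially. (\<integral>x. (cl n (w x) - g k x)\<^sup>2 \<partial>?M) < e / 4"
    using order_tendstoD(2)[of _ 0 sequentially "e/4"] e by simp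
  then obtain k where k: "(\<integral>x. (cl n (w x) - g k x)\<^sup>2 \<partial>?M) < e / 4"
    unfolding eventually_sequentially by blast
  have s1: "sq_int ?M (\<lambda>x. cl n (w x))" "sq_int ?M (g k)"
    using mcl mg cl_le by (auto intro!: sq_int_bounded[OF fin] simp: g_def)
  have "(\<integral>x. ((w x - cl n (w x)) + (cl n (w x) - g k x))\<^sup>2 \<partial>?M)
      \<le> 2 * (\<integral>x. (w x - cl n (w x))\<^sup>2 \<partial>?M) + 2 * (\<integral>x. (cl n (w x) - g k x)\<^sup>2 \<partial>?M)"
    by (intro integral_square_sum_le sq_int_diff w s1)
  also have "\<dots> < e" using n k by simp
  finally show thesis using that[OF cg[of k]] by simp
qed

text \<open>A smooth cut-off supported in \<open>[a + 1/k, b - 1/k]\<close> that tends to 1 on the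
  open interval. With this scaling its derivative at distance r from an end is at most of order 1/r,
  uniformly in k; a factor vanishing linearly at the ends can absorb that.\<close>

definition cut :: "nat \<Rightarrow> real \<Rightarrow> real \<Rightarrow> real \<Rightarrow> real" where
  "cut k a b s = flat 0 (real k * (s - a) - 1) * flat 0 (real k * (b - s) - 1)"

lemma flat_0: "flat 0 x = (if x > 0 then exp (- (1 / x)) else 0)"
  by (simp add: flat_def)

lemma flat_0_bounds: "0 \<le> flat 0 x" "flat 0 x \<le> 1"
  by (auto simp: flat_0)

lemma cut_bounds: "0 \<le> cut k a b s" "cut k a b s \<le> 1"
  unfolding cut_def using flat_0_bounds by (auto intro: mult_le_one)

lemma cut_abs_le: "\<bar>cut k a b s\<bar> \<le> 1"
  using cut_bounds[of k a b s] by simp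

lemma smooth1_cut: "smooth1 (cut k a b)"
proof -
  have "smooth1 (\<lambda>s. flat 0 (real k * s + (- (real k * a) - 1)) * flat 0 ((- real k) * s + (real k * b - 1)))"
    by (intro smooth1_mult smooth1_affine_compose smooth1_flat)
  then show ?thesis by (simp add: cut_def[abs_def] algebra_simps)
qed

lemma cut_support:
  assumes "cut k a b s \<noteq> 0"
  shows "k > 0" "a + 1 / real k \<le> s" "s \<le> b - 1 / real k"
proof -
  have *: "real k * (s - a) - 1 > 0" "real k * (b - s) - 1 > 0"
    using assms by (auto simp: cut_def flat_0 split: if_splits)
  then show k: "k > 0" by (cases "k = 0") auto
  show "a + 1 / real k \<le> s" "s \<le> b - 1 / real k" using * k by (simp_all add: field_simps)
qed

lemma cut_outside: "s \<notin> {a<..<b} \<Longrightarrow> cut k a b s = 0"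
  using cut_support[of k a b s] by (smt (verit) divide_pos_pos greaterThanLessThan_iff of_nat_0_less_iff)

lemma affine_at_top:
  fixes r :: real
  assumes "r > 0" shows "filterlim (\<lambda>k::nat. real k * r - 1) at_top sequentially"
proof -
  have "filterlim (\<lambda>k::nat. r * real k) at_top sequentially"
    by (rule filterlim_tendsto_pos_mult_at_top[OF tendsto_const assms filterlim_real_sequentially])
  then have "filterlim (\<lambda>k::nat. -1 + r * real k) at_top sequentially"
    by (rule filterlim_tendsto_add_at_top[OF tendsto_const])
  then show ?thesis by (simp add: mult.commute)
qed

lemma flat_0_tendsto_1: "(flat 0 \<longlongrightarrow> 1) at_top"
proof -
  have "((\<lambda>x::real. exp (- (inverse x))) \<longlongrightarrow> exp (- 0)) at_top"
    by (intro tendsto_intros tendsto_inverse_0_at_top filterlim_ident)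
  then have "((\<lambda>x::real. exp (- (1 / x))) \<longlongrightarrow> 1) at_top" by (simp add: inverse_eq_divide)
  then show ?thesis
    by (rule Lim_transform_eventually)
       (auto simp: flat_0 eventually_at_top_dense intro!: exI[of _ 0])
qed

lemma cut_tendsto_1:
  assumes "s \<in> {a<..<b}" shows "(\<lambda>k. cut k a b s) \<longlonglongrightarrow> 1"
proof -
  have "(\<lambda>k. flat 0 (real k * (s - a) - 1) * flat 0 (real k * (b - s) - 1)) \<longlonglongrightarrow> 1 * 1"
    using assms by (intro tendsto_mult filterlim_compose[OF flat_0_tendsto_1] affine_at_top) auto
  then show ?thesis by (simp add: cut_def)
qed

text \<open>\<open>flat 2\<close> is the derivative of \<open>flat 0\<close>. For x = k r - 1 the
  factor x + 1 is k r, so the bounds control \<open>k * flat 2 (k * r - 1)\<close> by a multiple of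
  1/r. In terms of y = 1/x the product is (y + y^2) exp(-y), and exp y \<ge> 1 + y + y^2/2 gives the
  3.\<close>

lemma flat_2_bounds:
  shows "0 \<le> flat 2 x" and "(x + 1) * flat 2 x \<le> 3" and "x > 1 \<Longrightarrow> (x + 1) * flat 2 x \<le> 2 / x"
proof -
  show "0 \<le> flat 2 x" by (auto simp: flat_def)
  show "(x + 1) * flat 2 x \<le> 3"
  proof (cases "x > 0")
    case True
    define y where "y = 1 / x"
    have y: "y > 0" "x = 1 / y" using True by (auto simp: y_def)
    have "y + y\<^sup>2 \<le> 3 * exp y"
      using exp_lower_Taylor_quadratic[of y] y by (simp add: field_simps) (smt (verit) zero_le_power2)
    then have "(y + y\<^sup>2) * exp (- y) \<le> 3"
      using y by (simp add: exp_minus field_simps)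
    moreover have "(x + 1) * flat 2 x = (y + y\<^sup>2) * exp (- y)"
      unfolding y(2) using y(1) by (simp add: flat_def field_simps power2_eq_square)
    ultimately show ?thesis by simp
  qed (simp add: flat_def)
  show "(x + 1) * flat 2 x \<le> 2 / x" if "x > 1"
  proof -
    have "exp (- (1 / x)) \<le> 1" using that by simp
    then have "(x + 1) * (1 / x)\<^sup>2 * exp (- (1 / x)) \<le> (x + 1) * (1 / x)\<^sup>2 * 1"
      using that by (intro mult_left_mono) auto
    also have "\<dots> \<le> 2 * x * (1 / x)\<^sup>2 * 1" using that by (intro mult_right_mono) auto
    also have "\<dots> = 2 / x" using that by (simp add: power2_eq_square)
    finally show ?thesis using that by (simp add: flat_def mult.assoc)
  qed
qed

lemma cut_deriv:
  "deriv (cut k a b) s = real k * flat 2 (real k * (s - a) - 1) * flat 0 (real k * (b - s) - 1)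
     - flat 0 (real k * (s - a) - 1) * (real k * flat 2 (real k * (b - s) - 1))"
proof -
  have 0: "(flat 0 has_real_derivative flat 2 x) (at x)" for x
    using flat_DERIV[of 0 x] by (simp add: numeral_2_eq_2)
  have 1: "((\<lambda>s. flat 0 (real k * (s - a) - 1)) has_real_derivative
      flat 2 (real k * (s - a) - 1) * real k) (at s)"
    by (rule DERIV_chain2[OF 0]) (auto intro!: derivative_eq_intros)
  have 2: "((\<lambda>s. flat 0 (real k * (b - s) - 1)) has_real_derivative
      flat 2 (real k * (b - s) - 1) * (- real k)) (at s)"
    by (rule DERIV_chain2[OF 0]) (auto intro!: derivative_eq_intros)
  show ?thesis
    unfolding cut_def[abs_def] by (rule DERIV_imp_deriv, rule DERIV_cong[OF DERIV_mult[OF 1 2]]) simp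
qed

text \<open>Here r is the distance to one end of the interval: the bound does not depend on k, and
  the limit holds for each fixed r.\<close>

lemma scaled_flat_bounds:
  assumes "r > 0"
  shows "\<bar>real k * flat 2 (real k * r - 1)\<bar> \<le> 3 / r"
    and "(\<lambda>k. real k * flat 2 (real k * r - 1)) \<longlonglongrightarrow> 0"
proof -
  have eq: "real k * flat 2 (real k * r - 1) = ((real k * r - 1) + 1) * flat 2 (real k * r - 1) / r" for k
    using assms by simp
  have "real k * flat 2 (real k * r - 1) \<le> 3 / r"
    unfolding eq using assms by (intro divide_right_mono flat_2_bounds(2)) simp
  then show "\<bar>real k * flat 2 (real k * r - 1)\<bar> \<le> 3 / r"
    using flat_2_bounds(1)[of "real k * r - 1"] by simp
  show "(\<lambda>k. real k * flat 2 (real k * r - 1)) \<longlonglongrightarrow> 0"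
  proof (rule tendsto_sandwich[of "\<lambda>_. 0"])
    have "(\<lambda>k. 2 / (real k * r - 1) / r) \<longlonglongrightarrow> 0 / r"
      by (intro tendsto_divide tendsto_const tendsto_divide_0[OF tendsto_const] filterlim_at_top_imp_at_infinity affine_at_top assms)
         (use assms in auto)
    then show "(\<lambda>k. 2 / (real k * r - 1) / r) \<longlonglongrightarrow> 0" by simp
    have "\<forall>\<^sub>F k in sequentially. real k * r - 1 > 1"
      using affine_at_top[OF assms] unfolding filterlim_at_top_dense by blast
    then show "\<forall>\<^sub>F k in sequentially. real k * flat 2 (real k * r - 1) \<le> 2 / (real k * r - 1) / r"
    proof eventually_elim
      case (elim k)
      then show ?case unfolding eq using assms by (intro divide_right_mono flat_2_bounds(3)) simp_all
    qed
    show "\<forall>\<^sub>F k in sequentially. 0 \<le> real k * flat 2 (real k * r - 1)"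
      by (simp add: flat_2_bounds(1))
  qed simp
qed

lemma cut_deriv_bound:
  assumes "s \<in> {a<..<b}"
  shows "\<bar>deriv (cut k a b) s\<bar> \<le> 3 / (s - a) + 3 / (b - s)"
proof -
  have "\<bar>real k * flat 2 (real k * (s - a) - 1) * flat 0 (real k * (b - s) - 1)\<bar> \<le> 3 / (s - a) * 1"
    unfolding abs_mult[of "real k * flat 2 _"] using assms flat_0_bounds
    by (intro mult_mono scaled_flat_bounds) auto
  moreover have "\<bar>flat 0 (real k * (s - a) - 1) * (real k * flat 2 (real k * (b - s) - 1))\<bar> \<le> 1 * (3 / (b - s))"
    unfolding abs_mult[of "flat 0 _"] using assms flat_0_bounds
    by (intro mult_mono scaled_flat_bounds) auto
  ultimately show ?thesis unfolding cut_deriv by linarith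
qed

lemma cut_deriv_tendsto_0:
  assumes "s \<in> {a<..<b}" shows "(\<lambda>k. deriv (cut k a b) s) \<longlonglongrightarrow> 0"
proof -
  have "(\<lambda>k. real k * flat 2 (real k * (s - a) - 1) * flat 0 (real k * (b - s) - 1)
     - flat 0 (real k * (s - a) - 1) * (real k * flat 2 (real k * (b - s) - 1))) \<longlonglongrightarrow> 0 * 1 - 1 * 0"
    using assms
    by (intro tendsto_diff tendsto_mult filterlim_compose[OF flat_0_tendsto_1] affine_at_top scaled_flat_bounds) auto
  then show ?thesis by (simp add: cut_deriv)
qed

lemma cut_test_function:
  assumes "smooth_alg \<phi>"
  shows "(\<lambda>p. cut k a b (co z p) * cut k c d (co (\<not> z) p) * \<phi> p) \<in> test_functions (orect z a b c d)"
proof (cases "k = 0")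
  \<comment> \<open>For k = 0 both arguments of \<open>flat 0\<close> are -1 and the product is
    zero. The support estimate would fail here, since 1/0 = 0 turns the inner rectangle into the
    full closed one.\<close>
  case True
  then have "(\<lambda>p. cut k a b (co z p) * cut k c d (co (\<not> z) p) * \<phi> p) = (\<lambda>p. 0)"
    using cut_support(1) by fastforce
  then show ?thesis by (simp add: test_functions_def smooth_zero)
next
  case False
  show ?thesis
  proof (rule test_functionI)
    show "smooth (\<lambda>p. cut k a b (co z p) * cut k c d (co (\<not> z) p) * \<phi> p)"
      by (intro smooth_alg_smooth smooth_alg.mult[OF smooth_alg_tensor assms] smooth1_cut)
    show "compact (crect z (a + 1 / real k) (b - 1 / real k) (c + 1 / real k) (d - 1 / real k))"
      by (rule compact_crect)
    define r where "r = 1 / real k"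
    have "r > 0" using False by (simp add: r_def)
    then show "crect z (a + 1 / real k) (b - 1 / real k) (c + 1 / real k) (d - 1 / real k) \<subseteq> orect z a b c d"
      unfolding crect_def orect_def r_def[symmetric] by auto
    show "p \<in> crect z (a + 1 / real k) (b - 1 / real k) (c + 1 / real k) (d - 1 / real k)"
      if "cut k a b (co z p) * cut k c d (co (\<not> z) p) * \<phi> p \<noteq> 0" for p
      using that cut_support[of k a b "co z p"] cut_support[of k c d "co (\<not> z) p"]
      by (auto simp: crect_def)
  qed
qed

lemma bounded_pointwise_inner:
  fixes w :: "'a \<Rightarrow> real"
  assumes w: "integrable M w" and m: "\<And>k. g k \<in> borel_measurable M" "h \<in> borel_measurable M"
    and B: "\<And>k x. x \<in> space M \<Longrightarrow> \<bar>g k x\<bar> \<le> B" and l: "\<And>x. x \<in> space M \<Longrightarrow> (\<lambda>k. g k x) \<longlonglongrightarrow> h x"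
  shows "(\<lambda>k. \<integral>x. w x * g k x \<partial>M) \<longlonglongrightarrow> (\<integral>x. w x * h x \<partial>M)"
proof (rule integral_dominated_convergence)
  show "integrable M (\<lambda>x. B * \<bar>w x\<bar>)" using w by simp
  show "AE x in M. (\<lambda>k. w x * g k x) \<longlonglongrightarrow> w x * h x"
    using l by (intro AE_I2 tendsto_mult tendsto_const)
  show "AE x in M. norm (w x * g k x) \<le> B * \<bar>w x\<bar>" for k
    using mult_right_mono[OF B abs_ge_zero] by (intro AE_I2) (simp add: abs_mult mult.commute)
qed (use w m in auto)

section \<open>Polynomials are dense, and test functions separate square integrable
  functions\<close>

lemma L2_polynomial_dense:
  assumes w: "sq_int (lebesgue_on (orect z a b c d)) w" and e: "e > 0"
  obtains p where "real_polynomial_function p" "(\<integral>x. (w x - p x)\<^sup>2 \<partial>lebesgue_on (orect z a b c d)) < e"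
proof -
  let ?M = "lebesgue_on (orect z a b c d)"
  obtain g where g: "continuous_on UNIV g" "(\<integral>x. (w x - g x)\<^sup>2 \<partial>?M) < e / 4"
    using L2_continuous_dense[OF w finite_measure_orect orect_sets] e by (metis divide_pos_pos zero_less_numeral)
  define m where "m = measure ?M (space ?M)"
  \<comment> \<open>Chosen so that \<delta>^2 times the measure m is at most e/4; the 1 keeps the
    quotient meaningful for rectangles of measure zero.\<close>
  define \<delta> where "\<delta> = sqrt (e / (4 * (m + 1)))"
  have m: "m \<ge> 0" by (simp add: m_def)
  then have \<delta>: "\<delta> > 0" using e by (simp add: \<delta>_def)
  obtain p where p: "real_polynomial_function p" "\<And>x. x \<in> crect z a b c d \<Longrightarrow> \<bar>g x - p x\<bar> < \<delta>"
    using Stone_Weierstrass_real_polynomial_function[OF compact_crect continuous_on_subset[OF g(1) subset_UNIV] \<delta>] by metis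
  have cp: "continuous_on UNIV p"
    using p(1) by (intro smooth_continuous smooth_alg_smooth real_polynomial_function_smooth_alg)
  have sg: "sq_int ?M g" and sp: "sq_int ?M p"
    using g(1) cp by (auto intro: continuous_sq_int_orect)
  have "(\<integral>x. (g x - p x)\<^sup>2 \<partial>?M) \<le> (\<integral>x. \<delta>\<^sup>2 \<partial>?M)"
  proof (rule integral_mono)
    show "integrable ?M (\<lambda>x. (g x - p x)\<^sup>2)" using sq_int_diff[OF sg sp] by (rule sq_int_square)
    show "integrable ?M (\<lambda>x. \<delta>\<^sup>2)" using finite_measure_orect by (simp add: finite_measure.integrable_const)
    show "(g x - p x)\<^sup>2 \<le> \<delta>\<^sup>2" if "x \<in> space ?M" for x
      using p(2)[of x] that orect_subset_crect[of z a b c d] \<delta>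
      by (intro abs_le_square_iff[THEN iffD1]) auto
  qed
  also have "\<dots> = e * (m / (4 * (m + 1)))" using e m by (simp add: \<delta>_def m_def)
  also have "\<dots> \<le> e * (1 / 4)" using e m by (intro mult_left_mono) (auto simp: field_simps)
  finally have gp: "(\<integral>x. (g x - p x)\<^sup>2 \<partial>?M) \<le> e / 4" by simp
  have "(\<integral>x. ((w x - g x) + (g x - p x))\<^sup>2 \<partial>?M) \<le> 2 * (\<integral>x. (w x - g x)\<^sup>2 \<partial>?M) + 2 * (\<integral>x. (g x - p x)\<^sup>2 \<partial>?M)"
    by (intro integral_square_sum_le sq_int_diff w sg sp)
  also have "\<dots> < e" using g gp by simp
  finally show thesis using that[OF p(1)] by simp
qed

text \<open>A polynomial times the cut-offs is a test function and tends boundedly to the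
  polynomial, so w is orthogonal to all polynomials. Subtracting a close polynomial p in one factor
  of the integral I of w^2 changes nothing, and Cauchy-Schwarz bounds I^2 by I times the squared
  distance of p from w.\<close>

lemma test_functions_separate:
  assumes w: "sq_int (lebesgue_on (orect z a b c d)) w"
    and 0: "\<And>\<phi>. \<phi> \<in> test_functions (orect z a b c d) \<Longrightarrow> (\<integral>p. w p * \<phi> p \<partial>lebesgue_on (orect z a b c d)) = 0"
  shows "AE p in lebesgue_on (orect z a b c d). w p = 0"
proof -
  let ?M = "lebesgue_on (orect z a b c d)"
  have poly0: "(\<integral>x. w x * p x \<partial>?M) = 0" if p: "real_polynomial_function p" for p
  proof -
    note sa = real_polynomial_function_smooth_alg[OF p]
    have cp: "continuous_on UNIV p" by (rule smooth_continuous[OF smooth_alg_smooth[OF sa]])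
    have cc: "continuous_on UNIV (\<lambda>p. cut k a b (co z p) * cut k c d (co (\<not> z) p))" for k
      by (rule smooth_continuous[OF smooth_alg_smooth[OF smooth_alg_tensor]]) (rule smooth1_cut)+
    have mc: "(\<lambda>p. cut k a b (co z p) * cut k c d (co (\<not> z) p)) \<in> borel_measurable ?M" for k
      by (rule sq_int_measurable[OF continuous_sq_int_orect[OF cc]])
    have "(\<lambda>k. \<integral>x. (w x * p x) * (cut k a b (co z x) * cut k c d (co (\<not> z) x)) \<partial>?M) \<longlonglongrightarrow> (\<integral>x. (w x * p x) * 1 \<partial>?M)"
    proof (rule bounded_pointwise_inner[where B = 1])
      show "integrable ?M (\<lambda>x. w x * p x)"
        by (rule sq_int_mult[OF w continuous_sq_int_orect[OF cp]])
      show "\<bar>cut k a b (co z x) * cut k c d (co (\<not> z) x)\<bar> \<le> 1" for k x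
        unfolding abs_mult using cut_abs_le by (intro mult_le_one) auto
      show "(\<lambda>k. cut k a b (co z x) * cut k c d (co (\<not> z) x)) \<longlonglongrightarrow> 1" if "x \<in> space ?M" for x
        using that tendsto_mult[OF cut_tendsto_1[of "co z x" a b] cut_tendsto_1[of "co (\<not> z) x" c d]]
        by (simp add: orect_def)
    qed (use mc in auto)
    moreover have "(\<integral>x. (w x * p x) * (cut k a b (co z x) * cut k c d (co (\<not> z) x)) \<partial>?M) = 0" for k
      using 0[OF cut_test_function[OF sa, of k a b z c d]] by (simp add: mult_ac)
    ultimately show ?thesis using LIMSEQ_unique[OF tendsto_const] by fastforce
  qed
  define I where "I = (\<integral>x. (w x)\<^sup>2 \<partial>?M)"
  have "I \<le> e" if e: "e > 0" for e
  proof -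
    obtain p where p: "real_polynomial_function p" "(\<integral>x. (w x - p x)\<^sup>2 \<partial>?M) < e"
      using L2_polynomial_dense[OF w e] .
    have sp: "sq_int ?M p"
      using p(1) by (intro continuous_sq_int_orect smooth_continuous smooth_alg_smooth real_polynomial_function_smooth_alg)
    have "I = (\<integral>x. w x * (w x - p x) \<partial>?M)"
      using poly0[OF p(1)] sq_int_mult[OF w w] sq_int_mult[OF w sp]
      by (simp add: I_def right_diff_distrib power2_eq_square)
    then have "I\<^sup>2 \<le> I * (\<integral>x. (w x - p x)\<^sup>2 \<partial>?M)"
      using sq_int_Cauchy_Schwarz[OF w sq_int_diff[OF w sp]] by (simp add: I_def)
    moreover have "I \<ge> 0" by (simp add: I_def)
    ultimately show ?thesis
      using p(2) by (cases "I = 0") (use e in \<open>auto simp: power2_eq_square\<close>)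
  qed
  then have "I \<le> 0" using field_le_epsilon[of I 0] by simp
  moreover have "I \<ge> 0" by (simp add: I_def)
  ultimately have "I = 0" by simp
  then have "AE x in ?M. (w x)\<^sup>2 = 0"
    using integral_nonneg_eq_0_iff_AE[OF sq_int_square[OF w]] by (simp add: I_def)
  then show ?thesis by simp
qed

section \<open>Trigonometric expansions and density of smooth functions\<close>

lemma L2_best_approximation:
  fixes e :: "'i \<Rightarrow> 'a \<Rightarrow> real"
  assumes I: "finite I" and v: "sq_int M v" and e: "\<And>i. i \<in> I \<Longrightarrow> sq_int M (e i)"
    and orth: "\<And>i j. i \<in> I \<Longrightarrow> j \<in> I \<Longrightarrow> i \<noteq> j \<Longrightarrow> (\<integral>x. e i x * e j x \<partial>M) = 0"
    and nrm: "\<And>i. i \<in> I \<Longrightarrow> (\<integral>x. e i x * e i x \<partial>M) = 1 \<or> e i = (\<lambda>x. 0)"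
  shows "(\<integral>x. (v x - (\<Sum>i\<in>I. (\<integral>x. v x * e i x \<partial>M) * e i x))\<^sup>2 \<partial>M)
    \<le> (\<integral>x. (v x - (\<Sum>i\<in>I. d i * e i x))\<^sup>2 \<partial>M)"
proof -
  define c where "c i = (\<integral>x. v x * e i x \<partial>M)" for i
  define r where "r x = v x - (\<Sum>i\<in>I. c i * e i x)" for x
  define q where "q x = (\<Sum>i\<in>I. (c i - d i) * e i x)" for x
  have sr: "sq_int M r" and sq: "sq_int M q"
    unfolding r_def[abs_def] q_def[abs_def] by (intro sq_int_diff v sq_int_sum sq_int_cmult e; simp)+
  have r0: "(\<integral>x. r x * e i x \<partial>M) = 0" if i: "i \<in> I" for i
  proof -
    have "(\<integral>x. r x * e i x \<partial>M) = (\<integral>x. v x * e i x - (\<Sum>j\<in>I. c j * (e j x * e i x)) \<partial>M)"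
      by (simp add: r_def left_diff_distrib sum_distrib_right mult.assoc)
    also have "\<dots> = c i - (\<Sum>j\<in>I. c j * (\<integral>x. e j x * e i x \<partial>M))"
      using sq_int_mult[OF v e[OF i]] sq_int_mult[OF e e[OF i]] by (simp add: c_def)
    also have "(\<Sum>j\<in>I. c j * (\<integral>x. e j x * e i x \<partial>M)) = (\<Sum>j\<in>I. if j = i then c j * (\<integral>x. e i x * e i x \<partial>M) else 0)"
      using orth i by (intro sum.cong) auto
    also have "\<dots> = c i * (\<integral>x. e i x * e i x \<partial>M)" using I i by simp
    also have "\<dots> = c i" using nrm[OF i] by (auto simp: c_def)
    finally show ?thesis by simp
  qed
  have rq: "(\<integral>x. r x * q x \<partial>M) = 0"
  proof -
    have "(\<integral>x. r x * q x \<partial>M) = (\<integral>x. (\<Sum>i\<in>I. (c i - d i) * (r x * e i x)) \<partial>M)"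
      by (simp add: q_def sum_distrib_left mult_ac)
    also have "\<dots> = (\<Sum>i\<in>I. (c i - d i) * (\<integral>x. r x * e i x \<partial>M))"
      using sq_int_mult[OF sr e] by simp
    finally show ?thesis using r0 by simp
  qed
  have "(\<integral>x. (v x - (\<Sum>i\<in>I. d i * e i x))\<^sup>2 \<partial>M) = (\<integral>x. (r x + 1 * q x)\<^sup>2 \<partial>M)"
    by (simp add: r_def q_def sum_subtractf left_diff_distrib)
  also have "\<dots> = (\<integral>x. (r x)\<^sup>2 \<partial>M) + (\<integral>x. (q x)\<^sup>2 \<partial>M)"
    using integral_square_add[OF sr sq, of 1] rq by simp
  finally show ?thesis by (simp add: r_def c_def)
qed

text \<open>Normalises the cosines on the unit interval: the mean of the square of a cosine is 1/2,
  except for index 0.\<close>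

definition nu :: "nat \<Rightarrow> real" where "nu m = (if m = 0 then 1 else sqrt 2)"

definition ec :: "nat \<Rightarrow> real \<Rightarrow> real" where "ec m s = nu m * cos (pi * real m * s)"

definition es :: "nat \<Rightarrow> real \<Rightarrow> real" where "es m s = nu m * sin (pi * real m * s)"

lemma nu_nonzero: "nu m \<noteq> 0" by (simp add: nu_def)

lemma smooth1_ec: "smooth1 (ec m)" and smooth1_es: "smooth1 (es m)"
  unfolding ec_def[abs_def] es_def[abs_def]
  by (intro smooth1_mult smooth1_const smooth1_cos smooth1_sin)+

lemma deriv_ec: "deriv (ec m) = (\<lambda>s. - (pi * real m) * es m s)"
  and deriv_es: "deriv (es m) = (\<lambda>s. (pi * real m) * ec m s)"
  unfolding ec_def[abs_def] es_def[abs_def]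
  by (intro ext DERIV_imp_deriv; auto intro!: derivative_eq_intros)+

lemma measure_line [simp]: "a \<le> b \<Longrightarrow> measure (lebesgue_on {a..b}) {a..b :: real} = b - a"
  using integral_line_FTC[of a b "\<lambda>x. x" "\<lambda>x. 1"] by simp

lemma integral_cos_pi:
  fixes k :: int
  shows "(\<integral>s. cos (pi * of_int k * s) \<partial>lebesgue_on {0..1}) = (if k = 0 then 1 else 0)"
proof (cases "k = 0")
  case True
  then show ?thesis using integral_line_FTC[of 0 1 "\<lambda>x. x" "\<lambda>x. 1"] by simp
next
  case False
  have "(\<integral>s. cos (pi * of_int k * s) \<partial>lebesgue_on {0..1})
      = sin (pi * of_int k * 1) / (pi * of_int k) - sin (pi * of_int k * 0) / (pi * of_int k)"
    by (rule integral_line_FTC) (use False in \<open>auto intro!: derivative_eq_intros continuous_intros\<close>)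
  then show ?thesis using False sin_int_times_real[of k pi] sin_integer_2pi by (simp add: mult.commute sin_zero_iff_int2)
qed

lemma integral_trig_product:
  "(\<integral>s. ec m s * ec n s \<partial>lebesgue_on {0..1}) = (if m = n then 1 else 0)"
  "(\<integral>s. es m s * es n s \<partial>lebesgue_on {0..1}) = (if m = n \<and> m \<noteq> 0 then 1 else 0)"
proof -
  let ?c = "\<lambda>k s. cos (pi * of_int k * s)"
  have i: "integrable (lebesgue_on {0..1}) (?c k)" for k
    by (intro continuous_integrable_line continuous_intros)
  have "(\<integral>s. ec m s * ec n s \<partial>lebesgue_on {0..1})
      = (\<integral>s. nu m * nu n / 2 * (?c (int m - int n) s + ?c (int m + int n) s) \<partial>lebesgue_on {0..1})"
    by (intro Bochner_Integration.integral_cong) (auto simp: ec_def cos_add cos_diff algebra_simps)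
  also have "\<dots> = nu m * nu n / 2 * ((if int m - int n = 0 then 1 else 0) + (if int m + int n = 0 then 1 else 0))"
    using i[of "int m - int n"] i[of "int m + int n"]
    by (simp only: Bochner_Integration.integral_mult_right_zero Bochner_Integration.integral_add integral_cos_pi)
  finally show "(\<integral>s. ec m s * ec n s \<partial>lebesgue_on {0..1}) = (if m = n then 1 else 0)"
    by (cases "m = n"; cases "n = 0") (simp_all add: nu_def add_nonneg_eq_0_iff)
  have "(\<integral>s. es m s * es n s \<partial>lebesgue_on {0..1})
      = (\<integral>s. nu m * nu n / 2 * (?c (int m - int n) s - ?c (int m + int n) s) \<partial>lebesgue_on {0..1})"
    by (intro Bochner_Integration.integral_cong) (auto simp: es_def cos_add cos_diff algebra_simps)
  also have "\<dots> = nu m * nu n / 2 * ((if int m - int n = 0 then 1 else 0) - (if int m + int n = 0 then 1 else 0))"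
    using i[of "int m - int n"] i[of "int m + int n"]
    by (simp only: Bochner_Integration.integral_mult_right_zero Bochner_Integration.integral_diff integral_cos_pi)
  finally show "(\<integral>s. es m s * es n s \<partial>lebesgue_on {0..1}) = (if m = n \<and> m \<noteq> 0 then 1 else 0)"
    by (cases "m = n"; cases "n = 0") (simp_all add: nu_def add_nonneg_eq_0_iff)
qed

text \<open>With f = \<open>ec\<close> this is the cosine basis of the square. With f =
  \<open>es\<close> it is the system into which differentiation along z transforms that basis, up to
  factors: sines along z, cosines across.\<close>

definition bas :: "bool \<Rightarrow> (nat \<Rightarrow> real \<Rightarrow> real) \<Rightarrow> nat \<times> nat \<Rightarrow> point \<Rightarrow> real" where
  "bas z f i p = f (fst i) (co z p) * ec (snd i) (co (\<not> z) p)"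

abbreviation usq :: "point set" where "usq \<equiv> orect True 0 1 0 1"

lemma usq_eq: "orect z 0 1 0 1 = usq"
  using orect_not[of True 0 1 0 1] by (cases z) auto

lemma unit_square_usq: "unit_square = usq"
  by (simp add: unit_square_def orect_True)

lemma bas_smooth_alg: "(\<And>m. smooth1 (f m)) \<Longrightarrow> smooth_alg (bas z f i)"
  unfolding bas_def[abs_def] by (intro smooth_alg_tensor smooth1_ec)

lemma bas_continuous: "(\<And>m. smooth1 (f m)) \<Longrightarrow> continuous_on S (bas z f i)"
  by (intro smooth_continuous smooth_alg_smooth bas_smooth_alg)

lemma bas_sq_int: "(\<And>m. smooth1 (f m)) \<Longrightarrow> sq_int (lebesgue_on usq) (bas z f i)"
  by (intro continuous_sq_int_orect bas_continuous)

lemma integral_bas_product: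
  assumes f: "\<And>m. smooth1 (f m)"
  shows "(\<integral>p. bas z f i p * bas z f j p \<partial>lebesgue_on usq)
    = (\<integral>s. f (fst i) s * f (fst j) s \<partial>lebesgue_on {0..1}) * (if snd i = snd j then 1 else 0)"
proof -
  have c: "continuous_on UNIV (\<lambda>p. bas z f i p * bas z f j p)"
    by (rule continuous_on_mult; rule bas_continuous; rule f)
  have eq: "bas z f i (pt z s t) * bas z f j (pt z s t) = (f (fst i) s * f (fst j) s) * (ec (snd i) t * ec (snd j) t)" for s t
    unfolding bas_def co_pt by (simp only: mult_ac)
  have "(\<integral>p. bas z f i p * bas z f j p \<partial>lebesgue_on (orect z 0 1 0 1))
    = (\<integral>t. (\<integral>s. (f (fst i) s * f (fst j) s) * (ec (snd i) t * ec (snd j) t) \<partial>lebesgue_on {0..1}) \<partial>lebesgue_on {0..1})"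
    unfolding integral_orect_iterated[OF c] eq ..
  also have "\<dots> = (\<integral>s. f (fst i) s * f (fst j) s \<partial>lebesgue_on {0..1}) * (\<integral>t. ec (snd i) t * ec (snd j) t \<partial>lebesgue_on {0..1})"
    unfolding Bochner_Integration.integral_mult_left_zero Bochner_Integration.integral_mult_right_zero ..
  finally show ?thesis unfolding usq_eq[of z] integral_trig_product .
qed

text \<open>Square partial sums are invariant under exchange of the two indices, so the same partial
  sum can be read with either direction in front.\<close>

definition sq_idx :: "nat \<Rightarrow> (nat \<times> nat) set" where "sq_idx N = {..<N} \<times> {..<N}"

lemma finite_sq_idx [simp]: "finite (sq_idx N)"
  by (simp add: sq_idx_def)

definition in_span :: "(nat \<times> nat \<Rightarrow> point \<Rightarrow> real) \<Rightarrow> (point \<Rightarrow> real) \<Rightarrow> nat \<Rightarrow> bool" where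
  "in_span e h N \<longleftrightarrow> (\<exists>d. \<forall>p. h p = (\<Sum>i\<in>sq_idx N. d i * e i p))"

lemma in_span_mono:
  assumes "in_span e h N" "N \<le> N'" shows "in_span e h N'"
proof -
  obtain d where d: "\<And>p. h p = (\<Sum>i\<in>sq_idx N. d i * e i p)" using assms(1) by (auto simp: in_span_def)
  have "h p = (\<Sum>i\<in>sq_idx N'. (if i \<in> sq_idx N then d i else 0) * e i p)" for p
    unfolding d using assms(2) by (intro sum.mono_neutral_cong_left) (auto simp: sq_idx_def)
  then show ?thesis unfolding in_span_def by (intro exI allI)
qed

lemma in_span_base: "\<exists>N. in_span e (\<lambda>p. c * e i p) N"
proof -
  define N where "N = Suc (max (fst i) (snd i))"
  have "i \<in> sq_idx N" by (cases i) (auto simp: sq_idx_def N_def)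
  then have "c * e i p = (\<Sum>j\<in>sq_idx N. (if j = i then c else 0) * e j p)" for p
    by (simp add: if_distrib[of "\<lambda>x. x * _"] cong: if_cong)
  then show ?thesis unfolding in_span_def by (intro exI allI)
qed

lemma in_span_add:
  assumes "\<exists>N. in_span e h N" "\<exists>N. in_span e g N"
  shows "\<exists>N. in_span e (\<lambda>p. h p + g p) N"
proof -
  obtain N N' where "in_span e h N" "in_span e g N'" using assms by auto
  then have "in_span e h (max N N')" "in_span e g (max N N')" by (auto intro: in_span_mono)
  then obtain d d' where *: "\<And>p. h p = (\<Sum>i\<in>sq_idx (max N N'). d i * e i p)"
    "\<And>p. g p = (\<Sum>i\<in>sq_idx (max N N'). d' i * e i p)" by (auto simp: in_span_def)
  have "h p + g p = (\<Sum>i\<in>sq_idx (max N N'). (d i + d' i) * e i p)" for p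
    unfolding * by (simp add: sum.distrib distrib_right)
  then show ?thesis unfolding in_span_def by (intro exI allI)
qed

text \<open>Cosine products without normalisation. Product formulas make their span an algebra;
  hence it contains q(cos, cos) for every polynomial q, which is what Stone-Weierstrass
  produces.\<close>

inductive trig_poly :: "bool \<Rightarrow> (point \<Rightarrow> real) \<Rightarrow> bool" for z where
  base: "trig_poly z (\<lambda>p. c * (cos (pi * real m * co z p) * cos (pi * real n * co (\<not> z) p)))"
| add: "trig_poly z f \<Longrightarrow> trig_poly z g \<Longrightarrow> trig_poly z (\<lambda>p. f p + g p)"

text \<open>The frequencies of the sum and the difference; since cosine is even, the absolute
  difference serves and stays a natural number.\<close>

lemma cos_mult_nat:
  "\<exists>k::nat. \<forall>x. cos (pi * real m * x) * cos (pi * real n * x)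
      = (cos (pi * real k * x) + cos (pi * real (m + n) * x)) / 2"
proof -
  define k where "k = (if m \<le> n then n - m else m - n)"
  have "cos (pi * real k * x) = cos (pi * real m * x - pi * real n * x)" for x
    by (cases "m \<le> n") (auto simp: k_def of_nat_diff algebra_simps cos_diff)
  then show ?thesis
    by (intro exI[of _ k]) (simp add: cos_times_cos algebra_simps)
qed

lemma trig_poly_mult_base:
  assumes "trig_poly z f"
  shows "trig_poly z (\<lambda>p. f p * (c * (cos (pi * real m * co z p) * cos (pi * real n * co (\<not> z) p))))"
  using assms
proof induction
  case (base c' m' n')
  obtain k where k: "\<And>x. cos (pi * real m' * x) * cos (pi * real m * x)
      = (cos (pi * real k * x) + cos (pi * real (m' + m) * x)) / 2" using cos_mult_nat[of m' m] by blast
  obtain l where l: "\<And>x. cos (pi * real n' * x) * cos (pi * real n * x)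
      = (cos (pi * real l * x) + cos (pi * real (n' + n) * x)) / 2" using cos_mult_nat[of n' n] by blast
  let ?b = "\<lambda>m n p. c' * c / 4 * (cos (pi * real m * co z p) * cos (pi * real n * co (\<not> z) p))"
  have "trig_poly z (\<lambda>p. (?b k l p + ?b k (n' + n) p) + (?b (m' + m) l p + ?b (m' + m) (n' + n) p))"
    by (rule trig_poly.add; rule trig_poly.add; rule trig_poly.base)
  moreover have "c' * (cos (pi * real m' * x) * cos (pi * real n' * y)) * (c * (cos (pi * real m * x) * cos (pi * real n * y)))
      = c' * c * (cos (pi * real m' * x) * cos (pi * real m * x)) * (cos (pi * real n' * y) * cos (pi * real n * y))" for x y
    by (simp only: mult_ac)
  moreover have "C * ((a + b) / 2) * ((e + f) / 2) = (C / 4 * (a * e) + C / 4 * (a * f)) + (C / 4 * (b * e) + C / 4 * (b * f))"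
    for C a b e f :: real by (simp add: field_simps)
  ultimately show ?case unfolding k l by (simp only: k l)
next
  case (add f g)
  then show ?case using trig_poly.add[OF add.IH] by (simp add: distrib_right)
qed

lemma trig_poly_mult:
  assumes "trig_poly z g" "trig_poly z f"
  shows "trig_poly z (\<lambda>p. f p * g p)"
  using assms(1)
proof induction
  case (base c m n)
  show ?case by (rule trig_poly_mult_base[OF assms(2)])
next
  case (add g h)
  then show ?case using trig_poly.add[OF add.IH] by (simp add: distrib_left)
qed

lemma trig_poly_polynomial:
  assumes "real_polynomial_function (q :: point \<Rightarrow> real)"
  shows "trig_poly z (\<lambda>p. q (pt z (cos (pi * co z p)) (cos (pi * co (\<not> z) p))))"
  using assms
proof (induction rule: real_polynomial_function.induct)
  case (linear f)
  have "f (pt z s t) = f (pt z 1 0) * s + f (pt z 0 1) * t" for s t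
  proof -
    have "pt z s t = s *\<^sub>R pt z 1 0 + t *\<^sub>R pt z 0 1" by (simp add: pt_def)
    then have "f (pt z s t) = f (s *\<^sub>R pt z 1 0 + t *\<^sub>R pt z 0 1)" by simp
    also have "\<dots> = s * f (pt z 1 0) + t * f (pt z 0 1)"
      using bounded_linear.linear[OF linear] by (simp only: linear_add linear_scale real_scaleR_def)
    finally show ?thesis by (simp add: mult.commute)
  qed
  then obtain A B where AB: "\<And>s t. f (pt z s t) = A * s + B * t" by blast
  show ?case
    unfolding AB using trig_poly.add[OF trig_poly.base[of z A 1 0] trig_poly.base[of z B 0 1]] by simp
next
  case (const c)
  then show ?case using trig_poly.base[of z c 0 0] by simp
next
  case (add f g)
  then show ?case using trig_poly.add[OF add.IH] by simp
next
  case (mult f g)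
  then show ?case using trig_poly_mult[OF mult.IH(2) mult.IH(1)] by simp
qed

lemma trig_poly_in_span: "trig_poly z f \<Longrightarrow> \<exists>N. in_span (bas z ec) f N"
proof (induction rule: trig_poly.induct)
  case (base c m n)
  have "c * (cos (pi * real m * co z p) * cos (pi * real n * co (\<not> z) p)) = c / (nu m * nu n) * bas z ec (m, n) p" for p
    using nu_nonzero[of m] nu_nonzero[of n] by (simp add: bas_def ec_def)
  then show ?case using in_span_base[of "bas z ec" "c / (nu m * nu n)" "(m, n)"] by simp
next
  case (add f g)
  then show ?case by (intro in_span_add)
qed

text \<open>The product of cos(m \<pi> s) and sin(\<pi> s) is half the difference of the sines of
  the frequencies m + 1 and m - 1.\<close>

lemma trig_poly_sin_in_span: "trig_poly z f \<Longrightarrow> \<exists>N. in_span (bas z es) (\<lambda>p. f p * sin (pi * co z p)) N"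
proof (induction rule: trig_poly.induct)
  case (base c m n)
  define c1 where "c1 = c / (2 * nu (m + 1) * nu n)"
  \<comment> \<open>For m = 0 the second frequency is -1. Sine being odd, index 1 with the opposite
    sign takes its place.\<close>
  define c2 where "c2 = (if m = 0 then c / (2 * nu 1 * nu n) else - c / (2 * nu (m - 1) * nu n))"
  define l where "l = (if m = 0 then 1 else m - 1)"
  have tr: "2 * (cos (pi * real m * x) * sin (pi * x)) = sin (pi * real (m + 1) * x) - sin (pi * (real m - 1) * x)" for x
    by (simp add: algebra_simps sin_add sin_diff)
  have "c * (cos (pi * real m * x) * cos (pi * real n * y)) * sin (pi * x)
     = c1 * (es (m + 1) x * ec n y) + c2 * (es l x * ec n y)" for x y
  proof -
    have "c * (cos (pi * real m * x) * cos (pi * real n * y)) * sin (pi * x)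
      = c / 2 * (2 * (cos (pi * real m * x) * sin (pi * x))) * cos (pi * real n * y)" by simp
    also have "\<dots> = c / 2 * sin (pi * real (m + 1) * x) * cos (pi * real n * y) - c / 2 * sin (pi * (real m - 1) * x) * cos (pi * real n * y)"
      unfolding tr by (simp add: algebra_simps)
    also have "c / 2 * sin (pi * real (m + 1) * x) * cos (pi * real n * y) = c1 * (es (m + 1) x * ec n y)"
      using nu_nonzero[of "m + 1"] nu_nonzero[of n] by (simp add: c1_def es_def ec_def)
    also have "c / 2 * sin (pi * (real m - 1) * x) * cos (pi * real n * y) = - c2 * (es l x * ec n y)"
    proof (cases "m = 0")
      case True
      then show ?thesis using nu_nonzero[of 1] nu_nonzero[of n] by (simp add: c2_def l_def es_def ec_def)
    next
      case False
      then have "real m - 1 = real (m - 1)" by simp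
      with False show ?thesis using nu_nonzero[of "m - 1"] nu_nonzero[of n]
        by (simp add: c2_def l_def es_def ec_def del: of_nat_diff)
    qed
    finally show ?thesis by simp
  qed
  then have "(\<lambda>p. c * (cos (pi * real m * co z p) * cos (pi * real n * co (\<not> z) p)) * sin (pi * co z p))
      = (\<lambda>p. c1 * bas z es (m + 1, n) p + c2 * bas z es (l, n) p)"
    by (simp add: bas_def)
  then show ?case by (simp only:) (rule in_span_add[OF in_span_base in_span_base])
next
  case (add f g)
  then show ?case using in_span_add[OF add.IH] by (simp add: distrib_right)
qed

lemma trig_poly_smooth_alg: "trig_poly z f \<Longrightarrow> smooth_alg f"
proof (induction rule: trig_poly.induct)
  case (base c m n)
  show ?case by (rule smooth_alg.mult[OF smooth_alg_const smooth_alg_tensor]; rule smooth1_cos)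
next
  case (add f g)
  show ?case by (rule smooth_alg.add[OF add.IH])
qed

lemma trig_poly_continuous: "trig_poly z f \<Longrightarrow> continuous_on UNIV f"
  by (rule smooth_continuous[OF smooth_alg_smooth[OF trig_poly_smooth_alg]])

text \<open>In the variables cos(\<pi> s) and cos(\<pi> t) a trigonometric polynomial is an ordinary
  polynomial on \<open>[-1, 1]\<^sup>2\<close>. A continuous g is transported there by arccos,
  approximated by Stone-Weierstrass and carried back.\<close>

lemma trig_poly_dense:
  assumes w: "sq_int (lebesgue_on usq) w" and e: "e > 0"
  obtains f where "trig_poly z f" "(\<integral>x. (w x - f x)\<^sup>2 \<partial>lebesgue_on usq) < e"
proof -
  let ?M = "lebesgue_on usq"
  obtain g where g: "continuous_on UNIV g" "(\<integral>x. (w x - g x)\<^sup>2 \<partial>?M) < e / 4"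
    using L2_continuous_dense[OF w finite_measure_orect orect_sets] e by (metis divide_pos_pos zero_less_numeral)
  define \<delta> where "\<delta> = sqrt (e / 4)"
  have \<delta>: "\<delta> > 0" using e by (simp add: \<delta>_def)
  let ?G = "\<lambda>p. g (pt z (arccos (co z p) / pi) (arccos (co (\<not> z) p) / pi))"
  have "continuous_on (crect z (-1) 1 (-1) 1) ?G"
    by (intro continuous_on_compose2[OF g(1)] continuous_intros) (auto simp: crect_def)
  then obtain q where q: "real_polynomial_function q" "\<And>x. x \<in> crect z (-1) 1 (-1) 1 \<Longrightarrow> \<bar>?G x - q x\<bar> < \<delta>"
    by (rule Stone_Weierstrass_real_polynomial_function[OF compact_crect _ \<delta>]) auto
  define f where "f p = q (pt z (cos (pi * co z p)) (cos (pi * co (\<not> z) p)))" for p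
  have tf: "trig_poly z f" unfolding f_def[abs_def] by (rule trig_poly_polynomial[OF q(1)])
  have near: "\<bar>g p - f p\<bar> < \<delta>" if p: "p \<in> orect z 0 1 0 1" for p
  proof -
    have ac: "arccos (cos (pi * s)) / pi = s" if "s \<in> {0<..<1}" for s
      using that by (subst arccos_cos) auto
    have "?G (pt z (cos (pi * co z p)) (cos (pi * co (\<not> z) p))) = g p"
      using p ac[of "co z p"] ac[of "co (\<not> z) p"] by (simp add: orect_def)
    moreover have "pt z (cos (pi * co z p)) (cos (pi * co (\<not> z) p)) \<in> crect z (-1) 1 (-1) 1"
      by (simp add: crect_def)
    ultimately show ?thesis using q(2) unfolding f_def by metis
  qed
  have sg: "sq_int ?M g" and sf: "sq_int ?M f"
    using g(1) trig_poly_continuous[OF tf] by (auto intro: continuous_sq_int_orect)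
  have "(\<integral>x. (g x - f x)\<^sup>2 \<partial>?M) \<le> (\<integral>x. \<delta>\<^sup>2 \<partial>?M)"
  proof (rule integral_mono)
    show "integrable ?M (\<lambda>x. (g x - f x)\<^sup>2)" using sq_int_diff[OF sg sf] by (rule sq_int_square)
    show "integrable ?M (\<lambda>x. \<delta>\<^sup>2)" using finite_measure_orect by (simp add: finite_measure.integrable_const)
    show "(g x - f x)\<^sup>2 \<le> \<delta>\<^sup>2" if "x \<in> space ?M" for x
      using near[of x] that \<delta> usq_eq[of z]
      by (intro abs_le_square_iff[THEN iffD1]) auto
  qed
  also have "\<dots> = e / 4"
  proof -
    have "(\<integral>x. 1 \<partial>?M) = (1::real)"
      using integral_orect_iterated[of "\<lambda>_. 1" True 0 1 0 1] by simp
    then show ?thesis using e by (simp add: \<delta>_def)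
  qed
  finally have gp: "(\<integral>x. (g x - f x)\<^sup>2 \<partial>?M) \<le> e / 4" by simp
  have "(\<integral>x. ((w x - g x) + (g x - f x))\<^sup>2 \<partial>?M) \<le> 2 * (\<integral>x. (w x - g x)\<^sup>2 \<partial>?M) + 2 * (\<integral>x. (g x - f x)\<^sup>2 \<partial>?M)"
    by (intro integral_square_sum_le sq_int_diff w sg sf)
  also have "\<dots> < e" using g gp by simp
  finally show thesis using that[OF tf] by simp
qed

text \<open>Divide w by the sine, approximate the quotient by a trigonometric polynomial and
  multiply by the sine again, which does not increase the error. The quotient need not be square
  integrable, so the divisor is first kept above 1/(k + 1).\<close>

lemma sin_span_dense:
  assumes w: "sq_int (lebesgue_on usq) w" and e: "e > 0"
  obtains f where "trig_poly z f" "(\<integral>x. (w x - f x * sin (pi * co z x))\<^sup>2 \<partial>lebesgue_on usq) < e"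
proof -
  let ?M = "lebesgue_on usq"
  let ?s = "\<lambda>x. sin (pi * co z x)"
  define g where "g k x = 1 / max (?s x) (1 / real (Suc k))" for k x
  have pos: "max (?s x) (1 / real (Suc k)) > 0" for k x
    by (simp add: less_max_iff_disj)
  have cg: "continuous_on UNIV (g k)" for k
    unfolding g_def[abs_def] using pos by (intro continuous_intros) (auto simp: order_less_imp_not_eq2)
  have cs: "continuous_on UNIV ?s" by (intro continuous_intros)
  have mg: "g k \<in> borel_measurable ?M" "?s \<in> borel_measurable ?M" for k
    using cg cs by (auto intro!: sq_int_measurable continuous_sq_int_orect)
  have gb: "\<bar>g k x\<bar> \<le> real (Suc k)" for k x
  proof -
    have "1 / max (?s x) (1 / real (Suc k)) \<le> 1 / (1 / real (Suc k))"
      by (intro divide_left_mono) (use pos in auto)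
    then show ?thesis using pos[of x k] by (simp add: g_def)
  qed
  have sx: "0 < ?s x" if "x \<in> usq" for x
  proof -
    have "0 < co z x" "co z x < 1" using that usq_eq[of z] by (auto simp: orect_def)
    then show ?thesis by (intro sin_gt_zero) auto
  qed
  have wgs: "\<bar>w x - w x * g k x * ?s x\<bar> \<le> \<bar>w x\<bar>" if "x \<in> usq" for k x
  proof -
    have "0 \<le> g k x * ?s x" "g k x * ?s x \<le> 1"
      using pos[of x k] sx[OF that] by (auto simp: g_def field_simps)
    then have "\<bar>w x\<bar> * \<bar>1 - g k x * ?s x\<bar> \<le> \<bar>w x\<bar> * 1" by (intro mult_left_mono) auto
    then show ?thesis by (simp flip: abs_mult add: algebra_simps)
  qed
  have "(\<lambda>k. \<integral>x. (w x - w x * g k x * ?s x)\<^sup>2 \<partial>?M) \<longlonglongrightarrow> (\<integral>x. 0 \<partial>?M)"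
  proof (rule integral_dominated_convergence)
    show "integrable ?M (\<lambda>x. (w x)\<^sup>2)" using w by (rule sq_int_square)
    show "AE x in ?M. (\<lambda>k. (w x - w x * g k x * ?s x)\<^sup>2) \<longlonglongrightarrow> 0"
    proof (rule AE_I2)
      fix x assume "x \<in> space ?M"
      then have s: "?s x > 0" using sx by simp
      have "\<forall>\<^sub>F k in sequentially. 1 / real (Suc k) < ?s x"
        using order_tendstoD(2)[OF LIMSEQ_Suc[OF lim_1_over_n] s] by simp
      then have "\<forall>\<^sub>F k in sequentially. (w x - w x * g k x * ?s x)\<^sup>2 = 0"
        by eventually_elim (use s in \<open>simp add: g_def max_def\<close>)
      then show "(\<lambda>k. (w x - w x * g k x * ?s x)\<^sup>2) \<longlonglongrightarrow> 0" by (rule tendsto_eventually)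
    qed
    show "AE x in ?M. norm ((w x - w x * g k x * ?s x)\<^sup>2) \<le> (w x)\<^sup>2" for k
      using wgs by (auto intro!: AE_I2 simp: abs_le_square_iff)
    show "(\<lambda>x. (w x - w x * g k x * ?s x)\<^sup>2) \<in> borel_measurable ?M" for k
      using mg sq_int_measurable[OF w] by measurable
  qed auto
  then have "\<forall>\<^sub>F n in sequentially. (\<integral>x. (w x - w x * g n x * ?s x)\<^sup>2 \<partial>?M) < e / 4"
    using order_tendstoD(2)[of _ 0 sequentially "e/4"] e by simp
  then obtain k where k: "(\<integral>x. (w x - w x * g k x * ?s x)\<^sup>2 \<partial>?M) < e / 4"
    unfolding eventually_sequentially by blast
  have swg: "sq_int ?M (\<lambda>x. w x * g k x)"
    by (rule sq_int_mult_bounded[OF w mg(1) gb])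
  obtain f where f: "trig_poly z f" "(\<integral>x. (w x * g k x - f x)\<^sup>2 \<partial>?M) < e / 4"
    using trig_poly_dense[OF swg, where e = "e / 4" and z = z] e by auto
  have sf: "sq_int ?M f"
    using trig_poly_continuous[OF f(1)] by (auto intro: continuous_sq_int_orect)
  have s1: "sq_int ?M (\<lambda>x. w x * g k x * ?s x)" "sq_int ?M (\<lambda>x. f x * ?s x)"
    by (rule sq_int_mult_bounded[OF swg mg(2), of 1] sq_int_mult_bounded[OF sf mg(2), of 1], simp)+
  have "(\<integral>x. (w x * g k x * ?s x - f x * ?s x)\<^sup>2 \<partial>?M) \<le> (\<integral>x. (w x * g k x - f x)\<^sup>2 \<partial>?M)"
  proof (rule integral_mono)
    show "integrable ?M (\<lambda>x. (w x * g k x * ?s x - f x * ?s x)\<^sup>2)" using sq_int_diff[OF s1] by (rule sq_int_square)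
    show "integrable ?M (\<lambda>x. (w x * g k x - f x)\<^sup>2)" using sq_int_diff[OF swg sf] by (rule sq_int_square)
    fix x
    have "(w x * g k x - f x)\<^sup>2 * (?s x)\<^sup>2 \<le> (w x * g k x - f x)\<^sup>2 * 1"
      by (intro mult_left_mono) (auto simp: abs_square_le_1)
    then show "(w x * g k x * ?s x - f x * ?s x)\<^sup>2 \<le> (w x * g k x - f x)\<^sup>2"
      by (simp flip: left_diff_distrib add: power_mult_distrib)
  qed
  moreover have "(\<integral>x. ((w x - w x * g k x * ?s x) + (w x * g k x * ?s x - f x * ?s x))\<^sup>2 \<partial>?M)
    \<le> 2 * (\<integral>x. (w x - w x * g k x * ?s x)\<^sup>2 \<partial>?M) + 2 * (\<integral>x. (w x * g k x * ?s x - f x * ?s x)\<^sup>2 \<partial>?M)"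
    by (intro integral_square_sum_le sq_int_diff w s1)
  ultimately show thesis using that[OF f(1)] k f(2) e by simp
qed

section \<open>First weak derivatives and their sine coefficients\<close>

definition wd :: "bool \<Rightarrow> point set \<Rightarrow> (point \<Rightarrow> real) \<Rightarrow> (point \<Rightarrow> real) \<Rightarrow> bool" where
  "wd z R v w \<longleftrightarrow> has_weak_deriv R (if z then 1 else 0) (if z then 0 else 1) v w"

lemma wd_iff:
  assumes "R \<in> sets lebesgue"
  shows "wd z R v w \<longleftrightarrow> sq_int (lebesgue_on R) v \<and> sq_int (lebesgue_on R) w \<and>
    (\<forall>\<phi>\<in>test_functions R. (\<integral>p. v p * pd z \<phi> p \<partial>lebesgue_on R) = - (\<integral>p. w p * \<phi> p \<partial>lebesgue_on R))"
  using assms by (simp add: wd_def has_weak_deriv_def L2_eq_sq_int set_integral_eq_lebesgue_on pd_def)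

text \<open>The weak derivatives \<open>vd\<close> are carried along as data. The operator
  \<open>weak_deriv\<close> picks a representative for each set anew, so its values on a rectangle
  and on the square could only be compared almost everywhere.\<close>

definition H1_lim :: "point set \<Rightarrow> (nat \<Rightarrow> point \<Rightarrow> real) \<Rightarrow> (point \<Rightarrow> real) \<Rightarrow> (bool \<Rightarrow> point \<Rightarrow> real) \<Rightarrow> bool" where
  "H1_lim R \<phi> v vd \<longleftrightarrow> (\<forall>k. smooth (\<phi> k)) \<and> (\<forall>z. wd z R v (vd z)) \<and> L2_lim (lebesgue_on R) \<phi> v \<and>
    (\<forall>z. L2_lim (lebesgue_on R) (\<lambda>k. pd z (\<phi> k)) (vd z))"

text \<open>Linear vanishing at both ends; the second bound follows from the first by the reflection
  s to 1 - s, which changes the sine at most in sign because the frequency is an integer.\<close>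

lemma sin_multiple_bound:
  assumes "0 \<le> s" "s \<le> 1"
  shows "\<bar>sin (pi * real m * s)\<bar> \<le> pi * real m * s" "\<bar>sin (pi * real m * s)\<bar> \<le> pi * real m * (1 - s)"
proof -
  have *: "\<bar>sin (pi * real m * r)\<bar> \<le> pi * real m * r" if "0 \<le> r" for r
    using abs_sin_x_le_abs_x[of "pi * real m * r"] that by simp
  show "\<bar>sin (pi * real m * s)\<bar> \<le> pi * real m * s" using * assms by simp
  have "sin (pi * real m * (1 - s)) = sin (pi * real m - pi * real m * s)" by (simp add: algebra_simps)
  also have "\<dots> = - ((- 1) ^ m * sin (pi * real m * s))"
    by (simp add: sin_diff sin_npi2 cos_npi2)
  finally have "\<bar>sin (pi * real m * (1 - s))\<bar> = \<bar>sin (pi * real m * s)\<bar>"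
    by (simp add: abs_mult)
  then show "\<bar>sin (pi * real m * s)\<bar> \<le> pi * real m * (1 - s)" using *[of "1 - s"] assms by simp
qed

lemma nu_le: "\<bar>nu m\<bar> \<le> 2"
  using real_sqrt_le_mono[of 2 4] by (simp add: nu_def)

lemma ec_bound: "\<bar>ec m s\<bar> \<le> 2" and es_bound: "\<bar>es m s\<bar> \<le> 2"
  unfolding ec_def es_def abs_mult
  using mult_mono[OF nu_le abs_cos_le_one] mult_mono[OF nu_le abs_sin_le_one] by simp_all

text \<open>The singular bounds 3/s and 3/(1 - s) of the differentiated cut-off meet the factors
  \<pi> m s and \<pi> m (1 - s) of the sine. The sum is 6 \<pi> m, and the normalisation contributes
  at most 2.\<close>

lemma cut_deriv_sin_bound:
  assumes "s \<in> {0<..<1}"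
  shows "\<bar>deriv (cut k 0 1) s * es m s\<bar> \<le> 12 * (pi * real m)"
proof -
  have s: "0 < s" "s < 1" using assms by auto
  have "\<bar>deriv (cut k 0 1) s\<bar> * \<bar>sin (pi * real m * s)\<bar> \<le> (3 / s + 3 / (1 - s)) * \<bar>sin (pi * real m * s)\<bar>"
    using cut_deriv_bound[OF assms, of k] by (intro mult_right_mono) auto
  also have "\<dots> = 3 / s * \<bar>sin (pi * real m * s)\<bar> + 3 / (1 - s) * \<bar>sin (pi * real m * s)\<bar>"
    by (simp add: distrib_right)
  also have "\<dots> \<le> 3 / s * (pi * real m * s) + 3 / (1 - s) * (pi * real m * (1 - s))"
    using s by (intro add_mono mult_left_mono sin_multiple_bound) auto
  also have "\<dots> = 6 * (pi * real m)" using s by simp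
  finally have *: "\<bar>deriv (cut k 0 1) s\<bar> * \<bar>sin (pi * real m * s)\<bar> \<le> 6 * (pi * real m)" .
  have "\<bar>deriv (cut k 0 1) s * es m s\<bar> = \<bar>nu m\<bar> * (\<bar>deriv (cut k 0 1) s\<bar> * \<bar>sin (pi * real m * s)\<bar>)"
    by (simp add: es_def abs_mult)
  also have "\<dots> \<le> 2 * (6 * (pi * real m))"
    by (intro mult_mono nu_le *) auto
  finally show ?thesis by simp
qed

text \<open>Test with the basis function times cut-offs and let these open. Along z the derivative
  of the cut-off stays bounded because the sine vanishes at the ends, and it tends to 0 pointwise.
  Across z the cut-off is not differentiated, so a cosine may stand there.\<close>

lemma weak_deriv_sine_coefficient:
  assumes vw: "wd z usq v w"
  shows "(\<integral>p. w p * bas z es i p \<partial>lebesgue_on usq) = - (pi * real (fst i)) * (\<integral>p. v p * bas z ec i p \<partial>lebesgue_on usq)"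
proof -
  let ?M = "lebesgue_on usq"
  define m n where "m = fst i" and "n = snd i"
  define f where "f k s = cut k 0 1 s * es m s" for k s
  define g where "g k s = cut k 0 1 s * ec n s" for k s
  have sf: "smooth1 (f k)" and sg: "smooth1 (g k)" for k
    unfolding f_def[abs_def] g_def[abs_def] by (intro smooth1_mult smooth1_cut smooth1_es smooth1_ec)+
  have df: "deriv (f k) s = deriv (cut k 0 1) s * es m s + cut k 0 1 s * (pi * real m * ec m s)" for k s
  proof -
    have "(f k has_real_derivative deriv (cut k 0 1) s * es m s + cut k 0 1 s * deriv (es m) s) (at s)"
      unfolding f_def[abs_def]
      by (rule DERIV_cong[OF DERIV_mult[OF smooth1_DERIV[OF smooth1_cut] smooth1_DERIV[OF smooth1_es]]]) simp
    then show ?thesis by (simp add: DERIV_imp_deriv deriv_es)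
  qed
  let ?\<psi> = "\<lambda>k p. f k (co z p) * g k (co (\<not> z) p)"
  have t: "?\<psi> k \<in> test_functions usq" for k
  proof -
    have "(\<lambda>p. cut k 0 1 (co z p) * cut k 0 1 (co (\<not> z) p) * bas z es i p) \<in> test_functions usq"
      using cut_test_function[where \<phi> = "bas z es i" and k = k and a = 0 and b = 1 and z = z and c = 0 and d = 1, OF bas_smooth_alg[OF smooth1_es]]
        usq_eq[of z] by simp
    then show ?thesis by (simp add: f_def g_def bas_def m_def n_def mult_ac)
  qed
  have sv: "sq_int ?M v" and sw: "sq_int ?M w"
    and ibp: "\<And>k. (\<integral>p. v p * pd z (?\<psi> k) p \<partial>?M) = - (\<integral>p. w p * ?\<psi> k p \<partial>?M)"
    using vw t by (auto simp: wd_iff)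
  have pdp: "pd z (?\<psi> k) = (\<lambda>p. deriv (f k) (co z p) * g k (co (\<not> z) p))" for k
    by (rule pd_tensor[OF sf])
  have cm: "continuous_on UNIV h \<Longrightarrow> h \<in> borel_measurable ?M" for h :: "point \<Rightarrow> real"
    by (rule sq_int_measurable[OF continuous_sq_int_orect])
  have c1: "smooth1 a \<Longrightarrow> smooth1 b \<Longrightarrow> (\<lambda>p. a (co z p) * b (co (\<not> z) p)) \<in> borel_measurable ?M" for a b
    by (intro cm smooth_continuous smooth_alg_smooth smooth_alg_tensor)
  have in01: "co z p \<in> {0<..<1}" "co (\<not> z) p \<in> {0<..<1}" if "p \<in> space ?M" for p
    using that usq_eq[of z] by (auto simp: orect_def)
  have gb: "\<bar>g k s\<bar> \<le> 2" for k s
    unfolding g_def abs_mult using mult_mono[OF cut_abs_le ec_bound] by fastforce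
  have fb: "\<bar>f k s\<bar> \<le> 2" for k s
    unfolding f_def abs_mult using mult_mono[OF cut_abs_le es_bound] by fastforce
  have gl: "(\<lambda>k. g k s) \<longlonglongrightarrow> ec n s" and fl: "(\<lambda>k. f k s) \<longlonglongrightarrow> es m s"
    and dl: "(\<lambda>k. deriv (f k) s) \<longlonglongrightarrow> pi * real m * ec m s" if "s \<in> {0<..<1}" for s
  proof -
    show "(\<lambda>k. g k s) \<longlonglongrightarrow> ec n s" "(\<lambda>k. f k s) \<longlonglongrightarrow> es m s"
      unfolding g_def f_def using tendsto_mult[OF cut_tendsto_1[OF that] tendsto_const] by simp_all
    have "(\<lambda>k. deriv (cut k 0 1) s * es m s + cut k 0 1 s * (pi * real m * ec m s)) \<longlonglongrightarrow> 0 * es m s + 1 * (pi * real m * ec m s)"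
      by (intro tendsto_add tendsto_mult cut_deriv_tendsto_0[OF that] cut_tendsto_1[OF that] tendsto_const)
    then show "(\<lambda>k. deriv (f k) s) \<longlonglongrightarrow> pi * real m * ec m s" by (simp add: df)
  qed
  \<comment> \<open>12 comes from the differentiated cut-off and 2 from the bound of
    \<open>ec\<close>.\<close>
  have dfb: "\<bar>deriv (f k) s\<bar> \<le> 14 * (pi * real m)" if s: "s \<in> {0<..<1}" for k s
  proof -
    have "\<bar>cut k 0 1 s * (pi * real m * ec m s)\<bar> = \<bar>cut k 0 1 s\<bar> * (pi * real m * \<bar>ec m s\<bar>)"
      by (simp add: abs_mult)
    also have "\<dots> \<le> 1 * (pi * real m * 2)" by (intro mult_mono cut_abs_le mult_nonneg_nonneg ec_bound) auto
    finally show ?thesis unfolding df using cut_deriv_sin_bound[OF s, of k m] by linarith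
  qed
  have 1: "(\<lambda>k. \<integral>p. w p * ?\<psi> k p \<partial>?M) \<longlonglongrightarrow> (\<integral>p. w p * bas z es i p \<partial>?M)"
  proof (rule bounded_pointwise_inner[where B = 4])
    show "integrable ?M w" by (rule sq_int_integrable[OF finite_measure_orect sw])
    show "\<bar>?\<psi> k p\<bar> \<le> 4" for k p
      unfolding abs_mult using mult_mono[OF fb gb, of k "co (\<not> z) p" k "co z p"] by simp
    show "(\<lambda>k. ?\<psi> k p) \<longlonglongrightarrow> bas z es i p" if "p \<in> space ?M" for p
      unfolding bas_def m_def[symmetric] n_def[symmetric] using in01[OF that] by (intro tendsto_mult gl fl)
    show "?\<psi> k \<in> borel_measurable ?M" for k by (intro c1 sf sg)
    show "bas z es i \<in> borel_measurable ?M" by (rule sq_int_measurable[OF bas_sq_int[OF smooth1_es]])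
  qed
  have 2: "(\<lambda>k. \<integral>p. v p * pd z (?\<psi> k) p \<partial>?M) \<longlonglongrightarrow> (\<integral>p. v p * (pi * real m * bas z ec i p) \<partial>?M)"
    unfolding pdp
  proof (rule bounded_pointwise_inner[where B = "14 * (pi * real m) * 2"])
    show "integrable ?M v" by (rule sq_int_integrable[OF finite_measure_orect sv])
    show "\<bar>deriv (f k) (co z p) * g k (co (\<not> z) p)\<bar> \<le> 14 * (pi * real m) * 2" if "p \<in> space ?M" for k p
      unfolding abs_mult by (intro mult_mono dfb gb in01[OF that]) auto
    show "(\<lambda>k. deriv (f k) (co z p) * g k (co (\<not> z) p)) \<longlonglongrightarrow> pi * real m * bas z ec i p" if "p \<in> space ?M" for p
      using tendsto_mult[OF dl[OF in01(1)[OF that]] gl[OF in01(2)[OF that]]]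
      by (simp add: bas_def m_def n_def mult.assoc)
    show "(\<lambda>p. deriv (f k) (co z p) * g k (co (\<not> z) p)) \<in> borel_measurable ?M" for k
      by (intro c1 smooth1_deriv sf sg)
    show "(\<lambda>p. pi * real m * bas z ec i p) \<in> borel_measurable ?M"
      using sq_int_measurable[OF bas_sq_int[OF smooth1_ec]] by simp
  qed
  have "(\<lambda>k. \<integral>p. v p * pd z (?\<psi> k) p \<partial>?M) \<longlonglongrightarrow> - (\<integral>p. w p * bas z es i p \<partial>?M)"
    unfolding ibp by (intro tendsto_minus 1)
  with 2 have "(\<integral>p. v p * (pi * real m * bas z ec i p) \<partial>?M) = - (\<integral>p. w p * bas z es i p \<partial>?M)"
    using LIMSEQ_unique by blast
  moreover have "(\<integral>p. v p * (pi * real m * bas z ec i p) \<partial>?M) = pi * real m * (\<integral>p. v p * bas z ec i p \<partial>?M)"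
    by (subst Bochner_Integration.integral_mult_right_zero[symmetric]) (simp add: mult_ac)
  ultimately show ?thesis by (simp add: m_def)
qed

section \<open>Convergence of the expansions in mean square\<close>

lemma projection_converges:
  assumes w: "sq_int (lebesgue_on R) w" and e: "\<And>i. sq_int (lebesgue_on R) (e i)"
    and orth: "\<And>i j. i \<noteq> j \<Longrightarrow> (\<integral>x. e i x * e j x \<partial>lebesgue_on R) = 0"
    and nrm: "\<And>i. (\<integral>x. e i x * e i x \<partial>lebesgue_on R) = 1 \<or> e i = (\<lambda>x. 0)"
    and dense: "\<And>\<epsilon>. \<epsilon> > 0 \<Longrightarrow> \<exists>h N. in_span e h N \<and> (\<integral>x. (w x - h x)\<^sup>2 \<partial>lebesgue_on R) < \<epsilon>"
  shows "L2_lim (lebesgue_on R) (\<lambda>N x. \<Sum>i\<in>sq_idx N. (\<integral>x. w x * e i x \<partial>lebesgue_on R) * e i x) w"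
  unfolding L2_lim_def
proof (intro conjI allI w)
  let ?P = "\<lambda>N x. \<Sum>i\<in>sq_idx N. (\<integral>x. w x * e i x \<partial>lebesgue_on R) * e i x"
  show "sq_int (lebesgue_on R) (?P N)" for N by (intro sq_int_sum sq_int_cmult e)
  show "(\<lambda>N. \<integral>x. (?P N x - w x)\<^sup>2 \<partial>lebesgue_on R) \<longlonglongrightarrow> 0"
  proof (rule tendstoI)
    fix \<epsilon> :: real assume "\<epsilon> > 0"
    then obtain h N where h: "in_span e h N" "(\<integral>x. (w x - h x)\<^sup>2 \<partial>lebesgue_on R) < \<epsilon>" using dense by blast
    have "dist (\<integral>x. (?P N' x - w x)\<^sup>2 \<partial>lebesgue_on R) 0 < \<epsilon>" if le: "N' \<ge> N" for N'
    proof -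
      obtain d where d: "\<And>p. h p = (\<Sum>i\<in>sq_idx N'. d i * e i p)"
        using in_span_mono[OF h(1) le] by (auto simp: in_span_def)
      have "(\<integral>x. (w x - ?P N' x)\<^sup>2 \<partial>lebesgue_on R) \<le> (\<integral>x. (w x - (\<Sum>i\<in>sq_idx N'. d i * e i x))\<^sup>2 \<partial>lebesgue_on R)"
        by (rule L2_best_approximation[OF finite_sq_idx w e orth nrm])
      then show ?thesis using h(2) by (simp add: d[symmetric] power2_commute[of "w _"])
    qed
    then show "\<forall>\<^sub>F N in sequentially. dist (\<integral>x. (?P N x - w x)\<^sup>2 \<partial>lebesgue_on R) 0 < \<epsilon>"
      unfolding eventually_sequentially by blast
  qed
qed

lemma cosine_projection_converges:
  assumes "sq_int (lebesgue_on usq) w"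
  shows "L2_lim (lebesgue_on usq) (\<lambda>N x. \<Sum>i\<in>sq_idx N. (\<integral>x. w x * bas z ec i x \<partial>lebesgue_on usq) * bas z ec i x) w"
proof (rule projection_converges[OF assms])
  show "sq_int (lebesgue_on usq) (bas z ec i)" for i by (rule bas_sq_int[OF smooth1_ec])
  show "(\<integral>x. bas z ec i x * bas z ec j x \<partial>lebesgue_on usq) = 0" if "i \<noteq> j" for i j
    using that by (auto simp: integral_bas_product[OF smooth1_ec] integral_trig_product prod_eq_iff)
  show "(\<integral>x. bas z ec i x * bas z ec i x \<partial>lebesgue_on usq) = 1 \<or> bas z ec i = (\<lambda>x. 0)" for i
    by (simp add: integral_bas_product[OF smooth1_ec] integral_trig_product)
  show "\<exists>h N. in_span (bas z ec) h N \<and> (\<integral>x. (w x - h x)\<^sup>2 \<partial>lebesgue_on usq) < \<epsilon>" if \<epsilon>: "\<epsilon> > 0" for \<epsilon>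
    by (rule trig_poly_dense[OF assms \<epsilon>, of z]) (use trig_poly_in_span in blast)
qed

lemma sine_projection_converges:
  assumes "sq_int (lebesgue_on usq) w"
  shows "L2_lim (lebesgue_on usq) (\<lambda>N x. \<Sum>i\<in>sq_idx N. (\<integral>x. w x * bas z es i x \<partial>lebesgue_on usq) * bas z es i x) w"
proof (rule projection_converges[OF assms])
  show "sq_int (lebesgue_on usq) (bas z es i)" for i by (rule bas_sq_int[OF smooth1_es])
  show "(\<integral>x. bas z es i x * bas z es j x \<partial>lebesgue_on usq) = 0" if "i \<noteq> j" for i j
    using that by (auto simp: integral_bas_product[OF smooth1_es] integral_trig_product prod_eq_iff)
  show "(\<integral>x. bas z es i x * bas z es i x \<partial>lebesgue_on usq) = 1 \<or> bas z es i = (\<lambda>x. 0)" for i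
  proof (cases "fst i = 0")
    case True
    then have "bas z es i = (\<lambda>x. 0)" by (intro ext) (simp add: bas_def es_def)
    then show ?thesis by simp
  next
    case False
    then show ?thesis by (simp add: integral_bas_product[OF smooth1_es] integral_trig_product)
  qed
  show "\<exists>h N. in_span (bas z es) h N \<and> (\<integral>x. (w x - h x)\<^sup>2 \<partial>lebesgue_on usq) < \<epsilon>" if \<epsilon>: "\<epsilon> > 0" for \<epsilon>
    by (rule sin_span_dense[OF assms \<epsilon>, of z]) (use trig_poly_sin_in_span in blast)
qed

lemma smooth_sum:
  assumes "finite I" "\<And>i. i \<in> I \<Longrightarrow> smooth (f i)"
  shows "smooth (\<lambda>p. \<Sum>i\<in>I. c i * f i p)"
  using assms
proof (induction I rule: finite_induct)
  case (insert i I)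
  then show ?case using smooth_lincomb[of "f i" "\<lambda>p. \<Sum>i\<in>I. c i * f i p" "c i" 1] by simp
qed (simp add: smooth_zero)

lemma pd_sum:
  assumes "finite I" "\<And>i. i \<in> I \<Longrightarrow> smooth (f i)"
  shows "pd z (\<lambda>p. \<Sum>i\<in>I. c i * f i p) = (\<lambda>p. \<Sum>i\<in>I. c i * pd z (f i) p)"
  by (rule pd_eqI) (intro DERIV_sum DERIV_cmult smooth_DERIV assms)

lemma pd_bas_ec: "pd z (bas z ec i) = (\<lambda>p. - (pi * real (fst i)) * bas z es i p)"
  unfolding bas_def[abs_def] pd_tensor[OF smooth1_ec] by (simp add: deriv_ec mult.assoc)

text \<open>Partial sums of the cosine expansion converge in \<open>H\<^sup>1\<close> because the sine expansion of a weak
  derivative is the termwise derivative of the cosine expansion; the sine factor suppresses the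
  boundary terms which the cut-off functions would otherwise produce.\<close>

theorem smooth_dense_H1:
  assumes v: "\<And>z. wd z usq v (vd z)"
  obtains \<phi> where "H1_lim usq \<phi> v vd"
proof -
  let ?M = "lebesgue_on usq"
  define c where "c z i = (\<integral>p. v p * bas z ec i p \<partial>?M)" for z i
  define \<phi> where "\<phi> N p = (\<Sum>i\<in>sq_idx N. c True i * bas True ec i p)" for N p
  have sb: "smooth (bas z ec i)" for z i by (intro smooth_alg_smooth bas_smooth_alg smooth1_ec)
  have \<phi>: "\<phi> N = (\<lambda>p. \<Sum>i\<in>sq_idx N. c z i * bas z ec i p)" for N z
  proof (cases z)
    case False
    \<comment> \<open>The cosine system is symmetric in the two variables. Swapping the indices
      rewrites the partial sum with the second direction in front, and one sequence approximates
      both derivatives.\<close>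
    have sw: "bas True ec (prod.swap i) = bas False ec i" for i
      by (auto simp: bas_def)
    have "bij_betw prod.swap (sq_idx N) (sq_idx N)"
      unfolding sq_idx_def by (rule bij_betwI[of _ _ _ prod.swap]) auto
    then have "\<phi> N p = (\<Sum>i\<in>sq_idx N. c True (prod.swap i) * bas True ec (prod.swap i) p)" for p
      unfolding \<phi>_def by (rule sum.reindex_bij_betw[symmetric])
    then show ?thesis using False by (auto simp: c_def sw)
  qed (auto simp: \<phi>_def)
  have sv: "sq_int ?M v" and svd: "\<And>z. sq_int ?M (vd z)" using v by (auto simp: wd_iff)
  have "smooth (\<phi> N)" for N unfolding \<phi>[of N True] by (intro smooth_sum sb) auto
  moreover have "L2_lim ?M \<phi> v"
  proof -
    have "\<phi> = (\<lambda>N p. \<Sum>i\<in>sq_idx N. c True i * bas True ec i p)" by (rule ext) (rule \<phi>)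
    then show ?thesis using cosine_projection_converges[OF sv, of True] by (simp only: c_def)
  qed
  moreover have "L2_lim ?M (\<lambda>N. pd z (\<phi> N)) (vd z)" for z
  proof -
    have "pd z (\<phi> N) = (\<lambda>p. \<Sum>i\<in>sq_idx N. (\<integral>p. vd z p * bas z es i p \<partial>?M) * bas z es i p)" for N
      unfolding \<phi>[of N z] pd_sum[OF finite_sq_idx sb] pd_bas_ec weak_deriv_sine_coefficient[OF v] c_def
      by (simp add: mult_ac)
    then show ?thesis using sine_projection_converges[OF svd, of z z] by simp
  qed
  ultimately show thesis using v that unfolding H1_lim_def by blast
qed

section \<open>Traces on segments\<close>

lemma squeeze_zero:
  fixes f g :: "nat \<Rightarrow> real"
  assumes "\<And>k. 0 \<le> f k" "\<And>k. f k \<le> g k" "g \<longlonglongrightarrow> 0"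
  shows "f \<longlonglongrightarrow> 0"
  by (rule tendsto_sandwich[OF _ _ tendsto_const assms(3)]) (simp_all add: assms)

text \<open>Fubini is applied to \<open>lborel\<close>, which is a product measure, whereas
  \<open>lebesgue\<close> is its completion; this is why Borel representatives are chosen
  below.\<close>

lemma lborel_iterated:
  fixes F :: "point \<Rightarrow> real"
  assumes F: "integrable lborel F"
  shows "AE t in lborel. integrable lborel (\<lambda>s. F (pt z s t))"
    and "integrable lborel (\<lambda>t. \<integral>s. F (pt z s t) \<partial>lborel)"
    and "(\<integral>t. (\<integral>s. F (pt z s t) \<partial>lborel) \<partial>lborel) = integral\<^sup>L lborel F"
proof -
  have F1: "integrable (lborel \<Otimes>\<^sub>M lborel) F" using F by (simp add: lborel_prod)
  have F2: "integrable (lborel \<Otimes>\<^sub>M lborel) (\<lambda>(x, y). F (y, x))"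
    using F1 by (simp add: lborel_pair.integrable_product_swap_iff)
  have F3: "integral\<^sup>L (lborel \<Otimes>\<^sub>M lborel) (\<lambda>(x, y). F (y, x)) = integral\<^sup>L lborel F"
    using lborel_pair.integral_product_swap[of F] F1 by (simp add: lborel_prod)
  show "AE t in lborel. integrable lborel (\<lambda>s. F (pt z s t))"
    using lborel_pair.AE_integrable_fst'[OF F1] lborel_pair.AE_integrable_fst'[OF F2]
    by (cases z) (simp_all add: pt_def)
  show "integrable lborel (\<lambda>t. \<integral>s. F (pt z s t) \<partial>lborel)"
    using lborel_pair.integrable_fst'[OF F1] lborel_pair.integrable_fst'[OF F2]
    by (cases z) (simp_all add: pt_def)
  show "(\<integral>t. (\<integral>s. F (pt z s t) \<partial>lborel) \<partial>lborel) = integral\<^sup>L lborel F"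
    using lborel_pair.integral_fst'[OF F1] lborel_pair.integral_fst'[OF F2] F3
    by (cases z) (simp_all add: pt_def lborel_prod)
qed

lemma integral_lebesgue_on_lborel:
  fixes f :: "'a::euclidean_space \<Rightarrow> real"
  assumes "S \<in> sets borel" "f \<in> borel_measurable borel"
  shows "integral\<^sup>L (lebesgue_on S) f = (\<integral>x. indicator S x * f x \<partial>lborel)"
    and "integrable (lebesgue_on S) f \<longleftrightarrow> integrable lborel (\<lambda>x. indicator S x * f x)"
proof -
  have m: "(\<lambda>x. indicator S x * f x) \<in> borel_measurable lborel" using assms by simp
  have S: "S \<inter> space lebesgue \<in> sets lebesgue" using assms(1) by simp
  show "integral\<^sup>L (lebesgue_on S) f = (\<integral>x. indicator S x * f x \<partial>lborel)"
    using integral_restrict_space[OF S, of f] integral_completion[OF m] by simp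
  show "integrable (lebesgue_on S) f \<longleftrightarrow> integrable lborel (\<lambda>x. indicator S x * f x)"
    using integrable_restrict_space[OF S, of f] integrable_completion[OF m] by simp
qed

lemma sq_int_lebesgue_on_borel:
  fixes f :: "'a::euclidean_space \<Rightarrow> real"
  assumes "S \<in> sets borel" "sq_int lborel f"
  shows "sq_int (lebesgue_on S) f"
proof -
  have f: "f \<in> borel_measurable borel" using assms(2) by (auto dest: sq_int_measurable)
  have "integrable lborel (\<lambda>x. indicator S x * (f x)\<^sup>2)"
    using integrable_real_mult_indicator[of S lborel "\<lambda>x. (f x)\<^sup>2"] assms sq_int_square[OF assms(2)]
    by (simp add: mult.commute)
  then have "integrable (lebesgue_on S) (\<lambda>x. (f x)\<^sup>2)"
    using integral_lebesgue_on_lborel(2)[OF assms(1), of "\<lambda>x. (f x)\<^sup>2"] f by simp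
  moreover have "f \<in> borel_measurable (lebesgue_on S)"
    using f by (intro measurable_restrict_space1 measurable_completion) simp
  ultimately show ?thesis by (simp add: sq_int_def)
qed

lemma borel_crect [simp]: "crect z a b c d \<in> sets borel"
  by (intro borel_compact compact_crect)

lemma sq_int_lborel_indicator:
  fixes H :: "point \<Rightarrow> real"
  assumes "continuous_on UNIV H"
  shows "sq_int lborel (\<lambda>p. indicator (crect z a b c d) p * H p)"
proof -
  have "integrable lborel (\<lambda>p. indicator (crect z a b c d) p *\<^sub>R (H p)\<^sup>2)"
    using assms by (intro borel_integrable_compact compact_crect) (auto intro!: continuous_intros continuous_on_subset[of UNIV H])
  moreover have "(indicator (crect z a b c d) p * H p)\<^sup>2 = indicator (crect z a b c d) p *\<^sub>R (H p)\<^sup>2" for p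
    by (simp add: indicator_def)
  moreover have "(\<lambda>p. indicator (crect z a b c d) p * H p) \<in> borel_measurable lborel"
    using borel_measurable_continuous_onI[OF assms] by (intro borel_measurable_times borel_measurable_indicator) auto
  ultimately show ?thesis by (simp add: sq_int_def)
qed

text \<open>Integration along lines of length b - a is bounded in mean square: on almost every line,
  Cauchy-Schwarz against the indicator of the interval. The bounded support turns square
  integrability into integrability, which Fubini requires.\<close>

lemma slice_integral:
  fixes D :: "point \<Rightarrow> real"
  assumes D: "sq_int lborel D" and supp: "\<forall>p. p \<notin> crect z a b c d \<longrightarrow> D p = 0" and ab: "a \<le> b"
  defines "m \<equiv> \<lambda>t. \<integral>s. D (pt z s t) \<partial>lborel"
  shows "integrable lborel D" "sq_int lborel m" "(\<integral>t. (m t)\<^sup>2 \<partial>lborel) \<le> (b - a) * (\<integral>p. (D p)\<^sup>2 \<partial>lborel)"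
proof -
  have "sq_int lborel (\<lambda>p. indicator (crect z a b c d) p * (1::real))"
    by (intro sq_int_lborel_indicator) simp
  then have "integrable lborel (\<lambda>p. D p * (indicator (crect z a b c d) p * 1))" by (rule sq_int_mult[OF D])
  moreover have "(\<lambda>p. D p * (indicator (crect z a b c d) p * 1)) = D"
    using supp by (intro ext) (auto simp: indicator_def)
  ultimately show iD: "integrable lborel D" by (simp only:)
  note i2 = sq_int_square[OF D]
  have ind: "sq_int lborel (indicator {a..b} :: real \<Rightarrow> real)" "(\<integral>s. (indicator {a..b} s)\<^sup>2 \<partial>lborel) = b - a"
  proof -
    have *: "(indicator {a..b} s)\<^sup>2 = (indicator {a..b} s :: real)" for s :: real by (simp add: indicator_def)
    show "sq_int lborel (indicator {a..b} :: real \<Rightarrow> real)" "(\<integral>s. (indicator {a..b} s)\<^sup>2 \<partial>lborel) = b - a"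
      using ab by (simp_all add: sq_int_def *)
  qed
  have AE: "AE t in lborel. (m t)\<^sup>2 \<le> (b - a) * (\<integral>s. (D (pt z s t))\<^sup>2 \<partial>lborel)"
    using lborel_iterated(1)[OF iD, of z] lborel_iterated(1)[OF i2, of z]
  proof eventually_elim
    case (elim t)
    have "sq_int lborel (\<lambda>s. D (pt z s t))" using elim by (auto simp: sq_int_def)
    then have "(\<integral>s. D (pt z s t) * indicator {a..b} s \<partial>lborel)\<^sup>2 \<le> (\<integral>s. (D (pt z s t))\<^sup>2 \<partial>lborel) * (b - a)"
      using sq_int_Cauchy_Schwarz[OF _ ind(1), of "\<lambda>s. D (pt z s t)"] unfolding ind(2) by blast
    moreover have "D (pt z s t) * indicator {a..b} s = D (pt z s t)" for s
      using supp[rule_format, of "pt z s t"] by (auto simp: indicator_def crect_def)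
    ultimately show ?case by (simp add: m_def mult.commute)
  qed
  have mm: "m \<in> borel_measurable lborel"
    using borel_measurable_integrable[OF lborel_iterated(2)[OF iD, of z]] by (simp add: m_def)
  have ib: "integrable lborel (\<lambda>t. (b - a) * (\<integral>s. (D (pt z s t))\<^sup>2 \<partial>lborel))"
    using lborel_iterated(2)[OF i2, of z] by simp
  have im: "integrable lborel (\<lambda>t. (m t)\<^sup>2)"
  proof (rule Bochner_Integration.integrable_bound[OF ib])
    show "AE t in lborel. norm ((m t)\<^sup>2) \<le> norm ((b - a) * (\<integral>s. (D (pt z s t))\<^sup>2 \<partial>lborel))"
      using AE by eventually_elim (simp add: abs_of_nonneg)
  qed (use mm in simp)
  then show "sq_int lborel m" using mm by (simp add: sq_int_def)
  have "(\<integral>t. (m t)\<^sup>2 \<partial>lborel) \<le> (\<integral>t. (b - a) * (\<integral>s. (D (pt z s t))\<^sup>2 \<partial>lborel) \<partial>lborel)"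
    by (rule integral_mono_AE[OF im ib AE])
  also have "\<dots> = (b - a) * (\<integral>p. (D p)\<^sup>2 \<partial>lborel)"
    using lborel_iterated(3)[OF i2, of z] by simp
  finally show "(\<integral>t. (m t)\<^sup>2 \<partial>lborel) \<le> (b - a) * (\<integral>p. (D p)\<^sup>2 \<partial>lborel)" .
qed

text \<open>Mean square convergence on the rectangle passes to the line integrals as functions of
  the transverse coordinate. This is the estimate behind the existence of traces.\<close>

lemma slice_limit:
  assumes L: "L2_lim (lebesgue_on (orect z a b c d)) H G" and H: "\<And>k. continuous_on UNIV (H k)" and ab: "a \<le> b"
  shows "\<exists>g. L2_lim (lebesgue_on {c..d}) (\<lambda>k t. \<integral>s. H k (pt z s t) \<partial>lebesgue_on {a..b}) g"
proof -
  let ?R = "orect z a b c d" and ?C = "crect z a b c d"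
  have G: "sq_int (lebesgue_on ?R) G" using L by (simp add: L2_lim_def)
  then have mG: "(\<lambda>p. indicator ?R p * G p) \<in> borel_measurable lebesgue"
    using borel_measurable_restrict_space_iff[of ?R lebesgue G] by (simp add: sq_int_def)
  \<comment> \<open>A Borel function that agrees almost everywhere with the limit extended by zero;
    cut off to the closed rectangle it satisfies the hypotheses of
    \<open>slice_integral\<close>.\<close>
  obtain G' where G': "G' \<in> borel_measurable lborel" "AE p in lborel. indicator ?R p * G p = G' p"
    using completion_ex_borel_measurable_real[OF mG] by blast
  define K where "K p = indicator ?C p * G' p" for p
  have mK: "K \<in> borel_measurable lborel" unfolding K_def[abs_def]
    using G'(1) by (intro borel_measurable_times borel_measurable_indicator) auto
  have Keq: "AE p in lebesgue. indicator ?R p * G p = K p"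
  proof -
    have "AE p in lborel. indicator ?R p * G p = K p"
      using G'(2)
    proof eventually_elim
      case (elim p)
      then show ?case
        using subsetD[OF orect_subset_crect, of p z a b c d] by (cases "p \<in> ?C"; cases "p \<in> ?R") (auto simp: K_def)
    qed
    then show ?thesis by (rule AE_completion)
  qed
  have GK: "AE p in lebesgue_on ?R. G p = K p"
    using Keq by (simp add: AE_restrict_space_iff) (erule AE_mp, intro AE_I2, auto)
  have "integrable lebesgue (\<lambda>p. indicator ?R p * (G p)\<^sup>2)"
    using sq_int_square[OF G] by (simp add: integrable_restrict_space)
  moreover have "integrable lebesgue (\<lambda>p. indicator ?R p * (G p)\<^sup>2) \<longleftrightarrow> integrable lebesgue (\<lambda>p. (K p)\<^sup>2)"
  proof (rule integrable_cong_AE)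
    have "(indicator ?R p * G p)\<^sup>2 = indicator ?R p * (G p)\<^sup>2" for p by (simp add: indicator_def)
    then show "(\<lambda>p. indicator ?R p * (G p)\<^sup>2) \<in> borel_measurable lebesgue"
      using borel_measurable_power[OF mG, of 2] by simp
    show "(\<lambda>p. (K p)\<^sup>2) \<in> borel_measurable lebesgue"
      using mK by (intro measurable_completion) simp
    show "AE p in lebesgue. indicator ?R p * (G p)\<^sup>2 = (K p)\<^sup>2"
      using Keq by eventually_elim (auto simp: indicator_def split: if_splits)
  qed
  ultimately have sK: "sq_int lborel K"
    using mK integrable_completion[of "\<lambda>p. (K p)\<^sup>2" lborel] by (simp add: sq_int_def)
  have K0: "\<forall>p. p \<notin> ?C \<longrightarrow> K p = 0" by (simp add: K_def)
  define g where "g t = (\<integral>s. K (pt z s t) \<partial>lborel)" for t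
  note slK = slice_integral[OF sK K0 ab]
  have sg: "sq_int (lebesgue_on {c..d}) g"
    using slK(2) unfolding g_def[abs_def] by (intro sq_int_lebesgue_on_borel) auto
  have lineH: "(\<integral>s. indicator ?C (pt z s t) * H k (pt z s t) \<partial>lborel) = (\<integral>s. H k (pt z s t) \<partial>lebesgue_on {a..b})"
    if "t \<in> {c..d}" for k t
  proof -
    have "continuous_on UNIV (\<lambda>s. H k (pt z s t))"
      by (intro continuous_on_compose2[OF H] continuous_intros) auto
    then have "(\<integral>s. H k (pt z s t) \<partial>lebesgue_on {a..b}) = (\<integral>s. indicator {a..b} s * H k (pt z s t) \<partial>lborel)"
      by (intro integral_lebesgue_on_lborel borel_measurable_continuous_onI) auto
    moreover have "indicator {a..b} s = (indicator ?C (pt z s t) :: real)" for s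
      using that by (auto simp: indicator_def crect_def)
    ultimately show ?thesis by simp
  qed
  have cline: "continuous_on UNIV (\<lambda>t. \<integral>s. H k (pt z s t) \<partial>lebesgue_on {a..b})" for k
  proof -
    have c1: "continuous_on S (\<lambda>s. H k (pt z s t))" for S t
      by (intro continuous_on_compose2[OF H] continuous_intros) auto
    have "(\<integral>s. H k (pt z s t) \<partial>lebesgue_on {a..b}) = integral (cbox a b) (\<lambda>s. H k (pt z s t))" for t
      using lebesgue_integral_eq_integral[OF continuous_integrable_line[OF c1, of a b t]] by simp
    moreover have "continuous_on UNIV (\<lambda>t. integral (cbox a b) (\<lambda>s. H k (pt z s t)))"
      by (rule integral_continuous_on_param[where f = "\<lambda>t s. H k (pt z s t)"])
         (simp add: split_beta, intro continuous_on_compose2[OF H] continuous_intros, auto)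
    ultimately show ?thesis by simp
  qed
  have bound: "(\<integral>t. ((\<integral>s. H k (pt z s t) \<partial>lebesgue_on {a..b}) - g t)\<^sup>2 \<partial>lebesgue_on {c..d})
      \<le> (b - a) * (\<integral>p. (H k p - G p)\<^sup>2 \<partial>lebesgue_on ?R)" for k
  proof -
    define E where "E p = indicator ?C p * H k p" for p
    have sE: "sq_int lborel E" unfolding E_def[abs_def] by (rule sq_int_lborel_indicator[OF H])
    have E0: "\<forall>p. p \<notin> ?C \<longrightarrow> E p = 0" by (simp add: E_def)
    have sEK: "sq_int lborel (\<lambda>p. E p - K p)" by (rule sq_int_diff[OF sE sK])
    have EK0: "\<forall>p. p \<notin> ?C \<longrightarrow> E p - K p = 0" by (simp add: E0 K0)
    define m where "m t = (\<integral>s. E (pt z s t) - K (pt z s t) \<partial>lborel)" for t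
    note sl = slice_integral[OF sEK EK0 ab, folded m_def]
    let ?h = "\<lambda>t. \<integral>s. H k (pt z s t) \<partial>lebesgue_on {a..b}"
    have "AE t in lborel. t \<in> {c..d} \<longrightarrow> m t = ?h t - g t"
      using lborel_iterated(1)[OF slice_integral(1)[OF sE E0 ab], of z] lborel_iterated(1)[OF slK(1), of z]
      by eventually_elim (auto simp: m_def g_def E_def lineH)
    then have "AE t in lebesgue. t \<in> {c..d} \<longrightarrow> m t = ?h t - g t" by (rule AE_completion)
    then have "AE t in lebesgue. t \<in> {c..d} \<longrightarrow> (?h t - g t)\<^sup>2 = (m t)\<^sup>2" by eventually_elim simp
    then have ae: "AE t in lebesgue_on {c..d}. (?h t - g t)\<^sup>2 = (m t)\<^sup>2"
      by (subst AE_restrict_space_iff) simp_all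
    have mh: "?h \<in> borel_measurable (lebesgue_on {c..d})"
      by (rule sq_int_measurable[OF continuous_sq_int_line[OF cline]])
    have sm: "sq_int (lebesgue_on {c..d}) m" by (intro sq_int_lebesgue_on_borel sl(2)) auto
    have "(\<integral>t. (?h t - g t)\<^sup>2 \<partial>lebesgue_on {c..d}) = (\<integral>t. (m t)\<^sup>2 \<partial>lebesgue_on {c..d})"
      using ae mh sq_int_measurable[OF sg] sq_int_measurable[OF sm] by (intro integral_cong_AE) auto
    also have "\<dots> \<le> (\<integral>t. (m t)\<^sup>2 \<partial>lebesgue_on UNIV)"
      using sq_int_lebesgue_on_borel[OF _ sl(2), of UNIV]
      by (intro integral_lebesgue_on_subset_mono sq_int_square) auto
    also have "\<dots> = (\<integral>t. (m t)\<^sup>2 \<partial>lborel)"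
      using sq_int_measurable[OF sl(2)] by (subst integral_lebesgue_on_lborel) auto
    also have "\<dots> \<le> (b - a) * (\<integral>p. (E p - K p)\<^sup>2 \<partial>lborel)" by (rule sl(3))
    also have "(\<integral>p. (E p - K p)\<^sup>2 \<partial>lborel) = (\<integral>p. (H k p - K p)\<^sup>2 \<partial>lebesgue_on ?C)"
    proof -
      have "(E p - K p)\<^sup>2 = indicator ?C p * (H k p - K p)\<^sup>2" for p
        by (simp add: E_def K_def indicator_def)
      then show ?thesis
        using integral_lebesgue_on_lborel(1)[OF borel_crect, of "\<lambda>p. (H k p - K p)\<^sup>2"] mK
          borel_measurable_continuous_onI[OF H[of k]] by simp
    qed
    also have "\<dots> = (\<integral>p. (H k p - K p)\<^sup>2 \<partial>lebesgue_on ?R)"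
    proof (rule integral_lebesgue_on_negligible_diff[symmetric, OF orect_subset_crect negligible_crect_diff])
      have "(\<lambda>p. (H k p - K p)\<^sup>2) \<in> borel_measurable borel"
        using mK borel_measurable_continuous_onI[OF H[of k]] by simp
      then show "(\<lambda>p. (H k p - K p)\<^sup>2) \<in> borel_measurable (lebesgue_on ?C)"
        by (intro measurable_restrict_space1 measurable_completion) simp
    qed auto
    also have "\<dots> = (\<integral>p. (H k p - G p)\<^sup>2 \<partial>lebesgue_on ?R)"
    proof (rule integral_cong_AE)
      have sKR: "sq_int (lebesgue_on ?R) K" by (rule sq_int_lebesgue_on_borel[OF borel_open[OF open_orect] sK])
      have "sq_int (lebesgue_on ?R) (\<lambda>p. H k p - K p)" "sq_int (lebesgue_on ?R) (\<lambda>p. H k p - G p)"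
        by (rule sq_int_diff[OF continuous_sq_int_orect[OF H] sKR] sq_int_diff[OF continuous_sq_int_orect[OF H] G])+
      then show "(\<lambda>p. (H k p - K p)\<^sup>2) \<in> borel_measurable (lebesgue_on ?R)"
        "(\<lambda>p. (H k p - G p)\<^sup>2) \<in> borel_measurable (lebesgue_on ?R)"
        by (auto dest!: sq_int_measurable)
      show "AE p in lebesgue_on ?R. (H k p - K p)\<^sup>2 = (H k p - G p)\<^sup>2" using GK by eventually_elim simp
    qed
    finally show ?thesis using ab by (simp add: mult_left_mono)
  qed
  have "(\<lambda>k. (b - a) * (\<integral>p. (H k p - G p)\<^sup>2 \<partial>lebesgue_on ?R)) \<longlonglongrightarrow> (b - a) * 0"
    using L by (intro tendsto_mult tendsto_const) (simp add: L2_lim_def)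
  then have lim0: "(\<lambda>k. (b - a) * (\<integral>p. (H k p - G p)\<^sup>2 \<partial>lebesgue_on ?R)) \<longlonglongrightarrow> 0" by simp
  have "(\<lambda>k. \<integral>t. ((\<integral>s. H k (pt z s t) \<partial>lebesgue_on {a..b}) - g t)\<^sup>2 \<partial>lebesgue_on {c..d}) \<longlonglongrightarrow> 0"
    by (rule squeeze_zero[OF _ bound lim0]) simp
  then show ?thesis
    using sg continuous_sq_int_line[OF cline] unfolding L2_lim_def by blast
qed

section \<open>Weak derivatives on rectangles and the norm of H^1\<close>

lemma integral_lebesgue_on_supported:
  fixes f :: "'a::euclidean_space \<Rightarrow> real"
  assumes "R \<subseteq> S" "R \<in> sets lebesgue" "S \<in> sets lebesgue" "\<And>p. p \<notin> R \<Longrightarrow> f p = 0"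
  shows "integral\<^sup>L (lebesgue_on R) f = integral\<^sup>L (lebesgue_on S) f"
proof -
  have "(\<lambda>x. indicator R x *\<^sub>R f x) = (\<lambda>x. indicator S x *\<^sub>R f x)"
    using assms(1,4) by (intro ext) (auto simp: indicator_def)
  then show ?thesis using assms(2,3) by (simp add: integral_restrict_space)
qed

text \<open>Test functions live on the whole plane, so one for R is also one for S, and the
  integrals over S only see R.\<close>

lemma wd_subset:
  assumes w: "wd z S v w" and "R \<subseteq> S" "R \<in> sets lebesgue" "S \<in> sets lebesgue"
  shows "wd z R v w"
proof -
  have *: "(\<integral>p. v p * pd z \<phi> p \<partial>lebesgue_on R) = - (\<integral>p. w p * \<phi> p \<partial>lebesgue_on R)"
    if \<phi>: "\<phi> \<in> test_functions R" for \<phi>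
  proof -
    have "\<phi> \<in> test_functions S" using \<phi> test_functions_mono[OF assms(2)] by blast
    then have "(\<integral>p. v p * pd z \<phi> p \<partial>lebesgue_on S) = - (\<integral>p. w p * \<phi> p \<partial>lebesgue_on S)"
      using w assms(4) by (simp add: wd_iff)
    moreover have "(\<integral>p. v p * pd z \<phi> p \<partial>lebesgue_on R) = (\<integral>p. v p * pd z \<phi> p \<partial>lebesgue_on S)"
      "(\<integral>p. w p * \<phi> p \<partial>lebesgue_on R) = (\<integral>p. w p * \<phi> p \<partial>lebesgue_on S)"
      using test_function_outside[OF \<phi>] test_function_outside[OF test_function_pd[OF \<phi>]]
      by (intro integral_lebesgue_on_supported assms; simp)+
    ultimately show ?thesis by simp
  qed
  then show ?thesis using w assms by (auto simp: wd_iff intro: sq_int_subset)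
qed

lemma H1_lim_subset:
  assumes "H1_lim S \<phi> v vd" "R \<subseteq> S" "R \<in> sets lebesgue" "S \<in> sets lebesgue"
  shows "H1_lim R \<phi> v vd"
  using assms unfolding H1_lim_def by (auto intro: wd_subset L2_lim_subset)

lemma test_function_sq_int: "\<phi> \<in> test_functions R \<Longrightarrow> sq_int (lebesgue_on (orect z a b c d)) \<phi>"
  by (intro continuous_sq_int_orect smooth_continuous test_function_smooth)

lemma wd_lincomb:
  assumes "wd z (orect x a b c d) v w" "wd z (orect x a b c d) v' w'"
  shows "wd z (orect x a b c d) (\<lambda>p. \<alpha> * v p + \<beta> * v' p) (\<lambda>p. \<alpha> * w p + \<beta> * w' p)"
proof -
  let ?M = "lebesgue_on (orect x a b c d)"
  have s: "sq_int ?M v" "sq_int ?M w" "sq_int ?M v'" "sq_int ?M w'" using assms by (auto simp: wd_iff)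
  have "(\<integral>p. (\<alpha> * v p + \<beta> * v' p) * pd z \<phi> p \<partial>?M) = - (\<integral>p. (\<alpha> * w p + \<beta> * w' p) * \<phi> p \<partial>?M)"
    if \<phi>: "\<phi> \<in> test_functions (orect x a b c d)" for \<phi>
  proof -
    note i = s[THEN sq_int_mult, OF test_function_sq_int[OF \<phi>]]
      s[THEN sq_int_mult, OF test_function_sq_int[OF test_function_pd[OF \<phi>, of z]]]
    have "(\<integral>p. (\<alpha> * v p + \<beta> * v' p) * pd z \<phi> p \<partial>?M) = \<alpha> * (\<integral>p. v p * pd z \<phi> p \<partial>?M) + \<beta> * (\<integral>p. v' p * pd z \<phi> p \<partial>?M)"
      using i by (simp add: distrib_right mult.assoc)
    moreover have "(\<integral>p. (\<alpha> * w p + \<beta> * w' p) * \<phi> p \<partial>?M) = \<alpha> * (\<integral>p. w p * \<phi> p \<partial>?M) + \<beta> * (\<integral>p. w' p * \<phi> p \<partial>?M)"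
      using i by (simp add: distrib_right mult.assoc)
    ultimately show ?thesis using assms \<phi> by (simp add: wd_iff)
  qed
  then show ?thesis using s by (simp add: wd_iff sq_int_add sq_int_cmult)
qed

lemma wd_smooth:
  assumes "smooth \<phi>" "a \<le> b" "c \<le> d"
  shows "wd z (orect x a b c d) \<phi> (pd z \<phi>)"
proof -
  have same: "wd z (orect z a b c d) \<phi> (pd z \<phi>)" if "a \<le> b" for a b c d
    using smooth_test_by_parts[OF assms(1) _ that] assms(1)
    by (auto simp: wd_iff intro!: continuous_sq_int_orect smooth_continuous pd_continuous)
  show ?thesis
  proof (cases "x = z")
    case True
    then show ?thesis using same[OF assms(2)] by simp
  next
    case False
    then have "x = (\<not> z)" by simp
    then show ?thesis using same[OF assms(3)] by (simp only: orect_not)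
  qed
qed

lemma H1_lim_lincomb:
  assumes "H1_lim (orect x a b c d) \<phi> v vd" "H1_lim (orect x a b c d) \<psi> w wd'"
  shows "H1_lim (orect x a b c d) (\<lambda>k p. \<alpha> * \<phi> k p + \<beta> * \<psi> k p) (\<lambda>p. \<alpha> * v p + \<beta> * w p) (\<lambda>z p. \<alpha> * vd z p + \<beta> * wd' z p)"
  using assms unfolding H1_lim_def
  by (auto simp: pd_lincomb intro!: smooth_lincomb wd_lincomb L2_lim_add L2_lim_cmult)

text \<open>The difference of two candidates is orthogonal to all test functions.\<close>

lemma weak_deriv_unique:
  assumes "has_weak_deriv (orect x a b c d) i j v w" "has_weak_deriv (orect x a b c d) i j v w'"
  shows "AE p in lebesgue_on (orect x a b c d). w p = w' p"
proof -
  let ?M = "lebesgue_on (orect x a b c d)"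
  have s: "sq_int ?M w" "sq_int ?M w'" using assms by (auto simp: has_weak_deriv_def L2_eq_sq_int)
  have "AE p in ?M. w p - w' p = 0"
  proof (rule test_functions_separate)
    show "sq_int ?M (\<lambda>p. w p - w' p)" using s by (rule sq_int_diff)
    fix \<phi> assume \<phi>: "\<phi> \<in> test_functions (orect x a b c d)"
    then have "(- 1) ^ (i + j) * (\<integral>p. w p * \<phi> p \<partial>?M) = (- 1) ^ (i + j) * (\<integral>p. w' p * \<phi> p \<partial>?M)"
      using assms by (simp add: has_weak_deriv_def set_integral_eq_lebesgue_on)
    then have "(\<integral>p. w p * \<phi> p \<partial>?M) = (\<integral>p. w' p * \<phi> p \<partial>?M)" by simp
    then show "(\<integral>p. (w p - w' p) * \<phi> p \<partial>?M) = 0"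
      using s[THEN sq_int_mult, OF test_function_sq_int[OF \<phi>]] by (simp add: left_diff_distrib)
  qed
  then show ?thesis by simp
qed

lemma weak_deriv_works: "has_weak_deriv R i j v w \<Longrightarrow> has_weak_deriv R i j v (weak_deriv R i j v)"
  unfolding weak_deriv_def by (erule someI[where P = "has_weak_deriv R i j v"])

lemma weak_deriv_AE:
  "has_weak_deriv (orect x a b c d) i j v w \<Longrightarrow>
    AE p in lebesgue_on (orect x a b c d). weak_deriv (orect x a b c d) i j v p = w p"
  by (rule weak_deriv_unique[OF weak_deriv_works])

lemma has_weak_deriv_0: "R \<in> sets lebesgue \<Longrightarrow> sq_int (lebesgue_on R) v \<Longrightarrow> has_weak_deriv R 0 0 v v"
  by (simp add: has_weak_deriv_def L2_eq_sq_int)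

lemma index_le_1: "{(i, j). i + j \<le> (1::nat)} = {(0, 0), (1, 0), (0, 1)}"
  by (auto simp: le_Suc_eq)

text \<open>The norm is defined with chosen weak derivatives; by uniqueness almost everywhere any
  family \<open>vd\<close> may replace them.\<close>

lemma Hnorm_1:
  assumes wd: "\<And>z. wd z (orect x a b c d) v (vd z)"
  shows "Hnorm 1 (orect x a b c d) v
    = sqrt ((\<integral>p. (v p)\<^sup>2 \<partial>lebesgue_on (orect x a b c d)) + (\<Sum>z\<in>UNIV. \<integral>p. (vd z p)\<^sup>2 \<partial>lebesgue_on (orect x a b c d)))"
proof -
  let ?R = "orect x a b c d"
  have eq: "(\<integral>p. (weak_deriv ?R i j v p)\<^sup>2 \<partial>lebesgue_on ?R) = (\<integral>p. (w p)\<^sup>2 \<partial>lebesgue_on ?R)"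
    if "has_weak_deriv ?R i j v w" for i j w
  proof (rule integral_cong_AE)
    have "sq_int (lebesgue_on ?R) (weak_deriv ?R i j v)" "sq_int (lebesgue_on ?R) w"
      using that weak_deriv_works[OF that] by (simp_all add: has_weak_deriv_def L2_eq_sq_int)
    then show "(\<lambda>p. (weak_deriv ?R i j v p)\<^sup>2) \<in> borel_measurable (lebesgue_on ?R)"
      "(\<lambda>p. (w p)\<^sup>2) \<in> borel_measurable (lebesgue_on ?R)"
      by (auto dest!: sq_int_measurable)
    show "AE p in lebesgue_on ?R. (weak_deriv ?R i j v p)\<^sup>2 = (w p)\<^sup>2"
      using weak_deriv_AE[OF that] by eventually_elim simp
  qed
  have v: "sq_int (lebesgue_on ?R) v" using wd[of True] by (simp add: wd_iff)
  have "has_weak_deriv ?R 0 0 v v" using v by (simp add: has_weak_deriv_0)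
  moreover have "has_weak_deriv ?R 1 0 v (vd True)" "has_weak_deriv ?R 0 1 v (vd False)"
    using wd[of True] wd[of False] by (simp_all add: wd_def)
  ultimately show ?thesis
    unfolding Hnorm_def index_le_1 by (simp add: set_integral_eq_lebesgue_on eq UNIV_bool add_ac)
qed

section \<open>Traces on edges\<close>

definition edg :: "bool \<Rightarrow> real \<Rightarrow> real \<Rightarrow> real \<Rightarrow> edge" where
  "edg z c s t = (if z then Vert c s t else Horz c s t)"

lemma edg_simps [simp]:
  "edge_interval (edg z c s t) = {s..t}" "edge_point (edg z c s t) r = pt z c r" "edge_length (edg z c s t) = t - s"
  by (simp_all add: edg_def pt_def)

lemma edge_integral_edg: "edge_integral (edg z c s t) \<phi> = (\<integral>r. \<phi> (pt z c r) \<partial>lebesgue_on {s..t})"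
  unfolding edge_integral_def edg_simps by (rule set_integral_eq_lebesgue_on) simp

lemma smooth_line_continuous: "smooth \<phi> \<Longrightarrow> continuous_on S (\<lambda>t. \<phi> (pt z c t))"
  by (intro continuous_on_compose2[OF smooth_continuous[of \<phi> UNIV]] continuous_intros) auto

lemma in_Hspace_1:
  assumes "\<And>z. wd z (orect x a b c d) v (vd z)"
  shows "v \<in> Hspace 1 (orect x a b c d)"
  unfolding Hspace_def mem_Collect_eq
proof (intro allI impI)
  fix i j :: nat assume "i + j \<le> 1"
  then have "(i, j) \<in> {(0, 0), (1, 0), (0, 1)}" using index_le_1 by blast
  moreover have "has_weak_deriv (orect x a b c d) 0 0 v v" 
    using assms[of True] by (simp add: has_weak_deriv_0 wd_iff)
  moreover have "has_weak_deriv (orect x a b c d) 1 0 v (vd True)" "has_weak_deriv (orect x a b c d) 0 1 v (vd False)"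
    using assms[of True] assms[of False] by (simp_all add: wd_def)
  ultimately show "\<exists>w. has_weak_deriv (orect x a b c d) i j v w" by auto
qed

lemma Hnorm_1_diff:
  assumes "\<And>z. wd z (orect x a b c d) v (vd z)" "smooth \<phi>" "a \<le> b" "c \<le> d"
  shows "(Hnorm 1 (orect x a b c d) (\<lambda>p. \<phi> p - v p))\<^sup>2
    = (\<integral>p. (\<phi> p - v p)\<^sup>2 \<partial>lebesgue_on (orect x a b c d)) + (\<Sum>z\<in>UNIV. \<integral>p. (pd z \<phi> p - vd z p)\<^sup>2 \<partial>lebesgue_on (orect x a b c d))"
proof -
  have "wd z (orect x a b c d) (\<lambda>p. \<phi> p - v p) (\<lambda>p. pd z \<phi> p - vd z p)" for z
    using wd_lincomb[OF wd_smooth[OF assms(2-4)] assms(1), where \<alpha> = 1 and \<beta> = "- 1"] by simp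
  then show ?thesis
    by (subst Hnorm_1[where vd = "\<lambda>z p. pd z \<phi> p - vd z p"]) (auto intro!: real_sqrt_pow2 add_nonneg_nonneg sum_nonneg)
qed

lemma has_traceI:
  assumes H: "H1_lim (orect x a b c d) \<phi> v vd" and ab: "a \<le> b" "c \<le> d"
    and g: "L2_lim (lebesgue_on {s..t}) (\<lambda>k r. \<phi> k (pt z e r)) (\<lambda>r. g (pt z e r))"
  shows "has_trace (orect x a b c d) v (edg z e s t) g"
  unfolding has_trace_def
proof (intro conjI exI[of _ \<phi>])
  let ?R = "orect x a b c d"
  have h: "\<And>k. smooth (\<phi> k)" "\<And>z. wd z ?R v (vd z)" "L2_lim (lebesgue_on ?R) \<phi> v"
    "\<And>z. L2_lim (lebesgue_on ?R) (\<lambda>k. pd z (\<phi> k)) (vd z)" using H by (auto simp: H1_lim_def)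
  show "v \<in> Hspace 1 ?R" by (rule in_Hspace_1[OF h(2)])
  show "L2 (edge_interval (edg z e s t)) (\<lambda>r. g (edge_point (edg z e s t) r))"
    using g by (simp add: L2_eq_sq_int L2_lim_def)
  show "\<forall>k. smooth (\<phi> k)" using h by simp
  have "(\<lambda>k. (\<integral>p. (\<phi> k p - v p)\<^sup>2 \<partial>lebesgue_on ?R) + (\<Sum>z\<in>UNIV. \<integral>p. (pd z (\<phi> k) p - vd z p)\<^sup>2 \<partial>lebesgue_on ?R))
      \<longlonglongrightarrow> 0 + (\<Sum>z\<in>(UNIV::bool set). 0)"
    using h(3,4) by (intro tendsto_add tendsto_sum) (simp_all add: L2_lim_def)
  then have "(\<lambda>k. (Hnorm 1 ?R (\<lambda>p. \<phi> k p - v p))\<^sup>2) \<longlonglongrightarrow> 0"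
    unfolding Hnorm_1_diff[OF h(2) h(1) ab] by simp
  then have "(\<lambda>k. sqrt ((Hnorm 1 ?R (\<lambda>p. \<phi> k p - v p))\<^sup>2)) \<longlonglongrightarrow> sqrt 0" by (rule tendsto_real_sqrt)
  then show "(\<lambda>k. Hnorm 1 ?R (\<lambda>p. \<phi> k p - v p)) \<longlonglongrightarrow> 0"
    unfolding real_sqrt_abs real_sqrt_zero by (rule tendsto_rabs_zero_cancel)
  show "(\<lambda>k. edge_integral (edg z e s t) (\<lambda>p. (\<phi> k p - g p)\<^sup>2)) \<longlonglongrightarrow> 0"
    using g by (simp add: edge_integral_edg L2_lim_def)
qed

text \<open>The norm dominates each of its parts, so the sequence hidden in \<open>has_trace\<close>
  converges together with both first derivatives, and to the prescribed representatives
  \<open>vd\<close>.\<close>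

lemma has_traceD:
  assumes tr: "has_trace (orect x a b c d) v (edg z e s t) g" and ab: "a \<le> b" "c \<le> d"
    and wdv: "\<And>z. wd z (orect x a b c d) v (vd z)"
  obtains \<phi> where "H1_lim (orect x a b c d) \<phi> v vd"
    "L2_lim (lebesgue_on {s..t}) (\<lambda>k r. \<phi> k (pt z e r)) (\<lambda>r. g (pt z e r))"
proof -
  let ?R = "orect x a b c d"
  obtain \<phi> where s: "\<And>k. smooth (\<phi> k)" and l: "(\<lambda>k. Hnorm 1 ?R (\<lambda>p. \<phi> k p - v p)) \<longlonglongrightarrow> 0"
    and e: "(\<lambda>k. edge_integral (edg z e s t) (\<lambda>p. (\<phi> k p - g p)\<^sup>2)) \<longlonglongrightarrow> 0"
    using tr unfolding has_trace_def by blast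
  have g: "sq_int (lebesgue_on {s..t}) (\<lambda>r. g (pt z e r))"
    using tr unfolding has_trace_def by (simp add: L2_eq_sq_int)
  have sv: "sq_int (lebesgue_on ?R) v" "\<And>z. sq_int (lebesgue_on ?R) (vd z)" using wdv by (auto simp: wd_iff)
  have sp: "sq_int (lebesgue_on ?R) (\<phi> k)" "sq_int (lebesgue_on ?R) (pd z (\<phi> k))" for k z
    using s by (auto intro!: continuous_sq_int_orect smooth_continuous pd_continuous)
  let ?N = "\<lambda>k. (Hnorm 1 ?R (\<lambda>p. \<phi> k p - v p))\<^sup>2"
  have N: "?N \<longlonglongrightarrow> 0" using tendsto_power[OF l, of 2] by simp
  have le: "(\<integral>p. (\<phi> k p - v p)\<^sup>2 \<partial>lebesgue_on ?R) \<le> ?N k" for k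
    unfolding Hnorm_1_diff[OF wdv s ab] by (simp add: sum_nonneg)
  have le': "(\<integral>p. (pd z (\<phi> k) p - vd z p)\<^sup>2 \<partial>lebesgue_on ?R) \<le> ?N k" for k z
    unfolding Hnorm_1_diff[OF wdv s ab]
    by (intro add_increasing member_le_sum[of z UNIV "\<lambda>z. \<integral>p. (pd z (\<phi> k) p - vd z p)\<^sup>2 \<partial>lebesgue_on ?R"]) auto
  have "L2_lim (lebesgue_on ?R) \<phi> v"
    unfolding L2_lim_def using sv sp by (auto intro: squeeze_zero[OF _ le N])
  moreover have "L2_lim (lebesgue_on ?R) (\<lambda>k. pd z (\<phi> k)) (vd z)" for z
    unfolding L2_lim_def using sv sp by (auto intro: squeeze_zero[OF _ le' N])
  ultimately have 1: "H1_lim ?R \<phi> v vd" using s wdv by (auto simp: H1_lim_def)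
  have "L2_lim (lebesgue_on {s..t}) (\<lambda>k r. \<phi> k (pt z e r)) (\<lambda>r. g (pt z e r))"
    using e g continuous_sq_int_line[OF smooth_line_continuous[OF s]]
    by (simp add: L2_lim_def edge_integral_edg)
  with 1 show thesis by (rule that)
qed

text \<open>The area integrals converge by weak convergence, so the edge terms of the approximants
  converge as well, before any trace of v has been constructed.\<close>

lemma Green_limit:
  assumes H: "H1_lim R \<phi> v vd" and R: "R \<in> sets lebesgue" "orect z a b c d \<subseteq> R" and ab: "a \<le> b"
    and P: "\<And>s. (P has_real_derivative P' s) (at s)" "continuous_on UNIV P'" and \<beta>: "continuous_on UNIV \<beta>"
  shows "(\<lambda>k. \<integral>t. (\<phi> k (pt z b t) * P b - \<phi> k (pt z a t) * P a) * \<beta> t \<partial>lebesgue_on {c..d})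
    \<longlonglongrightarrow> (\<integral>p. v p * (P' (co z p) * \<beta> (co (\<not> z) p)) + vd z p * (P (co z p) * \<beta> (co (\<not> z) p)) \<partial>lebesgue_on (orect z a b c d))"
proof -
  let ?M = "lebesgue_on (orect z a b c d)"
  have h: "\<And>k. smooth (\<phi> k)" "L2_lim ?M \<phi> v" "L2_lim ?M (\<lambda>k. pd z (\<phi> k)) (vd z)"
    using H1_lim_subset[OF H R(2) orect_sets R(1)] by (auto simp: H1_lim_def)
  have cP: "continuous_on UNIV P" using P(1) by (meson DERIV_isCont continuous_at_imp_continuous_on)
  have c1: "continuous_on UNIV (\<lambda>p. f (co z p))" if "continuous_on UNIV f" for f :: "real \<Rightarrow> real" and z
    by (intro continuous_on_compose2[OF that] continuous_intros) auto
  have s1: "sq_int ?M (\<lambda>p. P' (co z p) * \<beta> (co (\<not> z) p))" and s2: "sq_int ?M (\<lambda>p. P (co z p) * \<beta> (co (\<not> z) p))"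
    by (intro continuous_sq_int_orect continuous_intros c1 P(2) cP \<beta>)+
  have sm: "sq_int ?M v" "sq_int ?M (vd z)" "\<And>k. sq_int ?M (\<phi> k)" "\<And>k. sq_int ?M (pd z (\<phi> k))"
    using h(2,3) by (auto simp: L2_lim_def)
  have "(\<lambda>k. (\<integral>p. \<phi> k p * (P' (co z p) * \<beta> (co (\<not> z) p)) \<partial>?M) + (\<integral>p. pd z (\<phi> k) p * (P (co z p) * \<beta> (co (\<not> z) p)) \<partial>?M))
      \<longlonglongrightarrow> (\<integral>p. v p * (P' (co z p) * \<beta> (co (\<not> z) p)) \<partial>?M) + (\<integral>p. vd z p * (P (co z p) * \<beta> (co (\<not> z) p)) \<partial>?M)"
    by (intro tendsto_add L2_lim_inner[OF h(2) s1] L2_lim_inner[OF h(3) s2])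
  then show ?thesis
    using sq_int_mult[OF sm(1) s1] sq_int_mult[OF sm(2) s2] sq_int_mult[OF sm(3) s1] sq_int_mult[OF sm(4) s2]
    by (simp flip: Green_smooth[OF h(1) ab P \<beta>])
qed

text \<open>On each line the boundary value is the integral of the derivative of \<phi> times an
  affine weight that vanishes at the other end. By \<open>slice_limit\<close> these integrals have a
  limit in mean square.\<close>

lemma line_trace_exists:
  assumes H: "H1_lim usq \<phi> v vd" and e: "0 \<le> e" "e \<le> 1"
  shows "\<exists>g. L2_lim (lebesgue_on {0..1}) (\<lambda>k t. \<phi> k (pt z e t)) g"
proof -
  have h: "\<And>k. smooth (\<phi> k)" using H by (auto simp: H1_lim_def)
  have main: "\<exists>g. L2_lim (lebesgue_on {0..1}) (\<lambda>k t. \<phi> k (pt z b t) * (\<alpha> * b + \<gamma>) - \<phi> k (pt z a t) * (\<alpha> * a + \<gamma>)) g"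
    if ab: "0 \<le> a" "a \<le> b" "b \<le> 1" for a b \<alpha> \<gamma>
  proof -
    let ?R = "orect z a b 0 1"
    have "?R \<subseteq> orect z 0 1 0 1" using ab by (auto simp: orect_def)
    then have sub: "?R \<subseteq> usq" unfolding usq_eq[of z] .
    have L: "L2_lim (lebesgue_on ?R) \<phi> v" "L2_lim (lebesgue_on ?R) (\<lambda>k. pd z (\<phi> k)) (vd z)"
      using H1_lim_subset[OF H sub] by (auto simp: H1_lim_def)
    \<comment> \<open>The derivative along z of \<phi> k times the affine weight, so that its line
      integrals are weighted differences of boundary values.\<close>
    define H where "H k p = \<alpha> * \<phi> k p + (\<alpha> * co z p + \<gamma>) * pd z (\<phi> k) p" for k p
    have cH: "continuous_on UNIV (H k)" for k
      unfolding H_def[abs_def] by (intro continuous_intros smooth_continuous pd_continuous h)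
    have wL: "L2_lim (lebesgue_on ?R) (\<lambda>k p. (\<alpha> * co z p + \<gamma>) * pd z (\<phi> k) p) (\<lambda>p. (\<alpha> * co z p + \<gamma>) * vd z p)"
    proof -
      define B where "B = \<bar>\<alpha>\<bar> + \<bar>\<gamma>\<bar>"
      have B: "\<bar>\<alpha> * co z p + \<gamma>\<bar> \<le> B" if "p \<in> ?R" for p
      proof -
        have "\<bar>co z p\<bar> \<le> 1" using that ab by (auto simp: orect_def)
        then have "\<bar>\<alpha> * co z p\<bar> \<le> \<bar>\<alpha>\<bar>" by (simp add: abs_mult mult_left_le)
        then show ?thesis unfolding B_def by linarith
      qed
      have ml: "(\<lambda>p. \<alpha> * co z p + \<gamma>) \<in> borel_measurable (lebesgue_on ?R)"
        by (intro sq_int_measurable[OF continuous_sq_int_orect] continuous_intros)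
      have s: "sq_int (lebesgue_on ?R) (\<lambda>p. (\<alpha> * co z p + \<gamma>) * f p)" if "sq_int (lebesgue_on ?R) f" for f
        using sq_int_mult_bounded[OF that ml, of B] B by (simp add: mult.commute)
      have sd: "sq_int (lebesgue_on ?R) (\<lambda>p. pd z (\<phi> k) p - vd z p)" for k
        using L(2) by (auto simp: L2_lim_def intro: sq_int_diff)
      have bnd: "(\<integral>p. ((\<alpha> * co z p + \<gamma>) * pd z (\<phi> k) p - (\<alpha> * co z p + \<gamma>) * vd z p)\<^sup>2 \<partial>lebesgue_on ?R)
          \<le> (\<integral>p. B\<^sup>2 * (pd z (\<phi> k) p - vd z p)\<^sup>2 \<partial>lebesgue_on ?R)" for k
      proof (rule integral_mono)
        show "integrable (lebesgue_on ?R) (\<lambda>p. ((\<alpha> * co z p + \<gamma>) * pd z (\<phi> k) p - (\<alpha> * co z p + \<gamma>) * vd z p)\<^sup>2)"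
          using s[OF sd, THEN sq_int_square, of k] by (simp add: right_diff_distrib)
        show "integrable (lebesgue_on ?R) (\<lambda>p. B\<^sup>2 * (pd z (\<phi> k) p - vd z p)\<^sup>2)"
          using sd[THEN sq_int_square, of k] by simp
        fix p assume "p \<in> space (lebesgue_on ?R)"
        then have "(\<alpha> * co z p + \<gamma>)\<^sup>2 \<le> B\<^sup>2" using B[of p] by (simp add: abs_le_square_iff[symmetric])
        then show "((\<alpha> * co z p + \<gamma>) * pd z (\<phi> k) p - (\<alpha> * co z p + \<gamma>) * vd z p)\<^sup>2 \<le> B\<^sup>2 * (pd z (\<phi> k) p - vd z p)\<^sup>2"
          by (simp flip: right_diff_distrib add: power_mult_distrib mult_right_mono)
      qed
      have "(\<lambda>k. B\<^sup>2 * (\<integral>p. (pd z (\<phi> k) p - vd z p)\<^sup>2 \<partial>lebesgue_on ?R)) \<longlonglongrightarrow> B\<^sup>2 * 0"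
        using L(2) by (intro tendsto_mult tendsto_const) (simp add: L2_lim_def)
      then have lim0: "(\<lambda>k. \<integral>p. B\<^sup>2 * (pd z (\<phi> k) p - vd z p)\<^sup>2 \<partial>lebesgue_on ?R) \<longlonglongrightarrow> 0"
        by simp
      have "(\<lambda>k. \<integral>p. ((\<alpha> * co z p + \<gamma>) * pd z (\<phi> k) p - (\<alpha> * co z p + \<gamma>) * vd z p)\<^sup>2 \<partial>lebesgue_on ?R) \<longlonglongrightarrow> 0"
        by (rule squeeze_zero[OF _ bnd lim0]) simp
      moreover have "sq_int (lebesgue_on ?R) (vd z)" "\<And>k. sq_int (lebesgue_on ?R) (pd z (\<phi> k))"
        using L(2) by (simp_all add: L2_lim_def)
      ultimately show ?thesis unfolding L2_lim_def using s by blast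
    qed
    have "L2_lim (lebesgue_on ?R) H (\<lambda>p. \<alpha> * v p + (\<alpha> * co z p + \<gamma>) * vd z p)"
      unfolding H_def[abs_def] by (intro L2_lim_add L2_lim_cmult L wL)
    then obtain g where g: "L2_lim (lebesgue_on {0..1}) (\<lambda>k t. \<integral>s. H k (pt z s t) \<partial>lebesgue_on {a..b}) g"
      using slice_limit[where H = H, OF _ cH ab(2)] by blast
    have "(\<integral>s. H k (pt z s t) \<partial>lebesgue_on {a..b}) = \<phi> k (pt z b t) * (\<alpha> * b + \<gamma>) - \<phi> k (pt z a t) * (\<alpha> * a + \<gamma>)" for k t
    proof (rule integral_line_FTC[OF ab(2)])
      show "((\<lambda>s. \<phi> k (pt z s t) * (\<alpha> * s + \<gamma>)) has_real_derivative H k (pt z s t)) (at s)" for s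
        by (rule DERIV_cong[OF DERIV_mult[OF smooth_DERIV[OF h]]])
           (auto intro!: derivative_eq_intros simp: H_def algebra_simps)
      show "continuous_on UNIV (\<lambda>s. H k (pt z s t))"
        by (intro continuous_on_compose2[OF cH] continuous_intros) auto
    qed
    with g show ?thesis by auto
  qed
  show ?thesis
  proof (cases "e = 0")
    case True
    \<comment> \<open>The weight s - 1 vanishes at the far side and is -1 at 0; the lower boundary
      term enters with a minus sign.\<close>
    then show ?thesis using main[of 0 1 "1" "- 1"] by simp
  next
    case False
    \<comment> \<open>The weight s/e on the strip between 0 and e vanishes at 0 and is 1 on the line
      in question.\<close>
    have "\<exists>g. L2_lim (lebesgue_on {0..1}) (\<lambda>k t. \<phi> k (pt z e t) * (1 / e * e + 0) - \<phi> k (pt z 0 t) * (1 / e * 0 + 0)) g"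
      using e by (intro main) auto
    then show ?thesis using False by simp
  qed
qed

section \<open>Edge averages and the normal flux across an edge\<close>

lemma integral_orect_cong_AE:
  assumes "AE p in lebesgue_on (orect x a b c d). v p = v' p" "sq_int (lebesgue_on (orect x a b c d)) v"
    "sq_int (lebesgue_on (orect x a b c d)) v'" "sq_int (lebesgue_on (orect x a b c d)) \<phi>"
  shows "(\<integral>p. v p * \<phi> p \<partial>lebesgue_on (orect x a b c d)) = (\<integral>p. v' p * \<phi> p \<partial>lebesgue_on (orect x a b c d))"
proof (rule integral_cong_AE)
  show "AE p in lebesgue_on (orect x a b c d). v p * \<phi> p = v' p * \<phi> p" using assms(1) by eventually_elim simp
qed (use assms(2-4)[THEN sq_int_measurable] in auto)

lemma wd_cong_AE:
  assumes w: "wd z (orect x a b c d) v w" and m: "v' \<in> borel_measurable (lebesgue_on (orect x a b c d))"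
    and eq: "AE p in lebesgue_on (orect x a b c d). v p = v' p"
  shows "wd z (orect x a b c d) v' w"
proof -
  have s: "sq_int (lebesgue_on (orect x a b c d)) v" using w by (simp add: wd_iff)
  have s': "sq_int (lebesgue_on (orect x a b c d)) v'" by (rule sq_int_cong_AE[OF s m eq])
  show ?thesis
    using w s' integral_orect_cong_AE[OF eq s s' test_function_sq_int[OF test_function_pd]]
    by (auto simp: wd_iff)
qed

lemma H1_lim_cong_AE:
  assumes "H1_lim (orect x a b c d) \<phi> v vd" "v' \<in> borel_measurable (lebesgue_on (orect x a b c d))"
    "AE p in lebesgue_on (orect x a b c d). v p = v' p"
  shows "H1_lim (orect x a b c d) \<phi> v' vd"
  using assms unfolding H1_lim_def by (auto intro: wd_cong_AE L2_lim_cong_AE)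

lemma L2_lim_line_integral:
  assumes "L2_lim (lebesgue_on {c..d}) f g" "continuous_on UNIV \<beta>"
  shows "(\<lambda>k. \<integral>t. f k t * \<beta> t \<partial>lebesgue_on {c..d}) \<longlonglongrightarrow> (\<integral>t. g t * \<beta> t \<partial>lebesgue_on {c..d :: real})"
  by (rule L2_lim_inner[OF assms(1) continuous_sq_int_line[OF assms(2)]])

context
  fixes R \<phi> v vd and z :: bool and a b c d :: real and P P' \<beta> :: "real \<Rightarrow> real"
  assumes H: "H1_lim R \<phi> v vd" and R: "R \<in> sets lebesgue" "orect z a b c d \<subseteq> R" and ab: "a \<le> b"
    and P: "\<And>s. (P has_real_derivative P' s) (at s)" "continuous_on UNIV P'" and \<beta>: "continuous_on UNIV \<beta>"
begin

text \<open>With a weight vanishing at both ends the edge terms are zero already for the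
  approximants.\<close>

lemma Green_zero:
  assumes "P a = 0" "P b = 0"
  shows "(\<integral>p. v p * (P' (co z p) * \<beta> (co (\<not> z) p)) + vd z p * (P (co z p) * \<beta> (co (\<not> z) p)) \<partial>lebesgue_on (orect z a b c d)) = 0"
proof -
  let ?I = "\<integral>p. v p * (P' (co z p) * \<beta> (co (\<not> z) p)) + vd z p * (P (co z p) * \<beta> (co (\<not> z) p)) \<partial>lebesgue_on (orect z a b c d)"
  have "(\<lambda>k::nat. 0) \<longlonglongrightarrow> ?I" using Green_limit[OF H R ab P \<beta>] assms by simp
  then show ?thesis by (rule LIMSEQ_unique) (rule tendsto_const)
qed

text \<open>The zero of \<open>P\<close> at a leaves only the upper edge, where the limit of the
  approximants is known to be g.\<close>

lemma Green_upper:
  assumes "P a = 0" and g: "L2_lim (lebesgue_on {c..d}) (\<lambda>k t. \<phi> k (pt z b t)) g"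
  shows "(\<integral>p. v p * (P' (co z p) * \<beta> (co (\<not> z) p)) + vd z p * (P (co z p) * \<beta> (co (\<not> z) p)) \<partial>lebesgue_on (orect z a b c d))
    = P b * (\<integral>t. g t * \<beta> t \<partial>lebesgue_on {c..d})"
proof -
  have "(\<lambda>k. P b * (\<integral>t. \<phi> k (pt z b t) * \<beta> t \<partial>lebesgue_on {c..d})) \<longlonglongrightarrow> P b * (\<integral>t. g t * \<beta> t \<partial>lebesgue_on {c..d})"
    by (intro tendsto_mult tendsto_const L2_lim_line_integral[OF g \<beta>])
  moreover have "(\<integral>t. (\<phi> k (pt z b t) * P b - \<phi> k (pt z a t) * P a) * \<beta> t \<partial>lebesgue_on {c..d})
     = P b * (\<integral>t. \<phi> k (pt z b t) * \<beta> t \<partial>lebesgue_on {c..d})" for k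
    unfolding assms(1) by (subst Bochner_Integration.integral_mult_right_zero[symmetric]) (simp add: mult_ac)
  ultimately show ?thesis using LIMSEQ_unique[OF Green_limit[OF H R ab P \<beta>]] by simp
qed

lemma Green_lower:
  assumes "P b = 0" and g: "L2_lim (lebesgue_on {c..d}) (\<lambda>k t. \<phi> k (pt z a t)) g"
  shows "(\<integral>p. v p * (P' (co z p) * \<beta> (co (\<not> z) p)) + vd z p * (P (co z p) * \<beta> (co (\<not> z) p)) \<partial>lebesgue_on (orect z a b c d))
    = - P a * (\<integral>t. g t * \<beta> t \<partial>lebesgue_on {c..d})"
proof -
  have "(\<lambda>k. - P a * (\<integral>t. \<phi> k (pt z a t) * \<beta> t \<partial>lebesgue_on {c..d})) \<longlonglongrightarrow> - P a * (\<integral>t. g t * \<beta> t \<partial>lebesgue_on {c..d})"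
    by (intro tendsto_mult tendsto_const L2_lim_line_integral[OF g \<beta>])
  moreover have "(\<integral>t. (\<phi> k (pt z b t) * P b - \<phi> k (pt z a t) * P a) * \<beta> t \<partial>lebesgue_on {c..d})
     = - P a * (\<integral>t. \<phi> k (pt z a t) * \<beta> t \<partial>lebesgue_on {c..d})" for k
    unfolding assms(1) by (subst Bochner_Integration.integral_mult_right_zero[symmetric]) (simp add: mult_ac)
  ultimately show ?thesis using LIMSEQ_unique[OF Green_limit[OF H R ab P \<beta>]] by simp
qed

end

text \<open>The weight s - a, which vanishes on the opposite edge. The right-hand side does not
  mention the approximating sequence, so the edge integral of a trace does not depend on how the
  trace was obtained.\<close>

lemma line_integral_upper:
  assumes H: "H1_lim R \<phi> v vd" and R: "R \<in> sets lebesgue" "orect z a b c d \<subseteq> R" and ab: "a < b"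
    and g: "L2_lim (lebesgue_on {c..d}) (\<lambda>k t. \<phi> k (pt z b t)) g"
  shows "(\<integral>t. g t \<partial>lebesgue_on {c..d}) = (\<integral>p. v p + (co z p - a) * vd z p \<partial>lebesgue_on (orect z a b c d)) / (b - a)"
proof -
  have "(\<integral>p. v p * (1 * 1) + vd z p * ((co z p - a) * 1) \<partial>lebesgue_on (orect z a b c d)) = (b - a) * (\<integral>t. g t * 1 \<partial>lebesgue_on {c..d})"
    by (rule Green_upper[OF H R less_imp_le[OF ab] _ _ _ _ g, where P = "\<lambda>s. s - a" and P' = "\<lambda>_. 1" and \<beta> = "\<lambda>_. 1"])
       (auto intro!: derivative_eq_intros)
  then show ?thesis using ab by (simp add: mult.commute)
qed

lemma line_integral_lower:
  assumes H: "H1_lim R \<phi> v vd" and R: "R \<in> sets lebesgue" "orect z a b c d \<subseteq> R" and ab: "a < b"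
    and g: "L2_lim (lebesgue_on {c..d}) (\<lambda>k t. \<phi> k (pt z a t)) g"
  shows "(\<integral>t. g t \<partial>lebesgue_on {c..d}) = (\<integral>p. v p - (b - co z p) * vd z p \<partial>lebesgue_on (orect z a b c d)) / (b - a)"
proof -
  have "(\<integral>p. v p * (1 * 1) + vd z p * ((co z p - b) * 1) \<partial>lebesgue_on (orect z a b c d)) = - (a - b) * (\<integral>t. g t * 1 \<partial>lebesgue_on {c..d})"
    by (rule Green_lower[OF H R less_imp_le[OF ab] _ _ _ _ g, where P = "\<lambda>s. s - b" and P' = "\<lambda>_. 1" and \<beta> = "\<lambda>_. 1"])
       (auto intro!: derivative_eq_intros)
  moreover have "v p * (1 * 1) + vd z p * ((co z p - b) * 1) = v p - (b - co z p) * vd z p" for p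
    by (simp add: algebra_simps)
  ultimately show ?thesis using ab by (simp add: field_simps)
qed

lemma L2_lim_line_subset:
  assumes "L2_lim (lebesgue_on {s..t}) f g" "{c..d} \<subseteq> {s..t :: real}"
  shows "L2_lim (lebesgue_on {c..d}) f g"
  by (rule L2_lim_subset[OF assms]) auto

lemma edge_integral_trace_upper:
  assumes tr: "has_trace (orect x a' b' c' d') v (edg z b s t) g" and R: "a' \<le> b'" "c' \<le> d'" "orect z a b c d \<subseteq> orect x a' b' c' d'"
    and wdv: "\<And>z. wd z (orect x a' b' c' d') v (vd z)" and ab: "a < b" and sub: "{c..d} \<subseteq> {s..t}"
  shows "edge_integral (edg z b c d) g = (\<integral>p. v p + (co z p - a) * vd z p \<partial>lebesgue_on (orect z a b c d)) / (b - a)"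
proof -
  obtain \<phi> where H: "H1_lim (orect x a' b' c' d') \<phi> v vd"
    and g: "L2_lim (lebesgue_on {s..t}) (\<lambda>k r. \<phi> k (pt z b r)) (\<lambda>r. g (pt z b r))"
    by (rule has_traceD[OF tr R(1,2) wdv])
  show ?thesis
    unfolding edge_integral_edg
    by (rule line_integral_upper[OF H orect_sets R(3) ab L2_lim_line_subset[OF g sub]])
qed

lemma edge_integral_trace_lower:
  assumes tr: "has_trace (orect x a' b' c' d') v (edg z a s t) g" and R: "a' \<le> b'" "c' \<le> d'" "orect z a b c d \<subseteq> orect x a' b' c' d'"
    and wdv: "\<And>z. wd z (orect x a' b' c' d') v (vd z)" and ab: "a < b" and sub: "{c..d} \<subseteq> {s..t}"
  shows "edge_integral (edg z a c d) g = (\<integral>p. v p - (b - co z p) * vd z p \<partial>lebesgue_on (orect z a b c d)) / (b - a)"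
proof -
  obtain \<phi> where H: "H1_lim (orect x a' b' c' d') \<phi> v vd"
    and g: "L2_lim (lebesgue_on {s..t}) (\<lambda>k r. \<phi> k (pt z a r)) (\<lambda>r. g (pt z a r))"
    by (rule has_traceD[OF tr R(1,2) wdv])
  show ?thesis
    unfolding edge_integral_edg
    by (rule line_integral_lower[OF H orect_sets R(3) ab L2_lim_line_subset[OF g sub]])
qed

text \<open>Existence is what gives meaning to the choice in \<open>trace_on\<close>. The function
  v' need only agree with v almost everywhere on the rectangle, because the traces in question are
  those of chosen weak derivatives.\<close>

lemma has_trace_trace_on:
  assumes H: "H1_lim usq \<phi> v vd" and R: "a' \<le> b'" "c' \<le> d'" "orect x a' b' c' d' \<subseteq> usq"
    and v': "v' \<in> borel_measurable (lebesgue_on (orect x a' b' c' d'))" "AE p in lebesgue_on (orect x a' b' c' d'). v p = v' p"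
    and e: "0 \<le> e" "e \<le> 1" "0 \<le> s" "t \<le> 1"
  shows "has_trace (orect x a' b' c' d') v' (edg z e s t) (trace_on (orect x a' b' c' d') v' (edg z e s t))"
proof -
  let ?R = "orect x a' b' c' d'"
  have HR: "H1_lim ?R \<phi> v' vd"
    by (rule H1_lim_cong_AE[OF H1_lim_subset[OF H R(3) orect_sets orect_sets] v'])
  obtain g where g: "L2_lim (lebesgue_on {0..1}) (\<lambda>k t. \<phi> k (pt z e t)) g"
    using line_trace_exists[OF H e(1,2)] by blast
  have "L2_lim (lebesgue_on {s..t}) (\<lambda>k t. \<phi> k (pt z e t)) (\<lambda>r. (\<lambda>p. g (co (\<not> z) p)) (pt z e r))"
    using L2_lim_line_subset[OF g, of s t] e by simp
  then have "has_trace ?R v' (edg z e s t) (\<lambda>p. g (co (\<not> z) p))"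
    by (rule has_traceI[OF HR R(1,2)])
  then show ?thesis unfolding trace_on_def
    by (rule someI[where P = "has_trace ?R v' (edg z e s t)"])
qed

lemma orect_subset_usq:
  assumes "0 \<le> a" "b \<le> 1" "0 \<le> c" "d \<le> 1" shows "orect z a b c d \<subseteq> usq"
proof -
  have "orect z a b c d \<subseteq> orect z 0 1 0 1" using assms by (auto simp: orect_def)
  then show ?thesis unfolding usq_eq[of z] .
qed

text \<open>Two rectangles occur: the trace is taken from R, which is the square for derivatives of
  u and the element for derivatives of the flux, while the average is always computed over the
  element.\<close>

lemma Qb_trace_cell:
  assumes H: "H1_lim usq \<phi> v vd" and R: "a' \<le> b'" "c' \<le> d'" "orect x a' b' c' d' \<subseteq> usq" "orect z a b c d \<subseteq> orect x a' b' c' d'"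
    and v': "v' \<in> borel_measurable (lebesgue_on (orect x a' b' c' d'))" "AE p in lebesgue_on (orect x a' b' c' d'). v p = v' p"
    and cell: "0 \<le> a" "a < b" "b \<le> 1" "0 \<le> c" "c < d" "d \<le> 1"
  shows "Qb_trace (orect x a' b' c' d') v' (edg z b c d)
      = (\<integral>p. v p + (co z p - a) * vd z p \<partial>lebesgue_on (orect z a b c d)) / (b - a) / (d - c)"
    and "Qb_trace (orect x a' b' c' d') v' (edg z a c d)
      = (\<integral>p. v p - (b - co z p) * vd z p \<partial>lebesgue_on (orect z a b c d)) / (b - a) / (d - c)"
proof -
  let ?R = "orect x a' b' c' d'"
  have HR: "H1_lim ?R \<phi> v' vd"
    by (rule H1_lim_cong_AE[OF H1_lim_subset[OF H R(3) orect_sets orect_sets] v'])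
  then have wdv: "wd y ?R v' (vd y)" for y by (simp add: H1_lim_def)
  let ?O = "orect z a b c d"
  have ae: "AE p in lebesgue_on ?O. v p = v' p"
  proof -
    have "AE p in lebesgue. p \<in> ?R \<longrightarrow> v p = v' p" using v'(2) by (simp add: AE_restrict_space_iff)
    then have "AE p in lebesgue. p \<in> ?O \<longrightarrow> v p = v' p" by eventually_elim (use R(4) in blast)
    then show ?thesis by (simp add: AE_restrict_space_iff)
  qed
  have m: "f \<in> borel_measurable (lebesgue_on ?O)" if "f \<in> borel_measurable (lebesgue_on ?R)" for f :: "point \<Rightarrow> real"
    using that R(4) by (rule measurable_restrict_mono)
  have mv: "v \<in> borel_measurable (lebesgue_on ?O)" "v' \<in> borel_measurable (lebesgue_on ?O)" "vd z \<in> borel_measurable (lebesgue_on ?O)"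
    using H1_lim_subset[OF H order_trans[OF R(4,3)] orect_sets orect_sets] m[OF v'(1)]
    by (auto simp: H1_lim_def L2_lim_def dest!: sq_int_measurable)
  have mc: "co z \<in> borel_measurable (lebesgue_on ?O)"
    by (intro sq_int_measurable[OF continuous_sq_int_orect] continuous_intros)
  have 1: "(\<integral>p. v' p + (co z p - a) * vd z p \<partial>lebesgue_on ?O) = (\<integral>p. v p + (co z p - a) * vd z p \<partial>lebesgue_on ?O)"
    "(\<integral>p. v' p - (b - co z p) * vd z p \<partial>lebesgue_on ?O) = (\<integral>p. v p - (b - co z p) * vd z p \<partial>lebesgue_on ?O)"
  proof -
    have ae': "AE p in lebesgue_on ?O. v' p + (co z p - a) * vd z p = v p + (co z p - a) * vd z p"
      "AE p in lebesgue_on ?O. v' p - (b - co z p) * vd z p = v p - (b - co z p) * vd z p"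
      using ae by (eventually_elim, simp)+
    show "(\<integral>p. v' p + (co z p - a) * vd z p \<partial>lebesgue_on ?O) = (\<integral>p. v p + (co z p - a) * vd z p \<partial>lebesgue_on ?O)"
      by (rule integral_cong_AE[OF _ _ ae'(1)]) (use mv mc in measurable)
    show "(\<integral>p. v' p - (b - co z p) * vd z p \<partial>lebesgue_on ?O) = (\<integral>p. v p - (b - co z p) * vd z p \<partial>lebesgue_on ?O)"
      by (rule integral_cong_AE[OF _ _ ae'(2)]) (use mv mc in measurable)
  qed
  show "Qb_trace ?R v' (edg z b c d) = (\<integral>p. v p + (co z p - a) * vd z p \<partial>lebesgue_on ?O) / (b - a) / (d - c)"
    unfolding Qb_trace_def Qb_def
    using edge_integral_trace_upper[OF has_trace_trace_on[OF H R(1-3) v'] R(1,2,4) wdv cell(2) order_refl] cell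
    by (simp add: 1)
  show "Qb_trace ?R v' (edg z a c d) = (\<integral>p. v p - (b - co z p) * vd z p \<partial>lebesgue_on ?O) / (b - a) / (d - c)"
    unfolding Qb_trace_def Qb_def
    using edge_integral_trace_lower[OF has_trace_trace_on[OF H R(1-3) v'] R(1,2,4) wdv cell(2) order_refl] cell
    by (simp add: 1)
qed

section \<open>Continuity of the normal flux across an interior edge\<close>

lemma orect_split_integral:
  fixes f :: "point \<Rightarrow> real"
  assumes abe: "a \<le> b" "b \<le> e" and f: "integrable (lebesgue_on (orect z a e c d)) f"
  shows "integral\<^sup>L (lebesgue_on (orect z a e c d)) f
    = integral\<^sup>L (lebesgue_on (orect z a b c d)) f + integral\<^sup>L (lebesgue_on (orect z b e c d)) f"
proof -
  let ?A = "orect z a b c d" and ?B = "orect z b e c d" and ?S = "orect z a e c d"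
  have sub: "?A \<subseteq> ?S" "?B \<subseteq> ?S" using abe by (auto simp: orect_def)
  have iA: "integrable (lebesgue_on ?A) f" and iB: "integrable (lebesgue_on ?B) f"
    using integrable_lebesgue_on_subset[OF f sub(1)] integrable_lebesgue_on_subset[OF f sub(2)] by auto
  have neg: "negligible (?S - (?A \<union> ?B))"
  proof (rule negligible_subset[OF negligible_Un[OF negligible_crect_diff[of z a b c d] negligible_crect_diff[of z b e c d]]])
    show "?S - (?A \<union> ?B) \<subseteq> (crect z a b c d - ?A) \<union> (crect z b e c d - ?B)"
      by (auto simp: orect_def crect_def)
  qed
  have "integral\<^sup>L (lebesgue_on ?S) f = integral\<^sup>L (lebesgue_on (?A \<union> ?B)) f"
    using neg sub borel_measurable_integrable[OF f]
    by (intro integral_lebesgue_on_negligible_diff[symmetric]) auto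
  also have "\<dots> = (\<integral>p. indicator ?A p *\<^sub>R f p + indicator ?B p *\<^sub>R f p \<partial>lebesgue)"
  proof -
    have "indicator (?A \<union> ?B) p *\<^sub>R f p = indicator ?A p *\<^sub>R f p + indicator ?B p *\<^sub>R f p" for p
      by (auto simp: indicator_def orect_def)
    then show ?thesis by (subst integral_restrict_space) (auto intro: sets.Un)
  qed
  also have "\<dots> = integral\<^sup>L (lebesgue_on ?A) f + integral\<^sup>L (lebesgue_on ?B) f"
    using iA iB by (simp add: integral_restrict_space integrable_restrict_space)
  finally show ?thesis .
qed

text \<open>The test functions concentrate on the common edge only in the tangential direction; the
  contributions of the two cells then reduce to the jump of the normal flux across the edge.\<close>

lemma flux_jump_zero:
  assumes Hv: "H1_lim usq \<phi> v vd" and Hw: "H1_lim usq \<psi> w wd'"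
    and cell: "0 \<le> a" "a < b" "b < e" "e \<le> 1" "0 \<le> c" "c < d" "d \<le> 1"
    and s: "sq_int (lebesgue_on (orect z a e c d)) qn" "sq_int (lebesgue_on (orect z a e c d)) qt" "sq_int (lebesgue_on (orect z a e c d)) f"
    and q1: "\<And>p. p \<in> orect z a b c d \<Longrightarrow> qn p = \<alpha>1 * v p + \<gamma>1 * w p \<and> qt p = \<alpha>1' * v p + \<gamma>1' * w p"
    and q2: "\<And>p. p \<in> orect z b e c d \<Longrightarrow> qn p = \<alpha>2 * v p + \<gamma>2 * w p \<and> qt p = \<alpha>2' * v p + \<gamma>2' * w p"
    and f1: "AE p in lebesgue_on (orect z a b c d). f p = - (\<alpha>1 * vd z p + \<gamma>1 * wd' z p + \<alpha>1' * vd (\<not> z) p + \<gamma>1' * wd' (\<not> z) p)"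
    and f2: "AE p in lebesgue_on (orect z b e c d). f p = - (\<alpha>2 * vd z p + \<gamma>2 * wd' z p + \<alpha>2' * vd (\<not> z) p + \<gamma>2' * wd' (\<not> z) p)"
    and weak: "\<And>\<phi>. \<phi> \<in> test_functions (orect z a e c d) \<Longrightarrow>
      (\<integral>p. qn p * pd z \<phi> p + qt p * pd (\<not> z) \<phi> p \<partial>lebesgue_on (orect z a e c d)) = (\<integral>p. f p * \<phi> p \<partial>lebesgue_on (orect z a e c d))"
    and gv: "L2_lim (lebesgue_on {c..d}) (\<lambda>k t. \<phi> k (pt z b t)) gv"
    and gw: "L2_lim (lebesgue_on {c..d}) (\<lambda>k t. \<psi> k (pt z b t)) gw"
  shows "\<alpha>1 * (\<integral>t. gv t \<partial>lebesgue_on {c..d}) + \<gamma>1 * (\<integral>t. gw t \<partial>lebesgue_on {c..d})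
    = \<alpha>2 * (\<integral>t. gv t \<partial>lebesgue_on {c..d}) + \<gamma>2 * (\<integral>t. gw t \<partial>lebesgue_on {c..d})"
proof -
  have "(\<lambda>k. cut k a e b) \<longlonglongrightarrow> 1" using cell by (intro cut_tendsto_1) auto
  then have "\<forall>\<^sub>F k in sequentially. cut k a e b > 0" by (rule order_tendstoD) simp
  then obtain K where K: "cut K a e b > 0" unfolding eventually_sequentially by blast
  \<comment> \<open>One fixed cut-off across the edge suffices, since only
    \<open>A b \<noteq> 0\<close> matters. The limit is taken in the tangential factor
    alone.\<close>
  define A where "A = cut K a e"
  have sA: "smooth1 A" unfolding A_def by (rule smooth1_cut)
  have A0: "A a = 0" "A e = 0" "A b \<noteq> 0" using K by (auto simp: A_def cut_outside)
  have dA: "(A has_real_derivative deriv A s) (at s)" "continuous_on UNIV (deriv A)" "continuous_on UNIV A" for s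
    using sA by (auto intro: smooth1_DERIV smooth1_continuous smooth1_deriv)
  have jump: "(\<alpha>1 - \<alpha>2) * (\<integral>t. gv t * B t \<partial>lebesgue_on {c..d}) + (\<gamma>1 - \<gamma>2) * (\<integral>t. gw t * B t \<partial>lebesgue_on {c..d}) = 0"
    if B: "B = cut k c d" for B k
  proof -
    have sB: "smooth1 B" and B0: "B c = 0" "B d = 0" unfolding B by (auto intro: smooth1_cut simp: cut_outside)
    have dB: "(B has_real_derivative deriv B s) (at s)" "continuous_on UNIV (deriv B)" "continuous_on UNIV B" for s
      using sB by (auto intro: smooth1_DERIV smooth1_continuous smooth1_deriv)
    let ?\<psi> = "\<lambda>p. A (co z p) * B (co (\<not> z) p)"
    have t: "?\<psi> \<in> test_functions (orect z a e c d)"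
    proof -
      show ?thesis
      proof (cases "k > 0 \<and> K > 0")
        case True
        show ?thesis
        proof (rule test_functionI)
          show "smooth ?\<psi>" by (intro smooth_alg_smooth smooth_alg_tensor sA sB)
          show "compact (crect z (a + 1 / real K) (e - 1 / real K) (c + 1 / real k) (d - 1 / real k))" by (rule compact_crect)
          define r r' where "r = 1 / real K" and "r' = 1 / real k"
          have "r > 0" "r' > 0" using True by (auto simp: r_def r'_def)
          then show "crect z (a + 1 / real K) (e - 1 / real K) (c + 1 / real k) (d - 1 / real k) \<subseteq> orect z a e c d"
            unfolding crect_def orect_def r_def[symmetric] r'_def[symmetric] by auto
          show "p \<in> crect z (a + 1 / real K) (e - 1 / real K) (c + 1 / real k) (d - 1 / real k)" if "?\<psi> p \<noteq> 0" for p
            using that cut_support[of K a e "co z p"] cut_support[of k c d "co (\<not> z) p"]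
            by (auto simp: crect_def A_def B)
        qed
      next
        case False
        have "?\<psi> = (\<lambda>p. 0)"
        proof
          fix p
          show "?\<psi> p = 0"
            using False cut_support(1)[of K a e "co z p"] cut_support(1)[of k c d "co (\<not> z) p"] unfolding A_def B by auto
        qed
        then show ?thesis by (simp add: test_functions_def smooth_zero)
      qed
    qed
    have p1: "pd z ?\<psi> = (\<lambda>p. deriv A (co z p) * B (co (\<not> z) p))" by (rule pd_tensor[OF sA])
    have p2: "pd (\<not> z) ?\<psi> = (\<lambda>p. A (co z p) * deriv B (co (\<not> z) p))" by (rule pd_tensor_other[OF sB])
    have c1: "continuous_on UNIV (\<lambda>p. h (co z p) * h' (co (\<not> z) p))" if "continuous_on UNIV h" "continuous_on UNIV h'" for h h' :: "real \<Rightarrow> real"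
      by (intro continuous_on_mult continuous_on_compose2[OF that(1)] continuous_on_compose2[OF that(2)] co_continuous) auto
    note cc = c1[OF dA(2) dB(3)] c1[OF dA(3) dB(2)] c1[OF dA(3) dB(3)]
    \<comment> \<open>Both sides of the weak equation in one integrand, so that the integral over
      the two cells together vanishes.\<close>
    define F where "F p = qn p * (deriv A (co z p) * B (co (\<not> z) p)) + qt p * (A (co z p) * deriv B (co (\<not> z) p)) - f p * ?\<psi> p" for p
    have iF: "integrable (lebesgue_on (orect z a e c d)) F"
      unfolding F_def[abs_def]
      by (intro Bochner_Integration.integrable_add Bochner_Integration.integrable_diff sq_int_mult s continuous_sq_int_orect cc)
    have "integral\<^sup>L (lebesgue_on (orect z a e c d)) F = 0"
    proof -
      have "integrable (lebesgue_on (orect z a e c d)) (\<lambda>p. qn p * (deriv A (co z p) * B (co (\<not> z) p)) + qt p * (A (co z p) * deriv B (co (\<not> z) p)))"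
        "integrable (lebesgue_on (orect z a e c d)) (\<lambda>p. f p * ?\<psi> p)"
        by (intro Bochner_Integration.integrable_add sq_int_mult s continuous_sq_int_orect cc)+
      then show ?thesis using weak[OF t] unfolding p1 p2 F_def by simp
    qed
    then have split: "integral\<^sup>L (lebesgue_on (orect z a b c d)) F + integral\<^sup>L (lebesgue_on (orect z b e c d)) F = 0"
      using orect_split_integral[OF _ _ iF, of b] cell by simp
    have part: "integral\<^sup>L (lebesgue_on (orect z l u c d)) F
        = \<alpha> * ((\<integral>p. v p * (deriv A (co z p) * B (co (\<not> z) p)) + vd z p * (A (co z p) * B (co (\<not> z) p)) \<partial>lebesgue_on (orect z l u c d)))
        + \<gamma> * ((\<integral>p. w p * (deriv A (co z p) * B (co (\<not> z) p)) + wd' z p * (A (co z p) * B (co (\<not> z) p)) \<partial>lebesgue_on (orect z l u c d)))"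
      if lu: "orect z l u c d \<subseteq> orect z a e c d"
        and q: "\<And>p. p \<in> orect z l u c d \<Longrightarrow> qn p = \<alpha> * v p + \<gamma> * w p \<and> qt p = \<alpha>' * v p + \<gamma>' * w p"
        and fa: "AE p in lebesgue_on (orect z l u c d). f p = - (\<alpha> * vd z p + \<gamma> * wd' z p + \<alpha>' * vd (\<not> z) p + \<gamma>' * wd' (\<not> z) p)"
      for l u \<alpha> \<gamma> \<alpha>' \<gamma>'
    proof -
      let ?O = "orect z l u c d" and ?M = "lebesgue_on (orect z l u c d)"
      have Ou: "?O \<subseteq> usq" using lu orect_subset_usq[of a e c d z] cell by auto
      have HO: "H1_lim ?O \<phi> v vd" "H1_lim ?O \<psi> w wd'"
        using H1_lim_subset[OF Hv Ou] H1_lim_subset[OF Hw Ou] by auto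
      have sv: "sq_int ?M v" "sq_int ?M w" "sq_int ?M (vd y)" "sq_int ?M (wd' y)" for y
        using HO by (auto simp: H1_lim_def L2_lim_def)
      have sc: "sq_int ?M (\<lambda>p. deriv A (co z p) * B (co (\<not> z) p))" "sq_int ?M (\<lambda>p. A (co z p) * deriv B (co (\<not> z) p))" "sq_int ?M ?\<psi>"
        by (intro continuous_sq_int_orect cc)+
      let ?I1 = "\<lambda>v vd p. v p * (deriv A (co z p) * B (co (\<not> z) p)) + vd z p * (A (co z p) * B (co (\<not> z) p))"
      let ?I2 = "\<lambda>v vd p. v p * (A (co z p) * deriv B (co (\<not> z) p)) + vd (\<not> z) p * (A (co z p) * B (co (\<not> z) p))"
      have int: "integrable ?M (?I1 v vd)" "integrable ?M (?I1 w wd')" "integrable ?M (?I2 v vd)" "integrable ?M (?I2 w wd')"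
        by (intro Bochner_Integration.integrable_add sq_int_mult sv sc)+
      \<comment> \<open>The tangential derivative falls on \<open>B\<close>, which vanishes at c and
        d. Green's formula in the other direction therefore has no edge term.\<close>
      have tang: "integral\<^sup>L ?M (?I2 v' vd') = 0" if H': "H1_lim ?O \<phi>' v' vd'" for v' vd' \<phi>'
      proof -
        have "orect (\<not> z) c d l u \<subseteq> ?O" by (simp add: orect_not)
        then have "(\<integral>p. v' p * (deriv B (co (\<not> z) p) * A (co (\<not> (\<not> z)) p)) + vd' (\<not> z) p * (B (co (\<not> z) p) * A (co (\<not> (\<not> z)) p))
            \<partial>lebesgue_on (orect (\<not> z) c d l u)) = 0"
          using cell B0 by (intro Green_zero[OF H' orect_sets _ _ dB(1,2) dA(3)]) auto
        then show ?thesis by (simp add: orect_not mult_ac)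
      qed
      have "integral\<^sup>L ?M F = (\<integral>p. \<alpha> * ?I1 v vd p + \<gamma> * ?I1 w wd' p + \<alpha>' * ?I2 v vd p + \<gamma>' * ?I2 w wd' p \<partial>?M)"
      proof (rule integral_cong_AE)
        show "F \<in> borel_measurable ?M"
          by (rule borel_measurable_integrable[OF integrable_lebesgue_on_subset[OF iF lu]]) auto
        show "(\<lambda>p. \<alpha> * ?I1 v vd p + \<gamma> * ?I1 w wd' p + \<alpha>' * ?I2 v vd p + \<gamma>' * ?I2 w wd' p) \<in> borel_measurable ?M"
          using int by (intro borel_measurable_integrable) simp
        have "AE p in ?M. p \<in> ?O" by (rule AE_I2) simp
        then show "AE p in ?M. F p = \<alpha> * ?I1 v vd p + \<gamma> * ?I1 w wd' p + \<alpha>' * ?I2 v vd p + \<gamma>' * ?I2 w wd' p"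
          using fa
        proof eventually_elim
          case (elim p)
          show ?case
            unfolding F_def elim(2) conjunct1[OF q[OF elim(1)]] conjunct2[OF q[OF elim(1)]] by (simp add: algebra_simps)
        qed
      qed
      also have "\<dots> = \<alpha> * integral\<^sup>L ?M (?I1 v vd) + \<gamma> * integral\<^sup>L ?M (?I1 w wd') + \<alpha>' * integral\<^sup>L ?M (?I2 v vd) + \<gamma>' * integral\<^sup>L ?M (?I2 w wd')"
        using int by simp
      finally show ?thesis using tang[OF HO(1)] tang[OF HO(2)] by simp
    qed
    have subs: "orect z a b c d \<subseteq> orect z a e c d" "orect z b e c d \<subseteq> orect z a e c d"
      using cell by (auto simp: orect_def)
    have usqs: "orect z a b c d \<subseteq> usq" "orect z b e c d \<subseteq> usq"
      using cell by (intro orect_subset_usq; simp)+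
    note up = Green_upper[OF _ orect_sets usqs(1) less_imp_le[OF cell(2)] dA(1,2) dB(3) A0(1)]
    note lo = Green_lower[OF _ orect_sets usqs(2) less_imp_le[OF cell(3)] dA(1,2) dB(3) A0(2)]
    \<comment> \<open>The common edge is the upper end of the first cell and the lower end of the
      second, whence the opposite signs.\<close>
    have "A b * ((\<alpha>1 - \<alpha>2) * (\<integral>t. gv t * B t \<partial>lebesgue_on {c..d}) + (\<gamma>1 - \<gamma>2) * (\<integral>t. gw t * B t \<partial>lebesgue_on {c..d})) = 0"
    proof -
      have 1: "integral\<^sup>L (lebesgue_on (orect z a b c d)) F
        = \<alpha>1 * (A b * (\<integral>t. gv t * B t \<partial>lebesgue_on {c..d})) + \<gamma>1 * (A b * (\<integral>t. gw t * B t \<partial>lebesgue_on {c..d}))"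
        unfolding up[OF Hv gv, symmetric] up[OF Hw gw, symmetric] by (rule part[OF subs(1) _ f1]) (rule q1)
      have 2: "integral\<^sup>L (lebesgue_on (orect z b e c d)) F
        = \<alpha>2 * (- A b * (\<integral>t. gv t * B t \<partial>lebesgue_on {c..d})) + \<gamma>2 * (- A b * (\<integral>t. gw t * B t \<partial>lebesgue_on {c..d}))"
        unfolding lo[OF Hv gv, symmetric] lo[OF Hw gw, symmetric] by (rule part[OF subs(2) _ f2]) (rule q2)
      show ?thesis using split unfolding 1 2 by (simp add: algebra_simps)
    qed
    then show ?thesis using A0(3) by simp
  qed
  \<comment> \<open>At the end points the cut-offs are 0 for every k, so the pointwise limit is the
    indicator of the open interval; it equals 1 almost everywhere.\<close>
  have lim: "(\<lambda>k. \<integral>t. g t * cut k c d t \<partial>lebesgue_on {c..d}) \<longlonglongrightarrow> (\<integral>t. g t \<partial>lebesgue_on {c..d})"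
    if g: "sq_int (lebesgue_on {c..d}) g" for g
  proof -
    have fin: "finite_measure (lebesgue_on {c..d})" by (rule finite_measure_lebesgue_on) simp
    have mi: "(indicator {c<..<d} :: real \<Rightarrow> real) \<in> borel_measurable (lebesgue_on {c..d})"
      by (intro measurable_restrict_space1 borel_measurable_indicator) simp
    have "(\<lambda>k. \<integral>t. g t * cut k c d t \<partial>lebesgue_on {c..d}) \<longlonglongrightarrow> (\<integral>t. g t * indicator {c<..<d} t \<partial>lebesgue_on {c..d})"
    proof (rule bounded_pointwise_inner[where B = 1])
      show "integrable (lebesgue_on {c..d}) g" by (rule sq_int_integrable[OF fin g])
      show "cut k c d \<in> borel_measurable (lebesgue_on {c..d})" for k
        by (rule sq_int_measurable[OF continuous_sq_int_line[OF smooth1_continuous[OF smooth1_cut]]])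
      show "(\<lambda>k. cut k c d t) \<longlonglongrightarrow> indicator {c<..<d} t" for t
        using cut_tendsto_1[of t c d] cut_outside[of t c d] by (cases "t \<in> {c<..<d}") (simp_all add: indicator_def)
      show "\<bar>cut k c d t\<bar> \<le> 1" for k t by (rule cut_abs_le)
    qed (rule mi)
    moreover have "(\<integral>t. g t * indicator {c<..<d} t \<partial>lebesgue_on {c..d}) = (\<integral>t. g t \<partial>lebesgue_on {c..d})"
    proof (rule integral_cong_AE)
      show "(\<lambda>t. g t * indicator {c<..<d} t) \<in> borel_measurable (lebesgue_on {c..d})"
        by (intro borel_measurable_times sq_int_measurable[OF g] mi)
      show "g \<in> borel_measurable (lebesgue_on {c..d})" by (rule sq_int_measurable[OF g])
      have "AE t in lebesgue. t \<notin> {c, d}"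
        by (rule AE_not_in) (simp add: negligible_iff_null_sets[symmetric])
      then have "AE t in lebesgue. t \<in> {c..d} \<longrightarrow> g t * indicator {c<..<d} t = g t"
        by eventually_elim (auto simp: indicator_def)
      then show "AE t in lebesgue_on {c..d}. g t * indicator {c<..<d} t = g t"
        by (simp add: AE_restrict_space_iff)
    qed
    ultimately show ?thesis by simp
  qed
  have sg: "sq_int (lebesgue_on {c..d}) gv" "sq_int (lebesgue_on {c..d}) gw" using gv gw by (auto simp: L2_lim_def)
  have "(\<lambda>k. (\<alpha>1 - \<alpha>2) * (\<integral>t. gv t * cut k c d t \<partial>lebesgue_on {c..d}) + (\<gamma>1 - \<gamma>2) * (\<integral>t. gw t * cut k c d t \<partial>lebesgue_on {c..d}))
      \<longlonglongrightarrow> (\<alpha>1 - \<alpha>2) * (\<integral>t. gv t \<partial>lebesgue_on {c..d}) + (\<gamma>1 - \<gamma>2) * (\<integral>t. gw t \<partial>lebesgue_on {c..d})"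
    by (intro tendsto_add tendsto_mult tendsto_const lim sg)
  then have "(\<alpha>1 - \<alpha>2) * (\<integral>t. gv t \<partial>lebesgue_on {c..d}) + (\<gamma>1 - \<gamma>2) * (\<integral>t. gw t \<partial>lebesgue_on {c..d}) = 0"
    unfolding jump[OF refl] using LIMSEQ_unique[OF tendsto_const] by fastforce
  then show ?thesis by (simp add: algebra_simps)
qed

section \<open>Consistency on one element\<close>

text \<open>A cell given by functions of the direction. Its definition fixes one orientation, and
  \<open>ob_orect\<close> presents it with any direction z in front.\<close>

definition ob :: "(bool \<Rightarrow> real) \<Rightarrow> (bool \<Rightarrow> real) \<Rightarrow> point set" where
  "ob lo hi = orect True (lo True) (hi True) (lo False) (hi False)"

lemma ob_orect: "ob lo hi = orect z (lo z) (hi z) (lo (\<not> z)) (hi (\<not> z))"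
  using orect_not[of True "lo False" "hi False" "lo True" "hi True"] by (cases z) (auto simp: ob_def)

text \<open>One element with the constant coefficient \<open>A\<close>. The derivatives of u are
  representatives on the whole square, so that they have smooth approximants there and their norms
  over the elements can be added up at the end.\<close>

locale H3_cell =
  fixes lo hi :: "bool \<Rightarrow> real" and u :: "point \<Rightarrow> real" and U1 :: "bool \<Rightarrow> point \<Rightarrow> real"
    and U2 :: "bool \<Rightarrow> bool \<Rightarrow> point \<Rightarrow> real" and U3 :: "bool \<Rightarrow> bool \<Rightarrow> bool \<Rightarrow> point \<Rightarrow> real"
    and A :: "bool \<Rightarrow> bool \<Rightarrow> real" and \<beta> :: real
  assumes lo_hi: "lo z < hi z" and lo_0: "0 \<le> lo z" and hi_1: "hi z \<le> 1"
    and H1_u: "\<exists>\<phi>. H1_lim usq \<phi> u U1"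
    and H1_U1: "\<exists>\<phi>. H1_lim usq \<phi> (U1 x) (U2 x)"
    and H1_U2: "\<exists>\<phi>. H1_lim usq \<phi> (U2 x y) (U3 x y)"
    and A_le: "\<bar>A x y\<bar> \<le> \<beta>"
begin

abbreviation "cellM \<equiv> lebesgue_on (ob lo hi)"

definition "len z = hi z - lo z"
definition "ctr z = (lo z + hi z) / 2"
definition "ar = len True * len False"
definition "nrm = sqrt (\<Sum>x\<in>UNIV. \<Sum>y\<in>UNIV. \<Sum>z\<in>UNIV. \<integral>p. (U3 x y z p)\<^sup>2 \<partial>cellM)"

text \<open>The components of the flux with their first and second derivatives; the first index is
  the component, the others are directions of differentiation.\<close>

definition "q z p = (\<Sum>x\<in>UNIV. A z x * U1 x p)"
definition "Q z y p = (\<Sum>x\<in>UNIV. A z x * U2 x y p)"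
definition "Q2 z y w p = (\<Sum>x\<in>UNIV. A z x * U3 x y w p)"

text \<open>The average of the trace of \<open>f\<close> on the upper or lower edge in direction \<open>z\<close>, expressed through
  the derivative \<open>fz\<close> of \<open>f\<close> in that direction.\<close>

definition "tr f fz z up = (\<integral>p. f p + (co z p - (if up then lo z else hi z)) * fz p \<partial>cellM) / ar"

lemma len_pos: "len z > 0" using lo_hi by (simp add: len_def)

lemma ar_eq: "ar = len z * len (\<not> z)" by (cases z) (simp_all add: ar_def mult.commute)

lemma ar_pos: "ar > 0" using len_pos by (simp add: ar_def)

lemma ob_usq: "ob lo hi \<subseteq> usq"
  unfolding ob_def by (intro orect_subset_usq lo_0 hi_1)

lemma ob_sets [simp]: "ob lo hi \<in> sets lebesgue" by (simp add: ob_def)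

lemma co_bounds: "p \<in> ob lo hi \<Longrightarrow> lo z < co z p \<and> co z p < hi z"
  using ob_orect[of lo hi z] by (simp add: orect_def)

lemma finite_cellM: "finite_measure cellM" unfolding ob_def by (rule finite_measure_orect)

lemma integral_const_cell: "(\<integral>p. c \<partial>cellM) = c * ar"
proof -
  have "(\<integral>p. c \<partial>cellM) = (\<integral>t. (\<integral>s. c \<partial>lebesgue_on {lo True..hi True}) \<partial>lebesgue_on {lo False..hi False})"
    unfolding ob_def by (rule integral_orect_iterated[of "\<lambda>_. c" True]) simp
  then show ?thesis using lo_hi[of True] lo_hi[of False] by (simp add: ar_def len_def measure_line[OF less_imp_le] mult.commute)
qed

lemma continuous_sq_int_cell: "continuous_on UNIV f \<Longrightarrow> sq_int cellM f" for f :: "point \<Rightarrow> real"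
  unfolding ob_def by (rule continuous_sq_int_orect)

lemma H1_sq_int:
  assumes "\<exists>\<phi>. H1_lim usq \<phi> v vd" shows "sq_int cellM v" "sq_int cellM (vd z)"
  using assms H1_lim_subset[OF _ ob_usq ob_sets orect_sets] by (auto simp: H1_lim_def L2_lim_def)

lemma sq_int_u: "sq_int cellM u" and sq_int_U1: "sq_int cellM (U1 x)"
  and sq_int_U2: "sq_int cellM (U2 x y)" and sq_int_U3: "sq_int cellM (U3 x y z)"
  using H1_sq_int[OF H1_u] H1_sq_int[OF H1_U1] H1_sq_int[OF H1_U2] by auto

lemma sq_int_Q: "sq_int cellM (q z)" "sq_int cellM (Q z y)" "sq_int cellM (Q2 z y w)"
  unfolding q_def[abs_def] Q_def[abs_def] Q2_def[abs_def]
  by (intro sq_int_sum sq_int_cmult sq_int_U1 sq_int_U2 sq_int_U3)+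

lemma integrable_cell: "sq_int cellM f \<Longrightarrow> integrable cellM f"
  by (rule sq_int_integrable[OF finite_cellM])

lemma integrable_mult_cell: "sq_int cellM f \<Longrightarrow> continuous_on UNIV g \<Longrightarrow> integrable cellM (\<lambda>p. g p * f p)"
  using sq_int_mult[OF continuous_sq_int_cell] by blast

lemma by_parts:
  assumes H: "\<exists>\<phi>. H1_lim usq \<phi> v vd"
    and P: "\<And>s. (P has_real_derivative P' s) (at s)" "continuous_on UNIV P'" "P (lo z) = 0" "P (hi z) = 0"
  shows "(\<integral>p. P' (co z p) * v p \<partial>cellM) = - (\<integral>p. P (co z p) * vd z p \<partial>cellM)"
proof -
  obtain \<phi> where \<phi>: "H1_lim usq \<phi> v vd" using H by blast
  have "orect z (lo z) (hi z) (lo (\<not> z)) (hi (\<not> z)) \<subseteq> usq" using ob_usq ob_orect by metis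
  then have "(\<integral>p. v p * (P' (co z p) * 1) + vd z p * (P (co z p) * 1) \<partial>cellM) = 0"
    using Green_zero[OF \<phi> orect_sets _ less_imp_le[OF lo_hi] P(1,2) continuous_on_const[of _ 1] P(3,4)]
      ob_orect[of lo hi z] by simp
  moreover have "continuous_on UNIV P" using P(1) by (meson DERIV_isCont continuous_at_imp_continuous_on)
  then have "continuous_on UNIV (\<lambda>p. P (co z p))" "continuous_on UNIV (\<lambda>p. P' (co z p))"
    using continuous_on_compose2[OF _ co_continuous[of UNIV z] subset_UNIV, of P]
      continuous_on_compose2[OF P(2) co_continuous[of UNIV z] subset_UNIV] by simp_all
  then have "integrable cellM (\<lambda>p. P' (co z p) * v p)" "integrable cellM (\<lambda>p. P (co z p) * vd z p)"
    using integrable_mult_cell[OF H1_sq_int(1)[OF H]] integrable_mult_cell[OF H1_sq_int(2)[OF H]] by simp_all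
  ultimately show ?thesis by (simp add: mult.commute)
qed

text \<open>All remainders below are integrals of third derivatives against bounded kernels.
  Cauchy-Schwarz gives the root of the area, which the energy norm of the test function absorbs
  later.\<close>

lemma bound_U3:
  assumes f: "continuous_on UNIV f" "\<And>p. p \<in> ob lo hi \<Longrightarrow> \<bar>f p\<bar> \<le> B" and B: "0 \<le> B"
  shows "\<bar>\<integral>p. f p * U3 x y z p \<partial>cellM\<bar> \<le> B * sqrt ar * nrm"
proof -
  have "(\<integral>p. (f p)\<^sup>2 \<partial>cellM) \<le> (\<integral>p. B\<^sup>2 \<partial>cellM)"
  proof (rule integral_mono)
    show "integrable cellM (\<lambda>p. (f p)\<^sup>2)" by (rule sq_int_square[OF continuous_sq_int_cell[OF f(1)]])
    show "integrable cellM (\<lambda>p. B\<^sup>2)" using finite_cellM by (simp add: finite_measure.integrable_const)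
    show "(f p)\<^sup>2 \<le> B\<^sup>2" if "p \<in> space cellM" for p
      using f(2)[of p] B that by (intro abs_le_square_iff[THEN iffD1]) simp
  qed
  then have 1: "sqrt (\<integral>p. (f p)\<^sup>2 \<partial>cellM) \<le> B * sqrt ar"
    using B unfolding integral_const_cell by (intro real_le_lsqrt) (simp_all add: power_mult_distrib ar_pos less_imp_le)
  have "(\<integral>p. (U3 x y z p)\<^sup>2 \<partial>cellM) \<le> (\<Sum>z\<in>UNIV. \<integral>p. (U3 x y z p)\<^sup>2 \<partial>cellM)"
    by (rule member_le_sum) auto
  also have "\<dots> \<le> (\<Sum>y\<in>UNIV. \<Sum>z\<in>UNIV. \<integral>p. (U3 x y z p)\<^sup>2 \<partial>cellM)"
    by (rule member_le_sum[of y UNIV "\<lambda>y. \<Sum>z\<in>UNIV. \<integral>p. (U3 x y z p)\<^sup>2 \<partial>cellM"]) (auto intro!: sum_nonneg)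
  also have "\<dots> \<le> (\<Sum>x\<in>UNIV. \<Sum>y\<in>UNIV. \<Sum>z\<in>UNIV. \<integral>p. (U3 x y z p)\<^sup>2 \<partial>cellM)"
    by (rule member_le_sum[of x UNIV "\<lambda>x. \<Sum>y\<in>UNIV. \<Sum>z\<in>UNIV. \<integral>p. (U3 x y z p)\<^sup>2 \<partial>cellM"]) (auto intro!: sum_nonneg)
  finally have 2: "sqrt (\<integral>p. (U3 x y z p)\<^sup>2 \<partial>cellM) \<le> nrm" unfolding nrm_def by (rule real_sqrt_le_mono)
  have "\<bar>\<integral>p. f p * U3 x y z p \<partial>cellM\<bar> \<le> sqrt (\<integral>p. (f p)\<^sup>2 \<partial>cellM) * sqrt (\<integral>p. (U3 x y z p)\<^sup>2 \<partial>cellM)"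
    by (rule sq_int_Cauchy_Schwarz_sqrt[OF continuous_sq_int_cell[OF f(1)] sq_int_U3])
  also have "\<dots> \<le> (B * sqrt ar) * nrm" using 1 2 B ar_pos by (intro mult_mono) auto
  finally show ?thesis .
qed

lemma beta_nonneg: "0 \<le> \<beta>" using A_le[of True True] by linarith

lemma bound_Q2:
  assumes f: "continuous_on UNIV f" "\<And>p. p \<in> ob lo hi \<Longrightarrow> \<bar>f p\<bar> \<le> B" and B: "0 \<le> B"
  shows "\<bar>\<integral>p. f p * Q2 x y z p \<partial>cellM\<bar> \<le> 2 * \<beta> * (B * sqrt ar * nrm)"
proof -
  have "(\<integral>p. f p * Q2 x y z p \<partial>cellM) = (\<integral>p. A x True * (f p * U3 True y z p) + A x False * (f p * U3 False y z p) \<partial>cellM)"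
    by (simp add: Q2_def UNIV_bool algebra_simps)
  also have "\<dots> = A x True * (\<integral>p. f p * U3 True y z p \<partial>cellM) + A x False * (\<integral>p. f p * U3 False y z p \<partial>cellM)"
    using integrable_mult_cell[OF sq_int_U3 f(1)] by simp
  finally have "\<bar>\<integral>p. f p * Q2 x y z p \<partial>cellM\<bar>
      \<le> \<bar>A x True * (\<integral>p. f p * U3 True y z p \<partial>cellM)\<bar> + \<bar>A x False * (\<integral>p. f p * U3 False y z p \<partial>cellM)\<bar>"
    by simp
  also have "\<dots> \<le> \<beta> * (B * sqrt ar * nrm) + \<beta> * (B * sqrt ar * nrm)"
    unfolding abs_mult by (intro add_mono mult_mono A_le bound_U3[OF f B]) (use beta_nonneg in auto)
  finally show ?thesis by (simp add: algebra_simps)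
qed

section \<open>Sums and differences of opposite edge averages\<close>

lemma tr_diff:
  assumes "sq_int cellM f" "sq_int cellM fz"
  shows "tr f fz z True - tr f fz z False = (\<integral>p. fz p \<partial>cellM) / len (\<not> z)"
proof -
  have i: "integrable cellM (\<lambda>p. f p + (co z p - c) * fz p)" for c
    by (intro Bochner_Integration.integrable_add integrable_cell assms integrable_mult_cell continuous_intros)
  have "tr f fz z True - tr f fz z False
      = (\<integral>p. (f p + (co z p - lo z) * fz p) - (f p + (co z p - hi z) * fz p) \<partial>cellM) / ar"
    by (subst Bochner_Integration.integral_diff[OF i i]) (simp add: tr_def diff_divide_distrib)
  also have "\<dots> = (\<integral>p. len z * fz p \<partial>cellM) / ar" by (simp add: len_def algebra_simps)
  also have "\<dots> = len z * (\<integral>p. fz p \<partial>cellM) / (len z * len (\<not> z))" by (simp flip: ar_eq)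
  finally show ?thesis using len_pos[of z] by simp
qed

text \<open>The two formulas are anchored at the two ends; adding them moves the anchor to the
  midpoint, where the weight has mean zero.\<close>

lemma tr_sum:
  assumes "sq_int cellM f" "sq_int cellM fz"
  shows "tr f fz z True + tr f fz z False = 2 * ((\<integral>p. f p \<partial>cellM) + (\<integral>p. (co z p - ctr z) * fz p \<partial>cellM)) / ar"
proof -
  have i: "integrable cellM (\<lambda>p. f p + (co z p - c) * fz p)" "integrable cellM (\<lambda>p. (co z p - c) * fz p)" for c
    by (intro Bochner_Integration.integrable_add integrable_cell assms integrable_mult_cell continuous_intros)+
  have "tr f fz z True + tr f fz z False
      = (\<integral>p. (f p + (co z p - lo z) * fz p) + (f p + (co z p - hi z) * fz p) \<partial>cellM) / ar"
    by (subst Bochner_Integration.integral_add[OF i(1) i(1)]) (simp add: tr_def add_divide_distrib)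
  also have "(\<lambda>p. (f p + (co z p - lo z) * fz p) + (f p + (co z p - hi z) * fz p)) = (\<lambda>p. 2 * (f p + (co z p - ctr z) * fz p))"
    by (auto simp: fun_eq_iff ctr_def field_simps)
  also have "(\<integral>p. 2 * (f p + (co z p - ctr z) * fz p) \<partial>cellM) = 2 * ((\<integral>p. f p \<partial>cellM) + (\<integral>p. (co z p - ctr z) * fz p \<partial>cellM))"
    using i integrable_cell[OF assms(1)] by simp
  finally show ?thesis .
qed

text \<open>The cubic is the antiderivative, vanishing at both ends, of (s - lo)(hi - s) minus its
  mean \<open>(len z)\<^sup>2 / 6\<close>. It is the kernel left over when the trapezoidal error is
  freed of its main part.\<close>

definition "Rem z = (\<integral>p. ((co z p - lo z) * (hi z - co z p) * (2 * co z p - lo z - hi z) / 6) * U3 z z z p \<partial>cellM)"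

lemma Rem_bound: "\<bar>Rem z\<bar> \<le> (len z) ^ 3 * (sqrt ar * nrm)"
proof -
  have "\<bar>(co z p - lo z) * (hi z - co z p) * (2 * co z p - lo z - hi z) / 6\<bar> \<le> (len z) ^ 3" if "p \<in> ob lo hi" for p
  proof -
    have b: "\<bar>co z p - lo z\<bar> \<le> len z" "\<bar>hi z - co z p\<bar> \<le> len z" "\<bar>2 * co z p - lo z - hi z\<bar> \<le> len z"
      using co_bounds[OF that, of z] by (auto simp: len_def)
    have "\<bar>co z p - lo z\<bar> * \<bar>hi z - co z p\<bar> * \<bar>2 * co z p - lo z - hi z\<bar> \<le> len z * len z * len z"
      by (intro mult_mono b) (use len_pos[of z] in auto)
    also have "\<dots> \<le> 6 * (len z) ^ 3" using len_pos[of z] by (simp add: power3_eq_cube)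
    finally show ?thesis by (simp add: abs_mult)
  qed
  then show ?thesis
    unfolding Rem_def
    using bound_U3[of "\<lambda>p. (co z p - lo z) * (hi z - co z p) * (2 * co z p - lo z - hi z) / 6" "(len z) ^ 3" z z z]
      len_pos[of z] by (simp add: continuous_intros mult.assoc)
qed

text \<open>The centred weight is integrated by parts to the kernel (s - lo)(hi - s) of the
  trapezoidal rule. The mean of that kernel yields the main term, and its oscillating part is
  integrated by parts once more.\<close>

lemma trapezoid_u:
  "tr u (U1 z) z True + tr u (U1 z) z False
    = (2 * (\<integral>p. u p \<partial>cellM) + (len z)\<^sup>2 / 6 * (\<integral>p. U2 z z p \<partial>cellM) - Rem z) / ar"
proof -
  have 1: "(\<integral>p. (co z p - ctr z) * U1 z p \<partial>cellM) = - (\<integral>p. (- (1 / 2) * ((co z p - lo z) * (hi z - co z p))) * U2 z z p \<partial>cellM)"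
    by (rule by_parts[OF H1_U1, where P = "\<lambda>s. - (1 / 2) * ((s - lo z) * (hi z - s))" and P' = "\<lambda>s. s - ctr z"])
       (auto intro!: derivative_eq_intros continuous_intros simp: ctr_def field_simps)
  have 2: "(\<integral>p. ((co z p - lo z) * (hi z - co z p) - (len z)\<^sup>2 / 6) * U2 z z p \<partial>cellM) = - Rem z"
    unfolding Rem_def
    by (rule by_parts[OF H1_U2, where P = "\<lambda>s. (s - lo z) * (hi z - s) * (2 * s - lo z - hi z) / 6"
          and P' = "\<lambda>s. (s - lo z) * (hi z - s) - (len z)\<^sup>2 / 6"])
       (auto intro!: derivative_eq_intros continuous_intros simp: len_def field_simps power2_eq_square)
  have i: "integrable cellM (\<lambda>p. ((co z p - lo z) * (hi z - co z p)) * U2 z z p)" "integrable cellM (U2 z z)"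
    by (intro integrable_mult_cell integrable_cell sq_int_U2 continuous_intros)+
  have 3: "2 * (\<integral>p. (co z p - ctr z) * U1 z p \<partial>cellM) = (\<integral>p. ((co z p - lo z) * (hi z - co z p)) * U2 z z p \<partial>cellM)"
  proof -
    have "(\<integral>p. (- (1 / 2) * ((co z p - lo z) * (hi z - co z p))) * U2 z z p \<partial>cellM)
        = - (1 / 2) * (\<integral>p. ((co z p - lo z) * (hi z - co z p)) * U2 z z p \<partial>cellM)"
      unfolding mult.assoc by (rule Bochner_Integration.integral_mult_right_zero)
    then show ?thesis unfolding 1 by simp
  qed
  have 4: "(\<integral>p. ((co z p - lo z) * (hi z - co z p)) * U2 z z p \<partial>cellM) = (len z)\<^sup>2 / 6 * (\<integral>p. U2 z z p \<partial>cellM) - Rem z"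
  proof -
    have "(\<integral>p. ((co z p - lo z) * (hi z - co z p) - (len z)\<^sup>2 / 6) * U2 z z p \<partial>cellM)
      = (\<integral>p. ((co z p - lo z) * (hi z - co z p)) * U2 z z p - (len z)\<^sup>2 / 6 * U2 z z p \<partial>cellM)"
      by (simp add: left_diff_distrib)
    also have "\<dots> = (\<integral>p. ((co z p - lo z) * (hi z - co z p)) * U2 z z p \<partial>cellM) - (len z)\<^sup>2 / 6 * (\<integral>p. U2 z z p \<partial>cellM)"
      using i by simp
    finally show ?thesis using 2 by simp
  qed
  show ?thesis
    unfolding tr_sum[OF sq_int_u sq_int_U1] using 3 4 by simp
qed

text \<open>For edge values \<open>v\<close> on the cell, \<open>dg v\<close> is the discrete gradient. The residual
  \<open>v - Q\<^sub>b (\<S> v)\<close> is \<open>\<plusminus> kk * dif v\<close> divided by the edge length, with opposite signs on the edges of the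
  two directions, so the stabilizer of \<open>u\<close> and \<open>v\<close> is \<open>\<rho> / h * kk * dif u * dif v\<close>.\<close>

definition "dg v z = (v z True - v z False) / len z"
definition "dif v = v True True + v True False - v False True - (v False False :: real)"
definition "kk = ar / (2 * (len True + len False))"

text \<open>The edge averages entering the correction. The edge has normal direction z, so the
  differentiation is tangential to it, as for the second derivative in y on vertical edges.\<close>

definition "tu z up = tr (U2 (\<not> z) (\<not> z)) (U3 (\<not> z) (\<not> z) z) z up"
definition "tq z up = tr (Q (\<not> z) (\<not> z)) (Q2 (\<not> z) (\<not> z) z) z up"

definition "corr \<rho> h z up = 1 / 12 * len (\<not> z) * inverse \<rho> * inverse h *
  (\<rho> * inverse h * len (\<not> z) * tu z up - 6 * tq z up)"

text \<open>The moment across z that appears when the load is paired with the slope of the extension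
  in the other direction.\<close>

definition "J z = (\<integral>p. (co (\<not> z) p - ctr (\<not> z)) * Q z z p \<partial>cellM)"

text \<open>\<open>Er\<close> and \<open>Eq\<close> measure the replacement of averages over the two
  opposite edges by averages over the cell, for the two ingredients of the correction.\<close>

definition "Er z = (\<integral>p. (co z p - ctr z) * U3 (\<not> z) (\<not> z) z p \<partial>cellM)"
definition "Eq z = (\<integral>p. (co z p - ctr z) * Q2 (\<not> z) (\<not> z) z p \<partial>cellM)"

lemma centered_bound: "p \<in> ob lo hi \<Longrightarrow> \<bar>co z p - ctr z\<bar> \<le> len z"
  using co_bounds[of p z] by (auto simp: ctr_def len_def abs_if field_simps)

lemma nrm_nonneg: "0 \<le> nrm" unfolding nrm_def by (auto intro!: real_sqrt_ge_zero sum_nonneg)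

lemma Er_bound: "\<bar>Er z\<bar> \<le> len z * (sqrt ar * nrm)"
  unfolding Er_def using bound_U3[of "\<lambda>p. co z p - ctr z" "len z" "\<not> z" "\<not> z" z] centered_bound len_pos[of z]
  by (simp add: continuous_intros mult.assoc)

lemma Eq_bound: "\<bar>Eq z\<bar> \<le> 2 * \<beta> * (len z * (sqrt ar * nrm))"
  unfolding Eq_def using bound_Q2[of "\<lambda>p. co z p - ctr z" "len z" "\<not> z" "\<not> z" z] centered_bound len_pos[of z]
  by (simp add: continuous_intros mult.assoc)

text \<open>The weight is centred and hence has an antiderivative vanishing at both ends. One
  integration by parts gains a further power of the side length and leaves second derivatives of the
  flux.\<close>

lemma J_bound: "\<bar>J z\<bar> \<le> 2 * \<beta> * ((len (\<not> z))\<^sup>2 * (sqrt ar * nrm))"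
proof -
  let ?y = "\<not> z"
  have Q: "\<exists>\<phi>. H1_lim usq \<phi> (Q z z) (Q2 z z)"
  proof -
    obtain \<phi> \<psi> where "H1_lim usq \<phi> (U2 True z) (U3 True z)" "H1_lim usq \<psi> (U2 False z) (U3 False z)"
      using H1_U2 by blast
    then have "H1_lim usq (\<lambda>k p. A z True * \<phi> k p + A z False * \<psi> k p) (\<lambda>p. A z True * U2 True z p + A z False * U2 False z p)
        (\<lambda>y p. A z True * U3 True z y p + A z False * U3 False z y p)"
      by (rule H1_lim_lincomb)
    then show ?thesis unfolding Q_def[abs_def] Q2_def[abs_def] by (auto simp: UNIV_bool add.commute)
  qed
  let ?P = "\<lambda>s. - (1 / 2) * ((s - lo ?y) * (hi ?y - s))"
  have 1: "J z = - (\<integral>p. ?P (co ?y p) * Q2 z z ?y p \<partial>cellM)"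
    unfolding J_def
    by (rule by_parts[OF Q, where P = ?P and P' = "\<lambda>s. s - ctr ?y"])
       (auto intro!: derivative_eq_intros continuous_intros simp: ctr_def field_simps)
  have "\<bar>?P (co ?y p)\<bar> \<le> (len ?y)\<^sup>2" if "p \<in> ob lo hi" for p
  proof -
    have b: "\<bar>co ?y p - lo ?y\<bar> \<le> len ?y" "\<bar>hi ?y - co ?y p\<bar> \<le> len ?y"
      using co_bounds[OF that, of ?y] by (auto simp: len_def)
    have "\<bar>co ?y p - lo ?y\<bar> * \<bar>hi ?y - co ?y p\<bar> \<le> len ?y * len ?y"
      by (intro mult_mono b) (use len_pos[of ?y] in auto)
    then have "\<bar>(co ?y p - lo ?y) * (hi ?y - co ?y p)\<bar> \<le> (len ?y)\<^sup>2"
      by (simp add: abs_mult power2_eq_square)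
    then show ?thesis unfolding abs_mult[of "- (1 / 2)"] by simp
  qed
  moreover have "continuous_on UNIV (\<lambda>p. ?P (co ?y p))" by (intro continuous_intros)
  ultimately have "\<bar>\<integral>p. ?P (co ?y p) * Q2 z z ?y p \<partial>cellM\<bar> \<le> 2 * \<beta> * ((len ?y)\<^sup>2 * sqrt ar * nrm)"
    by (intro bound_Q2) auto
  then show ?thesis unfolding 1 by (simp add: mult.assoc)
qed

lemma I3_bound: "\<bar>\<integral>p. U3 x y z p \<partial>cellM\<bar> \<le> sqrt ar * nrm" and IQ2_bound: "\<bar>\<integral>p. Q2 x y z p \<partial>cellM\<bar> \<le> 2 * \<beta> * (sqrt ar * nrm)"
  using bound_U3[of "\<lambda>_. 1" 1 x y z] bound_Q2[of "\<lambda>_. 1" 1 x y z] by simp_all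

section \<open>The correction and the cancellation of second derivatives\<close>

lemma dif_u:
  "dif (\<lambda>z. tr u (U1 z) z) = ((len True)\<^sup>2 / 6 * (\<integral>p. U2 True True p \<partial>cellM) - (len False)\<^sup>2 / 6 * (\<integral>p. U2 False False p \<partial>cellM)
     - Rem True + Rem False) / ar"
  using trapezoid_u[of True] trapezoid_u[of False] ar_pos by (simp add: dif_def field_simps)

lemma grad_u: "dg (\<lambda>z. tr u (U1 z) z) z = (\<integral>p. U1 z p \<partial>cellM) / ar"
  unfolding dg_def tr_diff[OF sq_int_u sq_int_U1] ar_eq[of z] by (simp add: mult.commute)

text \<open>Here the constants of the correction show their origin: 1/12, doubled by the sum over
  two edges, is the 1/6 of the trapezoidal error, and 6/12, doubled, is the weight 1 of the load
  term.\<close>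

lemma sum_corr:
  assumes \<rho>: "\<rho> > 0" and h: "h > 0"
  shows "\<rho> * h * (corr \<rho> h z True + corr \<rho> h z False)
    = ((\<rho> / h) * ((len (\<not> z))\<^sup>2 / 6) * ((\<integral>p. U2 (\<not> z) (\<not> z) p \<partial>cellM) + Er z)
      - len (\<not> z) * ((\<integral>p. Q (\<not> z) (\<not> z) p \<partial>cellM) + Eq z)) / ar"
proof -
  let ?l = "len (\<not> z)"
  have su: "tu z True + tu z False = 2 * ((\<integral>p. U2 (\<not> z) (\<not> z) p \<partial>cellM) + Er z) / ar"
    unfolding tu_def Er_def by (rule tr_sum[OF sq_int_U2 sq_int_U3])
  have sq: "tq z True + tq z False = 2 * ((\<integral>p. Q (\<not> z) (\<not> z) p \<partial>cellM) + Eq z) / ar"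
    unfolding tq_def Eq_def by (rule tr_sum[OF sq_int_Q(2,3)])
  have "\<rho> * h * (corr \<rho> h z True + corr \<rho> h z False)
    = (?l / 12) * ((\<rho> / h) * ?l * (tu z True + tu z False) - 6 * (tq z True + tq z False))"
    using \<rho> h by (simp add: corr_def field_simps)
  also have "\<dots> = ((\<rho> / h) * (?l\<^sup>2 / 6) * ((\<integral>p. U2 (\<not> z) (\<not> z) p \<partial>cellM) + Er z)
      - ?l * ((\<integral>p. Q (\<not> z) (\<not> z) p \<partial>cellM) + Eq z)) / ar"
    unfolding su sq using ar_pos h by (simp add: field_simps power2_eq_square)
  finally show ?thesis .
qed

text \<open>All terms with second derivatives of \<open>u\<close> cancel; this is what the correction is made for.\<close>

lemma dif_cancellation:
  assumes \<rho>: "\<rho> > 0" and h: "h > 0"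
  shows "((\<rho> / h) * (dif (\<lambda>z. tr u (U1 z) z) + h\<^sup>2 * dif (corr \<rho> h))
      - (\<integral>p. Q True True p \<partial>cellM) / len False + (\<integral>p. Q False False p \<partial>cellM) / len True) * ar
    = (\<rho> / h) * (Rem False - Rem True + (len False)\<^sup>2 / 6 * Er True - (len True)\<^sup>2 / 6 * Er False)
      - len False * Eq True + len True * Eq False"
proof -
  \<comment> \<open>On the edges with normal z the correction carries tangential second derivatives.
    It thus cancels the trapezoidal term of the other pair of edges, which has the opposite sign in
    \<open>dif\<close>.\<close>
  have c: "(\<rho> / h) * (h\<^sup>2 * dif (corr \<rho> h)) = \<rho> * h * (corr \<rho> h True True + corr \<rho> h True False)
      - \<rho> * h * (corr \<rho> h False True + corr \<rho> h False False)"
    using h by (simp add: dif_def field_simps power2_eq_square)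
  define r du dc QT QF w1 w2 where "r = \<rho> / h" and "du = dif (\<lambda>z. tr u (U1 z) z)" and "dc = dif (corr \<rho> h)"
    and "QT = (\<integral>p. Q True True p \<partial>cellM)" and "QF = (\<integral>p. Q False False p \<partial>cellM)"
    and "w1 = \<rho> * h * (corr \<rho> h True True + corr \<rho> h True False)" and "w2 = \<rho> * h * (corr \<rho> h False True + corr \<rho> h False False)"
  have c': "r * (h\<^sup>2 * dc) = w1 - w2" using c by (simp add: r_def dc_def w1_def w2_def)
  have "(r * (du + h\<^sup>2 * dc) - QT / len False + QF / len True) * ar
      = r * (du * ar) + (r * (h\<^sup>2 * dc)) * ar - QT / len False * ar + QF / len True * ar"
    by (simp add: algebra_simps)
  also have "QT / len False * ar = len True * QT"
    using len_pos[of False] by (simp add: ar_def)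
  also have "QF / len True * ar = len False * QF"
    using len_pos[of True] by (simp add: ar_def)
  also have "du * ar = (len True)\<^sup>2 / 6 * (\<integral>p. U2 True True p \<partial>cellM) - (len False)\<^sup>2 / 6 * (\<integral>p. U2 False False p \<partial>cellM) - Rem True + Rem False"
    unfolding du_def dif_u using ar_pos by simp
  also have "(r * (h\<^sup>2 * dc)) * ar = w1 * ar - w2 * ar" unfolding c' by (simp add: algebra_simps)
  also have "w1 * ar = r * ((len False)\<^sup>2 / 6) * ((\<integral>p. U2 False False p \<partial>cellM) + Er True) - len False * (QF + Eq True)"
    unfolding w1_def sum_corr[OF \<rho> h] r_def QF_def using ar_pos by simp
  also have "w2 * ar = r * ((len True)\<^sup>2 / 6) * ((\<integral>p. U2 True True p \<partial>cellM) + Er False) - len True * (QT + Eq False)"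
    unfolding w2_def sum_corr[OF \<rho> h] r_def QT_def using ar_pos by simp
  finally show ?thesis
    unfolding r_def[symmetric] du_def[symmetric] dc_def[symmetric] QT_def[symmetric] QF_def[symmetric]
    by (simp add: algebra_simps)
qed

text \<open>The powers of 1/h in the correction are balanced by the factor h^2 and by the edge
  lengths. The difference over opposite edges then turns averages of second derivatives into
  integrals of third ones.\<close>

lemma grad_corr_bound:
  assumes \<rho>: "\<rho> > 0" and h: "h > 0" and lh: "\<And>z. len z \<le> h"
  shows "h\<^sup>2 * ar * \<bar>dg (corr \<rho> h) z\<bar> \<le> (1 + \<beta> / \<rho>) * h\<^sup>2 * (sqrt ar * nrm)"
proof -
  let ?l = "len (\<not> z)" and ?N = "sqrt ar * nrm"
  define a b where "a = (\<integral>p. U3 (\<not> z) (\<not> z) z p \<partial>cellM)" and "b = (\<integral>p. Q2 (\<not> z) (\<not> z) z p \<partial>cellM)"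
  have N: "0 \<le> ?N" using nrm_nonneg ar_pos by simp
  have du: "tu z True - tu z False = a / ?l"
    unfolding tu_def a_def by (rule tr_diff[OF sq_int_U2 sq_int_U3])
  have dq: "tq z True - tq z False = b / ?l"
    unfolding tq_def b_def by (rule tr_diff[OF sq_int_Q(2,3)])
  have "h\<^sup>2 * ar * dg (corr \<rho> h) z = (1 / 12) * ?l\<^sup>2 * (h\<^sup>2 * inverse \<rho> * inverse h * (\<rho> * inverse h * ?l * (tu z True - tu z False) - 6 * (tq z True - tq z False)))"
    unfolding dg_def corr_def ar_eq[of z] using len_pos[of z] \<rho> h by (simp add: field_simps power2_eq_square)
  also have "\<dots> = (1 / 12) * ?l\<^sup>2 * a + (- (1 / 2) * (?l * h / \<rho>)) * b"
    unfolding du dq using len_pos[of "\<not> z"] \<rho> h by (simp add: field_simps power2_eq_square)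
  finally have e: "h\<^sup>2 * ar * dg (corr \<rho> h) z = (1 / 12) * ?l\<^sup>2 * a + (- (1 / 2) * (?l * h / \<rho>)) * b" .
  have "\<bar>h\<^sup>2 * ar * dg (corr \<rho> h) z\<bar> \<le> \<bar>(1 / 12) * ?l\<^sup>2 * a\<bar> + \<bar>(- (1 / 2) * (?l * h / \<rho>)) * b\<bar>"
    unfolding e by (rule abs_triangle_ineq)
  also have "\<dots> = (1 / 12) * ?l\<^sup>2 * \<bar>a\<bar> + (1 / 2) * (?l * h / \<rho>) * \<bar>b\<bar>"
    using len_pos[of "\<not> z"] \<rho> h by (simp add: abs_mult)
  also have "\<dots> \<le> h\<^sup>2 * ?N + (1 / 2) * (h * h / \<rho>) * (2 * \<beta> * ?N)"
  proof (intro add_mono mult_mono)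
    have "?l\<^sup>2 \<le> h\<^sup>2" using lh[of "\<not> z"] len_pos[of "\<not> z"] by (intro power_mono) auto
    then show "1 / 12 * ?l\<^sup>2 \<le> h\<^sup>2" using zero_le_power2[of ?l] by linarith
    show "\<bar>a\<bar> \<le> ?N" "\<bar>b\<bar> \<le> 2 * \<beta> * ?N" unfolding a_def b_def by (rule I3_bound IQ2_bound)+
    show "?l * h / \<rho> \<le> h * h / \<rho>" using lh[of "\<not> z"] \<rho> h by (intro divide_right_mono mult_right_mono) auto
  qed (use \<rho> h beta_nonneg N len_pos[of "\<not> z"] in auto)
  also have "\<dots> = (1 + \<beta> / \<rho>) * h\<^sup>2 * ?N" using \<rho> by (simp add: field_simps power2_eq_square)
  finally show ?thesis using ar_pos by (simp add: abs_mult)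
qed

text \<open>\<open>kk\<close> is the area divided by 2 L, and L \<le> 2 h. The bound 8 L^2 of the
  bracket times the area becomes 4 L after this division; the comparison of D with the stabilizer
  contributes 2 h and the remaining L another 2 h, which makes 16 h^2.\<close>

lemma remainder_bound:
  assumes \<rho>: "\<rho> > 0" and h: "h > 0" and lh: "\<And>z. len z \<le> h"
  shows "\<bar>kk * D * ((\<rho> / h) * (dif (\<lambda>z. tr u (U1 z) z) + h\<^sup>2 * dif (corr \<rho> h))
      - (\<integral>p. Q True True p \<partial>cellM) / len False + (\<integral>p. Q False False p \<partial>cellM) / len True)\<bar>
    \<le> (16 * (\<rho> + \<beta>) / sqrt \<rho>) * h\<^sup>2 * nrm * sqrt (\<rho> * inverse h * (kk * D\<^sup>2))" (is "\<bar>kk * D * ?B\<bar> \<le> _")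
proof -
  define L N where "L = len True + len False" and "N = sqrt ar * nrm"
  have L: "0 < L" "L \<le> 2 * h" "len z \<le> L" for z
    using len_pos[of True] len_pos[of False] lh[of True] lh[of False] by (cases z; simp add: L_def)+
  have N: "0 \<le> N" using nrm_nonneg ar_pos by (simp add: N_def)
  have l0: "0 \<le> len z" for z using len_pos[of z] by simp
  have p3: "(len z) ^ 3 \<le> L ^ 3" "(len z)\<^sup>2 \<le> L\<^sup>2" for z using L(3) l0 by (auto intro: power_mono)
  have R: "\<bar>Rem z\<bar> \<le> L ^ 3 * N" for z
    using Rem_bound[of z] mult_right_mono[OF p3(1) N, of z] by (simp add: N_def)
  have E: "\<bar>(len y)\<^sup>2 / 6 * Er z\<bar> \<le> L ^ 3 * N" for y z
  proof -
    have "\<bar>(len y)\<^sup>2 / 6 * Er z\<bar> \<le> L\<^sup>2 * (L * N)"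
      unfolding abs_mult
    proof (intro mult_mono)
      have "(len y)\<^sup>2 / 6 \<le> L\<^sup>2" using p3(2)[of y] zero_le_power2[of "len y"] by linarith
      then show "\<bar>(len y)\<^sup>2 / 6\<bar> \<le> L\<^sup>2" by simp
      show "\<bar>Er z\<bar> \<le> L * N" using Er_bound[of z] mult_right_mono[OF L(3) N, of z] by (simp add: N_def)
    qed auto
    then show ?thesis by (simp add: power3_eq_cube power2_eq_square mult.assoc)
  qed
  have F: "\<bar>len y * Eq z\<bar> \<le> 2 * \<beta> * (L\<^sup>2 * N)" for y z
  proof -
    have "\<bar>len y * Eq z\<bar> \<le> L * (2 * \<beta> * (L * N))"
      unfolding abs_mult
    proof (intro mult_mono)
      show "\<bar>len y\<bar> \<le> L" using L(3)[of y] l0[of y] by simp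
      have "2 * \<beta> * (len z * N) \<le> 2 * \<beta> * (L * N)"
        using beta_nonneg L(3)[of z] N by (intro mult_left_mono mult_right_mono) auto
      then show "\<bar>Eq z\<bar> \<le> 2 * \<beta> * (L * N)" using Eq_bound[of z] by (simp add: N_def)
    qed (use L in auto)
    then show ?thesis by (simp add: power2_eq_square mult_ac)
  qed
  have rh: "0 < \<rho> / h" using \<rho> h by simp
  have "\<bar>?B * ar\<bar> \<le> (\<rho> / h) * (4 * (L ^ 3 * N)) + 4 * \<beta> * (L\<^sup>2 * N)"
  proof -
    have "\<bar>Rem False - Rem True + (len False)\<^sup>2 / 6 * Er True - (len True)\<^sup>2 / 6 * Er False\<bar> \<le> 4 * (L ^ 3 * N)"
      using R[of True] R[of False] E[of False True] E[of True False] by linarith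
    then have "\<bar>(\<rho> / h) * (Rem False - Rem True + (len False)\<^sup>2 / 6 * Er True - (len True)\<^sup>2 / 6 * Er False)\<bar> \<le> (\<rho> / h) * (4 * (L ^ 3 * N))"
      unfolding abs_mult[of "\<rho> / h"] abs_of_pos[OF rh] using rh by (intro mult_left_mono) auto
    moreover have "\<bar>a - b + c\<bar> \<le> x + 2 * y" if "\<bar>a\<bar> \<le> x" "\<bar>b\<bar> \<le> y" "\<bar>c\<bar> \<le> y" for a b c x y :: real
      using that by linarith
    ultimately have "\<bar>?B * ar\<bar> \<le> (\<rho> / h) * (4 * (L ^ 3 * N)) + 2 * (2 * \<beta> * (L\<^sup>2 * N))"
      unfolding dif_cancellation[OF \<rho> h] using F[of False True] F[of True False] by blast
    then show ?thesis by simp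
  qed
  also have "(\<rho> / h) * (4 * (L ^ 3 * N)) \<le> \<rho> * (8 * (L\<^sup>2 * N))"
  proof -
    have "(\<rho> / h) * (4 * (L ^ 3 * N)) = \<rho> * (4 * (L / h) * (L\<^sup>2 * N))" by (simp add: power3_eq_cube power2_eq_square)
    also have "\<dots> \<le> \<rho> * (4 * 2 * (L\<^sup>2 * N))"
      using L h \<rho> N by (intro mult_left_mono mult_right_mono) (auto simp: field_simps)
    finally show ?thesis by simp
  qed
  finally have F': "\<bar>?B * ar\<bar> \<le> \<rho> * (8 * (L\<^sup>2 * N)) + 4 * \<beta> * (L\<^sup>2 * N)" by simp
  have e: "\<bar>?B\<bar> * ar = \<bar>?B * ar\<bar>" unfolding abs_mult abs_of_pos[OF ar_pos] ..
  have B: "\<bar>?B\<bar> * ar \<le> 8 * (\<rho> + \<beta>) * (L\<^sup>2 * N)"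
    unfolding e
  proof (rule order_trans[OF F'])
    have "0 \<le> \<beta> * (L\<^sup>2 * N)" using beta_nonneg N by simp
    then show "\<rho> * (8 * (L\<^sup>2 * N)) + 4 * \<beta> * (L\<^sup>2 * N) \<le> 8 * (\<rho> + \<beta>) * (L\<^sup>2 * N)"
      by (simp add: algebra_simps)
  qed
  define Y where "Y = sqrt (\<rho> * inverse h * (kk * D\<^sup>2))"
  have kk: "kk = ar / (2 * L)" by (simp add: kk_def L_def)
  have Yeq: "Y = \<bar>D\<bar> * sqrt ar * sqrt (\<rho> / (2 * h * L))"
  proof -
    have "\<rho> * inverse h * (kk * D\<^sup>2) = D\<^sup>2 * ar * (\<rho> / (2 * h * L))" unfolding kk using L h by (simp add: field_simps)
    then show ?thesis unfolding Y_def by (simp only: real_sqrt_mult real_sqrt_abs)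
  qed
  \<comment> \<open>Since L \<le> 2 h, the factor \<open>sqrt (\<rho> / (2 * h * L))\<close>
    contained in Y is at least \<open>sqrt \<rho> / (2 * h)\<close>.\<close>
  have Dar: "\<bar>D\<bar> * sqrt ar \<le> Y * (2 * h / sqrt \<rho>)"
  proof -
    have "2 * h * L \<le> (2 * h)\<^sup>2" using L h by (simp add: power2_eq_square)
    then have "\<rho> / (2 * h)\<^sup>2 \<le> \<rho> / (2 * h * L)" using L h \<rho> by (intro divide_left_mono) auto
    then have le: "sqrt (\<rho> / (2 * h)\<^sup>2) \<le> sqrt (\<rho> / (2 * h * L))" by (rule real_sqrt_le_mono)
    have "sqrt (\<rho> / (2 * h)\<^sup>2) = sqrt \<rho> / \<bar>2 * h\<bar>" by (simp only: real_sqrt_divide real_sqrt_abs)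
    also have "\<dots> = sqrt \<rho> / (2 * h)" using h by simp
    finally have "sqrt \<rho> / (2 * h) \<le> sqrt (\<rho> / (2 * h * L))" using le by simp
    then have "\<bar>D\<bar> * sqrt ar * (sqrt \<rho> / (2 * h)) \<le> Y" unfolding Yeq using ar_pos by (intro mult_left_mono) auto
    then show ?thesis using h \<rho> by (simp add: field_simps)
  qed
  have "\<bar>kk * D * ?B\<bar> = \<bar>D\<bar> / (2 * L) * (\<bar>?B\<bar> * ar)"
    unfolding kk abs_mult using L ar_pos by simp
  also have "\<dots> \<le> \<bar>D\<bar> / (2 * L) * (8 * (\<rho> + \<beta>) * (L\<^sup>2 * N))" using B L by (intro mult_left_mono) auto
  also have "\<dots> = (4 * (\<rho> + \<beta>) * nrm * L) * (\<bar>D\<bar> * sqrt ar)"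
    using L by (simp add: N_def power2_eq_square field_simps)
  also have "\<dots> \<le> (4 * (\<rho> + \<beta>) * nrm * L) * (Y * (2 * h / sqrt \<rho>))"
    using Dar L \<rho> beta_nonneg nrm_nonneg by (intro mult_left_mono) auto
  also have "\<dots> = (8 * (\<rho> + \<beta>) / sqrt \<rho> * nrm * Y * h) * L" by (simp add: field_simps)
  also have "\<dots> \<le> (8 * (\<rho> + \<beta>) / sqrt \<rho> * nrm * Y * h) * (2 * h)"
    using L \<rho> beta_nonneg nrm_nonneg h by (intro mult_left_mono) (auto simp: Y_def kk ar_pos less_imp_le)
  finally show ?thesis unfolding Y_def[symmetric] by (simp add: power2_eq_square mult_ac)
qed

end

lemma harmonic_half:
  fixes a b :: real
  assumes "0 < a" "0 < b"
  shows "a * b / (2 * (a + b)) / a + a * b / (2 * (a + b)) / b = 1 / 2"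
proof -
  have "a * b / (2 * (a + b)) / a + a * b / (2 * (a + b)) / b = b / (2 * (a + b)) + a / (2 * (a + b))"
    using assms by simp
  also have "\<dots> = (b + a) / (2 * (a + b))" by (simp only: add_divide_distrib)
  finally show ?thesis using assms by (simp add: add.commute)
qed

context H3_cell
begin

text \<open>Closed form of the extension of the edge values v: its slopes are the discrete gradient,
  and its centre value is the mean of one pair of edge values shifted by the residual.\<close>

definition "ext v p = (v True True + v True False) / 2 - kk * dif v / len False + (\<Sum>y\<in>UNIV. dg v y * (co y p - ctr y))"

text \<open>The integral of the normal flux over the edge, as average times length.\<close>

definition "flx z up = tr (q z) (Q z z) z up * len (\<not> z)"

definition "sg z = (if z then 1 else - 1 :: real)"

lemma kk_sum: "kk / len True + kk / len False = 1 / 2"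
  unfolding kk_def ar_def by (rule harmonic_half[OF len_pos len_pos])

text \<open>The mean value of the extension can be read off in either direction.\<close>

lemma ext_mean:
  "(v True True + v True False) / 2 - kk * dif v / len False = (v z True + v z False) / 2 - sg z * kk * dif v / len (\<not> z)"
proof (cases z)
  case False
  have "dif v * (kk / len True + kk / len False) = dif v / 2" unfolding kk_sum by simp
  then have "kk * dif v / len True + kk * dif v / len False = dif v / 2"
    by (simp add: algebra_simps)
  moreover have "dif v / 2 = (v True True + v True False) / 2 - (v False True + v False False) / 2"
    by (simp add: dif_def diff_divide_distrib add_divide_distrib)
  ultimately show ?thesis using False by (simp add: sg_def)
qed (simp add: sg_def)

lemma dg_half: "dg v z * (len z / 2) = (v z True - v z False) / 2"
  using len_pos[of z] by (simp add: dg_def)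

text \<open>Expand the affine function about the centre. The slope along z meets the moment of
  \<open>Q\<close>, which \<open>tr_sum\<close> converts into edge fluxes and the mean of the flux;
  the slope across z gives \<open>J\<close>; the centre value differs from the mean of the two edge
  values by the term with \<open>dif v\<close>.\<close>

lemma integral_Q_ext:
  "(\<integral>p. Q z z p * ext v p \<partial>cellM) = v z True * flx z True - v z False * flx z False
     - dg v z * (\<integral>p. q z p \<partial>cellM) + dg v (\<not> z) * J z - sg z * kk * dif v * (\<integral>p. Q z z p \<partial>cellM) / len (\<not> z)"
proof -
  define m where "m = (v True True + v True False) / 2 - kk * dif v / len False"
  define K where "K = (\<integral>p. (co z p - ctr z) * Q z z p \<partial>cellM)"
  have sE: "(\<Sum>y\<in>UNIV. dg v y * (co y p - ctr y)) = dg v z * (co z p - ctr z) + dg v (\<not> z) * (co (\<not> z) p - ctr (\<not> z))" for p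
    by (cases z) (simp_all add: UNIV_bool)
  have i: "integrable cellM (Q z z)" "integrable cellM (\<lambda>p. (co y p - ctr y) * Q z z p)" for y
    by (intro integrable_cell integrable_mult_cell sq_int_Q continuous_intros)+
  have "(\<integral>p. Q z z p * ext v p \<partial>cellM) = (\<integral>p. m * Q z z p + dg v z * ((co z p - ctr z) * Q z z p)
      + dg v (\<not> z) * ((co (\<not> z) p - ctr (\<not> z)) * Q z z p) \<partial>cellM)"
    unfolding ext_def sE m_def[symmetric] by (simp add: algebra_simps)
  also have "\<dots> = m * (\<integral>p. Q z z p \<partial>cellM) + dg v z * K + dg v (\<not> z) * J z"
    unfolding K_def J_def using i by simp
  finally have 1: "(\<integral>p. Q z z p * ext v p \<partial>cellM) = m * (\<integral>p. Q z z p \<partial>cellM) + dg v z * K + dg v (\<not> z) * J z" .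
  have d: "flx z True - flx z False = (\<integral>p. Q z z p \<partial>cellM)"
    using tr_diff[OF sq_int_Q(1,2), of z z z z] len_pos[of "\<not> z"] by (simp add: flx_def flip: left_diff_distrib)
  have s: "flx z True + flx z False = 2 * ((\<integral>p. q z p \<partial>cellM) + K) / len z"
    using tr_sum[OF sq_int_Q(1,2), of z z z z] len_pos[of "\<not> z"] by (simp add: flx_def K_def ar_eq[of z] flip: distrib_right)
  have K: "K = (flx z True + flx z False) * (len z / 2) - (\<integral>p. q z p \<partial>cellM)"
    unfolding s using len_pos[of z] by (simp add: field_simps)
  have m: "m = (v z True + v z False) / 2 - sg z * kk * dif v / len (\<not> z)"
    unfolding m_def by (rule ext_mean)
  have "dg v z * K = (v z True - v z False) / 2 * (flx z True + flx z False) - dg v z * (\<integral>p. q z p \<partial>cellM)"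
    unfolding K dg_half[symmetric] by (simp add: algebra_simps)
  then show ?thesis unfolding 1 m d[symmetric] by (simp add: field_simps)
qed

text \<open>After exact cancellation three remainders survive: the discrete gradient of the
  correction, the moments \<open>J\<close>, and the bracket treated in
  \<open>remainder_bound\<close>. The first two are measured by the gradient of v, the third by its
  alternating sum.\<close>

lemma cell_error:
  assumes \<rho>: "\<rho> > 0" and h: "h > 0" and lh: "\<And>z. len z \<le> h"
  shows "\<bar>(\<Sum>z\<in>UNIV. \<Sum>y\<in>UNIV. ar * (A z y * (dg (\<lambda>z. tr u (U1 z) z) y + h\<^sup>2 * dg (corr \<rho> h) y) * dg v z))
      + \<rho> / h * kk * (dif (\<lambda>z. tr u (U1 z) z) + h\<^sup>2 * dif (corr \<rho> h)) * dif v
      + (\<Sum>z\<in>UNIV. \<integral>p. Q z z p * ext v p \<partial>cellM) - (\<Sum>z\<in>UNIV. v z True * flx z True - v z False * flx z False)\<bar>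
    \<le> (4 * \<beta> * (1 + \<beta> / \<rho>) + 4 * \<beta> + 16 * (\<rho> + \<beta>) / sqrt \<rho>) * h\<^sup>2 * nrm *
      (sqrt (ar * (\<Sum>z\<in>UNIV. (dg v z)\<^sup>2)) + sqrt (\<rho> * inverse h * (kk * (dif v)\<^sup>2)))"
proof -
  define G Y where "G = sqrt (ar * (\<Sum>z\<in>UNIV. (dg v z)\<^sup>2))" and "Y = sqrt (\<rho> * inverse h * (kk * (dif v)\<^sup>2))"
  define X1 where "X1 = (\<Sum>z\<in>UNIV. \<Sum>y\<in>UNIV. (A z y * dg v z) * (h\<^sup>2 * ar * dg (corr \<rho> h) y))"
  define X2 where "X2 = (\<Sum>z\<in>UNIV. dg v (\<not> z) * J z)"
  define B where "B = (\<rho> / h) * (dif (\<lambda>z. tr u (U1 z) z) + h\<^sup>2 * dif (corr \<rho> h))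
      - (\<integral>p. Q True True p \<partial>cellM) / len False + (\<integral>p. Q False False p \<partial>cellM) / len True"
  let ?N = "sqrt ar * nrm"
  have N: "0 \<le> ?N" using nrm_nonneg ar_pos by simp
  \<comment> \<open>The discrete gradient of the edge averages is the mean of the gradient. The
    diffusion term of u therefore cancels, without any error, the mean flux coming from the
    load.\<close>
  have q: "(\<integral>p. q z p \<partial>cellM) = (\<Sum>y\<in>UNIV. ar * (A z y * dg (\<lambda>z. tr u (U1 z) z) y))" for z
  proof -
    have "(\<integral>p. q z p \<partial>cellM) = (\<Sum>y\<in>UNIV. A z y * (\<integral>p. U1 y p \<partial>cellM))"
      unfolding q_def[abs_def] using integrable_cell[OF sq_int_U1] by simp
    then show ?thesis using ar_pos by (simp add: grad_u)
  qed
  have split: "(\<Sum>z\<in>UNIV. \<Sum>y\<in>UNIV. ar * (A z y * (dg (\<lambda>z. tr u (U1 z) z) y + h\<^sup>2 * dg (corr \<rho> h) y) * dg v z))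
      = (\<Sum>z\<in>UNIV. dg v z * (\<integral>p. q z p \<partial>cellM)) + X1"
    unfolding X1_def q by (simp add: UNIV_bool algebra_simps)
  have QE: "(\<Sum>z\<in>UNIV. \<integral>p. Q z z p * ext v p \<partial>cellM) = (\<Sum>z\<in>UNIV. v z True * flx z True - v z False * flx z False)
      - (\<Sum>z\<in>UNIV. dg v z * (\<integral>p. q z p \<partial>cellM)) + X2
      - kk * dif v * ((\<integral>p. Q True True p \<partial>cellM) / len False - (\<integral>p. Q False False p \<partial>cellM) / len True)"
    unfolding integral_Q_ext X2_def by (simp add: UNIV_bool sg_def algebra_simps)
  have eq: "(\<Sum>z\<in>UNIV. \<Sum>y\<in>UNIV. ar * (A z y * (dg (\<lambda>z. tr u (U1 z) z) y + h\<^sup>2 * dg (corr \<rho> h) y) * dg v z))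
      + \<rho> / h * kk * (dif (\<lambda>z. tr u (U1 z) z) + h\<^sup>2 * dif (corr \<rho> h)) * dif v
      + (\<Sum>z\<in>UNIV. \<integral>p. Q z z p * ext v p \<partial>cellM) - (\<Sum>z\<in>UNIV. v z True * flx z True - v z False * flx z False)
    = X1 + X2 + kk * dif v * B"
    unfolding split QE B_def by (simp add: algebra_simps)
  have sg: "sqrt ar * \<bar>dg v z\<bar> \<le> G" for z
  proof -
    have "(dg v z)\<^sup>2 \<le> (\<Sum>z\<in>UNIV. (dg v z)\<^sup>2)" by (rule member_le_sum) auto
    then have "sqrt (ar * (dg v z)\<^sup>2) \<le> G" unfolding G_def using ar_pos by (intro real_sqrt_le_mono mult_left_mono) auto
    then show ?thesis by (simp add: real_sqrt_mult)
  qed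
  have G: "0 \<le> G" unfolding G_def using ar_pos by (auto intro!: real_sqrt_ge_zero mult_nonneg_nonneg sum_nonneg)
  have kk: "0 < kk" using ar_pos len_pos[of True] len_pos[of False] by (simp add: kk_def)
  have Y: "0 \<le> Y" unfolding Y_def using \<rho> h kk by simp
  have t1: "\<bar>(A z y * dg v z) * (h\<^sup>2 * ar * dg (corr \<rho> h) y)\<bar> \<le> \<beta> * (1 + \<beta> / \<rho>) * h\<^sup>2 * nrm * G" for z y
  proof -
    have "\<bar>(A z y * dg v z) * (h\<^sup>2 * ar * dg (corr \<rho> h) y)\<bar> = \<bar>A z y\<bar> * (\<bar>dg v z\<bar> * (h\<^sup>2 * ar * \<bar>dg (corr \<rho> h) y\<bar>))"
      using ar_pos by (simp add: abs_mult)
    also have "\<dots> \<le> \<beta> * (\<bar>dg v z\<bar> * ((1 + \<beta> / \<rho>) * h\<^sup>2 * ?N))"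
      using ar_pos beta_nonneg by (intro mult_mono A_le mult_left_mono grad_corr_bound[OF \<rho> h lh]) auto
    also have "\<dots> = \<beta> * (1 + \<beta> / \<rho>) * h\<^sup>2 * nrm * (sqrt ar * \<bar>dg v z\<bar>)" by (simp add: mult_ac)
    also have "\<dots> \<le> \<beta> * (1 + \<beta> / \<rho>) * h\<^sup>2 * nrm * G"
      using beta_nonneg \<rho> nrm_nonneg by (intro mult_left_mono sg) auto
    finally show ?thesis .
  qed
  have "\<bar>X1\<bar> \<le> (\<Sum>z\<in>(UNIV :: bool set). \<Sum>y\<in>(UNIV :: bool set). \<beta> * (1 + \<beta> / \<rho>) * h\<^sup>2 * nrm * G)"
    unfolding X1_def by (rule order_trans[OF sum_abs], rule sum_mono, rule order_trans[OF sum_abs], rule sum_mono, rule t1)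
  then have X1: "\<bar>X1\<bar> \<le> 4 * (\<beta> * (1 + \<beta> / \<rho>) * h\<^sup>2 * nrm * G)"
    by (simp add: UNIV_bool)
  have t2: "\<bar>dg v (\<not> z) * J z\<bar> \<le> 2 * \<beta> * h\<^sup>2 * nrm * G" for z
  proof -
    have l2: "(len (\<not> z))\<^sup>2 \<le> h\<^sup>2" using lh[of "\<not> z"] len_pos[of "\<not> z"] by (intro power_mono) auto
    have "\<bar>dg v (\<not> z) * J z\<bar> \<le> \<bar>dg v (\<not> z)\<bar> * (2 * \<beta> * ((len (\<not> z))\<^sup>2 * ?N))"
      unfolding abs_mult by (intro mult_left_mono J_bound) auto
    also have "\<dots> \<le> \<bar>dg v (\<not> z)\<bar> * (2 * \<beta> * (h\<^sup>2 * ?N))"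
      using l2 N beta_nonneg by (intro mult_left_mono mult_right_mono) auto
    also have "\<dots> = 2 * \<beta> * h\<^sup>2 * nrm * (sqrt ar * \<bar>dg v (\<not> z)\<bar>)" by (simp add: mult_ac)
    also have "\<dots> \<le> 2 * \<beta> * h\<^sup>2 * nrm * G"
      using beta_nonneg nrm_nonneg by (intro mult_left_mono sg) auto
    finally show ?thesis .
  qed
  have "\<bar>X2\<bar> \<le> (\<Sum>z\<in>(UNIV :: bool set). 2 * \<beta> * h\<^sup>2 * nrm * G)"
    unfolding X2_def by (rule order_trans[OF sum_abs], rule sum_mono, rule t2)
  then have X2: "\<bar>X2\<bar> \<le> 4 * \<beta> * h\<^sup>2 * nrm * G" by (simp add: UNIV_bool)
  have X3: "\<bar>kk * dif v * B\<bar> \<le> (16 * (\<rho> + \<beta>) / sqrt \<rho>) * h\<^sup>2 * nrm * Y"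
    unfolding B_def Y_def by (rule remainder_bound[OF \<rho> h lh])
  have "\<bar>X1 + X2 + kk * dif v * B\<bar> \<le> 4 * (\<beta> * (1 + \<beta> / \<rho>) * h\<^sup>2 * nrm * G) + 4 * \<beta> * h\<^sup>2 * nrm * G
      + (16 * (\<rho> + \<beta>) / sqrt \<rho>) * h\<^sup>2 * nrm * Y"
    by (rule order_trans[OF abs_triangle_ineq add_mono[OF order_trans[OF abs_triangle_ineq add_mono[OF X1 X2]] X3]])
  also have "\<dots> = (4 * \<beta> * (1 + \<beta> / \<rho>) + 4 * \<beta>) * h\<^sup>2 * nrm * G + (16 * (\<rho> + \<beta>) / sqrt \<rho>) * h\<^sup>2 * nrm * Y"
    by (simp only: distrib_right mult.assoc)
  also have "\<dots> \<le> (4 * \<beta> * (1 + \<beta> / \<rho>) + 4 * \<beta> + 16 * (\<rho> + \<beta>) / sqrt \<rho>) * h\<^sup>2 * nrm * (G + Y)"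
  proof -
    have nn: "0 \<le> 16 * (\<rho> + \<beta>) / sqrt \<rho> * h\<^sup>2 * nrm * G" "0 \<le> (4 * \<beta> * (1 + \<beta> / \<rho>) + 4 * \<beta>) * h\<^sup>2 * nrm * Y"
      using \<rho> beta_nonneg nrm_nonneg G Y by (auto intro!: mult_nonneg_nonneg add_nonneg_nonneg divide_nonneg_nonneg)
    have "(a + b) * h\<^sup>2 * nrm * (G + Y) = a * h\<^sup>2 * nrm * G + b * h\<^sup>2 * nrm * Y + (b * h\<^sup>2 * nrm * G + a * h\<^sup>2 * nrm * Y)" for a b
      by (simp add: algebra_simps)
    then show ?thesis using nn by simp
  qed
  finally show ?thesis unfolding eq G_def Y_def .
qed

end

section \<open>Discrete operators on one element\<close>

fun rect_lo :: "rect \<Rightarrow> bool \<Rightarrow> real" where "rect_lo (Rect a b c d) z = (if z then a else c)"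
fun rect_hi :: "rect \<Rightarrow> bool \<Rightarrow> real" where "rect_hi (Rect a b c d) z = (if z then b else d)"

text \<open>Addresses the four edges uniformly: z is the direction of the normal, and
  \<open>up\<close> selects the edge with the larger coordinate.\<close>

definition rect_edge :: "rect \<Rightarrow> bool \<Rightarrow> bool \<Rightarrow> edge" where
  "rect_edge T z up = edg z (if up then rect_hi T z else rect_lo T z) (rect_lo T (\<not> z)) (rect_hi T (\<not> z))"

abbreviation ev :: "rect \<Rightarrow> (edge \<Rightarrow> real) \<Rightarrow> bool \<Rightarrow> bool \<Rightarrow> real" where
  "ev T w z up \<equiv> w (rect_edge T z up)"

lemma rect_edge_simps:
  "rect_edge (Rect a b c d) True up = Vert (if up then b else a) c d"
  "rect_edge (Rect a b c d) False up = Horz (if up then d else c) a b"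
  by (simp_all add: rect_edge_def edg_def)

definition cell_len :: "rect \<Rightarrow> bool \<Rightarrow> real" where "cell_len T z = rect_hi T z - rect_lo T z"
definition cell_ctr :: "rect \<Rightarrow> bool \<Rightarrow> real" where "cell_ctr T z = (rect_lo T z + rect_hi T z) / 2"
definition cell_area :: "rect \<Rightarrow> real" where "cell_area T = cell_len T True * cell_len T False"
definition cell_grad :: "rect \<Rightarrow> (edge \<Rightarrow> real) \<Rightarrow> bool \<Rightarrow> real" where
  "cell_grad T w z = (ev T w z True - ev T w z False) / cell_len T z"
definition cell_dif :: "rect \<Rightarrow> (edge \<Rightarrow> real) \<Rightarrow> real" where
  "cell_dif T w = ev T w True True + ev T w True False - ev T w False True - ev T w False False"
definition cell_weight :: "rect \<Rightarrow> real" where "cell_weight T = cell_area T / (2 * (cell_len T True + cell_len T False))"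
definition cell_ext :: "rect \<Rightarrow> (edge \<Rightarrow> real) \<Rightarrow> point \<Rightarrow> real" where
  "cell_ext T w p = (ev T w True True + ev T w True False) / 2 - cell_weight T * cell_dif T w / cell_len T False
    + (\<Sum>y\<in>UNIV. cell_grad T w y * (co y p - cell_ctr T y))"

definition proper :: "rect \<Rightarrow> bool" where "proper T \<longleftrightarrow> (\<forall>z. rect_lo T z < rect_hi T z)"

lemma cell_len_pos: "proper T \<Longrightarrow> 0 < cell_len T z" by (simp add: proper_def cell_len_def)

lemma cell_area_pos: "proper T \<Longrightarrow> 0 < cell_area T" by (simp add: cell_area_def cell_len_pos)

lemma cell_weight_pos: "proper T \<Longrightarrow> 0 < cell_weight T"
  using cell_area_pos[of T] cell_len_pos[of T True] cell_len_pos[of T False] by (simp add: cell_weight_def)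

text \<open>For a proper rectangle the four edges are distinct objects, so the sum over the set has
  four terms.\<close>

lemma sum_edges:
  assumes "proper T" shows "(\<Sum>e\<in>edges T. F e) = (\<Sum>z\<in>UNIV. F (rect_edge T z True) + F (rect_edge T z False))"
proof (cases T)
  case (Rect a b c d)
  then have "a < b" "c < d" using assms by (auto simp: proper_def dest: spec[of _ True] spec[of _ False])
  then show ?thesis using Rect by (simp add: edges_def rect_edge_simps UNIV_bool add_ac)
qed

lemma edge_integral_const_rect_edge:
  assumes "proper T" shows "edge_integral (rect_edge T z up) (\<lambda>_. k) = k * cell_len T (\<not> z)"
  using cell_len_pos[OF assms, of "\<not> z"]
  by (simp add: rect_edge_def edge_integral_edg cell_len_def)

lemma edge_length_rect_edge: "edge_length (rect_edge T z up) = cell_len T (\<not> z)"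
  by (simp add: rect_edge_def cell_len_def)

lemma bd_inner_const:
  assumes "proper T"
  shows "bd_inner T (\<lambda>e _. f e) (\<lambda>e _. g e) = (\<Sum>z\<in>UNIV. cell_len T (\<not> z) * (ev T f z True * ev T g z True + ev T f z False * ev T g z False))"
  unfolding bd_inner_def sum_edges[OF assms] edge_integral_const_rect_edge[OF assms]
  by (simp add: UNIV_bool algebra_simps)

lemma cell_crect: "cell T = crect True (rect_lo T True) (rect_hi T True) (rect_lo T False) (rect_hi T False)"
  by (cases T) (simp add: crect_True)

lemma interior_cell: "interior (cell T) = ob (rect_lo T) (rect_hi T)"
  unfolding cell_crect ob_def crect_cbox orect_box by (rule interior_cbox)

lemma cell_sets [simp]: "cell T \<in> sets lebesgue" unfolding cell_crect by simp

lemma integral_cell_const: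
  assumes "proper T" shows "(LINT p:cell T|lebesgue. k) = k * cell_area T"
proof -
  have "(LINT p:cell T|lebesgue. k) = (\<integral>t. (\<integral>s. k \<partial>lebesgue_on {rect_lo T True..rect_hi T True}) \<partial>lebesgue_on {rect_lo T False..rect_hi T False})"
  proof -
    have "(LINT p:cell T|lebesgue. k) = (\<integral>p. k \<partial>lebesgue_on (cell T))"
      by (rule set_integral_eq_lebesgue_on) simp
    also have "\<dots> = (\<integral>t. (\<integral>s. k \<partial>lebesgue_on {rect_lo T True..rect_hi T True}) \<partial>lebesgue_on {rect_lo T False..rect_hi T False})"
      unfolding cell_crect by (rule integral_crect_iterated) simp
    finally show ?thesis .
  qed
  then show ?thesis using cell_len_pos[OF assms, of True] cell_len_pos[OF assms, of False]
    by (simp add: cell_area_def cell_len_def mult.commute)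
qed

text \<open>The boundary of the cell is a null set, and f is controlled only almost everywhere
  inside. Its measurability follows from that of g because Lebesgue measure is complete.\<close>

lemma integral_cell_AE:
  fixes f g :: "point \<Rightarrow> real"
  assumes "AE p in lebesgue_on (ob (rect_lo T) (rect_hi T)). f p = g p" "g \<in> borel_measurable (lebesgue_on (ob (rect_lo T) (rect_hi T)))"
  shows "(LINT p:cell T|lebesgue. f p) = integral\<^sup>L (lebesgue_on (ob (rect_lo T) (rect_hi T))) g"
proof -
  let ?O = "ob (rect_lo T) (rect_hi T)"
  have O: "?O \<in> sets lebesgue" by (simp add: ob_def)
  have mg: "(\<lambda>p. indicator ?O p *\<^sub>R g p) \<in> borel_measurable lebesgue"
    using assms(2) O by (simp add: borel_measurable_restrict_space_iff)
  have "AE p in lebesgue. p \<notin> cell T - ?O"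
    unfolding cell_crect ob_def by (rule AE_not_in) (use negligible_crect_diff in \<open>simp add: negligible_iff_null_sets\<close>)
  moreover have "AE p in lebesgue. p \<in> ?O \<longrightarrow> f p = g p" using assms(1) O by (simp add: AE_restrict_space_iff)
  ultimately have ae: "AE p in lebesgue. indicator ?O p *\<^sub>R g p = indicator (cell T) p *\<^sub>R f p"
  proof eventually_elim
    case (elim p)
    then show ?case using subsetD[OF interior_subset[of "cell T"], of p] unfolding interior_cell
      by (cases "p \<in> ?O"; cases "p \<in> cell T") auto
  qed
  have mf: "(\<lambda>p. indicator (cell T) p *\<^sub>R f p) \<in> borel_measurable lebesgue"
    by (rule borel_measurable_AE[OF mg ae])
  have "integral\<^sup>L lebesgue (\<lambda>p. indicator (cell T) p *\<^sub>R f p) = integral\<^sup>L lebesgue (\<lambda>p. indicator ?O p *\<^sub>R g p)"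
    using ae by (intro integral_cong_AE[OF mf mg]) (auto elim: AE_mp)
  then show ?thesis using O by (simp add: set_lebesgue_integral_def integral_restrict_space)
qed

section \<open>The discrete gradient\<close>

lemma vec2_eq: "(\<forall>\<psi>. c \<bullet> \<psi> = x * \<psi> $ 1 + y * \<psi> $ 2) \<longleftrightarrow> c = (vector [x, y] :: real ^ 2)"
proof
  assume *: "\<forall>\<psi>. c \<bullet> \<psi> = x * \<psi> $ 1 + y * \<psi> $ 2"
  have "c $ 1 = x" "c $ 2 = y"
    using *[rule_format, of "vector [1, 0]"] *[rule_format, of "vector [0, 1]"] by (simp_all add: inner_vec_def sum_2)
  then show "c = vector [x, y]" by (simp add: vec_eq_iff forall_2)
qed (simp add: inner_vec_def sum_2)

lemma divergence_const: "divergence (\<lambda>_. \<psi>) p = 0"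
  by (simp add: divergence_def dx_def dy_def split_beta)

lemma normal_rect_edge:
  assumes "proper T"
  shows "normal T (rect_edge T True up) = vector [if up then 1 else - 1, 0]" "normal T (rect_edge T False up) = vector [0, if up then 1 else - 1]"
proof -
  obtain a b c d where T: "T = Rect a b c d" by (cases T)
  then have "a < b" "c < d" using assms by (auto simp: proper_def dest: spec[of _ True] spec[of _ False])
  then show "normal T (rect_edge T True up) = vector [if up then 1 else - 1, 0]" "normal T (rect_edge T False up) = vector [0, if up then 1 else - 1]"
    unfolding T rect_edge_simps normal_def by auto
qed

text \<open>The divergence of a constant field vanishes, which removes the interior part. What
  remains is a linear functional of the field, and it determines the vector uniquely.\<close>

lemma discrete_grad_eq:
  assumes T: "proper T"
  shows "discrete_grad (v0, w) T = vector [cell_grad T w True, cell_grad T w False]"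
proof -
  have "(LINT p:cell T|lebesgue. c \<bullet> \<psi>) = - (LINT p:cell T|lebesgue. v0 T p * divergence (\<lambda>_. \<psi>) p)
          + bd_inner T (\<lambda>e _. w e) (\<lambda>e _. \<psi> \<bullet> normal T e)
      \<longleftrightarrow> c \<bullet> \<psi> = cell_grad T w True * \<psi> $ 1 + cell_grad T w False * \<psi> $ 2" for c \<psi>
  proof -
    have "bd_inner T (\<lambda>e _. w e) (\<lambda>e _. \<psi> \<bullet> normal T e)
        = cell_len T False * (ev T w True True - ev T w True False) * \<psi> $ 1 + cell_len T True * (ev T w False True - ev T w False False) * \<psi> $ 2"
      unfolding bd_inner_const[OF T] normal_rect_edge[OF T] UNIV_bool
      by (simp add: normal_rect_edge[OF T] inner_vec_def sum_2 algebra_simps)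
    also have "\<dots> = (cell_grad T w True * \<psi> $ 1 + cell_grad T w False * \<psi> $ 2) * cell_area T"
      using cell_len_pos[OF T, of True] cell_len_pos[OF T, of False] by (simp add: cell_grad_def cell_area_def field_simps)
    finally show ?thesis
      using cell_area_pos[OF T] by (simp add: integral_cell_const[OF T] divergence_const)
  qed
  then show ?thesis
    unfolding discrete_grad_def fst_conv snd_conv by (simp add: vec2_eq)
qed

section \<open>Affine functions and the extension\<close>

lemma integral_affine_line:
  fixes A B :: real
  assumes "s \<le> t" shows "(\<integral>r. A + B * r \<partial>lebesgue_on {s..t}) = (t - s) * (A + B * ((s + t) / 2))"
proof -
  have "(\<integral>r. A + B * r \<partial>lebesgue_on {s..t}) = (A * t + B * t\<^sup>2 / 2) - (A * s + B * s\<^sup>2 / 2)"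
    by (rule integral_line_FTC[OF assms]) (auto intro!: derivative_eq_intros continuous_intros)
  then show ?thesis by (simp add: field_simps power2_eq_square)
qed

definition aff :: "real \<Rightarrow> (bool \<Rightarrow> real) \<Rightarrow> point \<Rightarrow> real" where "aff c g p = c + (\<Sum>y\<in>UNIV. g y * co y p)"

lemma P1_aff: "\<phi> \<in> P1 \<longleftrightarrow> (\<exists>c g. \<phi> = aff c g)"
proof
  assume "\<phi> \<in> P1"
  then obtain c0 c1 c2 where "\<And>x y. \<phi> (x, y) = c0 + c1 * x + c2 * y" by (auto simp: P1_def)
  then have "\<phi> = aff c0 (\<lambda>y. if y then c1 else c2)" by (auto simp: aff_def UNIV_bool co_def fun_eq_iff)
  then show "\<exists>c g. \<phi> = aff c g" by blast
next
  assume "\<exists>c g. \<phi> = aff c g"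
  then obtain c g where "\<phi> = aff c g" by blast
  then have "\<forall>x y. \<phi> (x, y) = c + g True * x + g False * y" by (simp add: aff_def UNIV_bool co_def)
  then show "\<phi> \<in> P1" unfolding P1_def by blast
qed

lemma Qb_aff:
  assumes T: "proper T"
  shows "Qb (aff c g) (rect_edge T z up) = c + g z * (if up then rect_hi T z else rect_lo T z) + g (\<not> z) * cell_ctr T (\<not> z)"
proof -
  let ?e = "if up then rect_hi T z else rect_lo T z"
  have "aff c g (pt z ?e r) = (c + g z * ?e) + g (\<not> z) * r" for r
    by (cases z) (simp_all add: aff_def UNIV_bool co_def pt_def)
  then have "edge_integral (rect_edge T z up) (aff c g) = cell_len T (\<not> z) * (c + g z * ?e + g (\<not> z) * cell_ctr T (\<not> z))"
    using cell_len_pos[OF T, of "\<not> z"]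
    by (simp only: rect_edge_def edge_integral_edg) (subst integral_affine_line, simp_all add: cell_len_def cell_ctr_def)
  then show ?thesis using cell_len_pos[OF T, of "\<not> z"] by (simp add: Qb_def edge_length_rect_edge)
qed

text \<open>The two averages in either direction have the value at the centre as their mean, so the
  alternating sum vanishes.\<close>

lemma cell_dif_Qb_P1:
  assumes T: "proper T" and "\<phi> \<in> P1" shows "cell_dif T (Qb \<phi>) = 0"
proof -
  obtain c g where "\<phi> = aff c g" using assms(2) P1_aff by blast
  then show ?thesis by (simp add: cell_dif_def Qb_aff[OF T] cell_ctr_def field_simps)
qed

lemma cell_ext_aff: "cell_ext T w = aff ((ev T w True True + ev T w True False) / 2 - cell_weight T * cell_dif T w / cell_len T False
    - (\<Sum>y\<in>UNIV. cell_grad T w y * cell_ctr T y)) (cell_grad T w)"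
  by (rule ext) (simp add: cell_ext_def aff_def UNIV_bool algebra_simps)

lemma cell_ext_P1: "cell_ext T w \<in> P1"
  using cell_ext_aff P1_aff by blast

lemma cell_weight_sum: "proper T \<Longrightarrow> cell_weight T / cell_len T True + cell_weight T / cell_len T False = 1 / 2"
  unfolding cell_weight_def cell_area_def by (rule harmonic_half[OF cell_len_pos cell_len_pos])

lemma Qb_cell_ext:
  assumes T: "proper T"
  shows "Qb (cell_ext T w) (rect_edge T z up) = ev T w z up - (if z then 1 else - 1) * cell_weight T * cell_dif T w / cell_len T (\<not> z)"
proof -
  have h: "cell_grad T w y * rect_hi T y = cell_grad T w y * cell_ctr T y + (ev T w y True - ev T w y False) / 2"
    "cell_grad T w y * rect_lo T y = cell_grad T w y * cell_ctr T y - (ev T w y True - ev T w y False) / 2" for y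
    using cell_len_pos[OF T, of y] by (simp_all add: cell_grad_def cell_ctr_def cell_len_def field_simps)
  have e: "cell_grad T w z * (if up then rect_hi T z else rect_lo T z)
      = cell_grad T w z * cell_ctr T z + (if up then 1 else - 1) * ((ev T w z True - ev T w z False) / 2)"
    using h[of z] by (cases up) (simp_all add: diff_divide_distrib)
  have m: "(ev T w True True + ev T w True False) / 2 - cell_weight T * cell_dif T w / cell_len T False
      = (ev T w z True + ev T w z False) / 2 - (if z then 1 else - 1) * cell_weight T * cell_dif T w / cell_len T (\<not> z)"
  proof (cases z)
    case False
    have "cell_dif T w * (cell_weight T / cell_len T True + cell_weight T / cell_len T False) = cell_dif T w / 2" unfolding cell_weight_sum[OF T] by simp
    then have "cell_weight T * cell_dif T w / cell_len T True + cell_weight T * cell_dif T w / cell_len T False = cell_dif T w / 2"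
      by (simp add: algebra_simps)
    moreover have "cell_dif T w / 2 = (ev T w True True + ev T w True False) / 2 - (ev T w False True + ev T w False False) / 2"
      by (simp add: cell_dif_def diff_divide_distrib add_divide_distrib)
    ultimately show ?thesis using False by simp
  qed simp
  have s: "(\<Sum>y\<in>UNIV. cell_grad T w y * cell_ctr T y) = cell_grad T w z * cell_ctr T z + cell_grad T w (\<not> z) * cell_ctr T (\<not> z)"
    by (cases z) (simp_all add: UNIV_bool)
  show ?thesis unfolding cell_ext_aff Qb_aff[OF T] m e s by (simp add: field_simps)
qed

lemma bd_inner_P1_right:
  assumes T: "proper T"
  shows "bd_inner T (\<lambda>_. s) (\<lambda>e _. r e) = (\<Sum>z\<in>UNIV. cell_len T (\<not> z) * (Qb s (rect_edge T z True) * ev T r z True + Qb s (rect_edge T z False) * ev T r z False))"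
    and "bd_inner T (\<lambda>e _. r e) (\<lambda>_. s) = (\<Sum>z\<in>UNIV. cell_len T (\<not> z) * (ev T r z True * Qb s (rect_edge T z True) + ev T r z False * Qb s (rect_edge T z False)))"
proof -
  have e: "edge_integral (rect_edge T z up) s = cell_len T (\<not> z) * Qb s (rect_edge T z up)" for z up
    using cell_len_pos[OF T, of "\<not> z"] by (simp add: Qb_def edge_length_rect_edge)
  have l: "edge_integral (rect_edge T z up) (\<lambda>p. s p * k) = edge_integral (rect_edge T z up) s * k"
    "edge_integral (rect_edge T z up) (\<lambda>p. k * s p) = k * edge_integral (rect_edge T z up) s" for z up k
    by (simp_all add: rect_edge_def edge_integral_edg)
  show "bd_inner T (\<lambda>_. s) (\<lambda>e _. r e) = (\<Sum>z\<in>UNIV. cell_len T (\<not> z) * (Qb s (rect_edge T z True) * ev T r z True + Qb s (rect_edge T z False) * ev T r z False))"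
    "bd_inner T (\<lambda>e _. r e) (\<lambda>_. s) = (\<Sum>z\<in>UNIV. cell_len T (\<not> z) * (ev T r z True * Qb s (rect_edge T z True) + ev T r z False * Qb s (rect_edge T z False)))"
    unfolding bd_inner_def sum_edges[OF T] l e by (simp_all add: UNIV_bool algebra_simps)
qed

text \<open>The residual of the closed form is orthogonal to the averages of affine functions. For
  uniqueness, the difference of two solutions is used as test function, so all its edge averages
  vanish, and four zero averages make an affine function zero.\<close>

lemma extension_eq:
  assumes T: "proper T" shows "extension w T = cell_ext T w"
  unfolding extension_def
proof (rule the_equality)
  \<comment> \<open>Multiplied by the edge length the residual has the same size on all four edges,
    with a sign depending on the direction only. It therefore acts on r through the alternating
    sum.\<close>
  have orth: "(\<Sum>z\<in>UNIV. cell_len T (\<not> z) * (Qb (cell_ext T w) (rect_edge T z True) * r z True + Qb (cell_ext T w) (rect_edge T z False) * r z False))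
      = (\<Sum>z\<in>UNIV. cell_len T (\<not> z) * (ev T w z True * r z True + ev T w z False * r z False))
        - cell_weight T * cell_dif T w * (r True True + r True False - r False True - r False False)" for r :: "bool \<Rightarrow> bool \<Rightarrow> real"
    unfolding Qb_cell_ext[OF T] using cell_len_pos[OF T, of True] cell_len_pos[OF T, of False]
    by (simp add: UNIV_bool field_simps)
  show cond: "cell_ext T w \<in> P1 \<and> (\<forall>\<phi>\<in>P1. bd_inner T (\<lambda>_. cell_ext T w) (\<lambda>e _. Qb \<phi> e) = bd_inner T (\<lambda>e _. w e) (\<lambda>_. \<phi>))"
  proof (intro conjI ballI cell_ext_P1)
    fix \<phi> assume \<phi>: "\<phi> \<in> P1"
    show "bd_inner T (\<lambda>_. cell_ext T w) (\<lambda>e _. Qb \<phi> e) = bd_inner T (\<lambda>e _. w e) (\<lambda>_. \<phi>)"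
      unfolding bd_inner_P1_right[OF T] orth[of "\<lambda>z up. Qb \<phi> (rect_edge T z up)"] using cell_dif_Qb_P1[OF T \<phi>] by (simp add: cell_dif_def)
  qed
  fix s assume s: "s \<in> P1 \<and> (\<forall>\<phi>\<in>P1. bd_inner T (\<lambda>_. s) (\<lambda>e _. Qb \<phi> e) = bd_inner T (\<lambda>e _. w e) (\<lambda>_. \<phi>))"
  obtain c g where sa: "s = aff c g" using s P1_aff by blast
  obtain c' g' where ca: "cell_ext T w = aff c' g'" using cell_ext_P1 P1_aff by blast
  define \<phi> where "\<phi> = aff (c - c') (\<lambda>y. g y - g' y)"
  have \<phi>: "\<phi> \<in> P1" unfolding \<phi>_def P1_aff by blast
  have Q\<phi>: "Qb \<phi> (rect_edge T z up) = Qb s (rect_edge T z up) - Qb (cell_ext T w) (rect_edge T z up)" for z up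
    unfolding \<phi>_def sa ca Qb_aff[OF T] by (simp add: algebra_simps)
  have "bd_inner T (\<lambda>_. s) (\<lambda>e _. Qb \<phi> e) = bd_inner T (\<lambda>_. cell_ext T w) (\<lambda>e _. Qb \<phi> e)"
    using s cond \<phi> by simp
  then have "(\<Sum>z\<in>UNIV. cell_len T (\<not> z) * ((Qb \<phi> (rect_edge T z True))\<^sup>2 + (Qb \<phi> (rect_edge T z False))\<^sup>2)) = 0"
    unfolding bd_inner_P1_right[OF T] Q\<phi> by (simp add: UNIV_bool algebra_simps power2_eq_square)
  moreover have "0 \<le> cell_len T (\<not> z) * ((Qb \<phi> (rect_edge T z True))\<^sup>2 + (Qb \<phi> (rect_edge T z False))\<^sup>2)" for z
    using cell_len_pos[OF T, of "\<not> z"] by simp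
  ultimately have zz: "cell_len T (\<not> z) * ((Qb \<phi> (rect_edge T z True))\<^sup>2 + (Qb \<phi> (rect_edge T z False))\<^sup>2) = 0" for z
    using sum_nonneg_eq_0_iff[of UNIV "\<lambda>z. cell_len T (\<not> z) * ((Qb \<phi> (rect_edge T z True))\<^sup>2 + (Qb \<phi> (rect_edge T z False))\<^sup>2)"] by simp
  have Q0: "Qb \<phi> (rect_edge T z up) = 0" for z up
    using zz[of z] cell_len_pos[OF T, of "\<not> z"] by (cases up) (simp_all add: sum_power2_eq_zero_iff)
  have "g z = g' z" for z
  proof -
    have "X * (r - l) = 0" if "C + X * r + D = 0" "C + X * l + D = 0" for C D X r l :: real
    proof -
      have "X * (r - l) = (C + X * r + D) - (C + X * l + D)" by (simp add: algebra_simps)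
      then show ?thesis unfolding that by simp
    qed
    then have "(g z - g' z) * (rect_hi T z - rect_lo T z) = 0"
      using Q0[of z True] Q0[of z False] unfolding \<phi>_def Qb_aff[OF T] if_True if_False by blast
    then show ?thesis using cell_len_pos[OF T, of z] by (simp add: cell_len_def)
  qed
  then have gg: "g = g'" by (rule ext)
  have "c = c'" using Q0[of True True] unfolding \<phi>_def Qb_aff[OF T] gg by simp
  then show "s = cell_ext T w" unfolding sa ca gg by simp
qed

lemma bd_inner_defect:
  assumes T: "proper T"
  shows "bd_inner T (\<lambda>e _. f e) (\<lambda>e _. w e - Qb (extension w T) e) = cell_weight T * cell_dif T f * cell_dif T w"
  unfolding bd_inner_const[OF T] extension_eq[OF T] Qb_cell_ext[OF T]
  using cell_len_pos[OF T, of True] cell_len_pos[OF T, of False] by (simp add: UNIV_bool cell_dif_def field_simps)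

text \<open>The alternating sum annihilates the averages of the affine function \<phi>. This removes
  the interior part of the discrete solution from the stabilizer.\<close>

lemma bd_inner_stabilizer:
  assumes T: "proper T" and "\<phi> \<in> P1"
  shows "bd_inner T (\<lambda>e _. f e - Qb \<phi> e) (\<lambda>e _. w e - Qb (extension w T) e) = cell_weight T * cell_dif T f * cell_dif T w"
  using bd_inner_defect[OF T, of "\<lambda>e. f e - Qb \<phi> e" w] cell_dif_Qb_P1[OF assms] by (simp add: cell_dif_def)

lemma bd_inner_seminorm:
  assumes T: "proper T"
  shows "bd_inner T (\<lambda>e _. Qb (extension w T) e - w e) (\<lambda>e _. Qb (extension w T) e - w e) = cell_weight T * (cell_dif T w)\<^sup>2"
proof -
  have "bd_inner T (\<lambda>e _. w e - Qb (extension w T) e) (\<lambda>e _. w e - Qb (extension w T) e) = cell_weight T * cell_dif T w * cell_dif T w"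
    by (rule bd_inner_stabilizer[OF T]) (simp add: extension_eq[OF T] cell_ext_P1)
  moreover have "(a - b) * (a - b) = (b - a) * (b - a)" for a b :: real by (simp add: algebra_simps)
  ultimately show ?thesis unfolding bd_inner_def by (simp add: power2_eq_square)
qed

section \<open>The weak Galerkin problem\<close>

text \<open>Both derivatives refer to the same function u. Testing the lower one with
  \<open>pd z \<phi>\<close> gives the integral that defines the higher one, and the two powers of
  -1 differ by one sign.\<close>

lemma weak_deriv_chain:
  assumes v: "has_weak_deriv R i j u v" and R: "R \<in> sets lebesgue"
    and w: "has_weak_deriv R (if z then Suc i else i) (if z then j else Suc j) u w"
  shows "wd z R v w"
proof -
  have "(\<integral>p. v p * pd z \<phi> p \<partial>lebesgue_on R) = - (\<integral>p. w p * \<phi> p \<partial>lebesgue_on R)" if \<phi>: "\<phi> \<in> test_functions R" for \<phi>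
  proof -
    have "(dx ^^ i) ((dy ^^ j) (pd z \<phi>)) = (dx ^^ (if z then Suc i else i)) ((dy ^^ (if z then j else Suc j)) \<phi>)"
      using dy_funpow_dx[OF test_function_smooth[OF \<phi>], of j] by (simp add: pd_def funpow_swap1)
    moreover have "(\<integral>p. u p * (dx ^^ i) ((dy ^^ j) (pd z \<phi>)) p \<partial>lebesgue_on R) = (- 1) ^ (i + j) * (\<integral>p. v p * pd z \<phi> p \<partial>lebesgue_on R)"
      using v R test_function_pd[OF \<phi>, of z] by (simp add: has_weak_deriv_def set_integral_eq_lebesgue_on)
    moreover have "(\<integral>p. u p * (dx ^^ (if z then Suc i else i)) ((dy ^^ (if z then j else Suc j)) \<phi>) p \<partial>lebesgue_on R)
        = (- 1) ^ Suc (i + j) * (\<integral>p. w p * \<phi> p \<partial>lebesgue_on R)"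
      using w R \<phi> by (cases z) (simp_all add: has_weak_deriv_def set_integral_eq_lebesgue_on)
    ultimately have "(- 1) ^ (i + j) * (\<integral>p. v p * pd z \<phi> p \<partial>lebesgue_on R) = (- 1) ^ (i + j) * (- (\<integral>p. w p * \<phi> p \<partial>lebesgue_on R))"
      by simp
    then show ?thesis by (subst (asm) mult_cancel_left) simp
  qed
  then show ?thesis using v w R by (simp add: wd_iff has_weak_deriv_def L2_eq_sq_int)
qed

lemma sq_int_split:
  fixes f :: "'a::euclidean_space \<Rightarrow> real"
  assumes A: "sq_int (lebesgue_on A) f" "A \<in> sets lebesgue" and B: "sq_int (lebesgue_on B) f" "B \<in> sets lebesgue"
    and S: "S \<in> sets lebesgue" "A \<subseteq> S" "B \<subseteq> S" "A \<inter> B = {}" "negligible (S - (A \<union> B))"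
  shows "sq_int (lebesgue_on S) f"
proof -
  have m: "(\<lambda>p. indicator A p *\<^sub>R f p + indicator B p *\<^sub>R f p) \<in> borel_measurable lebesgue"
    using A B by (intro borel_measurable_add) (simp_all add: sq_int_def borel_measurable_restrict_space_iff)
  have i: "integrable lebesgue (\<lambda>p. indicator A p *\<^sub>R (f p)\<^sup>2 + indicator B p *\<^sub>R (f p)\<^sup>2)"
    using A B by (intro Bochner_Integration.integrable_add) (simp_all add: sq_int_def integrable_restrict_space)
  have out: "AE p in lebesgue. p \<notin> S - (A \<union> B)"
    using S(5) by (intro AE_not_in) (simp add: negligible_iff_null_sets)
  have ae: "AE p in lebesgue. indicator A p *\<^sub>R f p + indicator B p *\<^sub>R f p = indicator S p *\<^sub>R f p"
    "AE p in lebesgue. indicator A p *\<^sub>R (f p)\<^sup>2 + indicator B p *\<^sub>R (f p)\<^sup>2 = indicator S p *\<^sub>R (f p)\<^sup>2"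
    subgoal using out by eventually_elim (use S(2-4) in \<open>auto simp: indicator_def\<close>)
    subgoal using out by eventually_elim (use S(2-4) in \<open>auto simp: indicator_def\<close>)
    done
  have mS: "(\<lambda>p. indicator S p *\<^sub>R f p) \<in> borel_measurable lebesgue" by (rule borel_measurable_AE[OF m ae(1)])
  have mS2: "(\<lambda>p. indicator S p *\<^sub>R (f p)\<^sup>2) \<in> borel_measurable lebesgue"
    by (rule borel_measurable_AE[OF borel_measurable_integrable[OF i] ae(2)])
  have "integrable lebesgue (\<lambda>p. indicator S p *\<^sub>R (f p)\<^sup>2)"
    using i integrable_cong_AE[OF borel_measurable_integrable[OF i] mS2 ae(2)] by simp
  then show ?thesis using mS S(1) by (simp add: sq_int_def borel_measurable_restrict_space_iff integrable_restrict_space)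
qed

section \<open>Grids and telescoping sums\<close>

lemma grid_less:
  assumes "grid n x" "i < j" "j \<le> n" shows "x i < x j"
  using assms(2,3)
proof (induction j)
  case (Suc j)
  then have "x j < x (Suc j)" using assms(1) by (simp add: grid_def)
  then show ?case using Suc by (cases "i = j") auto
qed simp

lemma grid_bounds: "grid n x \<Longrightarrow> i \<le> n \<Longrightarrow> 0 \<le> x i \<and> x i \<le> 1"
  using grid_less[of n x 0 i] grid_less[of n x i n] by (cases "i = 0"; cases "i = n") (auto simp: grid_def)

text \<open>F is the flux at the far edge of a cell and G the one at its near edge; equal fluxes of
  neighbours and zero weights at both ends leave nothing.\<close>

lemma telescope_flux:
  fixes w :: "nat \<Rightarrow> real"
  assumes "w 0 = 0" "w n = 0" "\<And>i. Suc i < n \<Longrightarrow> F i = G (Suc i)"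
  shows "(\<Sum>i<n. w (Suc i) * F i - w i * G i) = 0"
proof -
  \<comment> \<open>Set to 0 at n, where there is no further cell and \<open>G n\<close> carries no
    information.\<close>
  define H where "H i = (if i < n then w i * G i else 0)" for i
  have "(\<Sum>i<n. w (Suc i) * F i - w i * G i) = (\<Sum>i<n. H (Suc i) - H i)"
  proof (rule sum.cong[OF refl])
    fix i assume "i \<in> {..<n}"
    then show "w (Suc i) * F i - w i * G i = H (Suc i) - H i"
      using assms by (cases "Suc i < n") (auto simp: H_def less_Suc_eq not_less_eq dest: le_antisym)
  qed
  also have "\<dots> = H n - H 0" by (rule sum_lessThan_telescope)
  finally show ?thesis using assms(1) by (simp add: H_def)
qed

text \<open>\<open>nb\<close> turns directions into orders of differentiation with respect to the first variable.\<close>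

definition nb :: "bool \<Rightarrow> nat" where "nb z = (if z then 1 else 0)"

lemma nb_simps [simp]: "nb True = 1" "nb False = 0" by (simp_all add: nb_def)

lemma nb_le: "nb z \<le> 1" by (simp add: nb_def)

definition ix :: "bool \<Rightarrow> 2" where "ix z = (if z then 1 else 2)"

locale wg_problem =
  fixes \<rho> \<alpha> \<beta> h :: real and n m :: nat and x y :: "nat \<Rightarrow> real" and a :: "point \<Rightarrow> real ^ 2 ^ 2"
    and f g u :: "point \<Rightarrow> real" and wb ub eb :: "edge \<Rightarrow> real" and u0 :: "rect \<Rightarrow> point \<Rightarrow> real" and M :: "rect set"
  assumes \<rho>: "\<rho> > 0" and \<alpha>: "\<alpha> > 0" and gx: "grid n x" and gy: "grid m y"
    and M: "M = rect_partition n x m y" and h: "h = mesh_size M"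
    and adm: "admissible_coefficient \<alpha> \<beta> M a" and uH: "u \<in> Hspace 3 unit_square"
    and ex: "exact_solution a f g u" and cor: "is_correction \<rho> M a u wb"
    and wg: "wg_solution \<rho> M a f (\<lambda>e. Qb g e + h\<^sup>2 * wb e) (u0, ub)"
    and eb: "eb = (\<lambda>e. (Qb_trace unit_square u e + h\<^sup>2 * wb e) - ub e)"
begin

definition "R i j = Rect (x i) (x (Suc i)) (y j) (y (Suc j))"

text \<open>Only the number of derivatives in each variable enters, so mixed derivatives taken in
  different orders are literally the same representative.\<close>

definition "U1 z = weak_deriv usq (nb z) (1 - nb z) u"
definition "U2 z w = weak_deriv usq (nb z + nb w) (2 - (nb z + nb w)) u"
definition "U3 z w v = weak_deriv usq (nb z + nb w + nb v) (3 - (nb z + nb w + nb v)) u"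

abbreviation "cO T \<equiv> ob (rect_lo T) (rect_hi T)"

text \<open>The constant value on the open cell, read off at the centre; on the edges the
  coefficient is not tied to either neighbour.\<close>

definition "aT T = a (cell_ctr T True, cell_ctr T False)"
definition "AT T z w = aT T $ ix z $ ix w"

lemma M_R: "T \<in> M \<longleftrightarrow> (\<exists>i j. i < n \<and> j < m \<and> T = R i j)"
  by (auto simp: M rect_partition_def R_def)

lemma cell_range:
  assumes "T \<in> M" shows "rect_lo T z < rect_hi T z" "0 \<le> rect_lo T z" "rect_hi T z \<le> 1"
proof -
  obtain i j where T: "i < n" "j < m" "T = R i j" using assms M_R by blast
  then show "rect_lo T z < rect_hi T z" "0 \<le> rect_lo T z" "rect_hi T z \<le> 1"
    using grid_less[OF gx, of i "Suc i"] grid_less[OF gy, of j "Suc j"] grid_bounds[OF gx, of i] grid_bounds[OF gx, of "Suc i"]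
      grid_bounds[OF gy, of j] grid_bounds[OF gy, of "Suc j"] by (auto simp: R_def)
qed

lemma proper_M: "T \<in> M \<Longrightarrow> proper T"
  by (simp add: proper_def cell_range)

lemma n_pos: "0 < n" and m_pos: "0 < m"
  using gx gy by (cases n; cases m; auto simp: grid_def)+

lemma R_in_M: "i < n \<Longrightarrow> j < m \<Longrightarrow> R i j \<in> M"
  using M_R by blast

lemma M_image: "M = (\<lambda>(i, j). R i j) ` ({..<n} \<times> {..<m})"
  using M_R by auto

lemma finite_M: "finite M" unfolding M_image by simp

lemma sum_M: "(\<Sum>T\<in>M. F T) = (\<Sum>i<n. \<Sum>j<m. F (R i j))"
proof -
  have "inj_on (\<lambda>(i, j). R i j) ({..<n} \<times> {..<m})"
  proof (rule inj_onI, clarsimp simp: R_def)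
    fix i j i' j' assume "i < n" "j < m" "i' < n" "j' < m" "x i = x i'" "y j = y j'"
    then show "i = i' \<and> j = j'"
      using grid_less[OF gx, of i i'] grid_less[OF gx, of i' i] grid_less[OF gy, of j j'] grid_less[OF gy, of j' j]
      by (metis less_irrefl less_imp_le linorder_neqE_nat)
  qed
  then show ?thesis unfolding M_image by (subst sum.reindex) (simp_all add: sum.cartesian_product split_beta o_def)
qed

lemma h_bound: assumes "T \<in> M" shows "cell_len T z \<le> h"
proof -
  let ?p = "(rect_lo T True, rect_lo T False)" and ?q = "pt z (rect_hi T z) (rect_lo T (\<not> z))"
  have "?p \<in> cell T" "?q \<in> cell T"
    using cell_range(1)[OF assms, of True] cell_range(1)[OF assms, of False]
    unfolding cell_crect crect_def by (cases z; simp add: co_def pt_def)+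
  moreover have "bounded (cell T)" unfolding cell_crect by (rule compact_imp_bounded[OF compact_crect])
  ultimately have "dist ?p ?q \<le> diameter (cell T)" by (intro diameter_bounded_bound)
  moreover have "dist ?p ?q = cell_len T z"
    using cell_range(1)[OF assms, of z] by (cases z) (simp_all add: pt_def dist_prod_def cell_len_def dist_real_def)
  moreover have "diameter (cell T) \<le> h"
    unfolding h mesh_size_def using assms finite_M by (intro Max_ge) auto
  ultimately show ?thesis by simp
qed

lemma h_pos: "h > 0"
  using h_bound[OF R_in_M[OF n_pos m_pos], of True] cell_len_pos[OF proper_M[OF R_in_M[OF n_pos m_pos]], of True] by simp

lemma O_usq: "T \<in> M \<Longrightarrow> cO T \<subseteq> usq"
  unfolding ob_def by (intro orect_subset_usq cell_range)

lemma O_sets [simp]: "cO T \<in> sets lebesgue" by (simp add: ob_def)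

section \<open>Derivatives of the exact solution and the equation on the cells\<close>

lemma weak_derivs: "i + j \<le> 3 \<Longrightarrow> has_weak_deriv usq i j u (weak_deriv usq i j u)"
  using uH unfolding Hspace_def unit_square_usq by (auto intro: weak_deriv_works)

lemma wd_u: "wd z usq u (U1 z)"
proof -
  have "sq_int (lebesgue_on usq) u" using weak_derivs[of 0 0] by (simp add: has_weak_deriv_def L2_eq_sq_int)
  then have "has_weak_deriv usq 0 0 u u" by (simp add: has_weak_deriv_0)
  then show ?thesis by (rule weak_deriv_chain) (use weak_derivs[of 1 0] weak_derivs[of 0 1] in \<open>auto simp: U1_def\<close>)
qed

lemma wd_U1: "wd z usq (U1 w) (U2 w z)"
  unfolding U1_def by (rule weak_deriv_chain[OF weak_derivs])
    (cases z; cases w; auto simp: U2_def numeral_2_eq_2 intro!: weak_derivs)+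

lemma wd_U2: "wd z usq (U2 v w) (U3 v w z)"
  unfolding U2_def by (rule weak_deriv_chain[OF weak_derivs])
    (cases z; cases v; cases w; auto simp: U3_def numeral_2_eq_2 numeral_3_eq_3 intro!: weak_derivs)+

lemma H1_u: "\<exists>\<phi>. H1_lim usq \<phi> u U1" and H1_U1: "\<exists>\<phi>. H1_lim usq \<phi> (U1 w) (U2 w)" and H1_U2: "\<exists>\<phi>. H1_lim usq \<phi> (U2 v w) (U3 v w)"
  using smooth_dense_H1[OF wd_u] smooth_dense_H1[OF wd_U1] smooth_dense_H1[OF wd_U2] by metis+

lemma center_in: assumes "T \<in> M" shows "(cell_ctr T True, cell_ctr T False) \<in> cO T"
  using cell_range(1)[OF assms, of True] cell_range(1)[OF assms, of False]
  by (simp add: ob_def orect_def co_def cell_ctr_def)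

lemma a_const: assumes "T \<in> M" "p \<in> cO T" shows "a p = aT T"
proof -
  have "a constant_on interior (cell T)" using adm assms(1) by (simp add: admissible_coefficient_def)
  then show ?thesis using assms center_in[OF assms(1)] unfolding interior_cell constant_on_def aT_def by metis
qed

lemma AT_le: assumes "T \<in> M" shows "\<bar>AT T z w\<bar> \<le> \<bar>\<beta>\<bar>"
proof -
  have "(cell_ctr T True, cell_ctr T False) \<in> unit_square"
    using center_in[OF assms] O_usq[OF assms] unfolding unit_square_usq by blast
  then have "\<bar>AT T z w\<bar> \<le> \<beta>" using adm unfolding admissible_coefficient_def AT_def aT_def by blast
  then show ?thesis by simp
qed

lemma quadratic_AT: assumes "T \<in> M"
  shows "\<alpha> * (\<Sum>z\<in>UNIV. (\<gamma> z)\<^sup>2) \<le> (\<Sum>z\<in>UNIV. \<Sum>w\<in>UNIV. AT T z w * \<gamma> w * \<gamma> z)"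
proof -
  have "(cell_ctr T True, cell_ctr T False) \<in> unit_square"
    using center_in[OF assms] O_usq[OF assms] unfolding unit_square_usq by blast
  then have "\<alpha> * (\<xi> \<bullet> \<xi>) \<le> \<xi> \<bullet> (aT T *v \<xi>)" for \<xi> :: "real ^ 2"
    using adm unfolding admissible_coefficient_def aT_def by blast
  from this[of "vector [\<gamma> True, \<gamma> False]"] show ?thesis
    by (simp add: inner_vec_def sum_2 matrix_vector_mult_def UNIV_bool AT_def ix_def power2_eq_square algebra_simps)
qed

lemma H3: assumes "T \<in> M" shows "H3_cell (rect_lo T) (rect_hi T) u U1 U2 U3 (AT T) \<bar>\<beta>\<bar>"
  by unfold_locales (use cell_range[OF assms] H1_u H1_U1 H1_U2 AT_le[OF assms] in auto)

definition "cq T z p = (\<Sum>w\<in>UNIV. AT T z w * U1 w p)"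
definition "cQ T z v p = (\<Sum>w\<in>UNIV. AT T z w * U2 w v p)"

lemma flux_cell: assumes "T \<in> M" "p \<in> cO T" shows "flux a u p $ ix z = cq T z p"
  unfolding flux_def a_const[OF assms] cq_def weak_grad_def unit_square_usq
  by (simp add: matrix_vector_mult_def sum_2 UNIV_bool AT_def ix_def U1_def add.commute)

lemma wd_cq: assumes "T \<in> M" shows "wd z (cO T) (cq T v) (cQ T v z)"
proof -
  have "wd z (cO T) (\<lambda>p. AT T v True * U1 True p + AT T v False * U1 False p) (\<lambda>p. AT T v True * U2 True z p + AT T v False * U2 False z p)"
    unfolding ob_def by (intro wd_lincomb wd_subset[OF wd_U1] O_usq[OF assms, unfolded ob_def]) auto
  then show ?thesis unfolding cq_def[abs_def] cQ_def[abs_def] by (simp add: UNIV_bool add.commute)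
qed

lemma flux_inner: "flux a u p \<bullet> vector [dx \<phi> p, dy \<phi> p] = (\<Sum>z\<in>UNIV. flux a u p $ ix z * pd z \<phi> p)"
  by (simp add: inner_vec_def sum_2 UNIV_bool ix_def pd_def)

lemma weak_equation:
  assumes "S \<subseteq> usq" "S \<in> sets lebesgue" and \<phi>: "\<phi> \<in> test_functions S"
  shows "(\<integral>p. (\<Sum>z\<in>UNIV. flux a u p $ ix z * pd z \<phi> p) \<partial>lebesgue_on S) = (\<integral>p. f p * \<phi> p \<partial>lebesgue_on S)"
proof -
  have "\<phi> \<in> test_functions unit_square" using \<phi> test_functions_mono[OF assms(1)] unit_square_usq by auto
  then have "(\<integral>p. (\<Sum>z\<in>UNIV. flux a u p $ ix z * pd z \<phi> p) \<partial>lebesgue_on usq) = (\<integral>p. f p * \<phi> p \<partial>lebesgue_on usq)"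
    using ex unfolding exact_solution_def flux_inner unit_square_usq by (simp add: set_integral_eq_lebesgue_on)
  moreover have "(\<integral>p. (\<Sum>z\<in>UNIV. flux a u p $ ix z * pd z \<phi> p) \<partial>lebesgue_on S) = (\<integral>p. (\<Sum>z\<in>UNIV. flux a u p $ ix z * pd z \<phi> p) \<partial>lebesgue_on usq)"
    "(\<integral>p. f p * \<phi> p \<partial>lebesgue_on S) = (\<integral>p. f p * \<phi> p \<partial>lebesgue_on usq)"
    using test_function_outside[OF \<phi>] test_function_outside[OF test_function_pd[OF \<phi>]]
    by (intro integral_lebesgue_on_supported assms; simp)+
  ultimately show ?thesis by simp
qed

lemma sq_int_f: "S \<subseteq> usq \<Longrightarrow> S \<in> sets lebesgue \<Longrightarrow> sq_int (lebesgue_on S) f"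
  using ex unfolding exact_solution_def unit_square_usq by (auto simp: L2_eq_sq_int intro: sq_int_subset)

text \<open>Inside a cell the coefficient is constant, so the flux has weak derivatives there and
  the distributional equation, tested within the cell, becomes an identity almost
  everywhere.\<close>

lemma f_divergence:
  assumes T: "T \<in> M" shows "AE p in lebesgue_on (cO T). f p = - (\<Sum>z\<in>UNIV. cQ T z z p)"
proof -
  let ?M = "lebesgue_on (cO T)"
  have s: "sq_int ?M (cq T z)" "sq_int ?M (cQ T z z)" for z using wd_cq[OF T, of z z] by (simp_all add: wd_iff)
  have sf: "sq_int ?M f" by (rule sq_int_f[OF O_usq[OF T]]) simp
  have "AE p in ?M. f p + (\<Sum>z\<in>UNIV. cQ T z z p) = 0"
    unfolding ob_def
  proof (rule test_functions_separate, unfold ob_def[symmetric])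
    show "sq_int ?M (\<lambda>p. f p + (\<Sum>z\<in>UNIV. cQ T z z p))" by (intro sq_int_add sf sq_int_sum s)
    fix \<phi> assume \<phi>: "\<phi> \<in> test_functions (cO T)"
    have t: "sq_int ?M \<phi>" "sq_int ?M (pd z \<phi>)" for z
      unfolding ob_def by (rule test_function_sq_int[OF \<phi>] test_function_sq_int[OF test_function_pd[OF \<phi>]])+
    have i: "integrable ?M (\<lambda>p. cq T z p * pd z \<phi> p)" "integrable ?M (\<lambda>p. cQ T z z p * \<phi> p)" "integrable ?M (\<lambda>p. f p * \<phi> p)" for z
      by (intro sq_int_mult s t sf)+
    have "(\<integral>p. f p * \<phi> p \<partial>?M) = (\<integral>p. (\<Sum>z\<in>UNIV. cq T z p * pd z \<phi> p) \<partial>?M)"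
      unfolding weak_equation[OF O_usq[OF T] O_sets \<phi>, symmetric]
      by (intro Bochner_Integration.integral_cong) (simp_all add: flux_cell[OF T])
    also have "\<dots> = (\<Sum>z\<in>UNIV. \<integral>p. cq T z p * pd z \<phi> p \<partial>?M)" using i by simp
    also have "\<dots> = (\<Sum>z\<in>UNIV. - (\<integral>p. cQ T z z p * \<phi> p \<partial>?M))"
      using wd_cq[OF T] \<phi> by (intro sum.cong) (auto simp: wd_iff)
    finally have "(\<integral>p. f p * \<phi> p \<partial>?M) + (\<Sum>z\<in>UNIV. \<integral>p. cQ T z z p * \<phi> p \<partial>?M) = 0" by (simp add: sum_negf)
    then show "(\<integral>p. (f p + (\<Sum>z\<in>UNIV. cQ T z z p)) * \<phi> p \<partial>?M) = 0"
      using i by (simp add: distrib_right sum_distrib_right)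
  qed
  then show ?thesis by eventually_elim simp
qed

lemma wd_flux: assumes "T \<in> M" shows "wd z (cO T) (\<lambda>p. flux a u p $ ix v) (cQ T v z)"
proof -
  have sq: "sq_int (lebesgue_on (cO T)) (cq T v)" using wd_cq[OF assms] by (simp add: wd_iff)
  have "cq T v \<in> borel_measurable (lebesgue_on (cO T)) \<longleftrightarrow> (\<lambda>p. flux a u p $ ix v) \<in> borel_measurable (lebesgue_on (cO T))"
    using flux_cell[OF assms] by (intro measurable_cong) simp
  then have m: "(\<lambda>p. flux a u p $ ix v) \<in> borel_measurable (lebesgue_on (cO T))" using sq_int_measurable[OF sq] by simp
  have ae: "AE p in lebesgue_on (cO T). cq T v p = flux a u p $ ix v" using flux_cell[OF assms] by (intro AE_I2) simp
  show ?thesis using wd_cong_AE[OF wd_cq[OF assms, unfolded ob_def] m[unfolded ob_def] ae[unfolded ob_def]] unfolding ob_def .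
qed

text \<open>The integral of the normal flux over an edge, computed from inside T by the formula for
  edge averages.\<close>

definition "cell_flux T z up = (\<Sum>w\<in>UNIV. AT T z w * (\<integral>p. U1 w p + (co z p - (if up then rect_lo T z else rect_hi T z)) * U2 w z p \<partial>lebesgue_on (cO T))) / cell_len T z"

text \<open>Both cells see the same traces \<open>gv\<close> and \<open>gw\<close> of the two first
  derivatives of u, since these belong to H^1 of the square. Only the coefficients jump, and the
  weak equation on the union of the cells equates the two combinations.\<close>

lemma flux_match:
  assumes T: "T1 \<in> M" "T2 \<in> M" and adj: "rect_hi T1 z = rect_lo T2 z" "rect_lo T1 (\<not> z) = rect_lo T2 (\<not> z)" "rect_hi T1 (\<not> z) = rect_hi T2 (\<not> z)"
  shows "cell_flux T1 z True = cell_flux T2 z False"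
proof -
  let ?a = "rect_lo T1 z" and ?b = "rect_hi T1 z" and ?e = "rect_hi T2 z" and ?c = "rect_lo T1 (\<not> z)" and ?d = "rect_hi T1 (\<not> z)"
  have cell: "0 \<le> ?a" "?a < ?b" "?b < ?e" "?e \<le> 1" "0 \<le> ?c" "?c < ?d" "?d \<le> 1"
    using cell_range[OF T(1), of z] cell_range[OF T(1), of "\<not> z"] cell_range[OF T(2), of z] adj(1) by simp_all
  have O1: "cO T1 = orect z ?a ?b ?c ?d" by (rule ob_orect)
  have O2: "cO T2 = orect z ?b ?e ?c ?d" using ob_orect[of "rect_lo T2" "rect_hi T2" z] adj by simp
  let ?S = "orect z ?a ?e ?c ?d"
  have S: "?S \<subseteq> usq" using cell by (intro orect_subset_usq) auto
  have sub: "cO T1 \<subseteq> ?S" "cO T2 \<subseteq> ?S" "cO T1 \<inter> cO T2 = {}" unfolding O1 O2 using cell by (auto simp: orect_def)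
  have neg: "negligible (?S - (cO T1 \<union> cO T2))"
  proof (rule negligible_subset[OF negligible_Un[OF negligible_crect_diff[of z ?a ?b ?c ?d] negligible_crect_diff[of z ?b ?e ?c ?d]]])
    show "?S - (cO T1 \<union> cO T2) \<subseteq> (crect z ?a ?b ?c ?d - orect z ?a ?b ?c ?d) \<union> (crect z ?b ?e ?c ?d - orect z ?b ?e ?c ?d)"
      unfolding O1 O2 by (auto simp: orect_def crect_def)
  qed
  have sflux: "sq_int (lebesgue_on ?S) (\<lambda>p. flux a u p $ ix w)" for w
    by (rule sq_int_split[OF _ O_sets _ O_sets orect_sets sub neg]) (use T wd_flux in \<open>auto simp: wd_iff\<close>)
  obtain \<phi> where H: "H1_lim usq \<phi> (U1 True) (U2 True)" using H1_U1 by blast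
  obtain \<psi> where H': "H1_lim usq \<psi> (U1 False) (U2 False)" using H1_U1 by blast
  obtain gv where gv: "L2_lim (lebesgue_on {0..1}) (\<lambda>k t. \<phi> k (pt z ?b t)) gv"
    using line_trace_exists[OF H, of ?b z] cell by auto
  obtain gw where gw: "L2_lim (lebesgue_on {0..1}) (\<lambda>k t. \<psi> k (pt z ?b t)) gw"
    using line_trace_exists[OF H', of ?b z] cell by auto
  have cd: "{?c..?d} \<subseteq> {0..1}" using cell by auto
  note gv' = L2_lim_line_subset[OF gv cd] and gw' = L2_lim_line_subset[OF gw cd]
  have div: "AE p in lebesgue_on (cO T). f p = - (AT T z True * U2 True z p + AT T z False * U2 False z p
      + AT T (\<not> z) True * U2 True (\<not> z) p + AT T (\<not> z) False * U2 False (\<not> z) p)" if "T \<in> M" for T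
    using f_divergence[OF that] by eventually_elim (cases z; simp add: cQ_def UNIV_bool)
  have q: "flux a u p $ ix z = AT T z True * U1 True p + AT T z False * U1 False p
      \<and> flux a u p $ ix (\<not> z) = AT T (\<not> z) True * U1 True p + AT T (\<not> z) False * U1 False p" if "T \<in> M" "p \<in> cO T" for T p
    unfolding flux_cell[OF that] cq_def by (simp add: UNIV_bool)
  have jump: "AT T1 z True * (\<integral>t. gv t \<partial>lebesgue_on {?c..?d}) + AT T1 z False * (\<integral>t. gw t \<partial>lebesgue_on {?c..?d})
    = AT T2 z True * (\<integral>t. gv t \<partial>lebesgue_on {?c..?d}) + AT T2 z False * (\<integral>t. gw t \<partial>lebesgue_on {?c..?d})"
  proof (rule flux_jump_zero[OF H H' cell sflux sflux sq_int_f[OF S orect_sets] _ _ _ _ _ gv' gw'])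
    show "flux a u p $ ix z = AT T1 z True * U1 True p + AT T1 z False * U1 False p
      \<and> flux a u p $ ix (\<not> z) = AT T1 (\<not> z) True * U1 True p + AT T1 (\<not> z) False * U1 False p" if "p \<in> orect z ?a ?b ?c ?d" for p
      by (rule q[OF T(1)]) (use that O1 in simp)
    show "flux a u p $ ix z = AT T2 z True * U1 True p + AT T2 z False * U1 False p
      \<and> flux a u p $ ix (\<not> z) = AT T2 (\<not> z) True * U1 True p + AT T2 (\<not> z) False * U1 False p" if "p \<in> orect z ?b ?e ?c ?d" for p
      by (rule q[OF T(2)]) (use that O2 in simp)
    show "AE p in lebesgue_on (orect z ?a ?b ?c ?d). f p = - (AT T1 z True * U2 True z p + AT T1 z False * U2 False z p
      + AT T1 (\<not> z) True * U2 True (\<not> z) p + AT T1 (\<not> z) False * U2 False (\<not> z) p)" using div[OF T(1)] unfolding O1 .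
    show "AE p in lebesgue_on (orect z ?b ?e ?c ?d). f p = - (AT T2 z True * U2 True z p + AT T2 z False * U2 False z p
      + AT T2 (\<not> z) True * U2 True (\<not> z) p + AT T2 (\<not> z) False * U2 False (\<not> z) p)" using div[OF T(2)] unfolding O2 .
    show "(\<integral>p. flux a u p $ ix z * pd z \<phi> p + flux a u p $ ix (\<not> z) * pd (\<not> z) \<phi> p \<partial>lebesgue_on ?S) = (\<integral>p. f p * \<phi> p \<partial>lebesgue_on ?S)"
      if "\<phi> \<in> test_functions ?S" for \<phi>
      using weak_equation[OF S orect_sets that] by (cases z) (simp_all add: UNIV_bool add.commute)
  qed
  have u: "orect z ?a ?b ?c ?d \<subseteq> usq" "orect z ?b ?e ?c ?d \<subseteq> usq" using O_usq[OF T(1)] O_usq[OF T(2)] unfolding O1 O2 by auto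
  have "cell_flux T1 z True = AT T1 z True * (\<integral>t. gv t \<partial>lebesgue_on {?c..?d}) + AT T1 z False * (\<integral>t. gw t \<partial>lebesgue_on {?c..?d})"
    unfolding line_integral_upper[OF H orect_sets u(1) cell(2) gv'] line_integral_upper[OF H' orect_sets u(1) cell(2) gw'] cell_flux_def O1
    by (simp add: UNIV_bool cell_len_def add_divide_distrib add.commute)
  moreover have "cell_flux T2 z False = AT T2 z True * (\<integral>t. gv t \<partial>lebesgue_on {?c..?d}) + AT T2 z False * (\<integral>t. gw t \<partial>lebesgue_on {?c..?d})"
  proof -
    have r: "v - (?e - s) * w = v + (s - ?e) * w" for v s w :: real by (simp add: algebra_simps)
    show ?thesis
      unfolding line_integral_lower[OF H orect_sets u(2) cell(3) gv'] line_integral_lower[OF H' orect_sets u(2) cell(3) gw'] cell_flux_def O2 r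
      by (simp add: UNIV_bool cell_len_def adj add_divide_distrib add.commute)
  qed
  ultimately show ?thesis using jump by simp
qed

end

section \<open>The error estimate\<close>

text \<open>The three summands bound the gradient of the correction, the moments of the load and the
  alternating part. The absolute value makes the constant positive for every real \<beta>.\<close>

definition err_const :: "real \<Rightarrow> real \<Rightarrow> real" where
  "err_const \<rho> \<beta> = 4 * \<bar>\<beta>\<bar> * (1 + \<bar>\<beta>\<bar> / \<rho>) + 4 * \<bar>\<beta>\<bar> + 16 * (\<rho> + \<bar>\<beta>\<bar>) / sqrt \<rho>"

lemma err_const_pos: "\<rho> > 0 \<Longrightarrow> err_const \<rho> \<beta> > 0"
  unfolding err_const_def by (intro add_nonneg_pos add_nonneg_nonneg) (auto intro!: divide_pos_pos mult_nonneg_nonneg add_nonneg_nonneg)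

lemma pt_in_frontier:
  "pt z s t \<in> frontier unit_square \<longleftrightarrow> s \<in> {0..1} \<and> t \<in> {0..1} \<and> \<not> (s \<in> {0<..<1} \<and> t \<in> {0<..<1})"
proof -
  have "(1 / 2, 1 / 2) \<in> box (0, 0) (1 :: real, 1 :: real)" by (simp add: orect_box[symmetric] orect_def co_def)
  then have "box (0, 0) (1 :: real, 1 :: real) \<noteq> {}" by blast
  then have "frontier unit_square = crect True 0 1 0 1 - usq"
    unfolding unit_square_usq orect_box crect_cbox by (simp add: frontier_box)
  then show ?thesis by (cases z) (auto simp: crect_def orect_def co_def pt_def)
qed

lemma rect_edge_in_edges: "rect_edge T z up \<in> edges T"
  by (cases T; cases z; cases up) (simp_all add: rect_edge_simps edges_def)

lemma edges_rect_edge: "e \<in> edges T \<Longrightarrow> \<exists>z up. e = rect_edge T z up"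
proof -
  assume "e \<in> edges T"
  then have "e \<in> {rect_edge T True False, rect_edge T True True, rect_edge T False False, rect_edge T False True}"
    by (cases T) (simp add: edges_def rect_edge_simps)
  then show ?thesis by blast
qed

lemma edge_set_rect_edge: "edge_set (rect_edge T z up) = pt z (if up then rect_hi T z else rect_lo T z) ` {rect_lo T (\<not> z)..rect_hi T (\<not> z)}"
  by (auto simp: edge_set_def rect_edge_def)

context wg_problem
begin

text \<open>\<open>pe\<close> is the modified projection of \<open>u\<close>; by \<open>Qb_trace_tr\<close> below, \<open>trc\<close> is an edge average computed
  from inside the cell.\<close>

definition "trc T v vz z up = (\<integral>p. v p + (co z p - (if up then rect_lo T z else rect_hi T z)) * vz p \<partial>lebesgue_on (cO T)) / cell_area T"
definition "cQ2 T z v w p = (\<Sum>s\<in>UNIV. AT T z s * U3 s v w p)"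
definition "pe e = Qb_trace unit_square u e + h\<^sup>2 * wb e"
definition "cell_seminorm T = sqrt (\<Sum>r\<in>UNIV. \<Sum>s\<in>UNIV. \<Sum>t\<in>UNIV. \<integral>p. (U3 r s t p)\<^sup>2 \<partial>lebesgue_on (cO T))"

lemma cell_area_dir: "cell_area T = cell_len T z * cell_len T (\<not> z)"
  by (cases z) (simp_all add: cell_area_def)

lemma Qb_trace_tr:
  assumes T: "T \<in> M" and H: "\<exists>\<phi>. H1_lim usq \<phi> v vd"
    and R: "a' \<le> b'" "c' \<le> d'" "orect x' a' b' c' d' \<subseteq> usq" "cO T \<subseteq> orect x' a' b' c' d'"
    and v': "v' \<in> borel_measurable (lebesgue_on (orect x' a' b' c' d'))" "AE p in lebesgue_on (orect x' a' b' c' d'). v p = v' p"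
  shows "Qb_trace (orect x' a' b' c' d') v' (rect_edge T z up) = trc T v (vd z) z up"
proof -
  obtain \<phi> where \<phi>: "H1_lim usq \<phi> v vd" using H by blast
  have sub: "orect z (rect_lo T z) (rect_hi T z) (rect_lo T (\<not> z)) (rect_hi T (\<not> z)) \<subseteq> orect x' a' b' c' d'"
    using R(4) unfolding ob_orect[of "rect_lo T" "rect_hi T" z] .
  note q = Qb_trace_cell[OF \<phi> R(1-3) sub v' cell_range(2)[OF T] cell_range(1)[OF T] cell_range(3)[OF T]
      cell_range(2)[OF T] cell_range(1)[OF T] cell_range(3)[OF T]]
  have r: "k - (rect_hi T z - s) * w = k + (s - rect_hi T z) * w" for k s w :: real by (simp add: algebra_simps)
  show ?thesis
    using q unfolding rect_edge_def trc_def cell_area_dir[of T z] cell_len_def ob_orect[of "rect_lo T" "rect_hi T" z] r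
    by (cases up) simp_all
qed

lemma usq_measurable: "U2 v w \<in> borel_measurable (lebesgue_on usq)" "u \<in> borel_measurable (lebesgue_on usq)"
  using wd_U2[of True v w] wd_u[of True] by (simp_all add: wd_iff sq_int_measurable)

lemma Qb_trace_u: "T \<in> M \<Longrightarrow> Qb_trace unit_square u (rect_edge T z up) = trc T u (U1 z) z up"
  unfolding unit_square_usq by (rule Qb_trace_tr) (use H1_u O_usq usq_measurable in auto)

lemma Qb_trace_U2: "T \<in> M \<Longrightarrow> Qb_trace unit_square (U2 v w) (rect_edge T z up) = trc T (U2 v w) (U3 v w z) z up"
  unfolding unit_square_usq by (rule Qb_trace_tr) (use H1_U2 O_usq usq_measurable in auto)

lemma H1_cQ: "\<exists>\<phi>. H1_lim usq \<phi> (cQ T v w) (cQ2 T v w)"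
proof -
  obtain \<phi> \<psi> where "H1_lim usq \<phi> (U2 True w) (U3 True w)" "H1_lim usq \<psi> (U2 False w) (U3 False w)"
    using H1_U2 by metis
  from H1_lim_lincomb[OF this, of "AT T v True" "AT T v False"]
  show ?thesis unfolding cQ_def[abs_def] cQ2_def[abs_def] by (auto simp: UNIV_bool add.commute)
qed

text \<open>On the cell the derivative of the flux equals \<open>cQ T v v\<close> almost everywhere.
  This combination with the coefficients of T lies in H^1 of the whole square, so the trace exists
  although the flux may jump at the edge.\<close>

lemma Qb_trace_flux:
  assumes T: "T \<in> M"
  shows "Qb_trace (cO T) (weak_deriv (cO T) (nb v) (1 - nb v) (\<lambda>p. flux a u p $ ix v)) (rect_edge T z up)
    = trc T (cQ T v v) (cQ2 T v v z) z up"
proof -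
  let ?w = "weak_deriv (cO T) (nb v) (1 - nb v) (\<lambda>p. flux a u p $ ix v)"
  have nbv: "(if v then 1 else 0) = nb v" "(if v then 0 else 1) = 1 - nb v" by (cases v; simp)+
  have W: "has_weak_deriv (cO T) (nb v) (1 - nb v) (\<lambda>p. flux a u p $ ix v) (cQ T v v)"
    using wd_flux[OF T, of v v] unfolding wd_def nbv .
  have "sq_int (lebesgue_on (cO T)) ?w" using weak_deriv_works[OF W] by (simp add: has_weak_deriv_def L2_eq_sq_int)
  then have m: "?w \<in> borel_measurable (lebesgue_on (cO T))" by (rule sq_int_measurable)
  have "AE p in lebesgue_on (cO T). ?w p = cQ T v v p"
    using weak_deriv_AE[OF W[unfolded ob_def]] unfolding ob_def .
  then have ae: "AE p in lebesgue_on (cO T). cQ T v v p = ?w p" by eventually_elim simp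
  show ?thesis
    using Qb_trace_tr[OF T H1_cQ less_imp_le[OF cell_range(1)[OF T, of True]] less_imp_le[OF cell_range(1)[OF T, of False]]
        O_usq[OF T, unfolded ob_def] _ m[unfolded ob_def] ae[unfolded ob_def]]
    unfolding ob_def by simp
qed

lemma wb_eq:
  assumes T: "T \<in> M"
  shows "wb (rect_edge T z up) = 1 / 12 * cell_len T (\<not> z) * inverse \<rho> * inverse h *
    (\<rho> * inverse h * cell_len T (\<not> z) * trc T (U2 (\<not> z) (\<not> z)) (U3 (\<not> z) (\<not> z) z) z up
      - 6 * trc T (cQ T (\<not> z) (\<not> z)) (cQ2 T (\<not> z) (\<not> z) z) z up)"
proof -
  have U: "U2 False False = weak_deriv unit_square 0 2 u" "U2 True True = weak_deriv unit_square 2 0 u"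
    by (simp_all add: U2_def unit_square_usq numeral_2_eq_2)
  have m: "rect_edge T True up \<in> {left_edge T, right_edge T}" "rect_edge T False up \<in> {bottom_edge T, top_edge T}"
    by (cases T; cases up; simp add: rect_edge_simps)+
  note c = bspec[OF cor[unfolded is_correction_def Let_def interior_cell h[symmetric]] T]
  have "wb (rect_edge T z up) = 1 / 12 * cell_len T (\<not> z) * inverse \<rho> * inverse h *
    (\<rho> * inverse h * cell_len T (\<not> z) * Qb_trace unit_square (U2 (\<not> z) (\<not> z)) (rect_edge T z up)
      - 6 * Qb_trace (cO T) (weak_deriv (cO T) (nb (\<not> z)) (1 - nb (\<not> z)) (\<lambda>p. flux a u p $ ix (\<not> z))) (rect_edge T z up))"
    using bspec[OF conjunct1[OF c] m(1)] bspec[OF conjunct2[OF c] m(2)]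
    by (cases z) (simp_all add: U edge_length_rect_edge ix_def)
  then show ?thesis unfolding Qb_trace_U2[OF T] Qb_trace_flux[OF T] .
qed

text \<open>Translates the estimate on an abstract cell into the language of edges;
  \<open>pe\<close> is split into the averages of u and the correction.\<close>

lemma cell_bound:
  assumes T: "T \<in> M"
  shows "\<bar>(\<Sum>r\<in>UNIV. \<Sum>s\<in>UNIV. cell_area T * (AT T r s * cell_grad T pe s * cell_grad T w r)) + \<rho> / h * cell_weight T * cell_dif T pe * cell_dif T w
      + (\<Sum>r\<in>UNIV. \<integral>p. cQ T r r p * cell_ext T w p \<partial>lebesgue_on (cO T))
      - (\<Sum>r\<in>UNIV. ev T w r True * cell_flux T r True - ev T w r False * cell_flux T r False)\<bar>
    \<le> err_const \<rho> \<beta> * h\<^sup>2 * cell_seminorm T *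
      (sqrt (cell_area T * (\<Sum>r\<in>UNIV. (cell_grad T w r)\<^sup>2)) + sqrt (\<rho> * inverse h * (cell_weight T * (cell_dif T w)\<^sup>2)))"
proof -
  interpret c: H3_cell "rect_lo T" "rect_hi T" u U1 U2 U3 "AT T" "\<bar>\<beta>\<bar>" by (rule H3[OF T])
  have len: "c.len = cell_len T" by (rule ext) (simp add: c.len_def cell_len_def)
  have ctr: "c.ctr = cell_ctr T" by (rule ext) (simp add: c.ctr_def cell_ctr_def)
  have ar: "c.ar = cell_area T" by (simp add: c.ar_def cell_area_def len)
  have kk: "c.kk = cell_weight T" by (simp add: c.kk_def cell_weight_def len ar)
  have dg: "c.dg (ev T w') = cell_grad T w'" for w' by (rule ext) (simp add: c.dg_def cell_grad_def len)
  have dif: "c.dif (ev T w') = cell_dif T w'" for w' by (simp add: c.dif_def cell_dif_def)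
  have ex: "c.ext (ev T w) = cell_ext T w" by (rule ext) (simp only: c.ext_def cell_ext_def dif dg len ctr kk)
  have q: "c.q = cq T" "c.Q = cQ T" "c.Q2 = cQ2 T"
    by (simp_all add: fun_eq_iff c.q_def cq_def c.Q_def cQ_def c.Q2_def cQ2_def)
  have tr: "c.tr = trc T" by (simp add: fun_eq_iff c.tr_def trc_def ar)
  have nrm: "c.nrm = cell_seminorm T" by (simp add: c.nrm_def cell_seminorm_def)
  have flx: "c.flx = cell_flux T"
  proof (intro ext)
    fix z up
    let ?k = "if up then rect_lo T z else rect_hi T z"
    have i: "integrable c.cellM (\<lambda>p. U1 s p + (co z p - ?k) * U2 s z p)" for s
      by (intro Bochner_Integration.integrable_add c.integrable_cell c.integrable_mult_cell c.sq_int_U1 c.sq_int_U2 continuous_intros co_continuous)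
    have "(\<integral>p. cq T z p + (co z p - ?k) * cQ T z z p \<partial>c.cellM)
        = (\<integral>p. (\<Sum>s\<in>UNIV. AT T z s * (U1 s p + (co z p - ?k) * U2 s z p)) \<partial>c.cellM)"
      by (simp add: cq_def cQ_def UNIV_bool algebra_simps)
    also have "\<dots> = (\<Sum>s\<in>UNIV. AT T z s * (\<integral>p. U1 s p + (co z p - ?k) * U2 s z p \<partial>c.cellM))"
      using i by simp
    finally show "c.flx z up = cell_flux T z up"
      unfolding c.flx_def tr q len trc_def cell_flux_def cell_area_dir[of T z] using cell_len_pos[OF proper_M[OF T], of "\<not> z"] by simp
  qed
  have corr: "c.corr \<rho> h = ev T wb"
    by (intro ext) (simp only: c.corr_def c.tu_def c.tq_def len tr q wb_eq[OF T])
  have pe: "pe (rect_edge T z up) = trc T u (U1 z) z up + h\<^sup>2 * wb (rect_edge T z up)" for z up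
    unfolding pe_def Qb_trace_u[OF T] ..
  have gpe: "cell_grad T pe y = c.dg (\<lambda>z. trc T u (U1 z) z) y + h\<^sup>2 * c.dg (ev T wb) y" for y
    unfolding cell_grad_def pe c.dg_def len by (simp add: add_divide_distrib diff_divide_distrib right_diff_distrib)
  have dpe: "cell_dif T pe = c.dif (\<lambda>z. trc T u (U1 z) z) + h\<^sup>2 * c.dif (ev T wb)"
    unfolding cell_dif_def pe c.dif_def by (simp add: algebra_simps)
  have lh: "c.len z \<le> h" for z unfolding len by (rule h_bound[OF T])
  show ?thesis
    using c.cell_error[OF \<rho> h_pos lh, of "ev T w"]
    unfolding tr corr gpe[symmetric] dpe[symmetric]
    unfolding ar kk dg dif ex q flx nrm err_const_def[symmetric] gpe[symmetric] .
qed

text \<open>The midpoint of an edge has a tangential coordinate strictly between 0 and 1, so it can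
  lie on the boundary only if the normal coordinate is 0 or 1. The strict order of the two ends
  decides which of the two.\<close>

lemma boundary_rect_edge:
  assumes T: "T \<in> M"
  shows "rect_edge T z up \<in> boundary_edges M \<longleftrightarrow> (if up then rect_hi T z = 1 else rect_lo T z = 0)"
proof -
  let ?c = "if up then rect_hi T z else rect_lo T z" and ?t = "(rect_lo T (\<not> z) + rect_hi T (\<not> z)) / 2"
  note cr = cell_range[OF T, of z] cell_range[OF T, of "\<not> z"]
  have "rect_edge T z up \<in> boundary_edges M \<longleftrightarrow> (\<forall>t\<in>{rect_lo T (\<not> z)..rect_hi T (\<not> z)}. pt z ?c t \<in> frontier unit_square)"
    using rect_edge_in_edges[of T z up] T by (auto simp only: boundary_edges_def edge_set_rect_edge mem_Collect_eq image_subset_iff UN_iff)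
  also have "\<dots> \<longleftrightarrow> ?c = 0 \<or> ?c = 1"
  proof
    assume "\<forall>t\<in>{rect_lo T (\<not> z)..rect_hi T (\<not> z)}. pt z ?c t \<in> frontier unit_square"
    then have "pt z ?c ?t \<in> frontier unit_square" by (rule bspec) (use cr in simp)
    moreover have "?t \<in> {0<..<1}" using cr by simp
    ultimately have "?c \<in> {0..1} \<and> ?c \<notin> {0<..<1}" unfolding pt_in_frontier by blast
    then show "?c = 0 \<or> ?c = 1" by (auto simp del: if_split_asm split del: if_split)
  qed (use cr in \<open>auto simp: pt_in_frontier\<close>)
  also have "\<dots> \<longleftrightarrow> (if up then rect_hi T z = 1 else rect_lo T z = 0)" using cr by auto
  finally show ?thesis .
qed

text \<open>The datum g is a trace of u on a full side of the square. Its average over the edge and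
  the average of the chosen trace of u are given by the same integral over the adjacent
  cell.\<close>

lemma eb_boundary:
  assumes T: "T \<in> M" and b: "if up then rect_hi T z = 1 else rect_lo T z = 0"
  shows "eb (rect_edge T z up) = 0"
proof -
  have tr: "has_trace usq u (edg z (if up then 1 else 0) 0 1) g"
  proof -
    have "edg z (if up then 1 else 0) 0 1 \<in> edges (Rect 0 1 0 1)" by (cases z; cases up) (simp_all add: edg_def edges_def)
    then show ?thesis using ex unfolding exact_solution_def unit_square_usq by blast
  qed
  have cd: "{rect_lo T (\<not> z)..rect_hi T (\<not> z)} \<subseteq> {0..1}" using cell_range[OF T, of "\<not> z"] by auto
  have sub: "orect z (rect_lo T z) (rect_hi T z) (rect_lo T (\<not> z)) (rect_hi T (\<not> z)) \<subseteq> usq"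
    using O_usq[OF T] unfolding ob_orect[of "rect_lo T" "rect_hi T" z] .
  have r: "k - (rect_hi T z - s) * w = k + (s - rect_hi T z) * w" for k s w :: real by (simp add: algebra_simps)
  have "Qb g (rect_edge T z up) = trc T u (U1 z) z up"
  proof (cases up)
    case True
    then have "has_trace usq u (edg z (rect_hi T z) 0 1) g" using tr b by simp
    from edge_integral_trace_upper[OF this _ _ sub wd_u cell_range(1)[OF T] cd] show ?thesis
      using True by (simp add: Qb_def rect_edge_def trc_def cell_area_dir[of T z] cell_len_def ob_orect[of "rect_lo T" "rect_hi T" z])
  next
    case False
    then have "has_trace usq u (edg z (rect_lo T z) 0 1) g" using tr b by simp
    from edge_integral_trace_lower[OF this _ _ sub wd_u cell_range(1)[OF T] cd] show ?thesis
      using False by (simp add: Qb_def rect_edge_def trc_def cell_area_dir[of T z] cell_len_def ob_orect[of "rect_lo T" "rect_hi T" z] r)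
  qed
  moreover have "ub (rect_edge T z up) = Qb g (rect_edge T z up) + h\<^sup>2 * wb (rect_edge T z up)"
    using wg boundary_rect_edge[OF T, of z up] b unfolding wg_solution_def by auto
  ultimately show ?thesis unfolding eb Qb_trace_u[OF T] by simp
qed

lemma eb_boundary_edges: assumes "e \<in> boundary_edges M" shows "eb e = 0"
proof -
  obtain T where T: "T \<in> M" "e \<in> edges T" using assms unfolding boundary_edges_def by blast
  then obtain z up where e: "e = rect_edge T z up" using edges_rect_edge by blast
  show ?thesis using assms unfolding e boundary_rect_edge[OF T(1)] by (rule eb_boundary[OF T(1)])
qed

section \<open>Cancellation of the fluxes and the tested problem\<close>

lemma R_ends [simp]: "rect_lo (R i j) True = x i" "rect_hi (R i j) True = x (Suc i)" "rect_lo (R i j) False = y j" "rect_hi (R i j) False = y (Suc j)"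
  by (simp_all add: R_def)

lemma fluxes_cancel:
  "(\<Sum>T\<in>M. \<Sum>z\<in>UNIV. ev T eb z True * cell_flux T z True - ev T eb z False * cell_flux T z False) = 0"
proof -
  have ends: "x 0 = 0" "x n = 1" "y 0 = 0" "y m = 1" using gx gy by (simp_all add: grid_def)
  have V: "(\<Sum>i<n. ev (R i j) eb True True * cell_flux (R i j) True True - ev (R i j) eb True False * cell_flux (R i j) True False) = 0" if "j < m" for j
  proof -
    have "(\<Sum>i<n. (\<lambda>i. eb (Vert (x i) (y j) (y (Suc j)))) (Suc i) * cell_flux (R i j) True True
        - (\<lambda>i. eb (Vert (x i) (y j) (y (Suc j)))) i * cell_flux (R i j) True False) = 0"
    proof (rule telescope_flux)
      show "eb (Vert (x 0) (y j) (y (Suc j))) = 0"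
        using eb_boundary[OF R_in_M[OF n_pos that], of False True] ends by (simp add: R_def rect_edge_simps)
      obtain k where k: "n = Suc k" using n_pos gr0_implies_Suc by blast
      show "eb (Vert (x n) (y j) (y (Suc j))) = 0"
        using eb_boundary[OF R_in_M[OF _ that, of k], of True True] ends by (simp add: R_def rect_edge_simps k)
      show "cell_flux (R i j) True True = cell_flux (R (Suc i) j) True False" if "Suc i < n" for i
        by (rule flux_match) (use that \<open>j < m\<close> in \<open>auto intro: R_in_M\<close>)
    qed
    then show ?thesis by (simp add: R_def rect_edge_simps)
  qed
  have H: "(\<Sum>j<m. ev (R i j) eb False True * cell_flux (R i j) False True - ev (R i j) eb False False * cell_flux (R i j) False False) = 0" if "i < n" for i
  proof -
    have "(\<Sum>j<m. (\<lambda>j. eb (Horz (y j) (x i) (x (Suc i)))) (Suc j) * cell_flux (R i j) False True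
        - (\<lambda>j. eb (Horz (y j) (x i) (x (Suc i)))) j * cell_flux (R i j) False False) = 0"
    proof (rule telescope_flux)
      show "eb (Horz (y 0) (x i) (x (Suc i))) = 0"
        using eb_boundary[OF R_in_M[OF that m_pos], of False False] ends by (simp add: R_def rect_edge_simps)
      obtain k where k: "m = Suc k" using m_pos gr0_implies_Suc by blast
      show "eb (Horz (y m) (x i) (x (Suc i))) = 0"
        using eb_boundary[OF R_in_M[OF that, of k], of True False] ends by (simp add: R_def rect_edge_simps k)
      show "cell_flux (R i j) False True = cell_flux (R i (Suc j)) False False" if "Suc j < m" for j
        by (rule flux_match) (use that \<open>i < n\<close> in \<open>auto intro: R_in_M\<close>)
    qed
    then show ?thesis by (simp add: R_def rect_edge_simps)
  qed
  have "(\<Sum>i<n. \<Sum>j<m. ev (R i j) eb True True * cell_flux (R i j) True True - ev (R i j) eb True False * cell_flux (R i j) True False) = 0"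
    by (subst sum.swap) (simp add: V)
  moreover have "(\<Sum>i<n. \<Sum>j<m. ev (R i j) eb False True * cell_flux (R i j) False True - ev (R i j) eb False False * cell_flux (R i j) False False) = 0"
    by (simp add: H)
  ultimately show ?thesis unfolding sum_M UNIV_bool by (simp add: sum.distrib)
qed

lemma wg_tested:
  "(\<Sum>T\<in>M. \<Sum>r\<in>UNIV. \<Sum>s\<in>UNIV. cell_area T * (AT T r s * cell_grad T ub s * cell_grad T eb r)) + (\<Sum>T\<in>M. \<rho> / h * cell_weight T * cell_dif T ub * cell_dif T eb)
    = - (\<Sum>T\<in>M. \<Sum>r\<in>UNIV. \<integral>p. cQ T r r p * cell_ext T eb p \<partial>lebesgue_on (cO T))"
proof -
  let ?v = "(\<lambda>T. extension eb T, eb)"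
  have V: "(u0, ub) \<in> Vh M" using wg by (simp add: wg_solution_def)
  have "?v \<in> Vh0 M"
    unfolding Vh0_def Vh_def using eb_boundary_edges extension_eq[OF proper_M] cell_ext_P1 by auto
  then have E: "(\<Sum>T\<in>M. LINT p:cell T|lebesgue. (a p *v discrete_grad (u0, ub) T) \<bullet> discrete_grad ?v T)
      + stabilizer \<rho> M (u0, ub) ?v = (\<Sum>T\<in>M. LINT p:cell T|lebesgue. f p * fst ?v T p)"
    using wg unfolding wg_solution_def by blast
  have 1: "(LINT p:cell T|lebesgue. (a p *v discrete_grad (u0, ub) T) \<bullet> discrete_grad ?v T)
      = (\<Sum>r\<in>UNIV. \<Sum>s\<in>UNIV. cell_area T * (AT T r s * cell_grad T ub s * cell_grad T eb r))" if T: "T \<in> M" for T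
  proof -
    interpret c: H3_cell "rect_lo T" "rect_hi T" u U1 U2 U3 "AT T" "\<bar>\<beta>\<bar>" by (rule H3[OF T])
    let ?k = "\<Sum>r\<in>UNIV. \<Sum>s\<in>UNIV. AT T r s * cell_grad T ub s * cell_grad T eb r"
    have "(a p *v discrete_grad (u0, ub) T) \<bullet> discrete_grad ?v T = ?k" if "p \<in> cO T" for p
      unfolding a_const[OF T that] discrete_grad_eq[OF proper_M[OF T]]
      by (simp add: inner_vec_def sum_2 matrix_vector_mult_def UNIV_bool AT_def ix_def algebra_simps)
    then have "(LINT p:cell T|lebesgue. (a p *v discrete_grad (u0, ub) T) \<bullet> discrete_grad ?v T) = (\<integral>p. ?k \<partial>c.cellM)"
      by (intro integral_cell_AE AE_I2) auto
    also have "\<dots> = ?k * cell_area T"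
      unfolding c.integral_const_cell c.ar_def cell_area_def c.len_def cell_len_def ..
    finally show ?thesis by (simp add: UNIV_bool algebra_simps)
  qed
  \<comment> \<open>Each \<open>u0 T\<close> is affine and the second argument is a residual of the
    extension, so the interior part drops out here.\<close>
  have 2: "stabilizer \<rho> M (u0, ub) ?v = (\<Sum>T\<in>M. \<rho> / h * cell_weight T * cell_dif T ub * cell_dif T eb)"
  proof -
    have "bd_inner T (\<lambda>e _. ub e - Qb (u0 T) e) (\<lambda>e _. eb e - Qb (extension eb T) e) = cell_weight T * cell_dif T ub * cell_dif T eb" if "T \<in> M" for T
      by (rule bd_inner_stabilizer[OF proper_M[OF that]]) (use V that in \<open>simp add: Vh_def\<close>)
    then show ?thesis unfolding stabilizer_def h[symmetric] sum_distrib_left by (simp add: divide_inverse mult.assoc)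
  qed
  have 3: "(LINT p:cell T|lebesgue. f p * fst ?v T p) = - (\<Sum>r\<in>UNIV. \<integral>p. cQ T r r p * cell_ext T eb p \<partial>lebesgue_on (cO T))" if T: "T \<in> M" for T
  proof -
    interpret c: H3_cell "rect_lo T" "rect_hi T" u U1 U2 U3 "AT T" "\<bar>\<beta>\<bar>" by (rule H3[OF T])
    have "continuous_on UNIV (cell_ext T eb)" unfolding cell_ext_def[abs_def] by (intro continuous_intros co_continuous)
    then have "integrable c.cellM (\<lambda>p. cell_ext T eb p * c.Q r r p)" for r by (intro c.integrable_mult_cell c.sq_int_Q)
    then have i: "integrable c.cellM (\<lambda>p. cQ T r r p * cell_ext T eb p)" for r
      by (simp add: c.Q_def cQ_def mult.commute)
    have ae: "AE p in c.cellM. f p * cell_ext T eb p = - (\<Sum>r\<in>UNIV. cQ T r r p * cell_ext T eb p)"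
      using f_divergence[OF T] by eventually_elim (simp add: sum_distrib_right)
    have "(LINT p:cell T|lebesgue. f p * cell_ext T eb p) = (\<integral>p. - (\<Sum>r\<in>UNIV. cQ T r r p * cell_ext T eb p) \<partial>c.cellM)"
      by (rule integral_cell_AE[OF ae]) (use i in \<open>auto intro!: borel_measurable_sum borel_measurable_uminus\<close>)
    also have "\<dots> = - (\<Sum>r\<in>UNIV. \<integral>p. cQ T r r p * cell_ext T eb p \<partial>c.cellM)" using i by simp
    finally show ?thesis by (simp add: extension_eq[OF proper_M[OF T]])
  qed
  show ?thesis using E 1 2 3 by (simp add: sum_negf)
qed

text \<open>\<open>XT\<close> and \<open>YT\<close> are the contributions of one element to the
  squares of the two terms of the error norm.\<close>

definition "XT T = cell_area T * (\<Sum>r\<in>UNIV. (cell_grad T eb r)\<^sup>2)"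
definition "YT T = \<rho> * inverse h * (cell_weight T * (cell_dif T eb)\<^sup>2)"

text \<open>The error is \<open>pe\<close> minus \<open>ub\<close>. The discrete problem replaces
  the part with \<open>ub\<close> by the load, the elementwise estimate controls the rest up to edge
  fluxes, and these sum to zero. Coercivity bounds the form from below.\<close>

lemma energy_bound:
  "\<alpha> * (\<Sum>T\<in>M. XT T) + (\<Sum>T\<in>M. YT T) \<le> err_const \<rho> \<beta> * h\<^sup>2 * (\<Sum>T\<in>M. cell_seminorm T * (sqrt (XT T) + sqrt (YT T)))"
proof -
  define F where "F w T = (\<Sum>r\<in>UNIV. \<Sum>s\<in>UNIV. cell_area T * (AT T r s * cell_grad T w s * cell_grad T eb r)) + \<rho> / h * cell_weight T * cell_dif T w * cell_dif T eb" for w T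
  define I where "I T = (\<Sum>r\<in>UNIV. \<integral>p. cQ T r r p * cell_ext T eb p \<partial>lebesgue_on (cO T))" for T
  define S where "S T = (\<Sum>r\<in>UNIV. ev T eb r True * cell_flux T r True - ev T eb r False * cell_flux T r False)" for T
  have ub: "eb e = pe e - ub e" for e unfolding eb pe_def ..
  have F: "F pe T = F ub T + F eb T" for T
  proof -
    have "cell_grad T pe s = cell_grad T ub s + cell_grad T eb s" "cell_dif T pe = cell_dif T ub + cell_dif T eb" for s
      unfolding cell_grad_def cell_dif_def ub by (simp_all add: add_divide_distrib diff_divide_distrib)
    then show ?thesis unfolding F_def by (simp add: UNIV_bool algebra_simps)
  qed
  have low: "\<alpha> * XT T + YT T \<le> F eb T" if T: "T \<in> M" for T
  proof -
    have "cell_area T * (\<alpha> * (\<Sum>r\<in>UNIV. (cell_grad T eb r)\<^sup>2)) \<le> cell_area T * (\<Sum>r\<in>UNIV. \<Sum>s\<in>UNIV. AT T r s * cell_grad T eb s * cell_grad T eb r)"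
      using quadratic_AT[OF T] cell_area_pos[OF proper_M[OF T]] by (intro mult_left_mono) auto
    then show ?thesis
      unfolding XT_def YT_def F_def sum_distrib_left[symmetric] by (simp add: divide_inverse power2_eq_square mult_ac)
  qed
  have cb: "F pe T + I T - S T \<le> err_const \<rho> \<beta> * h\<^sup>2 * cell_seminorm T * (sqrt (XT T) + sqrt (YT T))" if T: "T \<in> M" for T
    using cell_bound[OF T, of eb] unfolding F_def I_def S_def XT_def YT_def by linarith
  have "(\<Sum>T\<in>M. F ub T) = - (\<Sum>T\<in>M. I T)"
    using wg_tested unfolding F_def I_def sum.distrib .
  moreover have "(\<Sum>T\<in>M. S T) = 0" using fluxes_cancel unfolding S_def .
  ultimately have "(\<Sum>T\<in>M. F eb T) = (\<Sum>T\<in>M. F pe T + I T - S T)"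
    unfolding F by (simp add: sum.distrib sum_subtractf)
  also have "\<dots> \<le> (\<Sum>T\<in>M. err_const \<rho> \<beta> * h\<^sup>2 * cell_seminorm T * (sqrt (XT T) + sqrt (YT T)))" by (rule sum_mono[OF cb])
  finally have up: "(\<Sum>T\<in>M. F eb T) \<le> err_const \<rho> \<beta> * h\<^sup>2 * (\<Sum>T\<in>M. cell_seminorm T * (sqrt (XT T) + sqrt (YT T)))"
    by (simp add: sum_distrib_left mult.assoc)
  have "\<alpha> * (\<Sum>T\<in>M. XT T) + (\<Sum>T\<in>M. YT T) = (\<Sum>T\<in>M. \<alpha> * XT T + YT T)" by (simp add: sum_distrib_left sum.distrib)
  also have "\<dots> \<le> (\<Sum>T\<in>M. F eb T)" by (rule sum_mono[OF low])
  finally show ?thesis using up by simp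
qed

lemma cells_disjoint:
  assumes "T \<in> M" "T' \<in> M" "p \<in> cO T" "p \<in> cO T'" shows "T = T'"
proof -
  obtain i j i' j' where T: "i < n" "j < m" "T = R i j" "i' < n" "j' < m" "T' = R i' j'"
    using assms(1,2) M_R by blast
  have p: "x i < co True p" "co True p < x (Suc i)" "y j < co False p" "co False p < y (Suc j)"
    "x i' < co True p" "co True p < x (Suc i')" "y j' < co False p" "co False p < y (Suc j')"
    using assms(3,4) unfolding T by (simp_all add: ob_def orect_def)
  have eq: "k = l" if g: "grid N z" and kl: "k < N" "l < N" and s: "z k < s" "s < z (Suc k)" "z l < s" "s < z (Suc l)"
    for N :: nat and z :: "nat \<Rightarrow> real" and k l s
  proof (rule ccontr)
    assume "k \<noteq> l"
    then consider "Suc k \<le> l" | "Suc l \<le> k" by linarith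
    then show False
    proof cases
      case 1
      then have "z (Suc k) \<le> z l" using grid_less[OF g, of "Suc k" l] kl by (cases "Suc k = l") auto
      then show False using s by linarith
    next
      case 2
      then have "z (Suc l) \<le> z k" using grid_less[OF g, of "Suc l" k] kl by (cases "Suc l = k") auto
      then show False using s by linarith
    qed
  qed
  show ?thesis unfolding T using eq[OF gx T(1,4) p(1,2,5,6)] eq[OF gy T(2,5) p(3,4,7,8)] by simp
qed

section \<open>Summation over the elements and comparison with the norm of H^3\<close>

lemma sum_cells_le:
  fixes F :: "point \<Rightarrow> real"
  assumes i: "integrable (lebesgue_on usq) F" and F: "\<And>p. 0 \<le> F p"
  shows "(\<Sum>T\<in>M. \<integral>p. F p \<partial>lebesgue_on (cO T)) \<le> (\<integral>p. F p \<partial>lebesgue_on usq)"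
proof -
  have iu: "integrable lebesgue (\<lambda>p. indicator usq p *\<^sub>R F p)"
    using i by (simp add: integrable_restrict_space)
  have iT: "integrable lebesgue (\<lambda>p. indicator (cO T) p *\<^sub>R F p)" if "T \<in> M" for T
    using integrable_lebesgue_on_subset[OF i O_usq[OF that]] by (simp add: integrable_restrict_space)
  have "(\<Sum>T\<in>M. indicator (cO T) p *\<^sub>R F p) \<le> indicator usq p *\<^sub>R F p" for p
  proof (cases "\<exists>T\<in>M. p \<in> cO T")
    case True
    then obtain T where T: "T \<in> M" "p \<in> cO T" by blast
    have "(\<Sum>T\<in>M. indicator (cO T) p *\<^sub>R F p) = (\<Sum>T'\<in>M. if T' = T then F p else 0)"
    proof (rule sum.cong[OF refl])
      fix T' assume "T' \<in> M"
      then have "p \<in> cO T' \<longleftrightarrow> T' = T" using cells_disjoint[OF T(1) _ T(2), of T'] T(2) by blast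
      then show "indicator (cO T') p *\<^sub>R F p = (if T' = T then F p else 0)" by (simp add: indicator_def)
    qed
    also have "\<dots> = F p" using T(1) finite_M by simp
    finally show ?thesis using O_usq[OF T(1)] T(2) by (simp add: subset_iff)
  next
    case False
    then have "(\<Sum>T\<in>M. indicator (cO T) p *\<^sub>R F p) = 0" by (intro sum.neutral) auto
    then show ?thesis using F by simp
  qed
  then have "integral\<^sup>L lebesgue (\<lambda>p. \<Sum>T\<in>M. indicator (cO T) p *\<^sub>R F p) \<le> integral\<^sup>L lebesgue (\<lambda>p. indicator usq p *\<^sub>R F p)"
    by (intro integral_mono Bochner_Integration.integrable_sum iT iu)
  then show ?thesis using iT by (simp add: integral_restrict_space)
qed

lemma finite_indices: "finite {(i, j). i + j \<le> (k :: nat)}"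
  by (rule finite_subset[of _ "{..k} \<times> {..k}"]) auto

lemma Hnorm_nonneg: "0 \<le> Hnorm 3 unit_square u"
  unfolding Hnorm_def unit_square_usq
  by (auto intro!: real_sqrt_ge_zero sum_nonneg simp: set_integral_eq_lebesgue_on)

lemma weak_deriv_le_Hnorm:
  assumes "i + j \<le> 3"
  shows "(\<integral>p. (weak_deriv usq i j u p)\<^sup>2 \<partial>lebesgue_on usq) \<le> (Hnorm 3 unit_square u)\<^sup>2"
proof -
  let ?I = "\<lambda>(i, j). \<integral>p. (weak_deriv usq i j u p)\<^sup>2 \<partial>lebesgue_on usq"
  have "(Hnorm 3 unit_square u)\<^sup>2 = sum ?I {(i, j). i + j \<le> 3}"
    unfolding Hnorm_def unit_square_usq
    by (subst real_sqrt_pow2) (auto intro!: sum_nonneg simp: set_integral_eq_lebesgue_on)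
  moreover have "?I (i, j) \<le> sum ?I {(i, j). i + j \<le> 3}"
    using assms by (intro member_le_sum finite_indices) auto
  ultimately show ?thesis by simp
qed

text \<open>The seminorm runs over ordered triples of directions, of which there are 8; each is
  estimated by the full norm.\<close>

lemma sum_cell_seminorm: "(\<Sum>T\<in>M. (cell_seminorm T)\<^sup>2) \<le> 8 * (Hnorm 3 unit_square u)\<^sup>2"
proof -
  have c: "(\<Sum>T\<in>M. \<integral>p. (U3 r s t p)\<^sup>2 \<partial>lebesgue_on (cO T)) \<le> (Hnorm 3 unit_square u)\<^sup>2" for r s t
  proof -
    have nb3: "nb r + nb s + nb t + (3 - (nb r + nb s + nb t)) \<le> 3" using nb_le[of r] nb_le[of s] nb_le[of t] by simp
    have "sq_int (lebesgue_on usq) (U3 r s t)" using wd_U2[of t r s] by (simp add: wd_iff)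
    then have "integrable (lebesgue_on usq) (\<lambda>p. (U3 r s t p)\<^sup>2)" by (rule sq_int_square)
    from sum_cells_le[OF this] have "(\<Sum>T\<in>M. \<integral>p. (U3 r s t p)\<^sup>2 \<partial>lebesgue_on (cO T)) \<le> (\<integral>p. (U3 r s t p)\<^sup>2 \<partial>lebesgue_on usq)" by simp
    also have "\<dots> \<le> (Hnorm 3 unit_square u)\<^sup>2" unfolding U3_def by (rule weak_deriv_le_Hnorm[OF nb3])
    finally show ?thesis .
  qed
  have "(cell_seminorm T)\<^sup>2 = (\<Sum>r\<in>UNIV. \<Sum>s\<in>UNIV. \<Sum>t\<in>UNIV. \<integral>p. (U3 r s t p)\<^sup>2 \<partial>lebesgue_on (cO T))" for T
    unfolding cell_seminorm_def by (subst real_sqrt_pow2) (auto intro!: sum_nonneg)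
  then have "(\<Sum>T\<in>M. (cell_seminorm T)\<^sup>2) = (\<Sum>r\<in>UNIV. \<Sum>s\<in>UNIV. \<Sum>t\<in>UNIV. \<Sum>T\<in>M. \<integral>p. (U3 r s t p)\<^sup>2 \<partial>lebesgue_on (cO T))"
    by (simp add: UNIV_bool sum.distrib)
  also have "\<dots> \<le> (\<Sum>r\<in>(UNIV :: bool set). \<Sum>s\<in>(UNIV :: bool set). \<Sum>t\<in>(UNIV :: bool set). (Hnorm 3 unit_square u)\<^sup>2)"
    by (intro sum_mono c)
  also have "\<dots> = 8 * (Hnorm 3 unit_square u)\<^sup>2" by (simp add: UNIV_bool)
  finally show ?thesis .
qed

lemma XT_nonneg: "T \<in> M \<Longrightarrow> 0 \<le> XT T"
  unfolding XT_def using less_imp_le[OF cell_area_pos[OF proper_M]] by (intro mult_nonneg_nonneg sum_nonneg) auto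

lemma YT_nonneg: "T \<in> M \<Longrightarrow> 0 \<le> YT T"
  unfolding YT_def using less_imp_le[OF cell_weight_pos[OF proper_M]] \<rho> h_pos by (intro mult_nonneg_nonneg) auto

text \<open>The factor 3 is a convenient bound for the square root of 8.\<close>

lemma cauchy_schwarz_cells:
  assumes Z: "\<And>T. T \<in> M \<Longrightarrow> 0 \<le> Z T"
  shows "(\<Sum>T\<in>M. cell_seminorm T * sqrt (Z T)) \<le> 3 * Hnorm 3 unit_square u * sqrt (\<Sum>T\<in>M. Z T)"
proof -
  have nT: "0 \<le> cell_seminorm T" for T unfolding cell_seminorm_def by (auto intro!: real_sqrt_ge_zero sum_nonneg)
  have "(\<Sum>T\<in>M. cell_seminorm T * sqrt (Z T)) = (\<Sum>T\<in>M. \<bar>cell_seminorm T\<bar> * \<bar>sqrt (Z T)\<bar>)"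
    using nT Z by (intro sum.cong) auto
  also have "\<dots> \<le> L2_set cell_seminorm M * L2_set (\<lambda>T. sqrt (Z T)) M" by (rule L2_set_mult_ineq)
  also have "L2_set (\<lambda>T. sqrt (Z T)) M = sqrt (\<Sum>T\<in>M. Z T)"
    unfolding L2_set_def using Z by (intro arg_cong[of _ _ sqrt] sum.cong) auto
  also have "L2_set cell_seminorm M * sqrt (\<Sum>T\<in>M. Z T) \<le> 3 * Hnorm 3 unit_square u * sqrt (\<Sum>T\<in>M. Z T)"
  proof (rule mult_right_mono)
    have "(\<Sum>T\<in>M. (cell_seminorm T)\<^sup>2) \<le> (3 * Hnorm 3 unit_square u)\<^sup>2"
      unfolding power_mult_distrib by (rule order_trans[OF sum_cell_seminorm]) simp
    then show "L2_set cell_seminorm M \<le> 3 * Hnorm 3 unit_square u"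
      unfolding L2_set_def using Hnorm_nonneg by (intro real_le_lsqrt) (auto intro: sum_nonneg)
    show "0 \<le> sqrt (\<Sum>T\<in>M. Z T)" using Z by (auto intro!: real_sqrt_ge_zero sum_nonneg)
  qed
  finally show ?thesis .
qed

text \<open>The square of s + t is at most twice s^2 + t^2, which coercivity with
  \<open>min \<alpha> 1\<close> bounds by a multiple of s + t; dividing by s + t gives the claim.
  The 6 is this 2 times the 3 from the summation over elements.\<close>

theorem error_bound:
  "sqrt (\<Sum>T\<in>M. LINT p:cell T|lebesgue. (norm (discrete_grad_b eb T))\<^sup>2) + extension_seminorm \<rho> M eb
    \<le> 6 * err_const \<rho> \<beta> / min \<alpha> 1 * h\<^sup>2 * Hnorm 3 unit_square u"
proof -
  let ?X = "\<Sum>T\<in>M. XT T" and ?Y = "\<Sum>T\<in>M. YT T"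
  define s t where "s = sqrt ?X" and "t = sqrt ?Y"
  have nn: "0 \<le> ?X" "0 \<le> ?Y" by (auto intro!: sum_nonneg XT_nonneg YT_nonneg)
  then have st: "0 \<le> s" "0 \<le> t" "s\<^sup>2 = ?X" "t\<^sup>2 = ?Y" unfolding s_def t_def by simp_all
  have 1: "(LINT p:cell T|lebesgue. (norm (discrete_grad_b eb T))\<^sup>2) = XT T" if "T \<in> M" for T
    unfolding integral_cell_const[OF proper_M[OF that]] discrete_grad_eq[OF proper_M[OF that]] XT_def
    unfolding power2_norm_eq_inner
    by (simp add: inner_vec_def sum_2 UNIV_bool power2_eq_square algebra_simps)
  have 2: "extension_seminorm \<rho> M eb = t"
    unfolding extension_seminorm_def t_def h[symmetric] YT_def sum_distrib_left[symmetric]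
    using bd_inner_seminorm[OF proper_M] by simp
  define B where "B = err_const \<rho> \<beta> * h\<^sup>2 * (3 * Hnorm 3 unit_square u)"
  define \<mu> where "\<mu> = min \<alpha> 1"
  have \<mu>: "0 < \<mu>" "\<mu> \<le> \<alpha>" "\<mu> \<le> 1" unfolding \<mu>_def using \<alpha> by auto
  have B: "0 \<le> B" unfolding B_def using err_const_pos[OF \<rho>, of \<beta>] Hnorm_nonneg by simp
  have "(\<Sum>T\<in>M. cell_seminorm T * (sqrt (XT T) + sqrt (YT T))) \<le> 3 * Hnorm 3 unit_square u * (s + t)"
    using add_mono[OF cauchy_schwarz_cells[of XT, OF XT_nonneg] cauchy_schwarz_cells[of YT, OF YT_nonneg]]
    unfolding s_def t_def by (simp add: distrib_left sum.distrib)
  then have "err_const \<rho> \<beta> * h\<^sup>2 * (\<Sum>T\<in>M. cell_seminorm T * (sqrt (XT T) + sqrt (YT T))) \<le> err_const \<rho> \<beta> * h\<^sup>2 * (3 * Hnorm 3 unit_square u * (s + t))"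
    using err_const_pos[OF \<rho>, of \<beta>] by (intro mult_left_mono) auto
  then have e: "\<alpha> * s\<^sup>2 + t\<^sup>2 \<le> B * (s + t)"
    using energy_bound unfolding B_def st by (simp add: mult.assoc)
  have "\<mu> * (s + t)\<^sup>2 \<le> \<mu> * (2 * (s\<^sup>2 + t\<^sup>2))"
    using \<mu> sum_squares_bound[of s t] by (intro mult_left_mono) (auto simp: power2_sum)
  also have "\<dots> \<le> 2 * (\<alpha> * s\<^sup>2 + t\<^sup>2)"
    using mult_right_mono[OF \<mu>(2), of "s\<^sup>2"] mult_right_mono[OF \<mu>(3), of "t\<^sup>2"] by (simp add: algebra_simps)
  also have "\<dots> \<le> 2 * (B * (s + t))" using e by simp
  finally have "(\<mu> * (s + t)) * (s + t) \<le> (2 * B) * (s + t)" by (simp add: power2_eq_square mult_ac)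
  then have "\<mu> * (s + t) \<le> 2 * B"
    using st B by (cases "s + t = 0") (auto simp: mult_le_cancel_right)
  then have "s + t \<le> 2 * B / \<mu>" using \<mu> by (simp add: field_simps)
  also have "\<dots> = 6 * err_const \<rho> \<beta> / min \<alpha> 1 * h\<^sup>2 * Hnorm 3 unit_square u"
    unfolding B_def \<mu>_def by simp
  finally show ?thesis unfolding 2 s_def using 1 by simp
qed

end

theorem theorem6p5:
  fixes \<rho> \<kappa> \<alpha> \<beta> :: real
  assumes "\<rho> > 0" and "\<alpha> > 0"
  shows "\<exists>C > 0. \<forall>n m x y a f g u wb u0 ub M h eb.
    grid n x \<longrightarrow> grid m y \<longrightarrow> M = rect_partition n x m y \<longrightarrow> h = mesh_size M \<longrightarrow>
    shape_regular \<kappa> M \<longrightarrow> admissible_coefficient \<alpha> \<beta> M a \<longrightarrow>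
    u \<in> Hspace 3 unit_square \<longrightarrow> exact_solution a f g u \<longrightarrow>
    is_correction \<rho> M a u wb \<longrightarrow>
    wg_solution \<rho> M a f (\<lambda>e. Qb g e + h\<^sup>2 * wb e) (u0, ub) \<longrightarrow>
    eb = (\<lambda>e. (Qb_trace unit_square u e + h\<^sup>2 * wb e) - ub e) \<longrightarrow>
    sqrt (\<Sum>T \<in> M. LINT p:cell T|lebesgue. (norm (discrete_grad_b eb T))\<^sup>2)
      + extension_seminorm \<rho> M eb
    \<le> C * h\<^sup>2 * Hnorm 3 unit_square u"
\<comment> \<open>The constant is built from \<rho>, \<alpha> and \<beta> alone, so it can be fixed
  before the mesh and the data.\<close>
proof (intro exI[of _ "6 * err_const \<rho> \<beta> / min \<alpha> 1"] conjI allI impI)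
  show "0 < 6 * err_const \<rho> \<beta> / min \<alpha> 1" using err_const_pos[OF assms(1), of \<beta>] assms(2) by simp
  fix n m x y a f g u wb u0 ub M h eb
  assume "grid n x" "grid m y" "M = rect_partition n x m y" "h = mesh_size M" "shape_regular \<kappa> M"
    "admissible_coefficient \<alpha> \<beta> M a" "u \<in> Hspace 3 unit_square" "exact_solution a f g u" "is_correction \<rho> M a u wb"
    "wg_solution \<rho> M a f (\<lambda>e. Qb g e + h\<^sup>2 * wb e) (u0, ub)"
    "eb = (\<lambda>e. (Qb_trace unit_square u e + h\<^sup>2 * wb e) - ub e)"
  then have "wg_problem \<rho> \<alpha> \<beta> h n m x y a f g u wb ub eb u0 M"
    using assms by (intro wg_problem.intro)
  then show "sqrt (\<Sum>T \<in> M. LINT p:cell T|lebesgue. (norm (discrete_grad_b eb T))\<^sup>2) + extension_seminorm \<rho> M eb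
    \<le> 6 * err_const \<rho> \<beta> / min \<alpha> 1 * h\<^sup>2 * Hnorm 3 unit_square u"
    by (rule wg_problem.error_bound)
qed

end
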